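(* Let $n,r\ge1$. Let $e:\mathbf{MR}^{(r)}\to Sym^{(r)}$ be the algebra homomorphism with $e(S_j^{(i)})=h_j(X_i)$, let $d:Sym^{(r)}\hookrightarrow QMR^{(r)}$ be the algebra homomorphism with $d(h_j(X_i))=F_{[(j),i^j]}$, and let $c=d\circ e$. Then $c$ is the Cartan map: for every anticycloribbon $[K,\mathbf c]$ of size $n$, with corresponding colored composition $(I,u)$, and every cycloribbon $[J,\mathbf d]$ of size $n$, the multiplicity of the simple module $S_{[J,\mathbf d]}$ as a composition factor of the indecomposable projective $\mathcal H_{n,r}(0)$-module $P_{[K,\mathbf c]}$ is equal to the coefficient of $F_{[J,\mathbf d]}$ in $c(R_{(I,u)})$.
   Context: **The algebra.** Fix $r\ge1$, the color set $C=\{1,\dots,r\}$, and $r$ distinct complex numbers $u_1,\dots,u_r$. Put $P_k(X)=\prod_{1\le l\le r,\,l\ne k}\frac{X-u_l}{u_k-u_l}$. The $0$-Ariki-Koike-Shoji algebra $\mathcal H_{n,r}(0)$ is the associative unital $\mathbb C$-algebra generated by $T_1,\dots,T_{n-1},\xi_1,\dots,\xi_n$ with relations: $T_i(T_i+1)=0$; $T_iT_{i+1}T_i=T_{i+1}T_iT_{i+1}$; $T_iT_j=T_jT_i$ for $|i-j|\ge2$; $(\xi_j-u_1)\cdots(\xi_j-u_r)=0$; $\xi_i\xi_j=\xi_j\xi_i$; $T_i\xi_i=\xi_{i+1}T_i+\sum_{1\le a<b\le r}(u_b-u_a)P_a(\xi_i)P_b(\xi_{i+1})$; $T_i(\xi_{i+1}+\xi_i)=(\xi_{i+1}+\xi_i)T_i$;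 $T_i\xi_j=\xi_jT_i$ for $j\ne i,i+1$. **Ribbons, simple and projective modules.** For a composition $I=(i_1,\dots,i_k)$ of $n$, $\mathrm{Des}(I)=\{i_1,i_1+i_2,\dots,i_1+\cdots+i_{k-1}\}$. A colored ribbon of size $n$ is a pair $[I,\mathbf c]$, $I$ a composition of $n$, $\mathbf c\in C^n$. It is a cycloribbon if $c_j\le c_{j+1}$ for $j\notin\mathrm{Des}(I)$ and $c_j\ge c_{j+1}$ for $j\in\mathrm{Des}(I)$; an anticycloribbon if $c_j\ge c_{j+1}$ for $j\notin\mathrm{Des}(I)$ and $c_j\le c_{j+1}$ for $j\in\mathrm{Des}(I)$. The involution $\phi$ sends $[I,\mathbf c]$ to $[I',\mathbf c]$ where $\mathrm{Des}(I')=\{j\in\mathrm{Des}(I): c_j=c_{j+1}\}\cup\{j\notin\mathrm{Des}(I): c_j\ne c_{j+1}\}$; it exchanges cycloribbons and anticycloribbons. For a cycloribbon $[I,\mathbf c]$, $S_{[I,\mathbf c]}$ is the one-dimensional simple $\mathcal H_{n,r}(0)$-module on which $\xi_i$ acts by $u_{c_i}$ and $T_i$ acts by $-1$ if $i$ is a descent of the shape of $\phi([I,\mathbf c])$ and by $0$ otherwise; these are all the simple modules, without repetition. For an anticycloribbon $[K,\mathbf c]$, $P_{[K,\mathbf c]}$ is the indecomposable projective $\mathcal H_{n,r}(0)$-module whose unique simple quotient is $S_{\phi([K,\mathbf c])}$. **Colored compositions.** A colored composition of $n$ is a pair $(I,u)$ with $I=(i_1,\dots,i_p)$ a composition of $n$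 and $u=(u_1,\dots,u_p)\in C^p$ (a word of colors, not the complex parameters). The colored composition corresponding to the anticycloribbon $[K,\mathbf c]$ is $(I,u)$ with $\mathrm{Des}(I)=\mathrm{Des}(K)\cap\{j:c_j=c_{j+1}\}\ \cup\ \{j:c_j\ne c_{j+1}\}$, and $u_k$ the common color of the $c_j$ with $j$ in the $k$-th block of $I$. **$\mathbf{MR}^{(r)}$.** The free associative $\mathbb C$-algebra on symbols $S_j^{(i)}$, $j\ge1$, $1\le i\le r$. For a colored composition, $S^{(I,u)}=S_{i_1}^{(u_1)}\cdots S_{i_p}^{(u_p)}$. Write $(J,v)\le(I,u)$ if $(J,v)$ is obtained from $(I,u)$ by adding up groups of consecutive parts of the same color. The colored ribbon basis $(R_{(I,u)})$ is defined by $S^{(I,u)}=\sum_{(J,v)\le(I,u)}R_{(J,v)}$. **$Sym^{(r)}$.** $Sym^{(r)}=Sym^{\otimes r}\simeq Sym(X_1,\dots,X_r)$ is the $r$-fold tensor power of the algebra of symmetric functions over $\mathbb C$, the $i$-th factor being symmetric functions of the alphabet $X_i$; $h_j$ is the complete homogeneous symmetric function of degree $j$. **$QMR^{(r)}$.** Take commuting variables $x_i^{(c)}$, $i\ge1$, $c\in C$. For a cycloribbon $[I,\mathbf c]$ of size $n$, $F_{[I,\mathbf c]}=\sum x_{i_1}^{(c_1)}\cdots x_{i_n}^{(c_n)}$, summed over $1\le i_1\le\cdots\le i_n$ with $i_j<i_{j+1}$ whenever $j\in\mathrm{Des}(I)$. $QMR^{(r)}$ is the $\mathbb C$-span of these series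 (and $1$), over all cycloribbons; they form a basis and $QMR^{(r)}$ is an algebra under multiplication of power series. $[(j),i^j]$ is the cycloribbon with a single row of $j$ cells all filled with $i$. *)

theory Defs
  imports
    Complex_Main
    "HOL-Library.Poly_Mapping"
    "HOL-Library.Multiset"
    "HOL-Combinatorics.Permutations"
    "HOL-Algebra.QuotRing"
    "HOL-Algebra.Module"
begin

section \<open>Left modules over a ring that need not be commutative\<close>

text \<open>The records and the predicate \<^const>\<open>submodule\<close> are those of HOL-Algebra, whose locale
  \<^const>\<open>module\<close> itself requires a commutative ring.  The fields \<^const>\<open>mult\<close> and
  \<^const>\<open>one\<close> of a module record are irrelevant when it is only used as a module.\<close>

locale left_module = R?: ring R + M?: abelian_group M
  for R (structure) and M (structure) +
  assumes smult_closed: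
      "\<lbrakk>a \<in> carrier R; x \<in> carrier M\<rbrakk> \<Longrightarrow> a \<odot>\<^bsub>M\<^esub> x \<in> carrier M"
    and smult_l_distr:
      "\<lbrakk>a \<in> carrier R; b \<in> carrier R; x \<in> carrier M\<rbrakk> \<Longrightarrow>
       (a \<oplus>\<^bsub>R\<^esub> b) \<odot>\<^bsub>M\<^esub> x = a \<odot>\<^bsub>M\<^esub> x \<oplus>\<^bsub>M\<^esub> b \<odot>\<^bsub>M\<^esub> x"
    and smult_r_distr:
      "\<lbrakk>a \<in> carrier R; x \<in> carrier M; y \<in> carrier M\<rbrakk> \<Longrightarrow>
       a \<odot>\<^bsub>M\<^esub> (x \<oplus>\<^bsub>M\<^esub> y) = a \<odot>\<^bsub>M\<^esub> x \<oplus>\<^bsub>M\<^esub> a \<odot>\<^bsub>M\<^esub> y"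
    and smult_assoc:
      "\<lbrakk>a \<in> carrier R; b \<in> carrier R; x \<in> carrier M\<rbrakk> \<Longrightarrow>
       (a \<otimes>\<^bsub>R\<^esub> b) \<odot>\<^bsub>M\<^esub> x = a \<odot>\<^bsub>M\<^esub> (b \<odot>\<^bsub>M\<^esub> x)"
    and smult_one:
      "x \<in> carrier M \<Longrightarrow> \<one>\<^bsub>R\<^esub> \<odot>\<^bsub>M\<^esub> x = x"

definition module_iso ::
  "('a, 'm) ring_scheme \<Rightarrow> ('a, 'b, 'k) module_scheme \<Rightarrow> ('a, 'c, 'l) module_scheme \<Rightarrow> bool"
  where
  "module_iso R M N \<longleftrightarrow>
     (\<exists>h. bij_betw h (carrier M) (carrier N)
        \<and> (\<forall>x\<in>carrier M. \<forall>y\<in>carrier M. h (x \<oplus>\<^bsub>M\<^esub> y) = h x \<oplus>\<^bsub>N\<^esub> h y)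
        \<and> (\<forall>a\<in>carrier R. \<forall>x\<in>carrier M. h (a \<odot>\<^bsub>M\<^esub> x) = a \<odot>\<^bsub>N\<^esub> h x))"

definition quot_module ::
  "('a, 'b, 'k) module_scheme \<Rightarrow> 'b set \<Rightarrow> ('a, 'b set) module" where
  "quot_module M N =
     \<lparr>carrier = a_rcosets\<^bsub>M\<^esub> N, mult = undefined, one = undefined, zero = N, add = set_add M,
      smult = (\<lambda>a X. \<Union>x\<in>X. N +>\<^bsub>M\<^esub> (a \<odot>\<^bsub>M\<^esub> x))\<rparr>"

definition simple_module :: "('a, 'm) ring_scheme \<Rightarrow> ('a, 'b, 'k) module_scheme \<Rightarrow> bool" where
  "simple_module R M \<longleftrightarrow>
     left_module R M \<and> carrier M \<noteq> {\<zero>\<^bsub>M\<^esub>} \<and>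
     (\<forall>N. submodule N R M \<longrightarrow> N = {\<zero>\<^bsub>M\<^esub>} \<or> N = carrier M)"

definition internal_direct_sum ::
  "('a, 'm) ring_scheme \<Rightarrow> ('a, 'b, 'k) module_scheme \<Rightarrow> 'b set \<Rightarrow> 'b set \<Rightarrow> bool" where
  "internal_direct_sum R M N N' \<longleftrightarrow>
     submodule N R M \<and> submodule N' R M \<and> N \<inter> N' = {\<zero>\<^bsub>M\<^esub>} \<and> N <+>\<^bsub>M\<^esub> N' = carrier M"

definition indecomposable :: "('a, 'm) ring_scheme \<Rightarrow> ('a, 'b, 'k) module_scheme \<Rightarrow> bool" where
  "indecomposable R M \<longleftrightarrow>
     carrier M \<noteq> {\<zero>\<^bsub>M\<^esub>} \<and>
     (\<forall>N N'. internal_direct_sum R M N N' \<longrightarrow> N = {\<zero>\<^bsub>M\<^esub>} \<or> N' = {\<zero>\<^bsub>M\<^esub>})"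

definition free_module :: "('a, 'm) ring_scheme \<Rightarrow> 'x set \<Rightarrow> ('a, 'x \<Rightarrow> 'a) module" where
  "free_module R X =
     \<lparr>carrier = {f. (\<forall>x\<in>X. f x \<in> carrier R) \<and> (\<forall>x. x \<notin> X \<longrightarrow> f x = \<zero>\<^bsub>R\<^esub>) \<and>
                    finite {x. f x \<noteq> \<zero>\<^bsub>R\<^esub>}},
      mult = undefined, one = undefined, zero = (\<lambda>x. \<zero>\<^bsub>R\<^esub>),
      add = (\<lambda>f g x. f x \<oplus>\<^bsub>R\<^esub> g x), smult = (\<lambda>a f x. a \<otimes>\<^bsub>R\<^esub> f x)\<rparr>"

text \<open>Projective means: isomorphic to a direct summand of a free module.  A free module with basis
  indexed by a set of elements of the module always suffices (one may take its whole carrier), so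
  the type of the index set is no restriction.\<close>

definition projective :: "('a, 'm) ring_scheme \<Rightarrow> ('a, 'b, 'k) module_scheme \<Rightarrow> bool" where
  "projective R P \<longleftrightarrow>
     left_module R P \<and>
     (\<exists>(X :: 'b set) N N'. internal_direct_sum R (free_module R X) N N' \<and>
        module_iso R P (free_module R X \<lparr>carrier := N\<rparr>))"

text \<open>\<open>P\<close> is an indecomposable projective module whose unique simple quotient is \<open>S\<close>.\<close>

definition indec_projective_with_top ::
  "('a, 'm) ring_scheme \<Rightarrow> ('a, 'b, 'k) module_scheme \<Rightarrow> ('a, 'c, 'l) module_scheme \<Rightarrow> bool" where
  "indec_projective_with_top R P S \<longleftrightarrow>
     projective R P \<and> indecomposable R P \<and>
     (\<exists>!N. submodule N R P \<and> simple_module R (quot_module P N)) \<and>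
     (\<forall>N. submodule N R P \<and> simple_module R (quot_module P N)
          \<longrightarrow> module_iso R (quot_module P N) S)"

definition composition_factor ::
  "('a, 'b, 'k) module_scheme \<Rightarrow> 'b set list \<Rightarrow> nat \<Rightarrow> ('a, 'b set) module" where
  "composition_factor M Ms i = quot_module (M \<lparr>carrier := Ms ! Suc i\<rparr>) (Ms ! i)"

definition composition_series ::
  "('a, 'm) ring_scheme \<Rightarrow> ('a, 'b, 'k) module_scheme \<Rightarrow> 'b set list \<Rightarrow> bool" where
  "composition_series R M Ms \<longleftrightarrow>
     Ms \<noteq> [] \<and> hd Ms = {\<zero>\<^bsub>M\<^esub>} \<and> last Ms = carrier M \<and>
     (\<forall>N\<in>set Ms. submodule N R M) \<and>
     (\<forall>i. Suc i < length Ms \<longrightarrow>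
        Ms ! i \<subseteq> Ms ! Suc i \<and> simple_module R (composition_factor M Ms i))"

text \<open>By the Jordan-Hoelder theorem the number below does not depend on the composition series.\<close>

definition composition_multiplicity ::
  "('a, 'm) ring_scheme \<Rightarrow> ('a, 'b, 'k) module_scheme \<Rightarrow> ('a, 'c, 'l) module_scheme \<Rightarrow> nat" where
  "composition_multiplicity R M S =
     (THE m. \<exists>Ms. composition_series R M Ms \<and>
        m = card {i. Suc i < length Ms \<and> module_iso R (composition_factor M Ms i) S})"


section \<open>Free associative algebras\<close>

datatype 'g free_monoid = Word (letters: "'g list")

instantiation free_monoid :: (type) monoid_add
begin

definition zero_free_monoid :: "'a free_monoid" where
  "zero_free_monoid = Word []"

definition plus_free_monoid :: "'a free_monoid \<Rightarrow> 'a free_monoid \<Rightarrow> 'a free_monoid" where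
  "plus_free_monoid v w = Word (letters v @ letters w)"

instance
  by standard (auto simp: zero_free_monoid_def plus_free_monoid_def)

end

text \<open>Noncommutative polynomials: finitely supported functions on words with the convolution
  product that \<^type>\<open>poly_mapping\<close> carries over a monoid.\<close>

type_synonym 'g ncpoly = "'g free_monoid \<Rightarrow>\<^sub>0 complex"

definition scal :: "complex \<Rightarrow> 'g ncpoly" where
  "scal a = Poly_Mapping.single 0 a"

definition gen :: "'g \<Rightarrow> 'g ncpoly" where
  "gen x = Poly_Mapping.single (Word [x]) 1"

text \<open>The free algebra on a set \<open>G\<close> of generators.  A complex algebra is encoded by its ring
  operations together with the scalar multiplication.\<close>

definition free_algebra :: "'g set \<Rightarrow> (complex, 'g ncpoly) module" where
  "free_algebra G =
     \<lparr>carrier = {f. \<forall>w\<in>Poly_Mapping.keys f. set (letters w) \<subseteq> G},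
      mult = (\<lambda>f g. f * g), one = 1, zero = 0, add = (\<lambda>f g. f + g),
      smult = (\<lambda>a f. scal a * f)\<rparr>"

definition algebra_hom ::
  "(complex, 'a) module \<Rightarrow> (complex, 'b) module \<Rightarrow> ('a \<Rightarrow> 'b) set" where
  "algebra_hom A B =
     {h \<in> ring_hom A B. \<forall>a. \<forall>x\<in>carrier A. h (a \<odot>\<^bsub>A\<^esub> x) = a \<odot>\<^bsub>B\<^esub> h x}"

definition eval_character :: "('g \<Rightarrow> complex) \<Rightarrow> 'g ncpoly \<Rightarrow> complex" where
  "eval_character \<chi> f =
     (\<Sum>w\<in>Poly_Mapping.keys f. Poly_Mapping.lookup f w * prod_list (map \<chi> (letters w)))"


section \<open>The 0-Ariki-Koike-Shoji algebra\<close>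

datatype ak_gen = GenT nat | GenXi nat

definition ak_gens :: "nat \<Rightarrow> ak_gen set" where
  "ak_gens n = GenT ` {1..<n} \<union> GenXi ` {1..n}"

abbreviation TT :: "nat \<Rightarrow> ak_gen ncpoly" where
  "TT i \<equiv> gen (GenT i)"

abbreviation XX :: "nat \<Rightarrow> ak_gen ncpoly" where
  "XX j \<equiv> gen (GenXi j)"

definition lagrange :: "nat \<Rightarrow> (nat \<Rightarrow> complex) \<Rightarrow> nat \<Rightarrow> 'g ncpoly \<Rightarrow> 'g ncpoly" where
  "lagrange r u k x =
     prod_list (map (\<lambda>l. scal (1 / (u k - u l)) * (x - scal (u l))) (filter (\<lambda>l. l \<noteq> k) [1..<Suc r]))"

text \<open>Each relation \<open>a = b\<close> is represented by the element \<open>a - b\<close>.\<close>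

definition ak_relations :: "nat \<Rightarrow> nat \<Rightarrow> (nat \<Rightarrow> complex) \<Rightarrow> ak_gen ncpoly set" where
  "ak_relations n r u =
     {TT i * (TT i + 1) | i. 1 \<le> i \<and> i < n}
   \<union> {TT i * TT (i+1) * TT i - TT (i+1) * TT i * TT (i+1) | i. 1 \<le> i \<and> i + 1 < n}
   \<union> {TT i * TT j - TT j * TT i | i j. 1 \<le> i \<and> i < n \<and> 1 \<le> j \<and> j < n \<and> (i + 2 \<le> j \<or> j + 2 \<le> i)}
   \<union> {prod_list (map (\<lambda>l. XX j - scal (u l)) [1..<Suc r]) | j. 1 \<le> j \<and> j \<le> n}
   \<union> {XX i * XX j - XX j * XX i | i j. 1 \<le> i \<and> i \<le> n \<and> 1 \<le> j \<and> j \<le> n}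
   \<union> {TT i * XX i - (XX (i+1) * TT i +
        (\<Sum>(a, b) \<in> {(a, b). 1 \<le> a \<and> a < b \<and> b \<le> r}.
           scal (u b - u a) * lagrange r u a (XX i) * lagrange r u b (XX (i+1)))) | i. 1 \<le> i \<and> i < n}
   \<union> {TT i * (XX (i+1) + XX i) - (XX (i+1) + XX i) * TT i | i. 1 \<le> i \<and> i < n}
   \<union> {TT i * XX j - XX j * TT i | i j. 1 \<le> i \<and> i < n \<and> 1 \<le> j \<and> j \<le> n \<and> j \<noteq> i \<and> j \<noteq> i + 1}"

definition ak_algebra :: "nat \<Rightarrow> nat \<Rightarrow> (nat \<Rightarrow> complex) \<Rightarrow> ak_gen ncpoly set ring" where
  "ak_algebra n r u =
     free_algebra (ak_gens n) Quot genideal (free_algebra (ak_gens n)) (ak_relations n r u)"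


section \<open>Colored ribbons and simple modules\<close>

definition is_composition :: "nat \<Rightarrow> nat list \<Rightarrow> bool" where
  "is_composition n I \<longleftrightarrow> (\<forall>i\<in>set I. 1 \<le> i) \<and> sum_list I = n"

definition Des :: "nat list \<Rightarrow> nat set" where
  "Des I = {sum_list (take k I) | k. 1 \<le> k \<and> k < length I}"

text \<open>The composition of \<open>n\<close> with a prescribed descent set \<open>D \<subseteq> {1, \<dots>, n - 1}\<close>.\<close>

definition composition_of_Des :: "nat \<Rightarrow> nat set \<Rightarrow> nat list" where
  "composition_of_Des n D = (THE I. is_composition n I \<and> Des I = D)"

text \<open>A colored ribbon is a pair of a composition and a word of colors; the letters of the word are
  indexed from 1.\<close>

type_synonym colored_ribbon = "nat list \<times> nat list"

definition col :: "nat list \<Rightarrow> nat \<Rightarrow> nat" where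
  "col c j = c ! (j - 1)"

definition is_colored_ribbon :: "nat \<Rightarrow> nat \<Rightarrow> colored_ribbon \<Rightarrow> bool" where
  "is_colored_ribbon r n = (\<lambda>(I, c). is_composition n I \<and> length c = n \<and> set c \<subseteq> {1..r})"

definition cycloribbon :: "nat \<Rightarrow> nat \<Rightarrow> colored_ribbon \<Rightarrow> bool" where
  "cycloribbon r n = (\<lambda>(I, c). is_colored_ribbon r n (I, c) \<and>
     (\<forall>j\<in>{1..<n}. (j \<notin> Des I \<longrightarrow> col c j \<le> col c (j+1)) \<and> (j \<in> Des I \<longrightarrow> col c j \<ge> col c (j+1))))"

definition anticycloribbon :: "nat \<Rightarrow> nat \<Rightarrow> colored_ribbon \<Rightarrow> bool" where
  "anticycloribbon r n = (\<lambda>(I, c). is_colored_ribbon r n (I, c) \<and>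
     (\<forall>j\<in>{1..<n}. (j \<notin> Des I \<longrightarrow> col c j \<ge> col c (j+1)) \<and> (j \<in> Des I \<longrightarrow> col c j \<le> col c (j+1))))"

definition phi :: "colored_ribbon \<Rightarrow> colored_ribbon" where
  "phi = (\<lambda>(I, c). (composition_of_Des (length c)
     ({j \<in> {1..<length c}. j \<in> Des I \<and> col c j = col c (j+1)} \<union>
      {j \<in> {1..<length c}. j \<notin> Des I \<and> col c j \<noteq> col c (j+1)}), c))"

text \<open>The scalars by which the generators act on the simple module of a cycloribbon.\<close>

definition simple_character :: "(nat \<Rightarrow> complex) \<Rightarrow> colored_ribbon \<Rightarrow> ak_gen \<Rightarrow> complex" where
  "simple_character u C g =
     (case g of GenT i \<Rightarrow> (if i \<in> Des (fst (phi C)) then - 1 else 0)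
              | GenXi j \<Rightarrow> u (col (snd C) j))"

text \<open>An element of the quotient algebra is a coset \<open>X\<close> of noncommutative polynomials; for a
  cycloribbon, all of them take the same value under the character.\<close>

definition simple_ak_module ::
  "(nat \<Rightarrow> complex) \<Rightarrow> colored_ribbon \<Rightarrow> (ak_gen ncpoly set, complex) module" where
  "simple_ak_module u C =
     \<lparr>carrier = UNIV, mult = undefined, one = undefined, zero = 0, add = (\<lambda>x y. x + y),
      smult = (\<lambda>X z. the_elem (eval_character (simple_character u C) ` X) * z)\<rparr>"


section \<open>Colored compositions and the algebra MR\<close>

text \<open>A colored composition \<open>(I, u)\<close> is encoded as the list of the pairs \<open>(i\<^sub>k, u\<^sub>k)\<close>.\<close>

type_synonym colored_composition = "(nat \<times> nat) list"

text \<open>The block of part number \<open>k\<close> (counted from 0) consists of the positions following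
  \<open>sum_list (take k I)\<close>.  All color changes of \<open>c\<close> being descents of \<open>I\<close>, its common color is that of
  its first position.\<close>

definition corresponding_colored_composition :: "colored_ribbon \<Rightarrow> colored_composition" where
  "corresponding_colored_composition = (\<lambda>(K, c).
     let n = length c;
         I = composition_of_Des n
               ((Des K \<inter> {j \<in> {1..<n}. col c j = col c (j+1)}) \<union>
                {j \<in> {1..<n}. col c j \<noteq> col c (j+1)})
     in map (\<lambda>k. (I ! k, col c (sum_list (take k I) + 1))) [0..<length I])"

text \<open>The generator \<open>(j, i)\<close> stands for the symbol with subscript \<open>j\<close> and color \<open>i\<close>.\<close>

definition MR :: "nat \<Rightarrow> (complex, (nat \<times> nat) ncpoly) module" where
  "MR r = free_algebra {(j, i). 1 \<le> j \<and> i \<in> {1..r}}"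

definition S_basis :: "colored_composition \<Rightarrow> (nat \<times> nat) ncpoly" where
  "S_basis I = prod_list (map gen I)"

definition coarser_eq :: "colored_composition \<Rightarrow> colored_composition \<Rightarrow> bool" where
  "coarser_eq J I \<longleftrightarrow>
     (\<exists>gs. concat gs = I \<and> (\<forall>g\<in>set gs. g \<noteq> [] \<and> (\<forall>p\<in>set g. snd p = snd (hd g))) \<and>
           J = map (\<lambda>g. (sum_list (map fst g), snd (hd g))) gs)"

lemma length_le_concat:
  "(\<forall>g\<in>set gs. g \<noteq> []) \<Longrightarrow> length gs \<le> length (concat gs)"
proof (induction gs)
  case (Cons g gs)
  then have "length g \<ge> 1" "length gs \<le> length (concat gs)"
    by (auto simp: Suc_le_eq)
  then show ?case by simp
qed simp

lemma length_concat_eq: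
  assumes "\<forall>g\<in>set gs. g \<noteq> []" "length gs = length (concat gs)"
  shows "\<forall>g\<in>set gs. length g = 1"
  using assms
proof (induction gs)
  case (Cons g gs)
  have "length g \<ge> 1" "length gs \<le> length (concat gs)"
    using Cons.prems(1) length_le_concat[of gs] by (auto simp: Suc_le_eq)
  then have "length g = 1" "length gs = length (concat gs)"
    using Cons.prems(2) by auto
  with Cons.IH Cons.prems(1) have "\<forall>h\<in>set gs. length h = 1"
    by simp
  with \<open>length g = 1\<close> show ?case by simp
qed simp

lemma coarser_eq_length: "coarser_eq J I \<Longrightarrow> length J \<le> length I"
  unfolding coarser_eq_def using length_le_concat by (metis length_map)

lemma coarser_eq_refl: "coarser_eq I I"
  unfolding coarser_eq_def
  by (rule exI[of _ "map (\<lambda>p. [p]) I"]) (induction I; simp)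

lemma coarser_neq_length:
  assumes "coarser_eq J I" "J \<noteq> I"
  shows "length J < length I"
proof (rule ccontr)
  assume "\<not> length J < length I"
  from assms(1) obtain gs where gs: "concat gs = I" "\<forall>g\<in>set gs. g \<noteq> []"
      "J = map (\<lambda>g. (sum_list (map fst g), snd (hd g))) gs"
    unfolding coarser_eq_def by blast
  with \<open>\<not> length J < length I\<close> have "length gs = length (concat gs)"
    using length_le_concat[of gs] by simp
  then have len: "\<forall>g\<in>set gs. length g = 1"
    using length_concat_eq gs(2) by blast
  then have "map (\<lambda>g. (sum_list (map fst g), snd (hd g))) gs = concat gs"
    by (induction gs) (auto simp: length_Suc_conv)
  with gs assms(2) show False by simp
qed

lemma finite_coarser_eq: "finite {J. coarser_eq J I}"
proof (rule finite_subset)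
  let ?A = "{..sum_list (map fst I)} \<times> (snd ` set I)"
  show "{J. coarser_eq J I} \<subseteq> {J. set J \<subseteq> ?A \<and> length J \<le> length I}"
  proof
    fix J assume J: "J \<in> {J. coarser_eq J I}"
    then obtain gs where gs: "concat gs = I" "\<forall>g\<in>set gs. g \<noteq> []"
        "J = map (\<lambda>g. (sum_list (map fst g), snd (hd g))) gs"
      unfolding coarser_eq_def by blast
    have part: "sum_list (map fst g) \<le> sum_list (map fst I) \<and> snd (hd g) \<in> snd ` set I"
      if g: "g \<in> set gs" for g
    proof
      obtain xs ys where "gs = xs @ g # ys"
        using g by (meson split_list)
      then show "sum_list (map fst g) \<le> sum_list (map fst I)"
        by (simp flip: gs(1))
      have "hd g \<in> set I"
        using g gs(2) hd_in_set[of g] unfolding gs(1)[symmetric] set_concat by blast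
      then show "snd (hd g) \<in> snd ` set I" by (rule imageI)
    qed
    have "set J \<subseteq> ?A"
      unfolding gs(3) set_map using part by (simp add: image_subset_iff)
    with J coarser_eq_length show "J \<in> {J. set J \<subseteq> ?A \<and> length J \<le> length I}"
      by blast
  qed
  show "finite {J. set J \<subseteq> ?A \<and> length J \<le> length I}"
    by (rule finite_lists_length_le) simp
qed

function R_basis :: "colored_composition \<Rightarrow> (nat \<times> nat) ncpoly" where
  "R_basis I = S_basis I - (\<Sum>J\<in>{J. coarser_eq J I \<and> J \<noteq> I}. R_basis J)"
  by auto
termination
  by (relation "measure length") (auto intro: coarser_neq_length)

declare R_basis.simps [simp del]

text \<open>The defining relation of the colored ribbon basis, which the recursion solves.\<close>

lemma S_basis_eq_sum_R_basis: "S_basis I = (\<Sum>J\<in>{J. coarser_eq J I}. R_basis J)"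
proof -
  have "{J. coarser_eq J I} = insert I {J. coarser_eq J I \<and> J \<noteq> I}"
    using coarser_eq_refl by auto
  moreover have "finite {J. coarser_eq J I \<and> J \<noteq> I}"
    by (rule finite_subset[OF _ finite_coarser_eq[of I]]) auto
  ultimately have "(\<Sum>J\<in>{J. coarser_eq J I}. R_basis J) =
      R_basis I + (\<Sum>J\<in>{J. coarser_eq J I \<and> J \<noteq> I}. R_basis J)"
    by simp
  then show ?thesis by (simp add: R_basis.simps[of I])
qed


section \<open>Power series in commuting variables, Sym and QMR\<close>

text \<open>The pair \<open>(i, a)\<close> is the variable of index \<open>i \<ge> 1\<close> and color \<open>a\<close>; monomials are finite
  multisets of variables, and series are given by their coefficients.\<close>

type_synonym series = "(nat \<times> nat) multiset \<Rightarrow> complex"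

definition series_algebra :: "series set \<Rightarrow> (complex, series) module" where
  "series_algebra A =
     \<lparr>carrier = A,
      mult = (\<lambda>f g m. \<Sum>a\<in>{a. a \<subseteq># m}. f a * g (m - a)),
      one = (\<lambda>m. if m = {#} then 1 else 0),
      zero = (\<lambda>m. 0), add = (\<lambda>f g m. f m + g m), smult = (\<lambda>a f m. a * f m)\<rparr>"

text \<open>The \<open>r\<close>-fold tensor power of the algebra of symmetric functions, as the algebra of series of
  bounded degree that are symmetric in each of the \<open>r\<close> alphabets separately; the alphabet of color
  \<open>a\<close> consists of the variables \<open>(i, a)\<close>.\<close>

definition Sym :: "nat \<Rightarrow> (complex, series) module" where
  "Sym r = series_algebra
     {f. (\<forall>m. f m \<noteq> 0 \<longrightarrow> set_mset m \<subseteq> {1..} \<times> {1..r}) \<and>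
         (\<exists>N. \<forall>m. f m \<noteq> 0 \<longrightarrow> size m \<le> N) \<and>
         (\<forall>a\<in>{1..r}. \<forall>\<pi>. \<pi> permutes {1..} \<longrightarrow>
            (\<forall>m. f (image_mset (\<lambda>(i, b). (if b = a then \<pi> i else i, b)) m) = f m))}"

definition complete_homogeneous :: "nat \<Rightarrow> nat \<Rightarrow> series" where
  "complete_homogeneous j a = (\<lambda>m. if size m = j \<and> set_mset m \<subseteq> {1..} \<times> {a} then 1 else 0)"

definition F_series :: "colored_ribbon \<Rightarrow> series" where
  "F_series = (\<lambda>(I, c) m. of_nat (card
     {is. length is = length c \<and> set is \<subseteq> {1..} \<and> sorted is \<and>
          (\<forall>j\<in>Des I. col is j < col is (j+1)) \<and> mset (zip is c) = m}))"

text \<open>\<open>a\<close> is the family of coefficients of \<open>f\<close> on the series \<^const>\<open>F_series\<close> of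
  cycloribbons; the cycloribbon of size 0 gives the constant series 1.\<close>

definition F_expansion :: "nat \<Rightarrow> (colored_ribbon \<Rightarrow> complex) \<Rightarrow> series \<Rightarrow> bool" where
  "F_expansion r a f \<longleftrightarrow>
     finite {C. a C \<noteq> 0} \<and> (\<forall>C. a C \<noteq> 0 \<longrightarrow> (\<exists>n. cycloribbon r n C)) \<and>
     f = (\<lambda>m. \<Sum>C\<in>{C. a C \<noteq> 0}. a C * F_series C m)"

definition QMR :: "nat \<Rightarrow> (complex, series) module" where
  "QMR r = series_algebra {f. \<exists>a. F_expansion r a f}"

definition F_coeff :: "nat \<Rightarrow> series \<Rightarrow> colored_ribbon \<Rightarrow> complex" where
  "F_coeff r f = (THE a. F_expansion r a f)"

end

theory Submission
  imports Defs "HOL-Library.Product_Lexorder"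
begin

text \<open>Both sides count the same permutations.  The functions on the permutations \<open>\<sigma>\<close> of \<open>{1..n}\<close> form
  a left module on which \<open>\<xi>\<^sub>j\<close> acts triangularly, with eigenvalue \<open>u (c (\<sigma> j))\<close> at \<open>\<sigma>\<close>.  It is the
  part of the regular representation of weight \<open>c\<close>: every vector of weight \<open>c\<close> in a module is the image
  of its generator.  The \<open>0\<close>-Hecke generators at the positions where \<open>c\<close> is constant act on it from the
  right, and an idempotent made of these cuts out the projective cover \<open>P\<close> of the simple module.  Acting on
  this summand by a polynomial that is an idempotent lift of the character of \<open>S\<close> computes the
  multiplicity of \<open>S\<close> in \<open>P\<close>: it is the number of \<open>\<sigma>\<close> with \<open>c \<circ> \<sigma> = d\<close> such that \<open>\<sigma>\<close> has the prescribed
  descents where \<open>d\<close> is constant and the inverse of \<open>\<sigma>\<close> those where \<open>c\<close> is constant.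

  On the other side, the coefficient of a monomial in a product of complete homogeneous series counts
  rearrangements of a word which ascend inside the blocks.  Stable sorting turns these into permutations whose
  inverse ascends inside the blocks; passing from the basis \<open>S\<close> to the basis \<open>R\<close> prescribes the descents
  of the inverse exactly, and sorting the permutations by their own descents gives the expansion on the
  series \<open>F\<close>.\<close>

text \<open>One ranking serves both actions. The statistic, the sum of all j * \<sigma>(j), does not
  change when \<sigma> is inverted, and it grows when a descent of \<sigma> or of its inverse is
  undone. So the left and the right generators are triangular for the same order, and the product of
  a left and a right idempotent has as diagonal the product of two character values. Dimensions are
  counted by leading positions, which turns a multiplicity into the number of permutations where
  this diagonal does not vanish. The count runs along an arbitrary composition series, so it also
  proves that the multiplicity is well defined. What makes the two sides comparable is the shape of
  the characters. The mixed relation between \<open>T\<close> and \<xi> forces the value of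
  \<open>T\<close> wherever neighbouring colors differ; the free data are a color word and a set of
  descents at equal colors. A cycloribbon carries exactly these data, and so does a colored
  composition.\<close>

declare One_nat_def [simp del]

subsection \<open>Linear functionals on noncommutative polynomials\<close>

lemma letters_plus [simp]: "letters (v + w) = letters v @ letters w"
  by (simp add: plus_free_monoid_def)

lemma letters_zero [simp]: "letters 0 = []"
  by (simp add: zero_free_monoid_def)

text \<open>Characters and representations are both linear extensions of functions on words, so the
  calculus of such extensions is set up once for both.\<close>

definition lin :: "('g list \<Rightarrow> complex) \<Rightarrow> 'g ncpoly \<Rightarrow> complex" where
  "lin \<phi> f = (\<Sum>w\<in>Poly_Mapping.keys f. Poly_Mapping.lookup f w * \<phi> (letters w))"

lemma eval_character_eq_lin: "eval_character \<chi> f = lin (\<lambda>w. prod_list (map \<chi> w)) f"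
  by (simp add: eval_character_def lin_def)

lemma lin_superset:
  assumes "finite A" "Poly_Mapping.keys f \<subseteq> A"
  shows "lin \<phi> f = (\<Sum>w\<in>A. Poly_Mapping.lookup f w * \<phi> (letters w))"
  unfolding lin_def using assms
  by (intro sum.mono_neutral_left) (auto simp: in_keys_iff)

lemma lin_add [simp]: "lin \<phi> (f + g) = lin \<phi> f + lin \<phi> g"
proof -
  let ?A = "Poly_Mapping.keys f \<union> Poly_Mapping.keys g"
  have "Poly_Mapping.keys (f + g) \<subseteq> ?A"
    by (rule Poly_Mapping.keys_add)
  then show ?thesis
    by (simp add: lin_superset[of ?A] lookup_add algebra_simps sum.distrib)
qed

lemma lin_single [simp]: "lin \<phi> (Poly_Mapping.single w a) = a * \<phi> (letters w)"
  by (simp add: lin_def)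

lemma lin_zero [simp]: "lin \<phi> 0 = 0"
  by (simp add: lin_def)

lemma lin_uminus [simp]: "lin \<phi> (- f) = - lin \<phi> f"
  by (simp add: lin_def sum_negf)

lemma lin_diff [simp]: "lin \<phi> (f - g) = lin \<phi> f - lin \<phi> g"
  using lin_add[of \<phi> f "- g"] by simp

lemma lin_sum [simp]: "lin \<phi> (sum f A) = (\<Sum>x\<in>A. lin \<phi> (f x))"
  by (induction A rule: infinite_finite_induct) auto

lemma ncpoly_eq_sum_single:
  fixes f :: "'g ncpoly"
  shows "f = (\<Sum>w\<in>Poly_Mapping.keys f. Poly_Mapping.single w (Poly_Mapping.lookup f w))"
  by (rule poly_mapping_eqI)
     (auto simp: lookup_sum lookup_single when_def in_keys_iff sum.delta)

lemma ncpoly_induct [case_names zero add single]: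
  fixes f :: "'g ncpoly"
  assumes "P 0" "\<And>f g. P f \<Longrightarrow> P g \<Longrightarrow> P (f + g)" "\<And>w a. P (Poly_Mapping.single w a)"
  shows "P f"
proof -
  have "P (\<Sum>w\<in>A. Poly_Mapping.single w (Poly_Mapping.lookup f w))" if "finite A" for A
    using that by (induction A) (auto intro: assms)
  from this[OF finite_keys[of f]] show ?thesis
    by (simp flip: ncpoly_eq_sum_single)
qed

text \<open>A Fubini rule: words of \<open>f\<close> are prepended to words of \<open>g\<close>. For
  a \<open>\<phi>\<close> multiplicative on words it makes characters multiplicative, for
  compositions of operators it makes representations multiplicative.\<close>

lemma lin_mult: "lin \<phi> (f * g) = lin (\<lambda>v. lin (\<lambda>w. \<phi> (v @ w)) g) f"
proof (induction f rule: ncpoly_induct)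
  case (single w a)
  show ?case
    by (induction g rule: ncpoly_induct) (auto simp: mult_single algebra_simps)
qed (auto simp: algebra_simps)

lemma scal_mult_single [simp]: "scal a * Poly_Mapping.single w b = Poly_Mapping.single w (a * b)"
  by (simp add: scal_def mult_single)

lemma lin_scal_mult [simp]: "lin \<phi> (scal a * f) = a * lin \<phi> f"
  by (simp add: lin_mult) (simp add: scal_def)

lemma lin_scal [simp]: "lin \<phi> (scal a) = a * \<phi> []"
  by (simp add: scal_def)

lemma lin_one [simp]: "lin \<phi> 1 = \<phi> []"
  by (simp flip: single_one)

lemma lin_gen [simp]: "lin \<phi> (gen x) = \<phi> [x]"
  by (simp add: gen_def)

lemma lin_lincomb: "lin (\<lambda>w. a * \<phi> w + b * \<psi> w) f = a * lin \<phi> f + b * lin \<psi> f"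
  by (simp add: lin_def algebra_simps sum.distrib sum_distrib_left)

lemma scal_0 [simp]: "scal 0 = 0" and scal_1 [simp]: "scal 1 = 1"
  by (simp_all add: scal_def)

lemma scal_add: "scal (a + b) = scal a + scal b"
  by (simp add: scal_def single_add)

lemma scal_uminus: "scal (- a) = - scal a"
  by (simp add: scal_def single_uminus)

lemma scal_diff: "scal (a - b) = scal a - scal b"
  by (simp add: scal_def single_diff)

lemma scal_mult: "scal (a * b) = scal a * scal b"
  by (simp add: scal_def mult_single)

lemma scal_comm: "f * scal a = scal a * f"
proof (induction f rule: ncpoly_induct)
  case (single w b)
  then show ?case by (simp add: scal_def mult_single mult.commute)
qed (auto simp: algebra_simps)

lemma scal_left_comm: "f * (scal a * g) = scal a * (f * g)"
  by (metis mult.assoc scal_comm)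

lemma eval_character_add [simp]: "eval_character \<chi> (f + g) = eval_character \<chi> f + eval_character \<chi> g"
  and eval_character_diff [simp]: "eval_character \<chi> (f - g) = eval_character \<chi> f - eval_character \<chi> g"
  and eval_character_uminus [simp]: "eval_character \<chi> (- f) = - eval_character \<chi> f"
  and eval_character_zero [simp]: "eval_character \<chi> 0 = 0"
  and eval_character_one [simp]: "eval_character \<chi> 1 = 1"
  and eval_character_scal [simp]: "eval_character \<chi> (scal a) = a"
  and eval_character_gen [simp]: "eval_character \<chi> (gen x) = \<chi> x"
  and eval_character_sum [simp]: "eval_character \<chi> (sum h A) = (\<Sum>x\<in>A. eval_character \<chi> (h x))"
  by (simp_all add: eval_character_eq_lin)

lemma eval_character_mult [simp]:
  "eval_character \<chi> (f * g) = eval_character \<chi> f * eval_character \<chi> g"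
proof -
  have "lin (\<lambda>w. prod_list (map \<chi> (v @ w))) g = prod_list (map \<chi> v) * lin (\<lambda>w. prod_list (map \<chi> w)) g"
    for v
    using lin_lincomb[of "prod_list (map \<chi> v)" "\<lambda>w. prod_list (map \<chi> w)" 0 "\<lambda>_. 0" g] by simp
  then show ?thesis
    using lin_lincomb[of "lin (\<lambda>w. prod_list (map \<chi> w)) g" "\<lambda>w. prod_list (map \<chi> w)" 0 "\<lambda>_. 0" f]
    by (simp add: eval_character_eq_lin lin_mult mult.commute)
qed

lemma eval_character_power [simp]: "eval_character \<chi> (f ^ k) = eval_character \<chi> f ^ k"
  by (induction k) auto

lemma eval_character_prod_list [simp]:
  "eval_character \<chi> (prod_list fs) = prod_list (map (eval_character \<chi>) fs)"
  by (induction fs) auto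

subsection \<open>Free algebras\<close>

abbreviation FA :: "'g set \<Rightarrow> 'g ncpoly set" where
  "FA G \<equiv> carrier (free_algebra G)"

lemma FA_def: "f \<in> FA G \<longleftrightarrow> (\<forall>w\<in>Poly_Mapping.keys f. set (letters w) \<subseteq> G)"
  by (simp add: free_algebra_def)

lemma free_algebra_simps [simp]:
  "mult (free_algebra G) = (*)" "one (free_algebra G) = 1" "zero (free_algebra G) = 0"
  "add (free_algebra G) = (+)" "smult (free_algebra G) = (\<lambda>a f. scal a * f)"
  by (simp_all add: free_algebra_def)

lemma FA_add: "f \<in> FA G \<Longrightarrow> g \<in> FA G \<Longrightarrow> f + g \<in> FA G"
  using Poly_Mapping.keys_add[of f g] by (auto simp: FA_def)

lemma FA_uminus: "f \<in> FA G \<Longrightarrow> - f \<in> FA G"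
  by (auto simp: FA_def)

lemma FA_diff: "f \<in> FA G \<Longrightarrow> g \<in> FA G \<Longrightarrow> f - g \<in> FA G"
  using FA_add[of f G "- g"] FA_uminus[of g G] by simp

lemma FA_mult: "f \<in> FA G \<Longrightarrow> g \<in> FA G \<Longrightarrow> f * g \<in> FA G"
  using keys_mult[of f g] by (fastforce simp: FA_def)

lemma FA_zero: "0 \<in> FA G" and FA_one: "1 \<in> FA G" and FA_scal: "scal a \<in> FA G"
  by (auto simp: FA_def scal_def split: if_splits)

lemma FA_gen: "x \<in> G \<Longrightarrow> gen x \<in> FA G"
  by (auto simp: FA_def gen_def)

lemma FA_power: "f \<in> FA G \<Longrightarrow> f ^ k \<in> FA G"
  by (induction k) (auto intro: FA_mult FA_one)

lemma FA_sum: "(\<And>x. x \<in> A \<Longrightarrow> f x \<in> FA G) \<Longrightarrow> sum f A \<in> FA G"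
  by (induction A rule: infinite_finite_induct) (auto intro: FA_zero FA_add)

lemma FA_prod_list: "set fs \<subseteq> FA G \<Longrightarrow> prod_list fs \<in> FA G"
  by (induction fs) (auto intro: FA_mult FA_one)

lemmas FA_intros = FA_add FA_uminus FA_diff FA_mult FA_zero FA_one FA_scal FA_gen FA_power FA_sum FA_prod_list

text \<open>Letters are stripped from the left, as suits left modules: the case \<open>gen\<close>
  asks only for the action of one generator on something already understood.\<close>

lemma FA_induct [consumes 1, case_names one add scal gen]:
  assumes "f \<in> FA G" "P 1" "\<And>f g. f \<in> FA G \<Longrightarrow> g \<in> FA G \<Longrightarrow> P f \<Longrightarrow> P g \<Longrightarrow> P (f + g)"
    "\<And>a f. f \<in> FA G \<Longrightarrow> P f \<Longrightarrow> P (scal a * f)" "\<And>x f. x \<in> G \<Longrightarrow> f \<in> FA G \<Longrightarrow> P f \<Longrightarrow> P (gen x * f)"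
  shows "P f"
proof -
  have word: "Poly_Mapping.single (Word xs) 1 \<in> FA G \<and> P (Poly_Mapping.single (Word xs) 1)" if "set xs \<subseteq> G" for xs
    using that
  proof (induction xs)
    case Nil
    then show ?case
      using assms(2) by (simp flip: zero_free_monoid_def add: FA_one)
  next
    case (Cons x xs)
    have "Poly_Mapping.single (Word (x # xs)) 1 = gen x * Poly_Mapping.single (Word xs) (1 :: complex)"
      by (simp add: gen_def mult_single plus_free_monoid_def)
    then show ?case
      using Cons assms(5) by (auto intro!: FA_mult FA_gen)
  qed
  have zero: "P 0"
    using assms(4)[OF FA_one assms(2), of 0] by simp
  have "(\<Sum>w\<in>A. Poly_Mapping.single w (Poly_Mapping.lookup f w)) \<in> FA G \<and>
      P (\<Sum>w\<in>A. Poly_Mapping.single w (Poly_Mapping.lookup f w))"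
    if "finite A" "A \<subseteq> Poly_Mapping.keys f" for A
    using that
  proof (induction A)
    case (insert w A)
    have "set (letters w) \<subseteq> G"
      using assms(1) insert by (auto simp: FA_def)
    with word[of "letters w"] have *: "Poly_Mapping.single w 1 \<in> FA G" "P (Poly_Mapping.single w 1)"
      by auto
    have "Poly_Mapping.single w (Poly_Mapping.lookup f w) =
        scal (Poly_Mapping.lookup f w) * Poly_Mapping.single w 1"
      by simp
    then have "Poly_Mapping.single w (Poly_Mapping.lookup f w) \<in> FA G"
        "P (Poly_Mapping.single w (Poly_Mapping.lookup f w))"
      using * assms(4) by (metis FA_mult FA_scal)+
    then show ?case
      using insert by (auto intro!: assms(3) FA_add)
  qed (simp add: zero FA_zero)
  from this[OF finite_keys[of f]] show ?thesis
    by (simp flip: ncpoly_eq_sum_single)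
qed

lemma ring_free_algebra: "ring (free_algebra G)"
proof (rule ringI)
  show "abelian_group (free_algebra G)"
  proof (rule abelian_groupI)
    show "\<exists>y\<in>FA G. y \<oplus>\<^bsub>free_algebra G\<^esub> x = \<zero>\<^bsub>free_algebra G\<^esub>" if "x \<in> FA G" for x
      using that by (auto intro!: bexI[of _ "- x"] FA_intros)
  qed (auto intro: FA_intros)
  show "Group.monoid (free_algebra G)"
    by (rule monoidI) (auto intro: FA_intros simp: mult.assoc)
qed (auto simp: algebra_simps)

lemma a_minus_free_algebra: "x \<in> FA G \<Longrightarrow> \<ominus>\<^bsub>free_algebra G\<^esub> x = - x"
proof -
  assume x: "x \<in> FA G"
  interpret ring "free_algebra G" by (rule ring_free_algebra)
  show ?thesis
    using x minus_equality[of "- x" x] by (auto intro: FA_intros)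
qed

lemma eval_character_cong:
  assumes "f \<in> FA G" "\<And>x. x \<in> G \<Longrightarrow> \<chi> x = \<chi>' x"
  shows "eval_character \<chi> f = eval_character \<chi>' f"
  using assms(1) by (induction f rule: FA_induct) (auto simp: assms(2))

text \<open>A polynomial in \<open>a\<close> that is divisible by \<open>a ^ N\<close> and congruent to \<open>1\<close> modulo \<open>(1 - a) ^ N\<close>.\<close>

definition idem_poly :: "nat \<Rightarrow> 'a \<Rightarrow> 'a :: ring_1" where
  "idem_poly N a = 1 - (1 - a ^ N) ^ N"

lemma one_minus_power_ring:
  fixes x :: "'a :: ring_1"
  shows "(1 - x) * (\<Sum>i<n. x ^ i) = 1 - x ^ n"
proof (induction n)
  case (Suc n)
  then show ?case by (simp add: distrib_left) (simp add: algebra_simps)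
qed simp

lemma power_mult_distrib_commuting:
  fixes x y :: "'a :: monoid_mult"
  assumes "x * y = y * x"
  shows "(x * y) ^ n = x ^ n * y ^ n"
proof (induction n)
  case (Suc n)
  have "y * x ^ n = x ^ n * y"
    using power_commuting_commutes[OF assms] by metis
  then show ?case
    using Suc by (metis mult.assoc power_Suc)
qed simp

lemma commutes_sum_power:
  fixes x y :: "'a :: ring_1"
  assumes "x * y = y * x"
  shows "(\<Sum>i<n. x ^ i) * y = y * (\<Sum>i<n. x ^ i)"
  using assms by (simp add: sum_distrib_left sum_distrib_right power_commuting_commutes)

text \<open>With \<open>b = 1 - a ^ N\<close> the difference is minus
  \<open>(1 - b ^ N) * b ^ N\<close>. The first factor is divisible by \<open>a ^ N\<close>, the
  second by \<open>(1 - a) ^ N\<close>, and all factors are polynomials in \<open>a\<close> and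
  commute. Hence \<open>idem_poly N a\<close> is idempotent on every vector killed by the
  \<open>N\<close>-th power of \<open>a * (1 - a)\<close>.\<close>

lemma idem_poly_idem:
  fixes a :: "'a :: ring_1"
  shows "\<exists>w. idem_poly N a * idem_poly N a - idem_poly N a = w * (a * (1 - a)) ^ N"
proof -
  define b where "b = 1 - a ^ N"
  define S where "S = (\<Sum>i<N. a ^ i)"
  define T where "T = (\<Sum>i<N. b ^ i)"
  have ab: "b * a = a * b"
    by (simp add: b_def algebra_simps power_commutes)
  have aS: "S * a = a * S"
    unfolding S_def by (rule commutes_sum_power) simp
  have bS: "b = (1 - a) * S"
    by (simp add: b_def S_def one_minus_power_ring)
  have comm: "(1 - a) * S = S * (1 - a)"
    using aS by (simp add: algebra_simps)
  have bN: "b ^ N = S ^ N * (1 - a) ^ N"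
    using power_mult_distrib_commuting[of S "1 - a" N] comm bS by metis
  have "T * a = a * T"
    unfolding T_def by (rule commutes_sum_power[OF ab])
  then have aNT: "a ^ N * T = T * a ^ N"
    using power_commuting_commutes[of a T N] by metis
  have T: "1 - b ^ N = a ^ N * T"
    using one_minus_power_ring[of b N] by (simp add: T_def b_def)
  have aSN: "a ^ N * S ^ N = S ^ N * a ^ N"
    by (metis aS power_commuting_commutes)
  have aaN: "a ^ N * (1 - a) ^ N = (a * (1 - a)) ^ N"
    by (rule power_mult_distrib_commuting[symmetric]) (simp add: algebra_simps)
  have "idem_poly N a * idem_poly N a - idem_poly N a = - ((1 - b ^ N) * b ^ N)"
    by (simp add: idem_poly_def b_def algebra_simps)
  also have "(1 - b ^ N) * b ^ N = T * a ^ N * (S ^ N * (1 - a) ^ N)"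
    unfolding bN[symmetric] T aNT ..
  also have "\<dots> = T * (S ^ N * (a ^ N * (1 - a) ^ N))"
    by (metis aSN mult.assoc)
  also have "- \<dots> = (- (T * S ^ N)) * (a * (1 - a)) ^ N"
    by (simp add: aaN mult.assoc)
  finally show ?thesis by blast
qed

text \<open>The polynomial fixes 0 and 1, so lifting to an idempotent does not disturb the
  diagonal.\<close>

lemma eval_character_idem_poly:
  assumes "eval_character \<chi> a \<in> {0, 1}" "N > 0"
  shows "eval_character \<chi> (idem_poly N a) = eval_character \<chi> a"
  using assms by (auto simp: idem_poly_def power_0_left)

lemma FA_idem_poly: "a \<in> FA G \<Longrightarrow> idem_poly N a \<in> FA G"
  by (auto simp: idem_poly_def intro!: FA_intros)

subsection \<open>Leading terms\<close>

text \<open>The cardinality of the set of leading terms plays the role of the dimension of a subspace.\<close>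

locale ranked_basis =
  fixes B :: "'s set" and rk :: "'s \<Rightarrow> nat"
  assumes fin_B: "finite B" and rk_inj: "inj_on rk B"
begin

definition V :: "('s \<Rightarrow> complex) set" where
  "V = {v. \<forall>\<sigma>. v \<sigma> \<noteq> 0 \<longrightarrow> \<sigma> \<in> B}"

definition below :: "nat \<Rightarrow> ('s \<Rightarrow> complex) set" where
  "below k = {v \<in> V. \<forall>\<sigma>. v \<sigma> \<noteq> 0 \<longrightarrow> rk \<sigma> < k}"

definition height :: nat where
  "height = Suc (Max (insert 0 (rk ` B)))"

text \<open>The entry at \<sigma> itself may vanish; in this weak form the property is inherited by
  images under triangular operators.\<close>

definition top_at :: "'s \<Rightarrow> ('s \<Rightarrow> complex) \<Rightarrow> bool" where
  "top_at \<sigma> v \<longleftrightarrow> (\<forall>\<tau>\<in>B. rk \<sigma> < rk \<tau> \<longrightarrow> v \<tau> = 0)"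

definition subsp :: "('s \<Rightarrow> complex) set \<Rightarrow> bool" where
  "subsp W \<longleftrightarrow> W \<subseteq> V \<and> (\<lambda>_. 0) \<in> W \<and> (\<forall>v\<in>W. \<forall>w\<in>W. \<forall>a b. (\<lambda>\<sigma>. a * v \<sigma> + b * w \<sigma>) \<in> W)"

definition lead :: "('s \<Rightarrow> complex) set \<Rightarrow> 's set" where
  "lead W = {\<sigma>\<in>B. \<exists>w\<in>W. w \<sigma> \<noteq> 0 \<and> top_at \<sigma> w}"

lemma V_D: "v \<in> V \<Longrightarrow> \<sigma> \<notin> B \<Longrightarrow> v \<sigma> = 0"
  by (auto simp: V_def)

lemma rk_less_height: "\<sigma> \<in> B \<Longrightarrow> rk \<sigma> < height"
  using fin_B by (auto simp: height_def less_Suc_eq_le intro!: Max_ge)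

lemma V_below: "v \<in> V \<Longrightarrow> v \<in> below height"
  using rk_less_height by (auto simp: below_def V_def)

lemma below_0: "v \<in> below 0 \<Longrightarrow> v = (\<lambda>_. 0)"
  by (auto simp: below_def)

lemma V_lincomb: "v \<in> V \<Longrightarrow> w \<in> V \<Longrightarrow> (\<lambda>\<sigma>. a * v \<sigma> + b * w \<sigma>) \<in> V"
  by (auto simp: V_def) force

lemma subsp_lincomb: "subsp W \<Longrightarrow> v \<in> W \<Longrightarrow> w \<in> W \<Longrightarrow> (\<lambda>\<sigma>. a * v \<sigma> + b * w \<sigma>) \<in> W"
  by (simp add: subsp_def)

lemma finite_lead: "finite (lead W)"
  using fin_B by (simp add: lead_def)

lemma lead_mono: "W \<subseteq> W' \<Longrightarrow> lead W \<subseteq> lead W'"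
  by (auto simp: lead_def)

lemma lead_zero: "lead {\<lambda>_. 0} = {}"
  by (simp add: lead_def)

text \<open>Gaussian elimination: the leading entry of a vector of \<open>W'\<close> is cancelled by
  a vector of \<open>W\<close> with the same leading position, and the remainder has smaller rank.
  Injectivity of \<open>rk\<close> makes leading positions unique.\<close>

lemma lead_eq_imp_eq:
  assumes W: "subsp W" "subsp W'" "W \<subseteq> W'" "lead W = lead W'"
  shows "W = W'"
proof -
  have "v \<in> W" if "v \<in> W'" "v \<in> below k" for v k
    using that
  proof (induction k arbitrary: v)
    case 0
    then show ?case using below_0[of v] W(1) by (simp add: subsp_def)
  next
    case (Suc k)
    show ?case
    proof (cases "v \<in> below k")
      case False
      then obtain \<sigma> where \<sigma>: "v \<sigma> \<noteq> 0" "rk \<sigma> = k" "\<sigma> \<in> B"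
        using Suc.prems(2) by (auto simp: below_def V_def less_Suc_eq)
      have top: "top_at \<sigma> v"
        using Suc.prems(2) \<sigma> by (auto simp: top_at_def below_def)
      then have "\<sigma> \<in> lead W"
        using \<sigma> Suc.prems(1) W(4) by (auto simp: lead_def)
      then obtain w where w: "w \<in> W" "w \<sigma> \<noteq> 0" "top_at \<sigma> w"
        by (auto simp: lead_def)
      define a where "a = v \<sigma> / w \<sigma>"
      let ?x = "\<lambda>\<tau>. 1 * v \<tau> + (- a) * w \<tau>"
      have x: "?x \<in> W'"
        using Suc.prems(1) w(1) W by (intro subsp_lincomb) auto
      moreover have "?x \<in> below k"
        unfolding below_def
      proof (intro CollectI conjI allI impI)
        show "?x \<in> V" using x W(2) by (auto simp: subsp_def)
        fix \<tau> assume nz: "?x \<tau> \<noteq> 0"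
        then have \<tau>: "\<tau> \<in> B" using \<open>?x \<in> V\<close> V_D by blast
        show "rk \<tau> < k"
        proof (rule ccontr)
          assume "\<not> rk \<tau> < k"
          then have "\<tau> = \<sigma> \<or> rk \<tau> > rk \<sigma>"
            using \<sigma> \<tau> rk_inj by (metis inj_onD linorder_neqE_nat)
          with nz top w \<tau> show False
            by (auto simp: top_at_def a_def)
        qed
      qed
      ultimately have "?x \<in> W" by (rule Suc.IH)
      then have "(\<lambda>\<tau>. 1 * ?x \<tau> + a * w \<tau>) \<in> W"
        by (rule subsp_lincomb[OF W(1) _ w(1)])
      moreover have "(\<lambda>\<tau>. 1 * ?x \<tau> + a * w \<tau>) = v" by auto
      ultimately show ?thesis by simp
    qed (use Suc in auto)
  qed
  moreover have "W' \<subseteq> V"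
    using W(2) by (simp add: subsp_def)
  ultimately have "W' \<subseteq> W"
    using V_below by blast
  then show ?thesis using W(3) by blast
qed

text \<open>Some leading position is new by \<open>lead_eq_imp_eq\<close>. Two new ones, at
  \<open>s\<close> and at \<open>t\<close> of larger rank, are impossible: the combination of the
  two vectors in which \<open>p\<close> cancels lies in \<open>W\<close> and still leads at
  \<open>t\<close>.\<close>

lemma card_lead_extend:
  assumes W: "subsp W" and p: "p \<in> V" "p \<notin> W"
    and W': "W' = {(\<lambda>\<sigma>. w \<sigma> + a * p \<sigma>) | w a. w \<in> W}" and sub: "subsp W'"
  shows "card (lead W') = Suc (card (lead W))"
proof -
  have le: "W \<subseteq> W'"
  proof
    fix w assume "w \<in> W"
    then show "w \<in> W'" unfolding W' by (intro CollectI exI[of _ w] exI[of _ 0]) auto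
  qed
  have "p \<in> W'"
    unfolding W' using W by (intro CollectI exI[of _ "\<lambda>_. 0"] exI[of _ 1]) (auto simp: subsp_def)
  then have "W \<noteq> W'" using p by auto
  then have "lead W \<noteq> lead W'"
    using lead_eq_imp_eq[OF W sub le] by auto
  then obtain \<sigma> where \<sigma>: "\<sigma> \<in> lead W'" "\<sigma> \<notin> lead W"
    using lead_mono[OF le] by auto
  have uniq: "\<tau> = \<sigma>" if \<tau>: "\<tau> \<in> lead W'" "\<tau> \<notin> lead W" for \<tau>
  proof (rule ccontr)
    assume ne: "\<tau> \<noteq> \<sigma>"
    have *: False if s: "s \<in> lead W'" "s \<notin> lead W" "t \<in> lead W'" "t \<notin> lead W" "rk s < rk t" for s t
    proof -
      from s obtain x y where x: "x \<in> W'" "x s \<noteq> 0" "top_at s x" and y: "y \<in> W'" "y t \<noteq> 0" "top_at t y"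
        and st: "s \<in> B" "t \<in> B"
        by (auto simp: lead_def)
      from x y obtain x1 a y1 b where e: "x = (\<lambda>\<sigma>. x1 \<sigma> + a * p \<sigma>)" "y = (\<lambda>\<sigma>. y1 \<sigma> + b * p \<sigma>)" "x1 \<in> W" "y1 \<in> W"
        unfolding W' by auto
      have "a \<noteq> 0"
      proof
        assume "a = 0"
        then show False using x e s st by (auto simp: lead_def)
      qed
      let ?z = "\<lambda>\<sigma>. a * y1 \<sigma> + (- b) * x1 \<sigma>"
      have z: "?z \<in> W" using W e by (intro subsp_lincomb)
      have zz: "?z \<sigma> = a * y \<sigma> - b * x \<sigma>" for \<sigma>
        by (simp add: e algebra_simps)
      have "x t = 0" using x(3) s(5) st by (auto simp: top_at_def)
      then have "?z t \<noteq> 0"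
        unfolding zz using y(2) \<open>a \<noteq> 0\<close> by simp
      moreover have "top_at t ?z"
        unfolding top_at_def
      proof (intro ballI impI)
        fix \<tau> assume "\<tau> \<in> B" "rk t < rk \<tau>"
        then have "x \<tau> = 0" "y \<tau> = 0"
          using x(3) y(3) s(5) by (simp_all add: top_at_def)
        then show "?z \<tau> = 0" unfolding zz by simp
      qed
      ultimately have "t \<in> lead W"
        using z st unfolding lead_def by (intro CollectI conjI bexI[of _ ?z])
      then show False using s by simp
    qed
    have "rk \<sigma> \<noteq> rk \<tau>"
      using ne rk_inj \<sigma> \<tau> by (auto simp: lead_def inj_on_def)
    then show False
      using *[of \<sigma> \<tau>] *[of \<tau> \<sigma>] \<sigma> \<tau> by (meson linorder_neqE_nat)
  qed
  then have "lead W' = insert \<sigma> (lead W)"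
    using lead_mono[OF le] \<sigma> by blast
  then show ?thesis
    using \<sigma> finite_lead by simp
qed

text \<open>If \<open>t \<sigma>\<close> is nonzero, the image of the indicator of \<sigma> leads at
  \<sigma>. Conversely a vector of the image is fixed by \<open>T\<close>, so its leading entry
  equals \<open>t \<sigma>\<close> times itself.\<close>

lemma lead_idempotent_image:
  assumes T: "\<And>v. v \<in> V \<Longrightarrow> T v \<in> V" "\<And>v. v \<in> V \<Longrightarrow> T (T v) = T v"
    and diag: "\<And>v \<sigma>. v \<in> V \<Longrightarrow> \<sigma> \<in> B \<Longrightarrow> top_at \<sigma> v \<Longrightarrow> T v \<sigma> = t \<sigma> * v \<sigma>"
  shows "lead (T ` V) = {\<sigma>\<in>B. t \<sigma> \<noteq> 0}"
proof -
  have top: "top_at \<sigma> (T v)" if "v \<in> V" "top_at \<sigma> v" for v \<sigma>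
    using that diag by (auto simp: top_at_def)
  have "\<sigma> \<in> lead (T ` V)" if "\<sigma> \<in> B" "t \<sigma> \<noteq> 0" for \<sigma>
  proof -
    let ?d = "\<lambda>\<tau>. if \<tau> = \<sigma> then 1 else 0 :: complex"
    have "?d \<in> V" "top_at \<sigma> ?d"
      using that by (auto simp: V_def top_at_def)
    then show ?thesis
      using that diag[of ?d \<sigma>] top[of ?d \<sigma>]
      unfolding lead_def by (intro CollectI conjI bexI[of _ "T ?d"]) simp_all
  qed
  moreover have "t \<sigma> \<noteq> 0" if "\<sigma> \<in> lead (T ` V)" for \<sigma>
  proof -
    from that obtain v where v: "v \<in> V" "T v \<sigma> \<noteq> 0" "top_at \<sigma> (T v)" "\<sigma> \<in> B"
      by (auto simp: lead_def)
    then have "T (T v) \<sigma> = t \<sigma> * T v \<sigma>"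
      using T(1) by (intro diag) auto
    then show ?thesis using T(2) v by auto
  qed
  ultimately show ?thesis
    by (auto simp: lead_def)
qed

end

subsection \<open>Triangular representations of free algebras\<close>

text \<open>A generator combines the entry at \<sigma> with a single entry of strictly larger rank.
  Both directions of the equivalence in \<open>sh_B\<close> matter: one keeps the support of vectors
  inside \<open>B\<close>, the other lets the induction on ranks continue inside
  \<open>B\<close>.\<close>

locale triangular_rep = ranked_basis B rk for B :: "'s set" and rk +
  fixes G :: "'g set" and dg off :: "'g \<Rightarrow> 's \<Rightarrow> complex" and sh :: "'g \<Rightarrow> 's \<Rightarrow> 's"
  assumes sh_B: "g \<in> G \<Longrightarrow> off g \<sigma> \<noteq> 0 \<Longrightarrow> sh g \<sigma> \<in> B \<longleftrightarrow> \<sigma> \<in> B"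
    and rk_sh: "g \<in> G \<Longrightarrow> \<sigma> \<in> B \<Longrightarrow> off g \<sigma> \<noteq> 0 \<Longrightarrow> rk \<sigma> < rk (sh g \<sigma>)"
begin

definition gop :: "'g \<Rightarrow> ('s \<Rightarrow> complex) \<Rightarrow> 's \<Rightarrow> complex" where
  "gop g v \<sigma> = dg g \<sigma> * v \<sigma> + off g \<sigma> * v (sh g \<sigma>)"

definition rho :: "'g ncpoly \<Rightarrow> ('s \<Rightarrow> complex) \<Rightarrow> 's \<Rightarrow> complex" where
  "rho f v \<sigma> = lin (\<lambda>w. foldr gop w v \<sigma>) f"

lemma rho_add: "rho (f + g) v \<sigma> = rho f v \<sigma> + rho g v \<sigma>"
  and rho_diff: "rho (f - g) v \<sigma> = rho f v \<sigma> - rho g v \<sigma>"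
  and rho_uminus: "rho (- f) v \<sigma> = - rho f v \<sigma>"
  and rho_zero: "rho 0 v \<sigma> = 0"
  and rho_one: "rho 1 v \<sigma> = v \<sigma>"
  and rho_scal: "rho (scal a) v \<sigma> = a * v \<sigma>"
  and rho_gen: "rho (gen x) v \<sigma> = gop x v \<sigma>"
  and rho_sum: "rho (sum h A) v \<sigma> = (\<Sum>i\<in>A. rho (h i) v \<sigma>)"
  by (simp_all add: rho_def)

lemma rho_one': "rho 1 v = v"
  by (auto simp: rho_one)

lemma foldr_gop_lin:
  "foldr gop v (\<lambda>\<sigma>. lin (\<lambda>w. F w \<sigma>) g) \<sigma> = lin (\<lambda>w. foldr gop v (F w) \<sigma>) g"
proof (induction v arbitrary: \<sigma>)
  case (Cons a v)
  show ?case
    by (simp only: foldr.simps comp_apply gop_def[of a] Cons lin_lincomb)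
qed simp

lemma rho_mult: "rho (f * g) v = rho f (rho g v)"
proof
  fix \<sigma>
  have "rho g v = (\<lambda>\<sigma>. lin (\<lambda>w. foldr gop w v \<sigma>) g)"
    by (auto simp: rho_def)
  then show "rho (f * g) v \<sigma> = rho f (rho g v) \<sigma>"
    by (simp add: rho_def lin_mult foldr_gop_lin)
qed

lemma gop_lincomb: "gop g (\<lambda>\<sigma>. a * v \<sigma> + b * w \<sigma>) = (\<lambda>\<sigma>. a * gop g v \<sigma> + b * gop g w \<sigma>)"
  by (auto simp: gop_def algebra_simps)

lemma foldr_gop_lincomb:
  "foldr gop ws (\<lambda>\<sigma>. a * v \<sigma> + b * w \<sigma>) = (\<lambda>\<sigma>. a * foldr gop ws v \<sigma> + b * foldr gop ws w \<sigma>)"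
  by (induction ws) (auto simp: gop_lincomb)

lemma rho_lincomb: "rho f (\<lambda>\<sigma>. a * v \<sigma> + b * w \<sigma>) = (\<lambda>\<sigma>. a * rho f v \<sigma> + b * rho f w \<sigma>)"
  by (auto simp: rho_def foldr_gop_lincomb lin_lincomb)

lemma rho_vscale: "rho f (\<lambda>\<sigma>. a * v \<sigma>) = (\<lambda>\<sigma>. a * rho f v \<sigma>)"
  using rho_lincomb[of f a v 0 v] by simp

lemma rho_vadd: "rho f (\<lambda>\<sigma>. v \<sigma> + w \<sigma>) = (\<lambda>\<sigma>. rho f v \<sigma> + rho f w \<sigma>)"
  using rho_lincomb[of f 1 v 1 w] by simp

lemma rho_vdiff: "rho f (\<lambda>\<sigma>. v \<sigma> - w \<sigma>) = (\<lambda>\<sigma>. rho f v \<sigma> - rho f w \<sigma>)"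
  using rho_lincomb[of f 1 v "-1" w] by simp

lemma rho_vzero: "rho f (\<lambda>_. 0) = (\<lambda>_. 0)"
  using rho_vscale[of f 0 "\<lambda>_. 0"] by simp

lemma gop_V:
  assumes "g \<in> G" "v \<in> V" shows "gop g v \<in> V"
proof -
  have "\<sigma> \<in> B" if "gop g v \<sigma> \<noteq> 0" for \<sigma>
  proof (rule ccontr)
    assume "\<sigma> \<notin> B"
    then have "v \<sigma> = 0" "off g \<sigma> = 0 \<or> v (sh g \<sigma>) = 0"
      using assms sh_B V_D by blast+
    then show False using that by (auto simp: gop_def)
  qed
  then show ?thesis by (simp add: V_def)
qed

lemma rho_V: "f \<in> FA G \<Longrightarrow> v \<in> V \<Longrightarrow> rho f v \<in> V"
proof (induction f rule: FA_induct)
  case one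
  then show ?case by (simp add: rho_one')
next
  case (add f g)
  then show ?case
    using V_lincomb[of "rho f v" "rho g v" 1 1] by (simp add: rho_add[abs_def])
next
  case (scal a f)
  then show ?case
    using V_lincomb[of "rho f v" "rho f v" a 0] by (simp add: rho_mult rho_scal[abs_def])
next
  case (gen x f)
  then show ?case
    using gop_V[of x "rho f v"] by (simp add: rho_mult rho_gen[abs_def])
qed

text \<open>The shifted entry sits at a position of larger rank, where \<open>v\<close> vanishes and
  \<open>top_at\<close> holds again, so by induction it contributes nothing. Only the diagonal
  survives, and it multiplies letter by letter.\<close>

lemma rho_diag:
  assumes "f \<in> FA G" "v \<in> V" "\<sigma> \<in> B" "top_at \<sigma> v"
  shows "rho f v \<sigma> = eval_character (\<lambda>g. dg g \<sigma>) f * v \<sigma>"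
  using assms
proof (induction f arbitrary: \<sigma> rule: FA_induct)
  case one
  then show ?case by (simp add: rho_one')
next
  case (add f g)
  then show ?case by (simp add: rho_add algebra_simps)
next
  case (scal a f)
  then show ?case by (simp add: rho_mult rho_scal)
next
  case (gen x f)
  have "off x \<sigma> * rho f v (sh x \<sigma>) = 0"
  proof (cases "off x \<sigma> = 0")
    case False
    then have s: "sh x \<sigma> \<in> B" "rk \<sigma> < rk (sh x \<sigma>)"
      using gen.hyps gen.prems sh_B rk_sh by blast+
    then have "v (sh x \<sigma>) = 0" "top_at (sh x \<sigma>) v"
      using gen.prems by (auto simp: top_at_def)
    then have "rho f v (sh x \<sigma>) = 0"
      using gen.IH[of "sh x \<sigma>"] gen.prems s by simp
    then show ?thesis by simp
  qed simp
  then show ?case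
    using gen.IH[of \<sigma>] gen.prems by (simp add: rho_mult rho_gen gop_def)
qed

text \<open>A zero diagonal annihilates the top entry of every vector, so each application lowers
  the bound on the ranks in the support by one; \<open>height\<close> exceeds all ranks.\<close>

lemma rho_nilpotent:
  assumes z: "z \<in> FA G" "\<And>\<sigma>. \<sigma> \<in> B \<Longrightarrow> eval_character (\<lambda>g. dg g \<sigma>) z = 0" and v: "v \<in> V"
  shows "rho (z ^ height) v = (\<lambda>_. 0)"
proof -
  have step: "rho z v \<in> below k" if "v \<in> below (Suc k)" for v k
  proof -
    have v: "v \<in> V" using that by (simp add: below_def)
    have V: "rho z v \<in> V" using z(1) v by (rule rho_V)
    have "rk \<sigma> < k" if "rho z v \<sigma> \<noteq> 0" for \<sigma>
    proof (rule ccontr)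
      assume nl: "\<not> rk \<sigma> < k"
      have B: "\<sigma> \<in> B" using V that by (auto simp: V_def)
      have "top_at \<sigma> v"
        using \<open>v \<in> below (Suc k)\<close> nl unfolding top_at_def below_def by force
      then show False
        using rho_diag[OF z(1) v B] that z(2)[OF B] by simp
    qed
    then show ?thesis using V by (simp add: below_def)
  qed
  have "rho (z ^ k) v \<in> below 0" if "v \<in> below k" for k v
    using that
  proof (induction k arbitrary: v)
    case (Suc k)
    have "rho (z ^ Suc k) v = rho (z ^ k) (rho z v)"
      by (simp add: power_commutes rho_mult[symmetric])
    then show ?case using Suc.IH[OF step[OF Suc.prems]] by simp
  qed (simp add: rho_one')
  then show ?thesis
    using below_0 V_below[OF v] by blast
qed

text \<open>A diagonal of zeros and ones makes \<open>a * (1 - a)\<close> strictly triangular, hence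
  nilpotent of index \<open>height\<close>, and \<open>idem_poly_idem\<close> applies.\<close>

lemma rho_idem_poly:
  assumes a: "a \<in> FA G" "\<And>\<sigma>. \<sigma> \<in> B \<Longrightarrow> eval_character (\<lambda>g. dg g \<sigma>) a \<in> {0, 1}" and v: "v \<in> V"
  defines "e \<equiv> idem_poly height a"
  shows "rho e (rho e v) = rho e v"
proof -
  obtain w where w: "e * e - e = w * (a * (1 - a)) ^ height"
    using idem_poly_idem unfolding e_def by blast
  have "rho ((a * (1 - a)) ^ height) v = (\<lambda>_. 0)"
  proof (rule rho_nilpotent)
    show "a * (1 - a) \<in> FA G" using a by (intro FA_intros)
    show "eval_character (\<lambda>g. dg g \<sigma>) (a * (1 - a)) = 0" if "\<sigma> \<in> B" for \<sigma>
      using a(2)[OF that] by auto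
  qed (rule v)
  then have "rho (e * e - e) v = (\<lambda>_. 0)"
    by (simp add: w rho_mult rho_vzero)
  then show ?thesis
    by (auto simp: rho_diff rho_mult fun_eq_iff)
qed

lemma height_pos: "height > 0"
  by (simp add: height_def)

end

subsection \<open>The ideal of relations\<close>

abbreviation AF :: "nat \<Rightarrow> ak_gen ncpoly set" where
  "AF n \<equiv> FA (ak_gens n)"

definition ak_ideal :: "nat \<Rightarrow> nat \<Rightarrow> (nat \<Rightarrow> complex) \<Rightarrow> ak_gen ncpoly set" where
  "ak_ideal n r u = genideal (free_algebra (ak_gens n)) (ak_relations n r u)"

lemma T_gens [simp]: "GenT i \<in> ak_gens n \<longleftrightarrow> 1 \<le> i \<and> i < n"
  and Xi_gens [simp]: "GenXi j \<in> ak_gens n \<longleftrightarrow> 1 \<le> j \<and> j \<le> n"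
  by (auto simp: ak_gens_def)

lemma FA_lagrange: "x \<in> FA G \<Longrightarrow> lagrange r u k x \<in> FA G"
  unfolding lagrange_def by (intro FA_prod_list) (auto intro!: FA_intros)

lemma ak_relations_FA: "ak_relations n r u \<subseteq> AF n"
  unfolding ak_relations_def
  by (auto simp: case_prod_beta intro!: FA_intros FA_lagrange)

lemma ideal_free_algebraI:
  assumes "I \<subseteq> FA G" "0 \<in> I" "\<And>x y. x \<in> I \<Longrightarrow> y \<in> I \<Longrightarrow> x + y \<in> I"
    "\<And>x y. x \<in> I \<Longrightarrow> y \<in> FA G \<Longrightarrow> y * x \<in> I" "\<And>x y. x \<in> I \<Longrightarrow> y \<in> FA G \<Longrightarrow> x * y \<in> I"
  shows "ideal I (free_algebra G)"
proof (rule idealI[OF ring_free_algebra])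
  interpret ring "free_algebra G" by (rule ring_free_algebra)
  show "subgroup I (add_monoid (free_algebra G))"
  proof (rule add.subgroupI)
    fix a assume a: "a \<in> I"
    have "scal (- 1) * a \<in> I" by (rule assms(4)[OF a FA_scal])
    then show "\<ominus>\<^bsub>free_algebra G\<^esub> a \<in> I"
      using a assms(1) by (simp add: a_minus_free_algebra subsetD scal_uminus)
  qed (use assms in auto)
qed (use assms in auto)

lemma ak_ideal_ideal: "ideal (ak_ideal n r u) (free_algebra (ak_gens n))"
  unfolding ak_ideal_def by (rule ring.genideal_ideal[OF ring_free_algebra ak_relations_FA])

lemma ak_relations_ideal: "ak_relations n r u \<subseteq> ak_ideal n r u"
  unfolding ak_ideal_def by (rule ring.genideal_self[OF ring_free_algebra ak_relations_FA])

lemma ak_ideal_minimal: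
  "ideal I (free_algebra (ak_gens n)) \<Longrightarrow> ak_relations n r u \<subseteq> I \<Longrightarrow> ak_ideal n r u \<subseteq> I"
  unfolding ak_ideal_def by (rule ring.genideal_minimal[OF ring_free_algebra])

lemma ak_ideal_FA: "x \<in> ak_ideal n r u \<Longrightarrow> x \<in> AF n"
  using ideal.Icarr[OF ak_ideal_ideal] .

lemma ak_ideal_mult:
  assumes "x \<in> ak_ideal n r u" "y \<in> AF n"
  shows "y * x \<in> ak_ideal n r u" "x * y \<in> ak_ideal n r u"
  using ideal.I_l_closed[OF ak_ideal_ideal assms] ideal.I_r_closed[OF ak_ideal_ideal assms] by simp_all

lemma ak_ideal_zero: "0 \<in> ak_ideal n r u"
  using additive_subgroup.zero_closed[OF ideal.axioms(1)[OF ak_ideal_ideal]] by simp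

lemma ak_ideal_add: "x \<in> ak_ideal n r u \<Longrightarrow> y \<in> ak_ideal n r u \<Longrightarrow> x + y \<in> ak_ideal n r u"
  using additive_subgroup.a_closed[OF ideal.axioms(1)[OF ak_ideal_ideal], of x _ r u y] by simp

lemma ak_ideal_uminus: "x \<in> ak_ideal n r u \<Longrightarrow> - x \<in> ak_ideal n r u"
  using ak_ideal_mult(1)[of x n r u "- 1"] by (simp add: FA_uminus FA_one)

lemma ak_ideal_diff: "x \<in> ak_ideal n r u \<Longrightarrow> y \<in> ak_ideal n r u \<Longrightarrow> x - y \<in> ak_ideal n r u"
  using ak_ideal_add[of x n r u "- y"] ak_ideal_uminus[of y n r u] by simp

lemma ak_relation_cases [consumes 1, case_names quadratic braid comm charpoly xi_comm t_xi t_sum t_xi_comm]: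
  assumes "x \<in> ak_relations n r u"
    and "\<And>i. 1 \<le> i \<Longrightarrow> i < n \<Longrightarrow> P (TT i * (TT i + 1))"
    and "\<And>i. 1 \<le> i \<Longrightarrow> Suc i < n \<Longrightarrow> P (TT i * TT (Suc i) * TT i - TT (Suc i) * TT i * TT (Suc i))"
    and "\<And>i j. 1 \<le> i \<Longrightarrow> i < n \<Longrightarrow> 1 \<le> j \<Longrightarrow> j < n \<Longrightarrow> i + 2 \<le> j \<or> j + 2 \<le> i \<Longrightarrow> P (TT i * TT j - TT j * TT i)"
    and "\<And>j. 1 \<le> j \<Longrightarrow> j \<le> n \<Longrightarrow> P (prod_list (map (\<lambda>l. XX j - scal (u l)) [1..<Suc r]))"
    and "\<And>i j. 1 \<le> i \<Longrightarrow> i \<le> n \<Longrightarrow> 1 \<le> j \<Longrightarrow> j \<le> n \<Longrightarrow> P (XX i * XX j - XX j * XX i)"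
    and "\<And>i. 1 \<le> i \<Longrightarrow> i < n \<Longrightarrow> P (TT i * XX i - (XX (Suc i) * TT i +
        (\<Sum>(a, b) \<in> {(a, b). 1 \<le> a \<and> a < b \<and> b \<le> r}.
           scal (u b - u a) * lagrange r u a (XX i) * lagrange r u b (XX (Suc i)))))"
    and "\<And>i. 1 \<le> i \<Longrightarrow> i < n \<Longrightarrow> P (TT i * (XX (Suc i) + XX i) - (XX (Suc i) + XX i) * TT i)"
    and "\<And>i j. 1 \<le> i \<Longrightarrow> i < n \<Longrightarrow> 1 \<le> j \<Longrightarrow> j \<le> n \<Longrightarrow> j \<noteq> i \<Longrightarrow> j \<noteq> Suc i \<Longrightarrow> P (TT i * XX j - XX j * TT i)"
  shows "P x"
  using assms(1) unfolding ak_relations_def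
  by (elim UnE CollectE exE conjE) (simp_all only: Suc_eq_plus1[symmetric] assms(2-) simp_thms)

lemma lagrange_value:
  fixes r a k :: nat
  assumes "inj_on u {1..r}" "a \<in> {1..r}" "k \<in> {1..r}"
  shows "prod_list (map (\<lambda>l. 1 / (u k - u l) * (u a - u l)) (filter (\<lambda>l. l \<noteq> k) [1..<Suc r]))
    = (if a = k then 1 else (0 :: complex))"
proof (cases "a = k")
  case True
  have "prod_list (map (\<lambda>l. 1 / (u k - u l) * (u a - u l)) ls) = 1" if "set ls \<subseteq> {1..r} - {k}" for ls
    using that
  proof (induction ls)
    case (Cons l ls)
    then have "u k \<noteq> u l"
      using inj_onD[OF assms(1), of k l] assms(3) by auto
    with Cons True show ?case by simp
  qed simp
  moreover have "set (filter (\<lambda>l. l \<noteq> k) [1..<Suc r]) \<subseteq> {1..r} - {k}"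
    by auto
  ultimately show ?thesis using True by metis
next
  case False
  then have "a \<in> set (filter (\<lambda>l. l \<noteq> k) [1..<Suc r])"
    using assms by auto
  then have "0 \<in> set (map (\<lambda>l. 1 / (u k - u l) * (u a - u l)) (filter (\<lambda>l. l \<noteq> k) [1..<Suc r]))"
    by (simp only: set_map) (rule image_eqI[of _ _ a], auto)
  then show ?thesis using False by (simp add: prod_list_zero_iff del: upt_Suc)
qed

text \<open>This evaluates the correction term of the mixed relation on a vector with colors
  \<open>a\<close> and \<open>b\<close> at neighbouring places: it survives only if the colors
  rise.\<close>

lemma sum_lagrange_value:
  fixes r a b :: nat
  assumes "a \<in> {1..r}" "b \<in> {1..r}"
  shows "(\<Sum>(k, l) \<in> {(k, l). 1 \<le> k \<and> k < l \<and> l \<le> r}. (u l - u k) * (if a = k then 1 else 0) * (if b = l then 1 else 0))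
    = (if a < b then u b - u a else (0 :: complex))"
proof -
  let ?S = "{(k, l). 1 \<le> k \<and> k < l \<and> l \<le> r}"
  have fin: "finite ?S"
    by (rule finite_subset[of _ "{1..r} \<times> {1..r}"]) auto
  have "(\<Sum>(k, l) \<in> ?S. (u l - u k) * (if a = k then 1 else 0) * (if b = l then 1 else 0))
      = (\<Sum>p\<in>?S. if p = (a, b) then u b - u a else 0)"
    by (rule sum.cong) (auto split: if_splits)
  also have "\<dots> = (if (a, b) \<in> ?S then u b - u a else 0)"
    using fin by simp
  finally show ?thesis using assms by simp
qed

lemma eval_character_lagrange:
  fixes r a k :: nat
  assumes "inj_on u {1..r}" "a \<in> {1..r}" "k \<in> {1..r}" "eval_character \<chi> x = u a"
  shows "eval_character \<chi> (lagrange r u k x) = (if a = k then 1 else 0)"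
  using lagrange_value[OF assms(1-3)] assms(4)
  by (simp add: lagrange_def comp_def del: upt_Suc)

text \<open>The character of the simple module with color word \<open>d\<close> on which, among the generators
  \<open>T\<^sub>i\<close> with \<open>d i = d (i + 1)\<close>, those with \<open>i \<in> E\<close> act by \<open>- 1\<close>.\<close>

definition gchar :: "(nat \<Rightarrow> complex) \<Rightarrow> (nat \<Rightarrow> nat) \<Rightarrow> nat set \<Rightarrow> ak_gen \<Rightarrow> complex" where
  "gchar u d E g = (case g of
      GenT i \<Rightarrow> if d i < d (Suc i) \<or> d i = d (Suc i) \<and> i \<in> E then - 1 else 0
    | GenXi j \<Rightarrow> u (d j))"

lemma gchar_simps [simp]:
  "gchar u d E (GenT i) = (if d i < d (Suc i) \<or> d i = d (Suc i) \<and> i \<in> E then - 1 else 0)"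
  "gchar u d E (GenXi j) = u (d j)"
  by (simp_all add: gchar_def)

lemma ideal_eval_character_kernel:
  "ideal {f \<in> FA G. eval_character \<chi> f = 0} (free_algebra G)"
  by (rule ideal_free_algebraI) (auto intro: FA_intros)

text \<open>Let \<open>a\<close>, \<open>b\<close> be the colors at \<open>i\<close> and
  \<open>i + 1\<close> and \<open>t\<close> the value of \<open>T\<close> there. The mixed relation
  says that t (u_a - u_b) equals u_b - u_a if a < b and 0 otherwise. This forces t = -1 for rising
  and t = 0 for falling colors and leaves t free at equal colors, where the quadratic relation
  allows 0 and -1.\<close>

lemma gchar_kills_ideal:
  assumes u: "inj_on u {1..r}" and d: "\<And>j. j \<in> {1..n} \<Longrightarrow> d j \<in> {1..r}" and f: "f \<in> ak_ideal n r u"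
  shows "eval_character (gchar u d E) f = 0"
proof -
  have "eval_character (gchar u d E) x = 0" if "x \<in> ak_relations n r u" for x
    using that
  proof (induction rule: ak_relation_cases)
    case (charpoly j)
    have "prod_list (map (\<lambda>l. u (d j) - u l) ls) = 0" if "d j \<in> set ls" for ls
      using that by (induction ls) auto
    then show ?case using d[of j] charpoly by (simp add: comp_def del: upt_Suc)
  next
    case (t_xi i)
    have *: "d i \<in> {1..r}" "d (Suc i) \<in> {1..r}" using d t_xi by auto
    have "eval_character (gchar u d E) (\<Sum>(a, b) \<in> {(a, b). 1 \<le> a \<and> a < b \<and> b \<le> r}.
           scal (u b - u a) * lagrange r u a (XX i) * lagrange r u b (XX (Suc i))) =
      (\<Sum>(k, l) \<in> {(k, l). 1 \<le> k \<and> k < l \<and> l \<le> r}. (u l - u k) * (if d i = k then 1 else 0) * (if d (Suc i) = l then 1 else 0))"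
      unfolding eval_character_sum
      by (rule sum.cong)
         (auto simp: eval_character_lagrange[OF u *(1)] eval_character_lagrange[OF u *(2)])
    then show ?case
      using sum_lagrange_value[OF *, of u] by (auto simp: algebra_simps)
  qed (simp_all add: algebra_simps)
  then have "ak_ideal n r u \<subseteq> {f \<in> AF n. eval_character (gchar u d E) f = 0}"
    using ak_relations_FA[of n r u] by (intro ak_ideal_minimal ideal_eval_character_kernel) auto
  then show ?thesis using f by auto
qed

subsection \<open>The weight module of a color word\<close>

text \<open>Chosen for its invariance under inversion of \<sigma>: one statistic then controls both
  the exchange of places and the exchange of values.\<close>

definition stat :: "nat \<Rightarrow> (nat \<Rightarrow> nat) \<Rightarrow> nat" where
  "stat n \<sigma> = (\<Sum>j\<in>{1..n}. j * \<sigma> j)"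

text \<open>A refinement of the order given by \<open>stat\<close> to an injective ranking; any one
  will do, so it is fixed by choice.\<close>

definition srank :: "nat \<Rightarrow> (nat \<Rightarrow> nat) \<Rightarrow> nat" where
  "srank n = (SOME rk. inj_on rk {\<sigma>. \<sigma> permutes {1..n}} \<and>
     (\<forall>\<sigma> \<tau>. \<sigma> permutes {1..n} \<and> \<tau> permutes {1..n} \<and> stat n \<sigma> < stat n \<tau> \<longrightarrow> rk \<sigma> < rk \<tau>))"

lemma srank:
  shows inj_srank: "inj_on (srank n) {\<sigma>. \<sigma> permutes {1..n}}"
    and srank_mono: "\<sigma> permutes {1..n} \<Longrightarrow> \<tau> permutes {1..n} \<Longrightarrow> stat n \<sigma> < stat n \<tau> \<Longrightarrow> srank n \<sigma> < srank n \<tau>"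
proof -
  let ?B = "{\<sigma>. \<sigma> permutes {1..n}}"
  let ?M = "card ?B"
  obtain f :: "(nat \<Rightarrow> nat) \<Rightarrow> nat" where f: "bij_betw f ?B {0..<?M}"
    using ex_bij_betw_finite_nat[of ?B] finite_permutations[of "{1..n}"] by auto
  then have less: "f \<sigma> < ?M" if "\<sigma> permutes {1..n}" for \<sigma>
    using that by (auto simp: bij_betw_def)
  \<comment> \<open>Lexicographic ranking: \<open>stat\<close> first, ties broken by an enumeration
    \<open>f\<close> with values below \<open>?M\<close>.\<close>
  let ?rk = "\<lambda>\<sigma>. stat n \<sigma> * ?M + f \<sigma>"
  have mono: "?rk \<sigma> < ?rk \<tau>" if "\<sigma> permutes {1..n}" "\<tau> permutes {1..n}" "stat n \<sigma> < stat n \<tau>" for \<sigma> \<tau>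
  proof -
    have "?rk \<sigma> < Suc (stat n \<sigma>) * ?M" using less[OF that(1)] by simp
    also have "\<dots> \<le> stat n \<tau> * ?M" using that(3) by (intro mult_right_mono) auto
    finally show ?thesis by simp
  qed
  have "inj_on ?rk ?B"
  proof (rule inj_onI)
    fix \<sigma> \<tau> assume *: "\<sigma> \<in> ?B" "\<tau> \<in> ?B" "?rk \<sigma> = ?rk \<tau>"
    then have "stat n \<sigma> = stat n \<tau>"
      using mono[of \<sigma> \<tau>] mono[of \<tau> \<sigma>] by (metis less_irrefl linorder_neqE_nat mem_Collect_eq)
    with * have "f \<sigma> = f \<tau>" by simp
    then show "\<sigma> = \<tau>" using f * by (auto simp: bij_betw_def inj_on_def)
  qed
  with mono have "\<exists>rk. inj_on rk {\<sigma>. \<sigma> permutes {1..n}} \<and>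
     (\<forall>\<sigma> \<tau>. \<sigma> permutes {1..n} \<and> \<tau> permutes {1..n} \<and> stat n \<sigma> < stat n \<tau> \<longrightarrow> rk \<sigma> < (rk \<tau> :: nat))"
    by (intro exI[of _ ?rk]) auto
  from someI_ex[OF this] show "inj_on (srank n) {\<sigma>. \<sigma> permutes {1..n}}"
    "\<sigma> permutes {1..n} \<Longrightarrow> \<tau> permutes {1..n} \<Longrightarrow> stat n \<sigma> < stat n \<tau> \<Longrightarrow> srank n \<sigma> < srank n \<tau>"
    unfolding srank_def by auto
qed

abbreviation ts :: "nat \<Rightarrow> nat \<Rightarrow> nat" where
  "ts i \<equiv> transpose i (Suc i)"

lemma ts_permutes: "1 \<le> i \<Longrightarrow> i < n \<Longrightarrow> ts i permutes {1..n}"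
  by (intro permutes_swap_id) auto

lemma comp_ts_permutes_iff:
  assumes "1 \<le> i" "i < n"
  shows "\<sigma> \<circ> ts i permutes {1..n} \<longleftrightarrow> \<sigma> permutes {1..n}"
proof
  assume "\<sigma> \<circ> ts i permutes {1..n}"
  then have "\<sigma> \<circ> ts i \<circ> ts i permutes {1..n}"
    by (rule permutes_compose[OF ts_permutes[OF assms]])
  then show "\<sigma> permutes {1..n}" by (simp add: comp_assoc)
qed (intro permutes_compose ts_permutes assms)

lemma ts_comp_permutes_iff:
  assumes "1 \<le> i" "i < n"
  shows "ts i \<circ> \<sigma> permutes {1..n} \<longleftrightarrow> \<sigma> permutes {1..n}"
proof
  assume "ts i \<circ> \<sigma> permutes {1..n}"
  then have "ts i \<circ> (ts i \<circ> \<sigma>) permutes {1..n}"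
    by (rule permutes_compose[OF _ ts_permutes[OF assms]])
  then show "\<sigma> permutes {1..n}" by (simp add: comp_assoc[symmetric])
qed (intro permutes_compose ts_permutes assms)

lemma comp_ts_ts [simp]: "\<sigma> \<circ> ts i \<circ> ts i = \<sigma>"
  by (simp add: comp_assoc)

lemma stat_comp_ts:
  assumes "1 \<le> i" "i < n"
  shows "stat n (\<sigma> \<circ> ts i) + \<sigma> (Suc i) = stat n \<sigma> + \<sigma> i"
proof -
  let ?R = "{1..n} - {i, Suc i}"
  have split: "{1..n} = insert i (insert (Suc i) ?R)" using assms by auto
  have sum: "(\<Sum>j\<in>{1..n}. h j) = h i + (h (Suc i) + (\<Sum>j\<in>?R. h j))" for h :: "nat \<Rightarrow> nat"
    by (subst split) simp
  have "(\<Sum>j\<in>?R. j * (\<sigma> \<circ> ts i) j) = (\<Sum>j\<in>?R. j * \<sigma> j)"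
    by (rule sum.cong) auto
  then show ?thesis
    unfolding stat_def sum by (simp add: algebra_simps)
qed

abbreviation pinv :: "(nat \<Rightarrow> nat) \<Rightarrow> nat \<Rightarrow> nat" where
  "pinv \<equiv> inv_into UNIV"

lemma stat_inv:
  assumes "\<sigma> permutes {1..n}"
  shows "stat n (pinv \<sigma>) = stat n \<sigma>"
proof -
  have "stat n (pinv \<sigma>) = (\<Sum>j\<in>{1..n}. \<sigma> j * pinv \<sigma> (\<sigma> j))"
    unfolding stat_def by (rule sum.permute[OF assms, unfolded comp_def])
  then show ?thesis
    using permutes_inverses(2)[OF assms] by (simp add: stat_def mult.commute)
qed

lemma srank_comp_ts:
  assumes "1 \<le> i" "i < n" "\<sigma> permutes {1..n}" "\<sigma> (Suc i) < \<sigma> i"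
  shows "srank n \<sigma> < srank n (\<sigma> \<circ> ts i)"
  using assms stat_comp_ts[OF assms(1,2), of \<sigma>]
  by (intro srank_mono) (auto simp: comp_ts_permutes_iff)

text \<open>Inversion turns the exchange of values into an exchange of places, and
  \<open>stat\<close> is invariant under it.\<close>

lemma srank_ts_comp:
  assumes "1 \<le> i" "i < n" "\<sigma> permutes {1..n}" "pinv \<sigma> (Suc i) < pinv \<sigma> i"
  shows "srank n \<sigma> < srank n (ts i \<circ> \<sigma>)"
proof (rule srank_mono)
  have "pinv (ts i \<circ> \<sigma>) = pinv \<sigma> \<circ> ts i"
    using assms permutes_bij by (subst o_inv_distrib) auto
  moreover have "stat n (pinv (ts i \<circ> \<sigma>)) = stat n (ts i \<circ> \<sigma>)"
    using assms by (intro stat_inv) (auto simp: ts_comp_permutes_iff)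
  ultimately show "stat n \<sigma> < stat n (ts i \<circ> \<sigma>)"
    using stat_comp_ts[OF assms(1,2), of "pinv \<sigma>"] assms(4) stat_inv[OF assms(3)] by simp
qed (use assms in \<open>auto simp: ts_comp_permutes_iff\<close>)

locale ak_word =
  fixes n r :: nat and u :: "nat \<Rightarrow> complex" and c :: "nat \<Rightarrow> nat"
  assumes u_inj: "inj_on u {1..r}" and c_range: "\<And>j. j \<in> {1..n} \<Longrightarrow> c j \<in> {1..r}"
begin

abbreviation BB :: "(nat \<Rightarrow> nat) set" where
  "BB \<equiv> {\<sigma>. \<sigma> permutes {1..n}}"

text \<open>The diagonal entries at \<sigma> form a character themselves, the one with color word
  \<open>c \<circ> \<sigma>\<close> and the descents of \<sigma>. Evaluating a polynomial on the
  diagonal is evaluating it at characters.\<close>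

definition ldg :: "ak_gen \<Rightarrow> (nat \<Rightarrow> nat) \<Rightarrow> complex" where
  "ldg g \<sigma> = gchar u (c \<circ> \<sigma>) {i. \<sigma> (Suc i) < \<sigma> i} g"

definition loff :: "ak_gen \<Rightarrow> (nat \<Rightarrow> nat) \<Rightarrow> complex" where
  "loff g \<sigma> = (case g of GenT i \<Rightarrow> if \<sigma> (Suc i) < \<sigma> i then 1 else 0 | GenXi j \<Rightarrow> 0)"

definition lsh :: "ak_gen \<Rightarrow> (nat \<Rightarrow> nat) \<Rightarrow> nat \<Rightarrow> nat" where
  "lsh g \<sigma> = (case g of GenT i \<Rightarrow> \<sigma> \<circ> ts i | GenXi j \<Rightarrow> \<sigma>)"

text \<open>The right generator \<open>i\<close> exchanges the values \<open>i\<close> and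
  \<open>i + 1\<close>. Only where these have the same color does it preserve the colors that the
  left action reads off.\<close>

definition Req :: "nat set" where
  "Req = {i \<in> {1..<n}. c i = c (Suc i)}"

definition rdg :: "nat \<Rightarrow> (nat \<Rightarrow> nat) \<Rightarrow> complex" where
  "rdg i \<sigma> = (if pinv \<sigma> (Suc i) < pinv \<sigma> i then - 1 else 0)"

definition roff :: "nat \<Rightarrow> (nat \<Rightarrow> nat) \<Rightarrow> complex" where
  "roff i \<sigma> = (if pinv \<sigma> (Suc i) < pinv \<sigma> i then 1 else 0)"

definition rsh :: "nat \<Rightarrow> (nat \<Rightarrow> nat) \<Rightarrow> nat \<Rightarrow> nat" where
  "rsh i \<sigma> = ts i \<circ> \<sigma>"

sublocale ranked_basis BB "srank n"
  by standard (auto simp: finite_permutations inj_srank)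

sublocale L: triangular_rep BB "srank n" "ak_gens n" ldg loff lsh
  by standard
     (auto simp: loff_def lsh_def comp_ts_permutes_iff srank_comp_ts split: ak_gen.splits if_splits)

sublocale R: triangular_rep BB "srank n" Req rdg roff rsh
  by standard
     (auto simp: roff_def rsh_def ts_comp_permutes_iff srank_ts_comp Req_def split: if_splits)

lemma Lgop_T: "L.gop (GenT i) v \<sigma> = (if \<sigma> (Suc i) < \<sigma> i then v (\<sigma> \<circ> ts i) else 0) -
    (if c (\<sigma> i) < c (\<sigma> (Suc i)) \<or> c (\<sigma> i) = c (\<sigma> (Suc i)) \<and> \<sigma> (Suc i) < \<sigma> i then v \<sigma> else 0)"
  by (simp add: L.gop_def ldg_def loff_def lsh_def)

lemma Lgop_Xi: "L.gop (GenXi j) v \<sigma> = u (c (\<sigma> j)) * v \<sigma>"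
  by (simp add: L.gop_def ldg_def loff_def)

lemma Rgop: "R.gop i v \<sigma> = (if pinv \<sigma> (Suc i) < pinv \<sigma> i then v (ts i \<circ> \<sigma>) - v \<sigma> else 0)"
  by (simp add: R.gop_def roff_def rdg_def rsh_def)

lemma color_range: "\<sigma> permutes {1..n} \<Longrightarrow> j \<in> {1..n} \<Longrightarrow> c (\<sigma> j) \<in> {1..r}"
  using permutes_in_image[of \<sigma> "{1..n}" j] by (intro c_range) blast

lemma rho_diag_xi:
  "L.rho (prod_list (map (\<lambda>l. scal (f l) * (XX j - scal (h l))) ls)) v \<sigma> =
   prod_list (map (\<lambda>l. f l * (u (c (\<sigma> j)) - h l)) ls) * v \<sigma>"
  by (induction ls arbitrary: v)
     (simp_all add: L.rho_one L.rho_mult L.rho_diff L.rho_scal L.rho_gen Lgop_Xi algebra_simps)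

lemma rho_lagrange:
  assumes "\<sigma> permutes {1..n}" "j \<in> {1..n}" "k \<in> {1..r}"
  shows "L.rho (lagrange r u k (XX j)) v \<sigma> = (if c (\<sigma> j) = k then v \<sigma> else 0)"
  unfolding lagrange_def rho_diag_xi
  using lagrange_value[OF u_inj color_range[OF assms(1,2)] assms(3)] by simp

text \<open>The entry at \<sigma> depends only on the order and the colors of the values that the
  relation moves. The relations among the \<open>T\<close> are thus finite case distinctions, and
  the mixed relation reduces to \<open>sum_lagrange_value\<close>.\<close>

lemma rho_relation:
  assumes "x \<in> ak_relations n r u" "\<sigma> permutes {1..n}"
  shows "L.rho x v \<sigma> = 0"
  using assms(1)
proof (induction rule: ak_relation_cases)
  case (quadratic i)
  have "\<sigma> i \<noteq> \<sigma> (Suc i)"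
    using permutes_inj[OF assms(2)] by (simp add: inj_eq)
  then show ?case
    by (auto simp: L.rho_mult L.rho_add[abs_def] L.rho_one L.rho_gen[abs_def] Lgop_T)
next
  case (braid i)
  define x y z where "x = \<sigma> i" "y = \<sigma> (Suc i)" "z = \<sigma> (Suc (Suc i))"
  have ne: "x \<noteq> y" "y \<noteq> z" "x \<noteq> z"
    using permutes_inj[OF assms(2)] by (simp_all add: x_y_z_def inj_eq)
  have br: "\<sigma> \<circ> ts i \<circ> ts (Suc i) \<circ> ts i = \<sigma> \<circ> ts (Suc i) \<circ> ts i \<circ> ts (Suc i)"
    by (auto simp: fun_eq_iff transpose_def)
  show ?case
    using ne
    by (simp add: L.rho_mult L.rho_diff L.rho_gen[abs_def])
       (auto simp add: Lgop_T br not_less simp flip: x_y_z_def)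
next
  case (comm i j)
  define \<tau> where "\<tau> = \<sigma> \<circ> ts i \<circ> ts j"
  have \<tau>: "\<sigma> \<circ> ts i \<circ> ts j = \<tau>" "\<sigma> \<circ> ts j \<circ> ts i = \<tau>"
    using comm by (auto simp: fun_eq_iff transpose_def \<tau>_def)
  have "ts i j = j" "ts i (Suc j) = Suc j" "ts j i = i" "ts j (Suc i) = Suc i"
    using comm by (auto simp: transpose_def)
  then show ?case
    by (simp add: L.rho_mult L.rho_diff L.rho_gen[abs_def] Lgop_T \<tau>)
next
  case (charpoly j)
  have "prod_list (map (\<lambda>l. u (c (\<sigma> j)) - u l) ls) = 0" if "c (\<sigma> j) \<in> set ls" for ls
    using that by (induction ls) auto
  then show ?case
    using rho_diag_xi[of "\<lambda>_. 1" j u "[1..<Suc r]" v \<sigma>] color_range[OF assms(2), of j] charpoly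
    by (simp del: upt_Suc)
next
  case (xi_comm i j)
  then show ?case by (simp add: L.rho_mult L.rho_diff L.rho_gen[abs_def] Lgop_Xi)
next
  case (t_xi i)
  have *: "c (\<sigma> i) \<in> {1..r}" "c (\<sigma> (Suc i)) \<in> {1..r}" using t_xi color_range[OF assms(2)] by auto
  have "L.rho (\<Sum>(a, b) \<in> {(a, b). 1 \<le> a \<and> a < b \<and> b \<le> r}.
           scal (u b - u a) * lagrange r u a (XX i) * lagrange r u b (XX (Suc i))) v \<sigma> =
    (\<Sum>(k, l) \<in> {(k, l). 1 \<le> k \<and> k < l \<and> l \<le> r}. (u l - u k) * (if c (\<sigma> i) = k then 1 else 0) * (if c (\<sigma> (Suc i)) = l then 1 else 0)) * v \<sigma>"
    unfolding L.rho_sum sum_distrib_right using t_xi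
    by (intro sum.cong) (auto simp: L.rho_mult L.rho_scal rho_lagrange[OF assms(2)])
  then show ?case
    using sum_lagrange_value[OF *, of u]
    by (auto simp: L.rho_mult L.rho_diff L.rho_add L.rho_gen[abs_def] Lgop_Xi Lgop_T algebra_simps)
next
  case (t_sum i)
  then show ?case
    by (auto simp: L.rho_mult L.rho_diff L.rho_add[abs_def] L.rho_gen[abs_def] Lgop_Xi Lgop_T algebra_simps)
next
  case (t_xi_comm i j)
  then show ?case
    by (auto simp: L.rho_mult L.rho_diff L.rho_gen[abs_def] Lgop_Xi Lgop_T right_diff_distrib)
qed

text \<open>The relations are verified at permutations; at all other arguments the image of a vector
  of \<open>V\<close> vanishes by support.\<close>

lemma rho_kills_ideal:
  assumes "f \<in> ak_ideal n r u" "v \<in> V"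
  shows "L.rho f v = (\<lambda>_. 0)"
proof -
  let ?I = "{f \<in> AF n. \<forall>v\<in>V. L.rho f v = (\<lambda>_. 0)}"
  have "ideal ?I (free_algebra (ak_gens n))"
    by (rule ideal_free_algebraI)
       (auto intro: FA_intros L.rho_V simp: L.rho_zero[abs_def] L.rho_add[abs_def] L.rho_mult L.rho_vzero)
  moreover have "ak_relations n r u \<subseteq> ?I"
  proof
    fix x assume x: "x \<in> ak_relations n r u"
    then have F: "x \<in> AF n" using ak_relations_FA by blast
    have "L.rho x v \<sigma> = 0" if "v \<in> V" for v \<sigma>
    proof (cases "\<sigma> permutes {1..n}")
      case False
      then show ?thesis using V_D[OF L.rho_V[OF F that]] by simp
    qed (rule rho_relation[OF x])
    with F show "x \<in> ?I" by auto
  qed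
  ultimately show ?thesis
    using ak_ideal_minimal[of ?I n r u] assms by blast
qed

text \<open>If \<sigma> maps {j, j + 1} onto {i, i + 1}, exchanging the values is the same as
  exchanging the places, and the two values have equal colors. Otherwise neither exchange affects
  the comparison or the colors that govern the other generator.\<close>

lemma gop_commute:
  assumes "g \<in> ak_gens n" "i \<in> Req" "v \<in> V"
  shows "L.gop g (R.gop i v) = R.gop i (L.gop g v)"
proof
  fix \<sigma>
  have ci: "c (ts i x) = c x" for x
    using assms(2) by (auto simp: transpose_def Req_def)
  show "L.gop g (R.gop i v) \<sigma> = R.gop i (L.gop g v) \<sigma>"
  proof (cases "\<sigma> permutes {1..n}")
    case False
    then show ?thesis
      using V_D[OF L.gop_V[OF assms(1) R.gop_V[OF assms(2,3)]]]
        V_D[OF R.gop_V[OF assms(2) L.gop_V[OF assms(1,3)]]] by simp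
  next
    case True
    show ?thesis
    proof (cases g)
      case (GenXi j)
      then show ?thesis by (simp add: Lgop_Xi Rgop ci algebra_simps)
    next
      case (GenT j)
      define p q where "p = pinv \<sigma> i" "q = pinv \<sigma> (Suc i)"
      have s: "\<sigma> p = i" "\<sigma> q = Suc i" "inj \<sigma>"
        using permutes_inverses(1)[OF True] permutes_inj[OF True] by (auto simp: p_q_def)
      have inv: "pinv \<sigma> x = y \<longleftrightarrow> \<sigma> y = x" for x y
        using permutes_inv_eq[OF True] .
      have ne: "\<sigma> j \<noteq> \<sigma> (Suc j)" "p \<noteq> q"
        using s(3) permutes_inj[OF permutes_inv[OF True]] by (simp_all add: inj_eq p_q_def)
      have inv1: "pinv (\<sigma> \<circ> ts j) x = ts j (pinv \<sigma> x)" for x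
        using True permutes_bij by (subst o_inv_distrib) auto
      have ass: "ts i \<circ> (\<sigma> \<circ> ts j) = ts i \<circ> \<sigma> \<circ> ts j" by (simp add: comp_assoc)
      consider "{\<sigma> j, \<sigma> (Suc j)} = {i, Suc i}" | "{\<sigma> j, \<sigma> (Suc j)} \<noteq> {i, Suc i}" by blast
      then show ?thesis
      proof cases
        case 1
        then consider "\<sigma> j = i" "\<sigma> (Suc j) = Suc i" | "\<sigma> j = Suc i" "\<sigma> (Suc j) = i"
          by (auto simp: doubleton_eq_iff)
        then have pq: "p = j \<and> q = Suc j \<or> p = Suc j \<and> q = j"
          using s by cases (metis injD)+
        have e: "ts i \<circ> \<sigma> = \<sigma> \<circ> ts j"
        proof
          fix x
          have "\<sigma> x = i \<longleftrightarrow> x = p" "\<sigma> x = Suc i \<longleftrightarrow> x = q"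
            using s by (metis injD)+
          then show "(ts i \<circ> \<sigma>) x = (\<sigma> \<circ> ts j) x"
            using pq s(1,2) by (auto simp: transpose_def)
        qed
        show ?thesis
          using pq s assms(2)
          by (auto simp: GenT Lgop_T Rgop inv1 ass e Req_def simp flip: p_q_def)
      next
        case 2
        have a: "ts i (\<sigma> (Suc j)) < ts i (\<sigma> j) \<longleftrightarrow> \<sigma> (Suc j) < \<sigma> j"
          using 2 ne by (auto simp: transpose_def)
        have nj: "\<not> (p = j \<and> q = Suc j)" "\<not> (p = Suc j \<and> q = j)"
          using 2 s by auto
        have b: "ts j q < ts j p \<longleftrightarrow> q < p"
          using nj ne(2) by (auto simp: transpose_def)
        show ?thesis
          by (auto simp: GenT Lgop_T Rgop inv1 ass a b ci simp flip: p_q_def)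
      qed
    qed
  qed
qed

lemma rho_commute:
  assumes "f \<in> AF n" "h \<in> FA Req" "v \<in> V"
  shows "L.rho f (R.rho h v) = R.rho h (L.rho f v)"
proof -
  have *: "L.gop g (R.rho h w) = R.rho h (L.gop g w)" if g: "g \<in> ak_gens n" and w: "w \<in> V" for g w
    using assms(2)
  proof (induction h rule: FA_induct)
    case one
    then show ?case by (simp add: R.rho_one')
  next
    case (add f h)
    then show ?case
      using L.gop_lincomb[of g 1 "R.rho f w" 1 "R.rho h w"] by (simp add: R.rho_add[abs_def])
  next
    case (scal a f)
    then show ?case
      using L.gop_lincomb[of g a "R.rho f w" 0 "R.rho f w"] by (simp add: R.rho_mult R.rho_scal[abs_def])
  next
    case (gen x f)
    then show ?case
      using gop_commute[OF g gen.hyps(1) R.rho_V[OF gen.hyps(2) w]] by (simp add: R.rho_mult R.rho_gen[abs_def])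
  qed
  show ?thesis
    using assms(1)
  proof (induction f rule: FA_induct)
    case one
    then show ?case by (simp add: L.rho_one')
  next
    case (add f g)
    then show ?case
      by (simp add: L.rho_add[abs_def] R.rho_vadd)
  next
    case (scal a f)
    then show ?case
      by (simp add: L.rho_mult L.rho_scal[abs_def] R.rho_vscale)
  next
    case (gen x f)
    then show ?case
      using *[OF gen.hyps(1) L.rho_V[OF gen.hyps(2) assms(3)]] by (simp add: L.rho_mult L.rho_gen[abs_def])
  qed
qed

end

subsection \<open>Presentation of the weight module\<close>

lemma permutes_no_descent:
  assumes "\<sigma> permutes {1..n}" "\<And>i. 1 \<le> i \<Longrightarrow> i < n \<Longrightarrow> \<not> \<sigma> (Suc i) < \<sigma> i"
  shows "\<sigma> = id"
proof (rule permutes_natset_ge[OF assms(1)])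
  have "j \<le> n \<longrightarrow> 1 \<le> j \<longrightarrow> j \<le> \<sigma> j" for j
  proof (induction j)
    case (Suc j)
    show ?case
    proof (cases "j = 0")
      case True
      have "\<sigma> 1 \<in> {1..n}" if "1 \<le> n" using permutes_in_image[OF assms(1), of 1] that by auto
      then show ?thesis using True by (auto simp: One_nat_def)
    next
      case False
      show ?thesis
      proof (intro impI)
        assume j: "Suc j \<le> n" "1 \<le> Suc j"
        have "\<sigma> j \<noteq> \<sigma> (Suc j)" using permutes_inj[OF assms(1)] by (simp add: inj_eq)
        moreover have "\<not> \<sigma> (Suc j) < \<sigma> j" using False j by (intro assms(2)) auto
        ultimately show "Suc j \<le> \<sigma> (Suc j)" using Suc False j by auto
      qed
    qed
  qed simp
  then show "\<forall>j\<in>{1..n}. j \<le> \<sigma> j" by auto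
qed

lemma scal_scal: "scal a * (scal b * g) = scal (a * b) * g"
  by (simp add: scal_mult mult.assoc)

lemma gen_scal: "gen x * (scal a * g) = scal a * (gen x * g)"
  by (rule scal_left_comm)

text \<open>The intertwiner from weight \<open>d\<close> to weight \<open>d \<circ> ts i\<close>.
  For rising colors the added 1 absorbs the correction term of the mixed relation.\<close>

definition ee :: "nat \<Rightarrow> (nat \<Rightarrow> nat) \<Rightarrow> ak_gen ncpoly" where
  "ee i d = (if d i < d (Suc i) then TT i + 1 else TT i)"

lemma ak_relation_braid:
    "1 \<le> i \<Longrightarrow> Suc i < n \<Longrightarrow> TT i * TT (Suc i) * TT i - TT (Suc i) * TT i * TT (Suc i) \<in> ak_relations n r u"
  and ak_relation_comm: "1 \<le> i \<Longrightarrow> i < n \<Longrightarrow> 1 \<le> j \<Longrightarrow> j < n \<Longrightarrow> i + 2 \<le> j \<Longrightarrow> TT i * TT j - TT j * TT i \<in> ak_relations n r u"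
  and ak_relation_t_xi: "1 \<le> i \<Longrightarrow> i < n \<Longrightarrow> TT i * XX i - (XX (Suc i) * TT i +
        (\<Sum>(a, b) \<in> {(a, b). 1 \<le> a \<and> a < b \<and> b \<le> r}.
           scal (u b - u a) * lagrange r u a (XX i) * lagrange r u b (XX (Suc i)))) \<in> ak_relations n r u"
  and ak_relation_t_sum: "1 \<le> i \<Longrightarrow> i < n \<Longrightarrow>
        TT i * (XX (Suc i) + XX i) - (XX (Suc i) + XX i) * TT i \<in> ak_relations n r u"
  and ak_relation_t_xi_comm: "1 \<le> i \<Longrightarrow> i < n \<Longrightarrow> j \<in> {1..n} \<Longrightarrow> j \<noteq> i \<Longrightarrow> j \<noteq> Suc i \<Longrightarrow>
        TT i * XX j - XX j * TT i \<in> ak_relations n r u"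
  and ak_relation_quadratic: "1 \<le> i \<Longrightarrow> i < n \<Longrightarrow> TT i * (TT i + 1) \<in> ak_relations n r u"
  and ak_relation_xi_comm: "i \<in> {1..n} \<Longrightarrow> j \<in> {1..n} \<Longrightarrow> XX i * XX j - XX j * XX i \<in> ak_relations n r u"
  and ak_relation_charpoly: "j \<in> {1..n} \<Longrightarrow>
        prod_list (map (\<lambda>l. XX j - scal (u l)) [1..<Suc r]) \<in> ak_relations n r u"
  unfolding ak_relations_def Suc_eq_plus1 Un_iff mem_Collect_eq atLeastAtMost_iff
  by blast+

context ak_word
begin

text \<open>The left ideals modulo which 1 becomes a vector of weight \<open>c\<close>. The two
  instances below are the kernel of a character and the annihilator of a weight vector.\<close>

definition lid :: "ak_gen ncpoly set \<Rightarrow> bool" where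
  "lid \<Lambda> \<longleftrightarrow> \<Lambda> \<subseteq> AF n \<and> ak_ideal n r u \<subseteq> \<Lambda> \<and> (\<forall>x\<in>\<Lambda>. \<forall>y\<in>\<Lambda>. x + y \<in> \<Lambda>) \<and>
     (\<forall>x\<in>\<Lambda>. \<forall>y\<in>AF n. y * x \<in> \<Lambda>) \<and> (\<forall>j\<in>{1..n}. XX j - scal (u (c j)) \<in> \<Lambda>)"

text \<open>A product of intertwiners along the word for \<sigma> that always undoes the smallest
  descent; it carries the generator \<open>v0\<close> to the indicator of \<sigma>. Undoing a
  descent raises the rank, so the recursion ends.\<close>

function th :: "(nat \<Rightarrow> nat) \<Rightarrow> ak_gen ncpoly" where
  "th \<sigma> = (if \<sigma> \<in> BB \<and> (\<exists>i. 1 \<le> i \<and> i < n \<and> \<sigma> (Suc i) < \<sigma> i)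
     then let i = LEAST i. 1 \<le> i \<and> i < n \<and> \<sigma> (Suc i) < \<sigma> i
          in ee i (c \<circ> (\<sigma> \<circ> ts i)) * th (\<sigma> \<circ> ts i)
     else 1)"
  by auto
termination
proof (relation "Wellfounded.measure (\<lambda>\<sigma>. height - srank n \<sigma>)", goal_cases)
  case (2 \<sigma> i)
  then have i: "1 \<le> i" "i < n" "\<sigma> (Suc i) < \<sigma> i"
    using LeastI_ex[of "\<lambda>i. 1 \<le> i \<and> i < n \<and> \<sigma> (Suc i) < \<sigma> i"] by auto
  then have "srank n \<sigma> < srank n (\<sigma> \<circ> ts i)" "srank n (\<sigma> \<circ> ts i) < height"
    using 2 srank_comp_ts rk_less_height by (auto simp: comp_ts_permutes_iff)
  then show ?case by simp
qed simp

declare th.simps [simp del]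

lemma th_cases:
  assumes "\<sigma> \<in> BB"
  obtains "\<sigma> = id" "th \<sigma> = 1"
  | i where "1 \<le> i" "i < n" "\<sigma> (Suc i) < \<sigma> i" "\<And>j. 1 \<le> j \<Longrightarrow> j < n \<Longrightarrow> \<sigma> (Suc j) < \<sigma> j \<Longrightarrow> i \<le> j"
    "th \<sigma> = ee i (c \<circ> (\<sigma> \<circ> ts i)) * th (\<sigma> \<circ> ts i)"
proof (cases "\<exists>i. 1 \<le> i \<and> i < n \<and> \<sigma> (Suc i) < \<sigma> i")
  case True
  define i where "i = (LEAST i. 1 \<le> i \<and> i < n \<and> \<sigma> (Suc i) < \<sigma> i)"
  have "1 \<le> i" "i < n" "\<sigma> (Suc i) < \<sigma> i"
    using LeastI_ex[OF True] by (auto simp: i_def)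
  moreover have "i \<le> j" if "1 \<le> j" "j < n" "\<sigma> (Suc j) < \<sigma> j" for j
    unfolding i_def using that by (intro Least_le) auto
  moreover have "th \<sigma> = ee i (c \<circ> (\<sigma> \<circ> ts i)) * th (\<sigma> \<circ> ts i)"
    using True assms by (subst th.simps) (simp add: i_def Let_def)
  ultimately show ?thesis using that(2) by blast
next
  case False
  then have "\<sigma> = id" using permutes_no_descent[of \<sigma> n] assms by auto
  moreover have "th \<sigma> = 1"
    by (subst th.simps) (use False in auto)
  ultimately show ?thesis by (rule that(1))
qed

text \<open>Induction downwards in rank: the hypothesis is available for
  \<open>\<sigma> \<circ> ts i\<close> at every descent \<open>i\<close> of \<sigma>, because
  undoing a descent raises the rank.\<close>

lemma perm_induct [consumes 1, case_names step]:
  assumes "\<sigma> \<in> BB"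
    and "\<And>\<sigma>. \<sigma> \<in> BB \<Longrightarrow> (\<And>\<tau>. \<tau> \<in> BB \<Longrightarrow> srank n \<sigma> < srank n \<tau> \<Longrightarrow> P \<tau>) \<Longrightarrow> P \<sigma>"
  shows "P \<sigma>"
  using assms(1)
proof (induction "height - srank n \<sigma>" arbitrary: \<sigma> rule: less_induct)
  case less
  show ?case
  proof (rule assms(2)[OF less.prems])
    fix \<tau> assume "\<tau> \<in> BB" "srank n \<sigma> < srank n \<tau>"
    then show "P \<tau>"
      using rk_less_height[of \<tau>] by (intro less.hyps) auto
  qed
qed

lemma comp_ts_descent:
  assumes "\<sigma> \<in> BB" "1 \<le> i" "i < n" "\<sigma> (Suc i) < \<sigma> i"
  shows "\<sigma> \<circ> ts i \<in> BB" "srank n \<sigma> < srank n (\<sigma> \<circ> ts i)"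
  using assms by (simp_all add: srank_comp_ts comp_ts_permutes_iff)

lemma FA_ee: "1 \<le> i \<Longrightarrow> i < n \<Longrightarrow> ee i d \<in> AF n"
  by (auto simp: ee_def intro!: FA_intros)

lemma FA_th: "\<sigma> \<in> BB \<Longrightarrow> th \<sigma> \<in> AF n"
proof (induction \<sigma> rule: perm_induct)
  case (step \<sigma>)
  from step.hyps show ?case
  proof (cases \<sigma> rule: th_cases)
    case 1
    then show ?thesis by (simp only: FA_one)
  next
    case (2 i)
    then have "th (\<sigma> \<circ> ts i) \<in> AF n"
      using step.IH[OF comp_ts_descent[OF step.hyps 2(1-3)]] by blast
    with 2 show ?thesis by (simp add: FA_mult FA_ee)
  qed
qed

definition delta :: "(nat \<Rightarrow> nat) \<Rightarrow> (nat \<Rightarrow> nat) \<Rightarrow> complex" where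
  "delta \<sigma> = (\<lambda>\<tau>. if \<tau> = \<sigma> then 1 else 0)"

definition v0 :: "(nat \<Rightarrow> nat) \<Rightarrow> complex" where
  "v0 = delta id"

lemma delta_V: "\<sigma> \<in> BB \<Longrightarrow> delta \<sigma> \<in> V"
  by (auto simp: delta_def V_def)

lemma v0_V: "v0 \<in> V"
  by (auto simp: v0_def intro!: delta_V permutes_id)

text \<open>\<open>T\<close> moves the indicator to \<sigma> and, for rising colors, also leaves an
  entry -1 at the old position; the added 1 in \<open>ee\<close> cancels it.\<close>

lemma rho_ee_delta:
  assumes "1 \<le> i" "i < n" "\<sigma> (Suc i) < \<sigma> i"
  shows "L.rho (ee i (c \<circ> (\<sigma> \<circ> ts i))) (delta (\<sigma> \<circ> ts i)) = delta \<sigma>"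
proof
  fix \<tau>
  have "\<tau> \<circ> ts i = \<sigma> \<circ> ts i \<longleftrightarrow> \<tau> = \<sigma>" "\<tau> = \<sigma> \<circ> ts i \<longleftrightarrow> \<tau> \<circ> ts i = \<sigma>"
    by (metis comp_ts_ts)+
  moreover have "\<sigma> \<circ> ts i \<noteq> \<sigma>"
  proof
    assume "\<sigma> \<circ> ts i = \<sigma>"
    from fun_cong[OF this, of i] show False using assms(3) by simp
  qed
  ultimately show "L.rho (ee i (c \<circ> (\<sigma> \<circ> ts i))) (delta (\<sigma> \<circ> ts i)) \<tau> = delta \<sigma> \<tau>"
    using assms(3) by (auto simp: ee_def L.rho_add L.rho_one L.rho_gen Lgop_T delta_def)
qed

lemma rho_th: "\<sigma> \<in> BB \<Longrightarrow> L.rho (th \<sigma>) v0 = delta \<sigma>"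
proof (induction \<sigma> rule: perm_induct)
  case (step \<sigma>)
  from step.hyps show ?case
  proof (cases \<sigma> rule: th_cases)
    case 1
    then show ?thesis unfolding 1(2) by (simp only: L.rho_one' v0_def)
  next
    case (2 i)
    then have "L.rho (th (\<sigma> \<circ> ts i)) v0 = delta (\<sigma> \<circ> ts i)"
      using step.IH[OF comp_ts_descent[OF step.hyps 2(1-3)]] by blast
    with 2 show ?thesis by (simp add: L.rho_mult rho_ee_delta)
  qed
qed

text \<open>A linear section of f \<mapsto> \<open>L.rho f v0\<close>. It shows that
  \<open>v0\<close> generates \<open>V\<close>, and by \<open>cg_Th\<close> it inverts that map
  modulo every \<Lambda> with \<open>lid \<Lambda>\<close>.\<close>

definition Th :: "((nat \<Rightarrow> nat) \<Rightarrow> complex) \<Rightarrow> ak_gen ncpoly" where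
  "Th v = (\<Sum>\<sigma>\<in>BB. scal (v \<sigma>) * th \<sigma>)"

lemma FA_Th: "Th v \<in> AF n"
  unfolding Th_def by (intro FA_sum FA_mult FA_scal FA_th)

lemma rho_Th: "v \<in> V \<Longrightarrow> L.rho (Th v) v0 = v"
proof
  fix \<tau> assume v: "v \<in> V"
  have "L.rho (Th v) v0 \<tau> = (\<Sum>\<sigma>\<in>BB. v \<sigma> * delta \<sigma> \<tau>)"
    unfolding Th_def L.rho_sum by (rule sum.cong) (auto simp: L.rho_mult L.rho_scal rho_th)
  also have "\<dots> = (\<Sum>\<sigma>\<in>BB. if \<tau> = \<sigma> then v \<tau> else 0)"
    by (rule sum.cong) (auto simp: delta_def)
  also have "\<dots> = v \<tau>"
    using V_D[OF v, of \<tau>] fin_B by (auto simp: sum.delta')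
  finally show "L.rho (Th v) v0 \<tau> = v \<tau>" .
qed

end

section \<open>Congruences modulo a left ideal: the universal property of the weight module\<close>

locale ak_word_lid = ak_word +
  fixes \<Lambda> :: "ak_gen ncpoly set"
  assumes lid: "lid \<Lambda>"
begin

definition cg :: "ak_gen ncpoly \<Rightarrow> ak_gen ncpoly \<Rightarrow> bool" (infix \<open>\<approx>\<close> 50) where
  "x \<approx> y \<longleftrightarrow> x - y \<in> \<Lambda>"

text \<open>The residue of \<open>y\<close> modulo \<Lambda>, possibly zero, is a simultaneous
  eigenvector of the \<xi> with color word \<open>d\<close>.\<close>

definition weight :: "(nat \<Rightarrow> nat) \<Rightarrow> ak_gen ncpoly \<Rightarrow> bool" where
  "weight d y \<longleftrightarrow> y \<in> AF n \<and> (\<forall>j\<in>{1..n}. d j \<in> {1..r}) \<and> (\<forall>j\<in>{1..n}. XX j * y \<approx> scal (u (d j)) * y)"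

lemma L_add: "x \<in> \<Lambda> \<Longrightarrow> y \<in> \<Lambda> \<Longrightarrow> x + y \<in> \<Lambda>"
  and L_mult: "x \<in> \<Lambda> \<Longrightarrow> y \<in> AF n \<Longrightarrow> y * x \<in> \<Lambda>"
  and L_ideal: "x \<in> ak_ideal n r u \<Longrightarrow> x \<in> \<Lambda>"
  and L_xi: "j \<in> {1..n} \<Longrightarrow> XX j - scal (u (c j)) \<in> \<Lambda>"
  using lid by (auto simp: lid_def)

lemma L_zero: "0 \<in> \<Lambda>"
  using L_ideal[OF ak_ideal_zero] .

lemma L_uminus: "x \<in> \<Lambda> \<Longrightarrow> - x \<in> \<Lambda>"
  using L_mult[of x "- 1"] by (simp add: FA_uminus FA_one)

lemma L_diff: "x \<in> \<Lambda> \<Longrightarrow> y \<in> \<Lambda> \<Longrightarrow> x - y \<in> \<Lambda>"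
  using L_add[of x "- y"] L_uminus[of y] by simp

lemma L_relation: "x \<in> ak_relations n r u \<Longrightarrow> y \<in> AF n \<Longrightarrow> x * y \<in> \<Lambda>"
  using ak_relations_ideal by (intro L_ideal ak_ideal_mult) auto

lemma cg_refl: "x \<approx> x"
  by (simp add: cg_def L_zero)

lemma cg_sym: "x \<approx> y \<Longrightarrow> y \<approx> x"
  using L_uminus[of "x - y"] by (simp add: cg_def)

lemma cg_trans [trans]: "x \<approx> y \<Longrightarrow> y \<approx> z \<Longrightarrow> x \<approx> z"
  using L_add[of "x - y" "y - z"] by (simp add: cg_def)

lemma cg_add: "x \<approx> y \<Longrightarrow> x' \<approx> y' \<Longrightarrow> x + x' \<approx> y + y'"
  using L_add[of "x - y" "x' - y'"] by (simp add: cg_def algebra_simps)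

lemma cg_diff: "x \<approx> y \<Longrightarrow> x' \<approx> y' \<Longrightarrow> x - x' \<approx> y - y'"
  using L_diff[of "x - y" "x' - y'"] by (simp add: cg_def algebra_simps)

lemma cg_mult: "x \<approx> y \<Longrightarrow> z \<in> AF n \<Longrightarrow> z * x \<approx> z * y"
  using L_mult[of "x - y" z] by (simp add: cg_def algebra_simps)

lemma cg_scal: "x \<approx> y \<Longrightarrow> scal a * x \<approx> scal a * y"
  by (rule cg_mult[OF _ FA_scal])

lemma cg_sum: "(\<And>i. i \<in> A \<Longrightarrow> f i \<approx> g i) \<Longrightarrow> sum f A \<approx> sum g A"
  by (induction A rule: infinite_finite_induct) (auto simp: cg_refl cg_add)

lemma weight_poly:
  assumes w: "weight d y" "j \<in> {1..n}"
  shows "prod_list (map (\<lambda>l. scal (f l) * (XX j - scal (h l))) ls) * y \<approx>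
    scal (prod_list (map (\<lambda>l. f l * (u (d j) - h l)) ls)) * y"
proof (induction ls)
  case (Cons l ls)
  let ?p = "prod_list (map (\<lambda>l. scal (f l) * (XX j - scal (h l))) ls)"
  let ?q = "prod_list (map (\<lambda>l. f l * (u (d j) - h l)) ls)"
  let ?x = "scal (f l) * (XX j - scal (h l))"
  have "?x * (?p * y) \<approx> ?x * (scal ?q * y)"
    using w(2) by (intro cg_mult[OF Cons]) (auto intro!: FA_intros)
  also have "?x * (scal ?q * y) = scal (f l * ?q) * (XX j * y) - scal (f l * ?q * h l) * y"
    by (simp add: left_diff_distrib right_diff_distrib mult_ac gen_scal scal_scal)
  also have "\<dots> \<approx> scal (f l * ?q) * (scal (u (d j)) * y) - scal (f l * ?q * h l) * y"
    using w by (intro cg_diff cg_scal cg_refl) (auto simp: weight_def)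
  also have "\<dots> = scal (f l * (u (d j) - h l) * ?q) * y"
    by (simp add: scal_scal left_diff_distrib[symmetric] scal_diff[symmetric])
       (simp add: algebra_simps)
  finally show ?case by (simp add: mult.assoc)
qed (simp add: cg_refl)

lemma weight_lagrange:
  assumes "weight d y" "j \<in> {1..n}" "k \<in> {1..r}"
  shows "lagrange r u k (XX j) * y \<approx> scal (if d j = k then 1 else 0) * y"
proof -
  have "d j \<in> {1..r}" using assms by (auto simp: weight_def)
  from lagrange_value[OF u_inj this assms(3)]
    weight_poly[OF assms(1,2), of "\<lambda>l. 1 / (u k - u l)" u "filter (\<lambda>l. l \<noteq> k) [1..<Suc r]"]
  show ?thesis unfolding lagrange_def by (simp only:)
qed

text \<open>The first congruence is the mixed relation applied to \<open>y\<close>. The second comes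
  from it through the relation that \<open>T\<close> commutes with the sum of the two \<xi>.\<close>

lemma weight_T:
  assumes w: "weight d y" and i: "1 \<le> i" "i < n"
  defines "s \<equiv> scal (if d i < d (Suc i) then u (d (Suc i)) - u (d i) else 0)"
  shows "XX (Suc i) * (TT i * y) \<approx> scal (u (d i)) * (TT i * y) - s * y"
    and "XX i * (TT i * y) \<approx> scal (u (d (Suc i))) * (TT i * y) + s * y"
proof -
  have y: "y \<in> AF n" and d: "d i \<in> {1..r}" "d (Suc i) \<in> {1..r}"
    and xy: "XX i * y \<approx> scal (u (d i)) * y" "XX (Suc i) * y \<approx> scal (u (d (Suc i))) * y"
    using w i by (auto simp: weight_def)
  have F: "TT i \<in> AF n" using i by (auto intro: FA_gen)
  let ?S = "{(a, b). 1 \<le> a \<and> a < b \<and> b \<le> r}"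
  let ?sum = "\<Sum>(a, b) \<in> ?S. scal (u b - u a) * lagrange r u a (XX i) * lagrange r u b (XX (Suc i))"
  have "?sum * y \<approx> (\<Sum>(a, b)\<in>?S. scal ((u b - u a) * (if d i = a then 1 else 0) * (if d (Suc i) = b then 1 else 0)) * y)"
    unfolding sum_distrib_right
  proof (intro cg_sum, clarify)
    fix a b assume ab: "1 \<le> a" "a < b" "b \<le> r"
    let ?a = "scal (if d i = a then 1 else 0) :: ak_gen ncpoly"
    let ?b = "scal (if d (Suc i) = b then 1 else 0) :: ak_gen ncpoly"
    let ?l = "lagrange r u a (XX i)"
    have l: "?l \<in> AF n" using i by (intro FA_lagrange FA_gen) auto
    have "lagrange r u b (XX (Suc i)) * y \<approx> ?b * y"
      using ab i by (intro weight_lagrange[OF w]) auto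
    then have "scal (u b - u a) * (?l * (lagrange r u b (XX (Suc i)) * y)) \<approx> scal (u b - u a) * (?l * (?b * y))"
      by (intro cg_scal cg_mult l)
    also have "\<dots> = scal (u b - u a) * (?b * (?l * y))"
      by (simp only: scal_left_comm[of ?l])
    also have "\<dots> \<approx> scal (u b - u a) * (?b * (?a * y))"
      using ab i by (intro cg_scal weight_lagrange[OF w]) auto
    also have "\<dots> = scal ((u b - u a) * (if d i = a then 1 else 0) * (if d (Suc i) = b then 1 else 0)) * y"
      unfolding scal_scal by (simp add: mult_ac)
    finally show "scal (u b - u a) * ?l * lagrange r u b (XX (Suc i)) * y \<approx>
        scal ((u b - u a) * (if d i = a then 1 else 0) * (if d (Suc i) = b then 1 else 0)) * y"
      by (simp only: mult.assoc)
  qed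
  also have "\<dots> = scal (\<Sum>(a, b)\<in>?S. (u b - u a) * (if d i = a then 1 else 0) * (if d (Suc i) = b then 1 else 0)) * y"
  proof -
    have "scal (sum h A) * y = (\<Sum>a\<in>A. scal (h a) * y)" for h :: "nat \<times> nat \<Rightarrow> complex" and A
      by (induction A rule: infinite_finite_induct) (auto simp: scal_add algebra_simps)
    then show ?thesis by (simp add: case_prod_beta)
  qed
  also have "\<dots> = s * y"
    unfolding s_def sum_lagrange_value[OF d] ..
  finally have sy: "?sum * y \<approx> s * y" .
  have "TT i * XX i - (XX (Suc i) * TT i + ?sum) \<in> ak_relations n r u"
    using i by (intro ak_relation_t_xi) auto
  from L_relation[OF this y]
  have "TT i * (XX i * y) \<approx> XX (Suc i) * (TT i * y) + ?sum * y"
    by (simp add: cg_def algebra_simps)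
  from cg_diff[OF cg_sym[OF this] cg_refl[of "?sum * y"]]
  have "XX (Suc i) * (TT i * y) + ?sum * y - ?sum * y \<approx> TT i * (XX i * y) - ?sum * y" .
  also have "\<dots> \<approx> TT i * (scal (u (d i)) * y) - s * y"
    by (intro cg_diff cg_mult F xy sy)
  finally show 1: "XX (Suc i) * (TT i * y) \<approx> scal (u (d i)) * (TT i * y) - s * y"
    by (simp add: gen_scal)
  have "TT i * (XX (Suc i) + XX i) - (XX (Suc i) + XX i) * TT i \<in> ak_relations n r u"
    using i by (intro ak_relation_t_sum) auto
  from L_relation[OF this y]
  have "TT i * (XX (Suc i) * y) + TT i * (XX i * y) \<approx> XX (Suc i) * (TT i * y) + XX i * (TT i * y)"
    by (simp add: cg_def algebra_simps)
  from cg_diff[OF cg_sym[OF this] cg_refl[of "XX (Suc i) * (TT i * y)"]]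
  have "XX (Suc i) * (TT i * y) + XX i * (TT i * y) - XX (Suc i) * (TT i * y) \<approx>
      TT i * (XX (Suc i) * y) + TT i * (XX i * y) - XX (Suc i) * (TT i * y)" .
  also have "\<dots> \<approx> TT i * (scal (u (d (Suc i))) * y) + TT i * (scal (u (d i)) * y) -
      (scal (u (d i)) * (TT i * y) - s * y)"
    by (intro cg_diff cg_add cg_mult F xy 1)
  finally show "XX i * (TT i * y) \<approx> scal (u (d (Suc i))) * (TT i * y) + s * y"
    by (simp add: gen_scal)
qed

text \<open>For rising colors the term \<open>s * y\<close> of \<open>weight_T\<close> and the
  eigenvalue of \<open>y\<close> combine so that \<open>T + 1\<close> maps weight vectors to weight
  vectors; otherwise \<open>s\<close> is zero and \<open>T\<close> does so itself.\<close>

lemma weight_ee: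
  assumes w: "weight d y" and i: "1 \<le> i" "i < n"
  shows "weight (d \<circ> ts i) (ee i d * y)"
  unfolding weight_def
proof (intro conjI ballI)
  have y: "y \<in> AF n" and d: "\<And>j. j \<in> {1..n} \<Longrightarrow> d j \<in> {1..r}"
    and xy: "\<And>j. j \<in> {1..n} \<Longrightarrow> XX j * y \<approx> scal (u (d j)) * y"
    using w by (auto simp: weight_def)
  show "ee i d * y \<in> AF n" using y i by (intro FA_mult FA_ee)
  fix j assume j: "j \<in> {1..n}"
  show "(d \<circ> ts i) j \<in> {1..r}"
    using i j d by (auto simp: transpose_def)
  have i': "i \<in> {1..n}" "Suc i \<in> {1..n}" using i by auto
  consider "j = i" | "j = Suc i" | "j \<noteq> i" "j \<noteq> Suc i" by blast
  then show "XX j * (ee i d * y) \<approx> scal (u ((d \<circ> ts i) j)) * (ee i d * y)"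
  proof cases
    case 1
    show ?thesis
    proof (cases "d i < d (Suc i)")
      case True
      with cg_add[OF weight_T(2)[OF w i] xy[OF i'(1)]] show ?thesis
        by (simp add: 1 ee_def algebra_simps scal_diff)
    next
      case False
      with weight_T(2)[OF w i] show ?thesis by (simp add: 1 ee_def algebra_simps)
    qed
  next
    case 2
    show ?thesis
    proof (cases "d i < d (Suc i)")
      case True
      with cg_add[OF weight_T(1)[OF w i] xy[OF i'(2)]] show ?thesis
        by (simp add: 2 ee_def algebra_simps scal_diff)
    next
      case False
      with weight_T(1)[OF w i] show ?thesis by (simp add: 2 ee_def algebra_simps)
    qed
  next
    case 3
    have "TT i * XX j - XX j * TT i \<in> ak_relations n r u"
      using i j 3 by (intro ak_relation_t_xi_comm) auto
    from L_relation[OF this y] have "TT i * (XX j * y) \<approx> XX j * (TT i * y)"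
      by (simp add: cg_def algebra_simps)
    from cg_sym[OF this] have "XX j * (TT i * y) \<approx> TT i * (XX j * y)" .
    also have "\<dots> \<approx> TT i * (scal (u (d j)) * y)"
      using i j by (intro cg_mult xy FA_gen) auto
    finally have T: "XX j * (TT i * y) \<approx> scal (u (d j)) * (TT i * y)"
      by (simp add: gen_scal)
    show ?thesis
      using T cg_add[OF T xy[OF j]] 3 by (auto simp: ee_def algebra_simps)
  qed
qed

lemma T_square: "y \<in> AF n \<Longrightarrow> 1 \<le> i \<Longrightarrow> i < n \<Longrightarrow> TT i * (TT i * y) + TT i * y \<in> \<Lambda>"
  using L_relation[OF ak_relation_quadratic, of i y] by (simp add: algebra_simps)

text \<open>If the two colors differ, exactly one of the two intertwiners is \<open>T + 1\<close>
  and the other is \<open>T\<close>, so the product is the quadratic relation.\<close>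

lemma ee_square:
  assumes y: "y \<in> AF n" and i: "1 \<le> i" "i < n"
  shows "ee i (d \<circ> ts i) * (ee i d * y) \<approx> (if d i = d (Suc i) then - (ee i d * y) else 0)"
  using T_square[OF y i] by (auto simp: ee_def cg_def algebra_simps)

lemma ee_comm:
  assumes y: "y \<in> AF n" and ij: "1 \<le> i" "Suc i < j" "j < n"
  shows "ee i (d \<circ> ts j) * (ee j d * y) \<approx> ee j (d \<circ> ts i) * (ee i d * y)"
proof -
  have "TT i * TT j - TT j * TT i \<in> ak_relations n r u"
    using ij by (intro ak_relation_comm) auto
  from L_relation[OF this y] have *: "TT i * (TT j * y) - TT j * (TT i * y) \<in> \<Lambda>"
    by (simp add: algebra_simps)
  have "ts j i = i" "ts j (Suc i) = Suc i" "ts i j = j" "ts i (Suc j) = Suc j"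
    using ij by (auto simp: transpose_def)
  then show ?thesis
    using * by (simp add: ee_def cg_def algebra_simps)
qed

text \<open>When the added ones are expanded, the lower terms of both sides cancel except for the
  difference of two quadratic relations, which is present if the outer two of the three colors
  rise.\<close>

lemma ee_braid:
  assumes y: "y \<in> AF n" and i: "1 \<le> i" "Suc i < n"
  shows "ee i (d \<circ> ts i \<circ> ts (Suc i)) * (ee (Suc i) (d \<circ> ts i) * (ee i d * y)) \<approx>
    ee (Suc i) (d \<circ> ts (Suc i) \<circ> ts i) * (ee i (d \<circ> ts (Suc i)) * (ee (Suc i) d * y))"
proof -
  have "TT i * TT (Suc i) * TT i - TT (Suc i) * TT i * TT (Suc i) \<in> ak_relations n r u"
    using i by (intro ak_relation_braid) auto
  from L_relation[OF this y]
  have b: "TT i * (TT (Suc i) * (TT i * y)) - TT (Suc i) * (TT i * (TT (Suc i) * y)) \<in> \<Lambda>" (is "?b \<in> \<Lambda>")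
    by (simp add: algebra_simps)
  have q1: "TT i * (TT i * y) + TT i * y \<in> \<Lambda>" (is "?q1 \<in> _")
    using y i by (intro T_square) auto
  have q2: "TT (Suc i) * (TT (Suc i) * y) + TT (Suc i) * y \<in> \<Lambda>" (is "?q2 \<in> _")
    using y i by (intro T_square) auto
  let ?l = "ee i (d \<circ> ts i \<circ> ts (Suc i)) * (ee (Suc i) (d \<circ> ts i) * (ee i d * y))"
  let ?r = "ee (Suc i) (d \<circ> ts (Suc i) \<circ> ts i) * (ee i (d \<circ> ts (Suc i)) * (ee (Suc i) d * y))"
  have "?l - ?r = ?b + (if d i < d (Suc (Suc i)) then ?q1 - ?q2 else 0)"
    by (simp add: ee_def algebra_simps)
  then show ?thesis
    using b q1 q2 L_add L_diff by (auto simp: cg_def)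
qed

lemma weight_1: "weight c 1"
  using L_xi c_range by (auto simp: weight_def cg_def FA_one)

lemma weight_th: "\<sigma> \<in> BB \<Longrightarrow> weight (c \<circ> \<sigma>) (th \<sigma>)"
proof (induction \<sigma> rule: perm_induct)
  case (step \<sigma>)
  from step.hyps show ?case
  proof (cases \<sigma> rule: th_cases)
    case 1
    show ?thesis unfolding 1(2) using weight_1 by (simp add: 1(1))
  next
    case (2 i)
    then have "weight (c \<circ> (\<sigma> \<circ> ts i)) (th (\<sigma> \<circ> ts i))"
      using step.IH[OF comp_ts_descent[OF step.hyps 2(1-3)]] by blast
    from weight_ee[OF this 2(1,2)] show ?thesis
      unfolding 2(5) by (simp add: comp_def)
  qed
qed

text \<open>Independence of the chosen word, in the manner of Matsumoto. The smallest descent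
  \<open>i\<close> and the given descent \<open>j\<close> are undone in either order until both ways
  meet at a common permutation: by commutation if \<open>i + 1 < j\<close>, by the braid relation if
  \<open>j = i + 1\<close>.\<close>

lemma th_descent:
  assumes "\<sigma> \<in> BB" "1 \<le> j" "j < n" "\<sigma> (Suc j) < \<sigma> j"
  shows "th \<sigma> \<approx> ee j (c \<circ> (\<sigma> \<circ> ts j)) * th (\<sigma> \<circ> ts j)"
  using assms
proof (induction \<sigma> arbitrary: j rule: perm_induct)
  case (step \<sigma>)
  from step.hyps show ?case
  proof (cases \<sigma> rule: th_cases)
    case 1
    then show ?thesis using step.prems by simp
  next
    case (2 i)
    have up: "\<tau> \<circ> ts k \<in> BB \<and> srank n \<sigma> < srank n (\<tau> \<circ> ts k)"
      if "\<tau> \<in> BB" "\<tau> = \<sigma> \<or> srank n \<sigma> < srank n \<tau>" "1 \<le> k" "k < n" "\<tau> (Suc k) < \<tau> k" for \<tau> k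
      using srank_comp_ts[of k n \<tau>] that by (auto simp: comp_ts_permutes_iff)
    have ij: "i \<le> j" using 2 step.prems by auto
    consider "i = j" | "j = Suc i" | "Suc i < j" using ij by linarith
    then show ?thesis
    proof cases
      case 1
      show ?thesis unfolding 1[symmetric] 2(5) by (rule cg_refl)
    next
      case 3
      note ts = this
      define \<tau> where "\<tau> = \<sigma> \<circ> ts i \<circ> ts j"
      have \<tau>: "\<sigma> \<circ> ts i \<circ> ts j = \<tau>" "\<sigma> \<circ> ts j \<circ> ts i = \<tau>"
        "c \<circ> (\<sigma> \<circ> ts i) = c \<circ> \<tau> \<circ> ts j" "c \<circ> (\<sigma> \<circ> ts j) = c \<circ> \<tau> \<circ> ts i"
        using ts by (auto simp: fun_eq_iff transpose_def \<tau>_def)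
      have t: "ts i j = j" "ts i (Suc j) = Suc j" "ts j i = i" "ts j (Suc i) = Suc i"
        using ts by (auto simp: transpose_def)
      have si: "\<sigma> \<circ> ts i \<in> BB" "srank n \<sigma> < srank n (\<sigma> \<circ> ts i)"
        and sj: "\<sigma> \<circ> ts j \<in> BB" "srank n \<sigma> < srank n (\<sigma> \<circ> ts j)"
        using up[of \<sigma>] step 2 by blast+
      have "th (\<sigma> \<circ> ts i) \<approx> ee j (c \<circ> (\<sigma> \<circ> ts i \<circ> ts j)) * th (\<sigma> \<circ> ts i \<circ> ts j)"
        using step.prems t by (intro step.IH si) auto
      then have i: "th (\<sigma> \<circ> ts i) \<approx> ee j (c \<circ> \<tau>) * th \<tau>" by (simp add: \<tau>)
      have "th (\<sigma> \<circ> ts j) \<approx> ee i (c \<circ> (\<sigma> \<circ> ts j \<circ> ts i)) * th (\<sigma> \<circ> ts j \<circ> ts i)"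
        using 2 t by (intro step.IH sj) auto
      then have j: "th (\<sigma> \<circ> ts j) \<approx> ee i (c \<circ> \<tau>) * th \<tau>" by (simp add: \<tau>)
      have \<tau>B: "\<tau> \<in> BB" using up[of "\<sigma> \<circ> ts i" j] si step.prems t by (auto simp: \<tau>)
      have 0: "th \<sigma> = ee i (c \<circ> \<tau> \<circ> ts j) * th (\<sigma> \<circ> ts i)" using 2(5) \<tau>(3) by simp
      have "ee i (c \<circ> \<tau> \<circ> ts j) * th (\<sigma> \<circ> ts i) \<approx> ee i (c \<circ> \<tau> \<circ> ts j) * (ee j (c \<circ> \<tau>) * th \<tau>)"
        by (rule cg_mult[OF i FA_ee[OF 2(1,2)]])
      also have "\<dots> \<approx> ee j (c \<circ> \<tau> \<circ> ts i) * (ee i (c \<circ> \<tau>) * th \<tau>)"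
        by (rule ee_comm[OF FA_th[OF \<tau>B] 2(1) ts step.prems(2)])
      also have "\<dots> \<approx> ee j (c \<circ> \<tau> \<circ> ts i) * th (\<sigma> \<circ> ts j)"
        by (rule cg_mult[OF cg_sym[OF j] FA_ee[OF step.prems(1,2)]])
      finally show ?thesis unfolding 0 \<tau>(4) .
    next
      case j: 2
      \<comment> \<open>The values of \<sigma> at \<open>i\<close>, \<open>i + 1\<close>,
        \<open>i + 2\<close> strictly decrease; \<tau> has the same three values in increasing
        order.\<close>
      define \<tau> where "\<tau> = \<sigma> \<circ> ts i \<circ> ts j \<circ> ts i"
      have \<tau>: "\<sigma> \<circ> ts i \<circ> ts j \<circ> ts i = \<tau>"
        by (simp add: \<tau>_def)
      have \<tau>': "\<sigma> \<circ> ts j \<circ> ts i \<circ> ts j = \<tau>"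
        unfolding j \<tau>_def by (auto simp: fun_eq_iff transpose_def)
      have \<tau>c: "c \<circ> (\<sigma> \<circ> ts i) = c \<circ> \<tau> \<circ> ts i \<circ> ts j" "c \<circ> (\<sigma> \<circ> ts i \<circ> ts j) = c \<circ> \<tau> \<circ> ts i"
        unfolding \<tau>[symmetric] by (simp_all only: o_assoc comp_ts_ts)
      have \<tau>c': "c \<circ> (\<sigma> \<circ> ts j) = c \<circ> \<tau> \<circ> ts j \<circ> ts i" "c \<circ> (\<sigma> \<circ> ts j \<circ> ts i) = c \<circ> \<tau> \<circ> ts j"
        unfolding \<tau>'[symmetric] by (simp_all only: o_assoc comp_ts_ts)
      note \<tau> = \<tau> \<tau>' \<tau>c(1) \<tau>c'(1) \<tau>c(2) \<tau>c'(2)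
      have t: "ts i j = i" "ts i (Suc j) = Suc j" "ts j i = i" "ts i i = j" "ts j j = Suc j" "ts j (Suc j) = j"
        "ts j (Suc i) = Suc j" "ts i (Suc i) = i"
        using j by (auto simp: transpose_def)
      have d: "\<sigma> j < \<sigma> i" "\<sigma> (Suc j) < \<sigma> j" using 2 step.prems j by auto
      have si: "\<sigma> \<circ> ts i \<in> BB \<and> srank n \<sigma> < srank n (\<sigma> \<circ> ts i)"
        using up[of \<sigma> i] step 2 by blast
      have sj: "\<sigma> \<circ> ts j \<in> BB \<and> srank n \<sigma> < srank n (\<sigma> \<circ> ts j)"
        using up[of \<sigma> j] step by blast
      have sij: "\<sigma> \<circ> ts i \<circ> ts j \<in> BB \<and> srank n \<sigma> < srank n (\<sigma> \<circ> ts i \<circ> ts j)"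
        using si step.prems d t by (intro up) auto
      have sji: "\<sigma> \<circ> ts j \<circ> ts i \<in> BB \<and> srank n \<sigma> < srank n (\<sigma> \<circ> ts j \<circ> ts i)"
        using sj 2(1,2) d t by (intro up) auto
      have \<tau>B: "\<tau> \<in> BB"
        using sij 2(1,2) by (simp add: comp_ts_permutes_iff flip: \<tau>(1))
      have "th (\<sigma> \<circ> ts i) \<approx> ee j (c \<circ> (\<sigma> \<circ> ts i \<circ> ts j)) * th (\<sigma> \<circ> ts i \<circ> ts j)"
        using step.prems d t by (intro step.IH[OF conjunct1[OF si] conjunct2[OF si]]) auto
      then have i: "th (\<sigma> \<circ> ts i) \<approx> ee j (c \<circ> \<tau> \<circ> ts i) * th (\<sigma> \<circ> ts i \<circ> ts j)" by (simp add: \<tau>)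
      have "th (\<sigma> \<circ> ts i \<circ> ts j) \<approx> ee i (c \<circ> (\<sigma> \<circ> ts i \<circ> ts j \<circ> ts i)) * th (\<sigma> \<circ> ts i \<circ> ts j \<circ> ts i)"
        using 2(1,2) d t by (intro step.IH[OF conjunct1[OF sij] conjunct2[OF sij]]) auto
      then have ij: "th (\<sigma> \<circ> ts i \<circ> ts j) \<approx> ee i (c \<circ> \<tau>) * th \<tau>" by (simp add: \<tau>)
      have "th (\<sigma> \<circ> ts j) \<approx> ee i (c \<circ> (\<sigma> \<circ> ts j \<circ> ts i)) * th (\<sigma> \<circ> ts j \<circ> ts i)"
        using 2(1,2) d t by (intro step.IH[OF conjunct1[OF sj] conjunct2[OF sj]]) auto
      then have j': "th (\<sigma> \<circ> ts j) \<approx> ee i (c \<circ> \<tau> \<circ> ts j) * th (\<sigma> \<circ> ts j \<circ> ts i)" by (simp add: \<tau>)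
      have "th (\<sigma> \<circ> ts j \<circ> ts i) \<approx> ee j (c \<circ> (\<sigma> \<circ> ts j \<circ> ts i \<circ> ts j)) * th (\<sigma> \<circ> ts j \<circ> ts i \<circ> ts j)"
        using step.prems d t by (intro step.IH[OF conjunct1[OF sji] conjunct2[OF sji]]) auto
      then have ji: "th (\<sigma> \<circ> ts j \<circ> ts i) \<approx> ee j (c \<circ> \<tau>) * th \<tau>" by (simp add: \<tau>)
      note F = FA_ee[OF 2(1,2)] FA_ee[OF step.prems(1,2)]
      have 0: "th \<sigma> = ee i (c \<circ> \<tau> \<circ> ts i \<circ> ts j) * th (\<sigma> \<circ> ts i)" unfolding 2(5) \<tau>(3) ..
      have "ee i (c \<circ> \<tau> \<circ> ts i \<circ> ts j) * th (\<sigma> \<circ> ts i) \<approx> ee i (c \<circ> \<tau> \<circ> ts i \<circ> ts j) * (ee j (c \<circ> \<tau> \<circ> ts i) * th (\<sigma> \<circ> ts i \<circ> ts j))"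
        by (intro cg_mult i F)
      also have "\<dots> \<approx> ee i (c \<circ> \<tau> \<circ> ts i \<circ> ts j) * (ee j (c \<circ> \<tau> \<circ> ts i) * (ee i (c \<circ> \<tau>) * th \<tau>))"
        by (intro cg_mult ij F)
      also have "\<dots> \<approx> ee j (c \<circ> \<tau> \<circ> ts j \<circ> ts i) * (ee i (c \<circ> \<tau> \<circ> ts j) * (ee j (c \<circ> \<tau>) * th \<tau>))"
        using ee_braid[OF FA_th[OF \<tau>B] 2(1) step.prems(2)[unfolded j], of "c \<circ> \<tau>"] unfolding j .
      also have "\<dots> \<approx> ee j (c \<circ> \<tau> \<circ> ts j \<circ> ts i) * (ee i (c \<circ> \<tau> \<circ> ts j) * th (\<sigma> \<circ> ts j \<circ> ts i))"
        by (intro cg_mult cg_sym[OF ji] F)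
      also have "\<dots> \<approx> ee j (c \<circ> \<tau> \<circ> ts j \<circ> ts i) * th (\<sigma> \<circ> ts j)"
        by (intro cg_mult cg_sym[OF j'] F)
      finally show ?thesis unfolding 0 \<tau>(4) .
    qed
  qed
qed

text \<open>This is the rule by which \<open>T\<close> acts on the indicator of \<sigma>. At an
  ascent \<open>T\<close> is an intertwiner up to the added 1; at a descent
  \<open>th \<sigma>\<close> already begins with an intertwiner and \<open>ee_square\<close>
  applies.\<close>

lemma T_th:
  assumes \<sigma>: "\<sigma> \<in> BB" and i: "1 \<le> i" "i < n"
  shows "TT i * th \<sigma> \<approx> scal (ldg (GenT i) \<sigma>) * th \<sigma> + (if \<sigma> i < \<sigma> (Suc i) then th (\<sigma> \<circ> ts i) else 0)"
proof (cases "\<sigma> i < \<sigma> (Suc i)")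
  case True
  have B: "\<sigma> \<circ> ts i \<in> BB" using \<sigma> i by (simp add: comp_ts_permutes_iff)
  have "th (\<sigma> \<circ> ts i) \<approx> ee i (c \<circ> (\<sigma> \<circ> ts i \<circ> ts i)) * th (\<sigma> \<circ> ts i \<circ> ts i)"
    using True i by (intro th_descent[OF B]) auto
  from cg_sym[OF this] have *: "ee i (c \<circ> \<sigma>) * th \<sigma> \<approx> th (\<sigma> \<circ> ts i)"
    unfolding comp_ts_ts .
  show ?thesis
  proof (cases "c (\<sigma> i) < c (\<sigma> (Suc i))")
    case lt: True
    then have "ee i (c \<circ> \<sigma>) * th \<sigma> - th \<sigma> = TT i * th \<sigma>" "ldg (GenT i) \<sigma> = - 1"
      by (simp_all add: ee_def ldg_def distrib_right)
    with cg_diff[OF * cg_refl[of "th \<sigma>"]] True show ?thesis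
      by (simp add: scal_uminus)
  next
    case False
    then have "ee i (c \<circ> \<sigma>) = TT i" "ldg (GenT i) \<sigma> = 0"
      using True by (simp_all add: ee_def ldg_def)
    with * True show ?thesis by simp
  qed
next
  case False
  then have lt: "\<sigma> (Suc i) < \<sigma> i"
  proof -
    have "\<sigma> i \<noteq> \<sigma> (Suc i)" using permutes_inj[of \<sigma> "{1..n}"] \<sigma> by (simp add: inj_eq)
    with False show ?thesis by simp
  qed
  let ?d = "c \<circ> (\<sigma> \<circ> ts i)"
  let ?y = "th (\<sigma> \<circ> ts i)"
  have B: "\<sigma> \<circ> ts i \<in> BB" using \<sigma> i by (simp add: comp_ts_permutes_iff)
  note des = th_descent[OF \<sigma> i lt]
  have d: "?d \<circ> ts i = c \<circ> \<sigma>" by (simp add: comp_assoc)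
  have "ee i (c \<circ> \<sigma>) * th \<sigma> \<approx> ee i (c \<circ> \<sigma>) * (ee i ?d * ?y)"
    by (intro cg_mult des FA_ee i)
  also have "\<dots> \<approx> (if ?d i = ?d (Suc i) then - (ee i ?d * ?y) else 0)"
    using ee_square[OF FA_th[OF B] i, of ?d] by (simp only: d)
  also have "\<dots> \<approx> (if ?d i = ?d (Suc i) then - th \<sigma> else 0)"
    using L_uminus[of "ee i ?d * ?y - th \<sigma>"] cg_sym[OF des] by (auto simp: cg_def L_zero)
  finally have *: "ee i (c \<circ> \<sigma>) * th \<sigma> \<approx> (if c (\<sigma> i) = c (\<sigma> (Suc i)) then - th \<sigma> else 0)"
    by (simp add: eq_commute)
  show ?thesis
  proof (cases "c (\<sigma> i) < c (\<sigma> (Suc i))")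
    case True
    then have "ee i (c \<circ> \<sigma>) * th \<sigma> - th \<sigma> = TT i * th \<sigma>" "ldg (GenT i) \<sigma> = - 1"
      by (simp_all add: ee_def ldg_def distrib_right)
    with cg_diff[OF * cg_refl[of "th \<sigma>"]] True lt show ?thesis
      by (simp add: scal_uminus)
  next
    case False
    then have "ee i (c \<circ> \<sigma>) = TT i" "ldg (GenT i) \<sigma> = (if c (\<sigma> i) = c (\<sigma> (Suc i)) then - 1 else 0)"
      using lt by (simp_all add: ee_def ldg_def)
    with * lt show ?thesis by (cases "c (\<sigma> i) = c (\<sigma> (Suc i))") (simp_all add: scal_uminus)
  qed
qed

lemma gen_Th:
  assumes g: "g \<in> ak_gens n"
  shows "gen g * Th v \<approx> Th (L.gop g v)"
proof (cases g)
  case (GenXi j)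
  then have j: "j \<in> {1..n}" using g by simp
  have "gen g * Th v = (\<Sum>\<sigma>\<in>BB. scal (v \<sigma>) * (XX j * th \<sigma>))"
    by (simp add: Th_def sum_distrib_left gen_scal GenXi)
  also have "\<dots> \<approx> (\<Sum>\<sigma>\<in>BB. scal (v \<sigma>) * (scal (u (c (\<sigma> j))) * th \<sigma>))"
    using weight_th j by (intro cg_sum cg_scal) (auto simp: weight_def)
  also have "\<dots> = Th (L.gop g v)"
    unfolding Th_def
    by (rule sum.cong) (auto simp: Lgop_Xi GenXi scal_scal mult.commute[of "v _"])
  finally show ?thesis .
next
  case (GenT i)
  then have i: "1 \<le> i" "i < n" using g by auto
  have 0: "gen g * Th v = (\<Sum>\<sigma>\<in>BB. scal (v \<sigma>) * (TT i * th \<sigma>))"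
    by (simp add: Th_def sum_distrib_left gen_scal GenT)
  have 1: "gen g * Th v \<approx>
      (\<Sum>\<sigma>\<in>BB. scal (v \<sigma>) * (scal (ldg (GenT i) \<sigma>) * th \<sigma> + (if \<sigma> i < \<sigma> (Suc i) then th (\<sigma> \<circ> ts i) else 0)))"
    unfolding 0 using T_th i by (intro cg_sum cg_scal) auto
  have bij: "bij_betw (\<lambda>\<sigma>. \<sigma> \<circ> ts i) BB BB"
    by (rule bij_betw_byWitness[where f' = "\<lambda>\<sigma>. \<sigma> \<circ> ts i"])
       (simp_all only: comp_ts_ts image_subset_iff mem_Collect_eq comp_ts_permutes_iff[OF i] simp_thms, auto)
  let ?h = "\<lambda>\<sigma>. if \<sigma> (Suc i) < \<sigma> i then scal (v (\<sigma> \<circ> ts i)) * th \<sigma> else 0"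
  \<comment> \<open>Reindexing by the exchange of places turns what ascents send away into what
    descents receive.\<close>
  have 2: "(\<Sum>\<sigma>\<in>BB. if \<sigma> i < \<sigma> (Suc i) then scal (v \<sigma>) * th (\<sigma> \<circ> ts i) else 0) = sum ?h BB"
    using sum.reindex_bij_betw[OF bij, of ?h] by (simp only: comp_ts_ts comp_apply transpose_apply_first transpose_apply_second)
  have 3: "scal (L.gop g v \<sigma>) * th \<sigma> = scal (v \<sigma>) * (scal (ldg (GenT i) \<sigma>) * th \<sigma>) + ?h \<sigma>" for \<sigma>
    by (simp only: scal_scal L.gop_def GenT loff_def lsh_def ak_gen.case)
       (simp add: scal_add distrib_right mult.commute)
  have "(\<Sum>\<sigma>\<in>BB. scal (v \<sigma>) * (scal (ldg (GenT i) \<sigma>) * th \<sigma> + (if \<sigma> i < \<sigma> (Suc i) then th (\<sigma> \<circ> ts i) else 0)))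
      = (\<Sum>\<sigma>\<in>BB. scal (v \<sigma>) * (scal (ldg (GenT i) \<sigma>) * th \<sigma>)) +
        (\<Sum>\<sigma>\<in>BB. if \<sigma> i < \<sigma> (Suc i) then scal (v \<sigma>) * th (\<sigma> \<circ> ts i) else 0)"
    unfolding sum.distrib[symmetric] by (rule sum.cong) (simp_all add: distrib_left)
  also have "\<dots> = Th (L.gop g v)"
    unfolding Th_def 2 3 sum.distrib ..
  finally have "(\<Sum>\<sigma>\<in>BB. scal (v \<sigma>) * (scal (ldg (GenT i) \<sigma>) * th \<sigma> + (if \<sigma> i < \<sigma> (Suc i) then th (\<sigma> \<circ> ts i) else 0)))
      = Th (L.gop g v)" .
  from 1[unfolded this] show ?thesis .
qed

text \<open>The universal property: a polynomial that kills \<open>v0\<close> lies in \<Lambda>. So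
  every module generated by a vector of weight \<open>c\<close> is an image of
  \<open>V\<close>.\<close>

lemma cg_Th:
  assumes "f \<in> AF n"
  shows "f \<approx> Th (L.rho f v0)"
  using assms
proof (induction f rule: FA_induct)
  case one
  have "id \<in> BB" by (simp add: permutes_id)
  then have "Th v0 = (\<Sum>\<sigma>\<in>BB. if \<sigma> = id then th id else 0)"
    unfolding Th_def v0_def delta_def by (intro sum.cong) auto
  also have "\<dots> = th id" using fin_B \<open>id \<in> BB\<close> by simp
  also have "\<dots> = 1" using \<open>id \<in> BB\<close> by (cases rule: th_cases) auto
  finally show ?case by (simp add: L.rho_one' cg_refl)
next
  case (add f g)
  have "Th (\<lambda>\<sigma>. L.rho f v0 \<sigma> + L.rho g v0 \<sigma>) = Th (L.rho f v0) + Th (L.rho g v0)"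
    by (simp add: Th_def scal_add distrib_right sum.distrib)
  with cg_add[OF add.IH] show ?case by (simp add: L.rho_add[abs_def])
next
  case (scal a f)
  have "Th (\<lambda>\<sigma>. a * L.rho f v0 \<sigma>) = scal a * Th (L.rho f v0)"
    by (simp add: Th_def scal_mult sum_distrib_left mult.assoc)
  with cg_scal[OF scal.IH] show ?case by (simp add: L.rho_mult L.rho_scal[abs_def])
next
  case (gen x f)
  have "gen x * f \<approx> gen x * Th (L.rho f v0)"
    by (intro cg_mult gen FA_gen)
  also have "\<dots> \<approx> Th (L.gop x (L.rho f v0))"
    by (rule gen_Th[OF gen.hyps(1)])
  finally show ?case by (simp add: L.rho_mult L.rho_gen[abs_def])
qed

end

subsection \<open>Subquotients of modules\<close>

lemma quot_module_simps [simp]: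
  "carrier (quot_module M N) = a_rcosets\<^bsub>M\<^esub> N" "zero (quot_module M N) = N"
  by (simp_all add: quot_module_def)

context left_module
begin

abbreviation subq :: "'c set \<Rightarrow> 'c set \<Rightarrow> ('a, 'c set) module" where
  "subq N2 N1 \<equiv> quot_module (M\<lparr>carrier := N2\<rparr>) N1"

lemma submodule_facts:
  assumes "submodule N R M"
  shows sm_subset: "N \<subseteq> carrier M" and sm_zero: "\<zero>\<^bsub>M\<^esub> \<in> N"
    and sm_add: "x \<in> N \<Longrightarrow> y \<in> N \<Longrightarrow> x \<oplus>\<^bsub>M\<^esub> y \<in> N"
    and sm_minus: "x \<in> N \<Longrightarrow> \<ominus>\<^bsub>M\<^esub> x \<in> N"
    and sm_smult: "a \<in> carrier R \<Longrightarrow> x \<in> N \<Longrightarrow> a \<odot>\<^bsub>M\<^esub> x \<in> N"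
    and sm_abelian_subgroup: "abelian_subgroup N M"
proof -
  have sg: "subgroup N (add_monoid M)" and sc: "submodule_axioms N R M"
    using assms by (auto simp: submodule_def)
  then have "additive_subgroup N M" by (simp add: additive_subgroup_def)
  then show "abelian_subgroup N M"
    by (rule abelian_subgroupI3) (rule M.abelian_group_axioms)
  show "N \<subseteq> carrier M" "\<zero>\<^bsub>M\<^esub> \<in> N" "x \<in> N \<Longrightarrow> y \<in> N \<Longrightarrow> x \<oplus>\<^bsub>M\<^esub> y \<in> N" "x \<in> N \<Longrightarrow> \<ominus>\<^bsub>M\<^esub> x \<in> N"
    using subgroup.subset[OF sg] subgroup.one_closed[OF sg] subgroup.m_closed[OF sg] subgroup.m_inv_closed[OF sg]
    by (auto simp: a_inv_def)
  show "a \<in> carrier R \<Longrightarrow> x \<in> N \<Longrightarrow> a \<odot>\<^bsub>M\<^esub> x \<in> N"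
    using sc by (simp add: submodule_axioms_def)
qed

text \<open>Closure under negation is obtained from the action of minus one.\<close>

lemma submodule_iff:
  "submodule N R M \<longleftrightarrow> N \<subseteq> carrier M \<and> \<zero>\<^bsub>M\<^esub> \<in> N \<and> (\<forall>x\<in>N. \<forall>y\<in>N. x \<oplus>\<^bsub>M\<^esub> y \<in> N) \<and>
     (\<forall>a\<in>carrier R. \<forall>x\<in>N. a \<odot>\<^bsub>M\<^esub> x \<in> N)"
proof
  assume *: "N \<subseteq> carrier M \<and> \<zero>\<^bsub>M\<^esub> \<in> N \<and> (\<forall>x\<in>N. \<forall>y\<in>N. x \<oplus>\<^bsub>M\<^esub> y \<in> N) \<and>
     (\<forall>a\<in>carrier R. \<forall>x\<in>N. a \<odot>\<^bsub>M\<^esub> x \<in> N)"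
  have zero: "\<zero>\<^bsub>R\<^esub> \<odot>\<^bsub>M\<^esub> x = \<zero>\<^bsub>M\<^esub>" if "x \<in> carrier M" for x
  proof -
    have "\<zero>\<^bsub>R\<^esub> \<odot>\<^bsub>M\<^esub> x \<oplus>\<^bsub>M\<^esub> \<zero>\<^bsub>R\<^esub> \<odot>\<^bsub>M\<^esub> x = (\<zero>\<^bsub>R\<^esub> \<oplus>\<^bsub>R\<^esub> \<zero>\<^bsub>R\<^esub>) \<odot>\<^bsub>M\<^esub> x"
      using that by (intro smult_l_distr[symmetric]) auto
    then show ?thesis using that smult_closed[of "\<zero>\<^bsub>R\<^esub>" x] by simp
  qed
  have "\<ominus>\<^bsub>M\<^esub> x \<in> N" if "x \<in> N" for x
  proof -
    have x: "x \<in> carrier M" using that * by auto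
    have c: "(\<ominus>\<^bsub>R\<^esub> \<one>\<^bsub>R\<^esub>) \<odot>\<^bsub>M\<^esub> x \<in> carrier M" using x by (intro smult_closed) auto
    have "(\<ominus>\<^bsub>R\<^esub> \<one>\<^bsub>R\<^esub>) \<odot>\<^bsub>M\<^esub> x \<oplus>\<^bsub>M\<^esub> \<one>\<^bsub>R\<^esub> \<odot>\<^bsub>M\<^esub> x = (\<ominus>\<^bsub>R\<^esub> \<one>\<^bsub>R\<^esub> \<oplus>\<^bsub>R\<^esub> \<one>\<^bsub>R\<^esub>) \<odot>\<^bsub>M\<^esub> x"
      using x by (intro smult_l_distr[symmetric]) auto
    then have "(\<ominus>\<^bsub>R\<^esub> \<one>\<^bsub>R\<^esub>) \<odot>\<^bsub>M\<^esub> x \<oplus>\<^bsub>M\<^esub> x = \<zero>\<^bsub>M\<^esub>"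
      using x zero smult_one by (simp add: R.l_neg)
    then have "\<ominus>\<^bsub>M\<^esub> x = (\<ominus>\<^bsub>R\<^esub> \<one>\<^bsub>R\<^esub>) \<odot>\<^bsub>M\<^esub> x"
      using x c by (intro M.minus_equality)
    then show ?thesis using * that by auto
  qed
  with * show "submodule N R M"
    unfolding submodule_def submodule_axioms_def
    by (intro conjI M.add.subgroupI) (auto simp: a_inv_def)
qed (simp add: submodule_facts subset_iff; metis sm_subset subsetD)

context
  fixes N1 N2
  assumes N1: "submodule N1 R M" and N2: "submodule N2 R M" and le: "N1 \<subseteq> N2"
begin

lemma N2_carrier: "x \<in> N2 \<Longrightarrow> x \<in> carrier M"
  using sm_subset[OF N2] by auto

lemma coset_restrict: "N1 +>\<^bsub>M\<lparr>carrier := N2\<rparr>\<^esub> x = N1 +>\<^bsub>M\<^esub> x"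
  by (simp add: a_r_coset_def')

lemma subq_carrier: "a_rcosets\<^bsub>M\<lparr>carrier := N2\<rparr>\<^esub> N1 = (\<lambda>x. N1 +>\<^bsub>M\<^esub> x) ` N2"
  by (auto simp: A_RCOSETS_def' coset_restrict)

lemma coset_eq_iff: "x \<in> carrier M \<Longrightarrow> y \<in> carrier M \<Longrightarrow> N1 +>\<^bsub>M\<^esub> x = N1 +>\<^bsub>M\<^esub> y \<longleftrightarrow> x \<ominus>\<^bsub>M\<^esub> y \<in> N1"
  using abelian_subgroup.a_rcos_module[OF sm_abelian_subgroup[OF N1], of y x]
    abelian_subgroup.a_repr_independence'[OF sm_abelian_subgroup[OF N1], of x y]
    abelian_subgroup.a_rcos_self[OF sm_abelian_subgroup[OF N1], of x]
  by (auto simp: M.minus_eq)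

lemma coset_add: "x \<in> N2 \<Longrightarrow> y \<in> N2 \<Longrightarrow>
    (N1 +>\<^bsub>M\<^esub> x) \<oplus>\<^bsub>subq N2 N1\<^esub> (N1 +>\<^bsub>M\<^esub> y) = N1 +>\<^bsub>M\<^esub> (x \<oplus>\<^bsub>M\<^esub> y)"
  using abelian_subgroup.a_rcos_sum[OF sm_abelian_subgroup[OF N1], of x y] N2_carrier
  by (simp add: set_add_def' quot_module_def)

lemma coset_smult:
  assumes "a \<in> carrier R" "x \<in> N2"
  shows "a \<odot>\<^bsub>subq N2 N1\<^esub> (N1 +>\<^bsub>M\<^esub> x) = N1 +>\<^bsub>M\<^esub> (a \<odot>\<^bsub>M\<^esub> x)"
proof -
  have x: "x \<in> carrier M" using assms N2_carrier by auto
  have eq: "N1 +>\<^bsub>M\<^esub> (a \<odot>\<^bsub>M\<^esub> y) = N1 +>\<^bsub>M\<^esub> (a \<odot>\<^bsub>M\<^esub> x)" if y: "y \<in> N1 +>\<^bsub>M\<^esub> x" for y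
  proof -
    obtain h where h: "h \<in> N1" "y = h \<oplus>\<^bsub>M\<^esub> x" using y by (auto simp: a_r_coset_def')
    have hc: "h \<in> carrier M" using h sm_subset[OF N1] by auto
    have "a \<odot>\<^bsub>M\<^esub> y = a \<odot>\<^bsub>M\<^esub> h \<oplus>\<^bsub>M\<^esub> a \<odot>\<^bsub>M\<^esub> x"
      using assms h hc x by (simp add: smult_r_distr)
    then have "a \<odot>\<^bsub>M\<^esub> y \<ominus>\<^bsub>M\<^esub> a \<odot>\<^bsub>M\<^esub> x = a \<odot>\<^bsub>M\<^esub> h"
      using assms x hc smult_closed by (simp add: M.minus_eq M.a_assoc M.r_neg)
    then show ?thesis
      using assms x hc h smult_closed sm_smult[OF N1] by (subst coset_eq_iff) auto
  qed
  moreover have "x \<in> N1 +>\<^bsub>M\<^esub> x"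
    using abelian_subgroup.a_rcos_self[OF sm_abelian_subgroup[OF N1] x] .
  ultimately have "(\<Union>y\<in>N1 +>\<^bsub>M\<^esub> x. N1 +>\<^bsub>M\<^esub> (a \<odot>\<^bsub>M\<^esub> y)) = N1 +>\<^bsub>M\<^esub> (a \<odot>\<^bsub>M\<^esub> x)"
    by blast
  then show ?thesis by (simp add: quot_module_def coset_restrict)
qed

lemma coset_zero: "N1 +>\<^bsub>M\<^esub> \<zero>\<^bsub>M\<^esub> = N1"
  using sm_subset[OF N1] by (simp add: M.a_coset_add_zero)

lemma coset_eq_N1: "x \<in> carrier M \<Longrightarrow> N1 +>\<^bsub>M\<^esub> x = N1 \<longleftrightarrow> x \<in> N1"
  using coset_eq_iff[of x "\<zero>\<^bsub>M\<^esub>"] M.minus_equality[of "\<zero>\<^bsub>M\<^esub>" "\<zero>\<^bsub>M\<^esub>"]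
  by (simp add: coset_zero M.minus_eq)

lemma subq_left_module: "left_module R (subq N2 N1)"
proof -
  note simps = subq_carrier coset_restrict coset_add coset_smult
  note cl = sm_add[OF N2] sm_smult[OF N2] sm_zero[OF N2] sm_minus[OF N2] N2_carrier
  show ?thesis
  proof (intro left_module.intro left_module_axioms.intro)
    show "ring R" by (rule R.ring_axioms)
    show "abelian_group (subq N2 N1)"
    proof (rule abelian_groupI)
      show "\<zero>\<^bsub>subq N2 N1\<^esub> \<in> carrier (subq N2 N1)"
        using coset_zero sm_zero[OF N2] by (auto simp: simps intro!: image_eqI)
      fix X assume X: "X \<in> carrier (subq N2 N1)"
      then obtain x where x: "x \<in> N2" "X = N1 +>\<^bsub>M\<^esub> x" by (auto simp: simps)
      show "\<zero>\<^bsub>subq N2 N1\<^esub> \<oplus>\<^bsub>subq N2 N1\<^esub> X = X"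
        using coset_add[OF sm_zero[OF N2] x(1)] x cl by (simp add: coset_zero)
      show "\<exists>Y\<in>carrier (subq N2 N1). Y \<oplus>\<^bsub>subq N2 N1\<^esub> X = \<zero>\<^bsub>subq N2 N1\<^esub>"
        using x cl by (intro bexI[of _ "N1 +>\<^bsub>M\<^esub> (\<ominus>\<^bsub>M\<^esub> x)"]) (auto simp: simps coset_zero M.l_neg)
    qed (auto simp: simps cl M.a_ac)
  qed (auto simp: simps cl smult_l_distr smult_r_distr smult_assoc smult_one)
qed

lemma simple_subq_no_intermediate:
  assumes "simple_module R (subq N2 N1)"
  shows "N1 \<noteq> N2" and "submodule W R M \<Longrightarrow> N1 \<subseteq> W \<Longrightarrow> W \<subseteq> N2 \<Longrightarrow> W = N1 \<or> W = N2"
proof -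
  have s: "carrier (subq N2 N1) \<noteq> {\<zero>\<^bsub>subq N2 N1\<^esub>}"
    "\<And>N. submodule N R (subq N2 N1) \<Longrightarrow> N = {\<zero>\<^bsub>subq N2 N1\<^esub>} \<or> N = carrier (subq N2 N1)"
    using assms by (auto simp: simple_module_def)
  show "N1 \<noteq> N2"
  proof
    assume "N1 = N2"
    then have "(\<lambda>x. N1 +>\<^bsub>M\<^esub> x) ` N2 = {N1}"
      using coset_eq_N1 N2_carrier sm_zero[OF N1] by auto
    with s(1) show False by (simp add: subq_carrier)
  qed
  assume W: "submodule W R M" "N1 \<subseteq> W" "W \<subseteq> N2"
  let ?W = "(\<lambda>x. N1 +>\<^bsub>M\<^esub> x) ` W"
  have "submodule ?W R (subq N2 N1)"
    unfolding left_module.submodule_iff[OF subq_left_module]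
  proof (intro conjI ballI)
    show "\<zero>\<^bsub>subq N2 N1\<^esub> \<in> ?W"
      using coset_zero sm_zero[OF W(1)] by (auto intro!: image_eqI)
  qed (use W in \<open>auto simp: subq_carrier coset_add coset_restrict coset_smult subset_iff sm_add[OF W(1)] sm_smult[OF W(1)]\<close>)
  from s(2)[OF this] show "W = N1 \<or> W = N2"
  proof
    assume "?W = {\<zero>\<^bsub>subq N2 N1\<^esub>}"
    then have "N1 +>\<^bsub>M\<^esub> x = N1" if "x \<in> W" for x using that by auto
    then have "W \<subseteq> N1" using coset_eq_N1 N2_carrier W(3) by blast
    then show ?thesis using W by auto
  next
    assume eq: "?W = carrier (subq N2 N1)"
    have "x \<in> W" if x: "x \<in> N2" for x
    proof -
      have "N1 +>\<^bsub>M\<^esub> x \<in> ?W" unfolding eq using x by (simp add: subq_carrier)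
      then obtain w where w: "w \<in> W" "N1 +>\<^bsub>M\<^esub> x = N1 +>\<^bsub>M\<^esub> w" by auto
      then have "x \<ominus>\<^bsub>M\<^esub> w \<in> W" using x W N2_carrier by (subst (asm) coset_eq_iff) auto
      from sm_add[OF W(1) this w(1)] show ?thesis
        using x w W N2_carrier by (simp add: M.minus_eq M.a_assoc M.l_neg subset_iff)
    qed
    then show ?thesis using W by auto
  qed
qed

lemma simple_subqI:
  assumes "N1 \<noteq> N2" and int: "\<And>W. submodule W R M \<Longrightarrow> N1 \<subseteq> W \<Longrightarrow> W \<subseteq> N2 \<Longrightarrow> W = N1 \<or> W = N2"
  shows "simple_module R (subq N2 N1)"
  unfolding simple_module_def
proof (intro conjI allI impI)
  show "left_module R (subq N2 N1)" by (rule subq_left_module)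
  obtain x where x: "x \<in> N2" "x \<notin> N1" using assms(1) le by auto
  then have "N1 +>\<^bsub>M\<^esub> x \<noteq> N1" using coset_eq_N1 N2_carrier by auto
  then show "carrier (subq N2 N1) \<noteq> {\<zero>\<^bsub>subq N2 N1\<^esub>}"
    using x by (auto simp: subq_carrier)
  fix W' assume W': "submodule W' R (subq N2 N1)"
  note f = left_module.submodule_facts[OF subq_left_module W']
  let ?W = "{x \<in> N2. N1 +>\<^bsub>M\<^esub> x \<in> W'}"
  have "submodule ?W R M"
    unfolding submodule_iff
  proof (intro conjI ballI)
    fix x y assume "x \<in> ?W" "y \<in> ?W"
    then show "x \<oplus>\<^bsub>M\<^esub> y \<in> ?W"
      using f(3)[of "N1 +>\<^bsub>M\<^esub> x" "N1 +>\<^bsub>M\<^esub> y"] sm_add[OF N2] by (auto simp: coset_add)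
  next
    fix a x assume "a \<in> carrier R" "x \<in> ?W"
    then show "a \<odot>\<^bsub>M\<^esub> x \<in> ?W"
      using f(5)[of a "N1 +>\<^bsub>M\<^esub> x"] sm_smult[OF N2] by (auto simp: coset_smult coset_restrict)
  qed (use N2_carrier sm_zero[OF N2] f(2) in \<open>auto simp: coset_zero\<close>)
  moreover have "N1 \<subseteq> ?W"
  proof
    fix x assume "x \<in> N1"
    moreover from this have "N1 +>\<^bsub>M\<^esub> x = N1" using coset_eq_N1 le N2_carrier by auto
    ultimately show "x \<in> ?W" using f(2) le by auto
  qed
  ultimately have "?W = N1 \<or> ?W = N2" by (intro int) auto
  moreover have "W' = (\<lambda>x. N1 +>\<^bsub>M\<^esub> x) ` ?W"
    using f(1) by (auto simp: subq_carrier)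
  moreover have "(\<lambda>x. N1 +>\<^bsub>M\<^esub> x) ` N1 = {N1}"
    using coset_eq_N1 N2_carrier le sm_zero[OF N1] by auto
  ultimately show "W' = {\<zero>\<^bsub>subq N2 N1\<^esub>} \<or> W' = carrier (subq N2 N1)"
    by (auto simp: subq_carrier)
qed

text \<open>The homomorphism theorem for a target on which the ring acts by scalars. It trades
  cosets for a functional on \<open>N2\<close>, the form in which composition factors are recognised
  later.\<close>

lemma subq_iso_one_dim_iff:
  assumes S: "carrier S = UNIV" "add S = (+)" "smult S = (\<lambda>a z. ev a * z)"
  shows "module_iso R (subq N2 N1) (S :: ('a, complex, 'l) module_scheme) \<longleftrightarrow>
    (\<exists>\<chi>. (\<forall>x\<in>N2. \<forall>y\<in>N2. \<chi> (x \<oplus>\<^bsub>M\<^esub> y) = \<chi> x + \<chi> y) \<and> (\<forall>a\<in>carrier R. \<forall>x\<in>N2. \<chi> (a \<odot>\<^bsub>M\<^esub> x) = ev a * \<chi> x) \<and>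
      (\<forall>x\<in>N2. \<chi> x = 0 \<longleftrightarrow> x \<in> N1) \<and> \<chi> ` N2 = UNIV)"
proof
  assume "module_iso R (subq N2 N1) S"
  then obtain h where h: "bij_betw h ((\<lambda>x. N1 +>\<^bsub>M\<^esub> x) ` N2) UNIV"
    "\<And>x y. x \<in> N2 \<Longrightarrow> y \<in> N2 \<Longrightarrow> h (N1 +>\<^bsub>M\<^esub> (x \<oplus>\<^bsub>M\<^esub> y)) = h (N1 +>\<^bsub>M\<^esub> x) + h (N1 +>\<^bsub>M\<^esub> y)"
    "\<And>a x. a \<in> carrier R \<Longrightarrow> x \<in> N2 \<Longrightarrow> h (N1 +>\<^bsub>M\<^esub> (a \<odot>\<^bsub>M\<^esub> x)) = ev a * h (N1 +>\<^bsub>M\<^esub> x)"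
    unfolding module_iso_def using S
    by (auto simp: subq_carrier coset_add coset_restrict coset_smult)
  have h0: "h N1 = 0"
    using h(2)[OF sm_zero[OF N2] sm_zero[OF N2]] by (simp add: coset_zero)
  have "h (N1 +>\<^bsub>M\<^esub> x) = 0 \<longleftrightarrow> x \<in> N1" if x: "x \<in> N2" for x
  proof
    assume "h (N1 +>\<^bsub>M\<^esub> x) = 0"
    then have "h (N1 +>\<^bsub>M\<^esub> x) = h (N1 +>\<^bsub>M\<^esub> \<zero>\<^bsub>M\<^esub>)" by (simp add: coset_zero h0)
    then have "N1 +>\<^bsub>M\<^esub> x = N1 +>\<^bsub>M\<^esub> \<zero>\<^bsub>M\<^esub>"
      using h(1) x sm_zero[OF N2] by (auto simp: bij_betw_def dest: inj_onD)
    then show "x \<in> N1" using coset_eq_N1 x N2_carrier by (simp add: coset_zero)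
  next
    assume "x \<in> N1"
    then have "N1 +>\<^bsub>M\<^esub> x = N1" using coset_eq_N1 x N2_carrier by simp
    then show "h (N1 +>\<^bsub>M\<^esub> x) = 0" by (simp add: h0)
  qed
  moreover have "(\<lambda>x. h (N1 +>\<^bsub>M\<^esub> x)) ` N2 = UNIV"
    using h(1) by (simp add: bij_betw_def image_image)
  ultimately show "\<exists>\<chi>. (\<forall>x\<in>N2. \<forall>y\<in>N2. \<chi> (x \<oplus>\<^bsub>M\<^esub> y) = \<chi> x + \<chi> y) \<and> (\<forall>a\<in>carrier R. \<forall>x\<in>N2. \<chi> (a \<odot>\<^bsub>M\<^esub> x) = ev a * \<chi> x) \<and>
      (\<forall>x\<in>N2. \<chi> x = 0 \<longleftrightarrow> x \<in> N1) \<and> \<chi> ` N2 = UNIV"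
    using h by (intro exI[of _ "\<lambda>x. h (N1 +>\<^bsub>M\<^esub> x)"]) auto
next
  assume "\<exists>\<chi>. (\<forall>x\<in>N2. \<forall>y\<in>N2. \<chi> (x \<oplus>\<^bsub>M\<^esub> y) = \<chi> x + \<chi> y) \<and> (\<forall>a\<in>carrier R. \<forall>x\<in>N2. \<chi> (a \<odot>\<^bsub>M\<^esub> x) = ev a * \<chi> x) \<and>
      (\<forall>x\<in>N2. \<chi> x = 0 \<longleftrightarrow> x \<in> N1) \<and> \<chi> ` N2 = UNIV"
  then obtain \<chi> where chi: "\<And>x y. x \<in> N2 \<Longrightarrow> y \<in> N2 \<Longrightarrow> \<chi> (x \<oplus>\<^bsub>M\<^esub> y) = \<chi> x + \<chi> y"
    "\<And>a x. a \<in> carrier R \<Longrightarrow> x \<in> N2 \<Longrightarrow> \<chi> (a \<odot>\<^bsub>M\<^esub> x) = ev a * \<chi> x"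
    "\<And>x. x \<in> N2 \<Longrightarrow> \<chi> x = 0 \<longleftrightarrow> x \<in> N1" "\<chi> ` N2 = UNIV" by blast
  define h where "h X = \<chi> (SOME x. x \<in> N2 \<and> X = N1 +>\<^bsub>M\<^esub> x)" for X
  have eq: "\<chi> x = \<chi> y \<longleftrightarrow> N1 +>\<^bsub>M\<^esub> x = N1 +>\<^bsub>M\<^esub> y" if "x \<in> N2" "y \<in> N2" for x y
  proof -
    have "x = (x \<ominus>\<^bsub>M\<^esub> y) \<oplus>\<^bsub>M\<^esub> y" "x \<ominus>\<^bsub>M\<^esub> y \<in> N2"
      using that N2_carrier sm_add[OF N2] sm_minus[OF N2] by (auto simp: M.minus_eq M.a_assoc M.l_neg)
    then have "\<chi> x = \<chi> (x \<ominus>\<^bsub>M\<^esub> y) + \<chi> y" using chi(1) that by metis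
    then show ?thesis
      using chi(3)[OF \<open>x \<ominus>\<^bsub>M\<^esub> y \<in> N2\<close>] that N2_carrier by (subst coset_eq_iff) auto
  qed
  have h: "h (N1 +>\<^bsub>M\<^esub> x) = \<chi> x" if "x \<in> N2" for x
    unfolding h_def using someI[of "\<lambda>y. y \<in> N2 \<and> N1 +>\<^bsub>M\<^esub> x = N1 +>\<^bsub>M\<^esub> y" x] that
    by (subst eq) auto
  have "bij_betw h ((\<lambda>x. N1 +>\<^bsub>M\<^esub> x) ` N2) UNIV"
    unfolding bij_betw_def
  proof
    show "inj_on h ((\<lambda>x. N1 +>\<^bsub>M\<^esub> x) ` N2)"
      by (rule inj_onI) (auto simp: h eq)
    have "h ` (\<lambda>x. N1 +>\<^bsub>M\<^esub> x) ` N2 = \<chi> ` N2"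
      by (auto simp: image_image h)
    then show "h ` (\<lambda>x. N1 +>\<^bsub>M\<^esub> x) ` N2 = UNIV" using chi(4) by simp
  qed
  then show "module_iso R (subq N2 N1) S"
    unfolding module_iso_def using S
    by (intro exI[of _ h])
       (auto simp: subq_carrier coset_add coset_restrict coset_smult h chi sm_add[OF N2] sm_smult[OF N2])
qed

end

end

subsection \<open>Modules over the algebra as modules over the free algebra\<close>

definition ak_class :: "nat \<Rightarrow> nat \<Rightarrow> (nat \<Rightarrow> complex) \<Rightarrow> ak_gen ncpoly \<Rightarrow> ak_gen ncpoly set" where
  "ak_class n r u f = ak_ideal n r u +>\<^bsub>free_algebra (ak_gens n)\<^esub> f"

lemma ak_class_alt: "ak_class n r u f = {x + f | x. x \<in> ak_ideal n r u}"
  by (auto simp: ak_class_def a_r_coset_def')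

lemma ak_algebra_simps:
  shows ak_carrier: "carrier (ak_algebra n r u) = ak_class n r u ` AF n"
    and ak_one: "\<one>\<^bsub>ak_algebra n r u\<^esub> = ak_class n r u 1"
    and ak_zero: "\<zero>\<^bsub>ak_algebra n r u\<^esub> = ak_class n r u 0"
    and ak_add: "f \<in> AF n \<Longrightarrow> g \<in> AF n \<Longrightarrow> ak_class n r u f \<oplus>\<^bsub>ak_algebra n r u\<^esub> ak_class n r u g = ak_class n r u (f + g)"
    and ak_mult: "f \<in> AF n \<Longrightarrow> g \<in> AF n \<Longrightarrow> ak_class n r u f \<otimes>\<^bsub>ak_algebra n r u\<^esub> ak_class n r u g = ak_class n r u (f * g)"
proof -
  note h = ideal.rcos_ring_hom[OF ak_ideal_ideal, of n r u]
  note ak = ak_algebra_def[of n r u, folded ak_ideal_def]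
  show "carrier (ak_algebra n r u) = ak_class n r u ` AF n"
    by (auto simp: ak FactRing_def A_RCOSETS_def' ak_class_def)
  show "\<one>\<^bsub>ak_algebra n r u\<^esub> = ak_class n r u 1"
    using ring_hom_one[OF h] by (simp add: ak ak_class_def)
  show "\<zero>\<^bsub>ak_algebra n r u\<^esub> = ak_class n r u 0"
    by (simp add: ak FactRing_def ak_class_alt)
  show "f \<in> AF n \<Longrightarrow> g \<in> AF n \<Longrightarrow> ak_class n r u f \<oplus>\<^bsub>ak_algebra n r u\<^esub> ak_class n r u g = ak_class n r u (f + g)"
    using ring_hom_add[OF h, of f g] by (simp add: ak ak_class_def)
  show "f \<in> AF n \<Longrightarrow> g \<in> AF n \<Longrightarrow> ak_class n r u f \<otimes>\<^bsub>ak_algebra n r u\<^esub> ak_class n r u g = ak_class n r u (f * g)"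
    using ring_hom_mult[OF h, of f g] by (simp add: ak ak_class_def)
qed

lemma ak_class_eq_iff:
  "ak_class n r u f = ak_class n r u g \<longleftrightarrow> f - g \<in> ak_ideal n r u"
proof
  assume "ak_class n r u f = ak_class n r u g"
  moreover have "0 + f \<in> ak_class n r u f"
    unfolding ak_class_alt using ak_ideal_zero by blast
  ultimately obtain x where "f = x + g" "x \<in> ak_ideal n r u" by (auto simp: ak_class_alt)
  then show "f - g \<in> ak_ideal n r u" by simp
next
  assume fg: "f - g \<in> ak_ideal n r u"
  have 1: "x + f = (x + (f - g)) + g" "x + g = (x - (f - g)) + f" for x by simp_all
  show "ak_class n r u f = ak_class n r u g"
    unfolding ak_class_alt using ak_ideal_add[OF _ fg] ak_ideal_diff[OF _ fg] 1 by blast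
qed

lemma the_elem_ak_class:
  assumes "\<And>f. f \<in> ak_ideal n r u \<Longrightarrow> eval_character \<chi> f = 0"
  shows "the_elem (eval_character \<chi> ` ak_class n r u f) = eval_character \<chi> f"
proof -
  have "eval_character \<chi> ` ak_class n r u f = {eval_character \<chi> f}"
    using assms ak_ideal_zero[of n r u] by (auto simp: ak_class_alt intro!: image_eqI[of _ _ f] exI[of _ 0])
  then show ?thesis by simp
qed

locale ak_mod =
  fixes n r :: nat and u :: "nat \<Rightarrow> complex" and P :: "(ak_gen ncpoly set, 'p) module"
  assumes P_mod: "left_module (ak_algebra n r u) P"
begin

sublocale P: left_module "ak_algebra n r u" P
  by (rule P_mod)

abbreviation A :: "ak_gen ncpoly set ring" where
  "A \<equiv> ak_algebra n r u"

definition act :: "ak_gen ncpoly \<Rightarrow> 'p \<Rightarrow> 'p" where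
  "act f p = ak_class n r u f \<odot>\<^bsub>P\<^esub> p"

lemma act_closed: "f \<in> AF n \<Longrightarrow> p \<in> carrier P \<Longrightarrow> act f p \<in> carrier P"
  unfolding act_def by (rule P.smult_closed) (auto simp: ak_carrier)

lemma act_add: "f \<in> AF n \<Longrightarrow> g \<in> AF n \<Longrightarrow> p \<in> carrier P \<Longrightarrow> act (f + g) p = act f p \<oplus>\<^bsub>P\<^esub> act g p"
  unfolding act_def by (subst P.smult_l_distr[symmetric]) (auto simp: ak_carrier ak_add)

lemma act_mult: "f \<in> AF n \<Longrightarrow> g \<in> AF n \<Longrightarrow> p \<in> carrier P \<Longrightarrow> act (f * g) p = act f (act g p)"
  unfolding act_def by (subst P.smult_assoc[symmetric]) (auto simp: ak_carrier ak_mult)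

lemma act_one: "p \<in> carrier P \<Longrightarrow> act 1 p = p"
  unfolding act_def using P.smult_one[of p] by (simp add: ak_one)

lemma act_radd: "f \<in> AF n \<Longrightarrow> p \<in> carrier P \<Longrightarrow> q \<in> carrier P \<Longrightarrow> act f (p \<oplus>\<^bsub>P\<^esub> q) = act f p \<oplus>\<^bsub>P\<^esub> act f q"
  unfolding act_def by (rule P.smult_r_distr) (auto simp: ak_carrier)

lemma act_zero: "p \<in> carrier P \<Longrightarrow> act 0 p = \<zero>\<^bsub>P\<^esub>"
  using act_add[OF FA_zero FA_zero, of p] act_closed[OF FA_zero, of p] by simp

lemma act_rzero: "f \<in> AF n \<Longrightarrow> act f \<zero>\<^bsub>P\<^esub> = \<zero>\<^bsub>P\<^esub>"
  using act_radd[of f "\<zero>\<^bsub>P\<^esub>" "\<zero>\<^bsub>P\<^esub>"] act_closed[of f "\<zero>\<^bsub>P\<^esub>"] by simp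

lemma act_uminus: "f \<in> AF n \<Longrightarrow> p \<in> carrier P \<Longrightarrow> act (- f) p = \<ominus>\<^bsub>P\<^esub> act f p"
  using act_add[of "- f" f p] act_closed
  by (intro P.M.minus_equality[symmetric]) (auto simp: act_zero FA_uminus)

lemma act_diff: "f \<in> AF n \<Longrightarrow> g \<in> AF n \<Longrightarrow> p \<in> carrier P \<Longrightarrow> act (f - g) p = act f p \<ominus>\<^bsub>P\<^esub> act g p"
  using act_add[of f "- g" p] by (simp add: FA_uminus act_uminus P.M.minus_eq)

lemma act_cong: "f - g \<in> ak_ideal n r u \<Longrightarrow> act f p = act g p"
  unfolding act_def using ak_class_eq_iff by metis

lemma act_ideal: "f \<in> ak_ideal n r u \<Longrightarrow> p \<in> carrier P \<Longrightarrow> act f p = \<zero>\<^bsub>P\<^esub>"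
  using act_cong[of f 0 p] act_zero by simp

lemma submodule_act_iff:
  "submodule N A P \<longleftrightarrow> N \<subseteq> carrier P \<and> \<zero>\<^bsub>P\<^esub> \<in> N \<and> (\<forall>x\<in>N. \<forall>y\<in>N. x \<oplus>\<^bsub>P\<^esub> y \<in> N) \<and>
     (\<forall>f\<in>AF n. \<forall>x\<in>N. act f x \<in> N)"
  unfolding P.submodule_iff by (simp add: ak_carrier act_def)

lemma eq_of_diff: "x \<in> carrier P \<Longrightarrow> y \<in> carrier P \<Longrightarrow> x \<ominus>\<^bsub>P\<^esub> y = \<zero>\<^bsub>P\<^esub> \<Longrightarrow> x = y"
  by (metis P.M.add.inv_closed P.M.add.inv_equality P.M.add.inv_inv a_inv_def P.M.minus_eq)

lemma carrier_submodule: "submodule (carrier P) A P"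
  by (auto simp: submodule_act_iff act_closed)

lemma zero_submodule: "submodule {\<zero>\<^bsub>P\<^esub>} A P"
  by (auto simp: submodule_act_iff act_rzero)

lemma subq_iso_simple_iff:
  assumes N: "submodule N1 A P" "submodule N2 A P" "N1 \<subseteq> N2"
    and ev: "\<And>f. f \<in> AF n \<Longrightarrow> the_elem (eval_character (simple_character u C) ` ak_class n r u f) = ev f"
  shows "module_iso A (quot_module (P\<lparr>carrier := N2\<rparr>) N1) (simple_ak_module u C) \<longleftrightarrow>
    (\<exists>\<chi>. (\<forall>x\<in>N2. \<forall>y\<in>N2. \<chi> (x \<oplus>\<^bsub>P\<^esub> y) = \<chi> x + \<chi> y) \<and> (\<forall>f\<in>AF n. \<forall>x\<in>N2. \<chi> (act f x) = ev f * \<chi> x) \<and>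
      (\<forall>x\<in>N2. \<chi> x = 0 \<longleftrightarrow> x \<in> N1) \<and> \<chi> ` N2 = UNIV)"
proof -
  have S: "carrier (simple_ak_module u C) = UNIV" "add (simple_ak_module u C) = (+)"
    "smult (simple_ak_module u C) = (\<lambda>X z. the_elem (eval_character (simple_character u C) ` X) * z)"
    by (simp_all add: simple_ak_module_def)
  show ?thesis
    unfolding P.subq_iso_one_dim_iff[OF N S] by (simp add: ak_carrier act_def ev)
qed

end

subsection \<open>Idempotents attached to characters\<close>

lemma commutes_mod_ideal_prod_list:
  assumes x: "x \<in> AF n" and "\<And>y. y \<in> set ys \<Longrightarrow> y \<in> AF n \<and> x * y - y * x \<in> ak_ideal n r u"
  shows "x * prod_list ys - prod_list ys * x \<in> ak_ideal n r u"
  using assms(2)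
proof (induction ys)
  case (Cons y ys)
  have F: "prod_list ys \<in> AF n" using Cons.prems by (intro FA_prod_list) auto
  have "(x * y - y * x) * prod_list ys + y * (x * prod_list ys - prod_list ys * x) \<in> ak_ideal n r u"
    using Cons F by (intro ak_ideal_add ak_ideal_mult) auto
  then show ?case by (simp add: algebra_simps)
qed (simp add: ak_ideal_zero)

lemma xi_commutes_lagrange:
  assumes "j \<in> {1..n}" "k \<in> {1..n}"
  shows "XX j * lagrange r u a (XX k) - lagrange r u a (XX k) * XX j \<in> ak_ideal n r u"
  unfolding lagrange_def
proof (rule commutes_mod_ideal_prod_list)
  fix y assume "y \<in> set (map (\<lambda>l. scal (1 / (u a - u l)) * (XX k - scal (u l))) (filter (\<lambda>l. l \<noteq> a) [1..<Suc r]))"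
  then obtain b h where y: "y = scal b * (XX k - scal h)" by auto
  have "XX j * XX k - XX k * XX j \<in> ak_ideal n r u"
    using ak_relations_ideal ak_relation_xi_comm[OF assms] by blast
  then have "scal b * (XX j * XX k - XX k * XX j) \<in> ak_ideal n r u"
    by (rule ak_ideal_mult) (rule FA_scal)
  moreover have "XX j * y - y * XX j = scal b * (XX j * XX k - XX k * XX j)"
    unfolding y by (simp add: algebra_simps gen_scal) (simp add: scal_comm[of "gen _"])
  ultimately show "y \<in> AF n \<and> XX j * y - y * XX j \<in> ak_ideal n r u"
    using assms unfolding y by (auto intro!: FA_intros)
qed (use assms in \<open>auto intro: FA_gen\<close>)

lemma prod_list_split_commuting:
  fixes x :: "'a :: monoid_mult"
  assumes "k \<in> set ls" "distinct ls" "\<And>l. f k * f l = f l * f k"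
  shows "prod_list (map f ls) = f k * prod_list (map f (filter (\<lambda>l. l \<noteq> k) ls))"
  using assms(1,2)
proof (induction ls)
  case (Cons l ls)
  show ?case
  proof (cases "l = k")
    case True
    then have "filter (\<lambda>l. l \<noteq> k) ls = ls" using Cons.prems by (auto simp: filter_id_conv)
    with True show ?thesis by simp
  next
    case False
    with Cons have "prod_list (map f ls) = f k * prod_list (map f (filter (\<lambda>l. l \<noteq> k) ls))" by auto
    with False show ?thesis by (simp add: mult.assoc[symmetric] assms(3))
  qed
qed simp

text \<open>Up to a scalar the product is the whole characteristic polynomial of the generator,
  which is a defining relation.\<close>

lemma xi_times_lagrange:
  assumes "j \<in> {1..n}" "k \<in> {1..r}"
  shows "(XX j - scal (u k)) * lagrange r u k (XX j) \<in> ak_ideal n r u"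
proof -
  let ?f = "\<lambda>l. XX j - scal (u l)"
  have scal_out: "prod_list (map (\<lambda>l. scal (h l) * ?f l) ls) = scal (prod_list (map h ls)) * prod_list (map ?f ls)"
    for h ls
    by (induction ls) (simp_all add: scal_mult mult.assoc scal_left_comm[of "XX j - _"])
  let ?c = "prod_list (map (\<lambda>l. 1 / (u k - u l)) (filter (\<lambda>l. l \<noteq> k) [1..<Suc r]))"
  have "prod_list (map ?f [1..<Suc r]) = ?f k * prod_list (map ?f (filter (\<lambda>l. l \<noteq> k) [1..<Suc r]))"
  proof (rule prod_list_split_commuting)
    show "?f k * ?f l = ?f l * ?f k" for l
      by (simp add: left_diff_distrib right_diff_distrib scal_comm[of "gen _"])
         (simp add: scal_mult[symmetric] mult.commute)
  qed (use assms in auto)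
  then have "(XX j - scal (u k)) * lagrange r u k (XX j) = scal ?c * prod_list (map ?f [1..<Suc r])"
    unfolding lagrange_def scal_out by (simp add: scal_left_comm[of "XX j - _"] del: upt_Suc)
  moreover have "scal ?c * prod_list (map ?f [1..<Suc r]) \<in> ak_ideal n r u"
    using ak_relation_charpoly[OF assms(1)] ak_relations_ideal by (intro ak_ideal_mult FA_scal) blast
  ultimately show ?thesis by simp
qed

context ak_word
begin

text \<open>The projector to weight \<open>c\<close>, composed of the Lagrange idempotents of the
  single \<xi>.\<close>

definition iota :: "ak_gen ncpoly" where
  "iota = prod_list (map (\<lambda>k. lagrange r u (c k) (XX k)) [1..<Suc n])"

lemma FA_iota: "iota \<in> AF n"
  unfolding iota_def by (intro FA_prod_list) (auto intro!: FA_lagrange FA_gen)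

text \<open>Modulo the ideal the generator commutes up to its own Lagrange factor, and there
  \<open>xi_times_lagrange\<close> applies.\<close>

lemma xi_iota:
  assumes j: "j \<in> {1..n}"
  shows "(XX j - scal (u (c j))) * iota \<in> ak_ideal n r u"
proof -
  let ?lg = "\<lambda>k. lagrange r u (c k) (XX k)"
  have "j \<in> set [1..<Suc n]" using j by auto
  then obtain xs ys where xs: "[1..<Suc n] = xs @ j # ys" by (meson split_list)
  have "set xs \<union> set ys \<subseteq> set [1..<Suc n]"
    unfolding xs by auto
  then have sub: "1 \<le> k \<and> k \<le> n" if "k \<in> set xs \<or> k \<in> set ys" for k
    using that by (auto simp del: upt_Suc)
  let ?A = "prod_list (map ?lg xs)" and ?B = "prod_list (map ?lg ys)"
  have F: "?A \<in> AF n" "?B \<in> AF n" "?lg j \<in> AF n"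
    using sub j by (auto intro!: FA_prod_list FA_lagrange FA_gen)
  have "XX j * ?A - ?A * XX j \<in> ak_ideal n r u"
    using sub j xi_commutes_lagrange[OF j]
    by (intro commutes_mod_ideal_prod_list) (auto intro!: FA_lagrange FA_gen)
  then have "(XX j * ?A - ?A * XX j) * (?lg j * ?B) + ?A * ((XX j - scal (u (c j))) * ?lg j) * ?B \<in> ak_ideal n r u"
    using F j c_range[OF j] by (intro ak_ideal_add ak_ideal_mult FA_mult xi_times_lagrange)
  moreover have "(XX j - scal (u (c j))) * iota =
      (XX j * ?A - ?A * XX j) * (?lg j * ?B) + ?A * ((XX j - scal (u (c j))) * ?lg j) * ?B"
    unfolding iota_def xs by (simp add: algebra_simps scal_left_comm[of ?A])
  ultimately show ?thesis by simp
qed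

lemma rho_iota: "L.rho iota v0 = v0"
proof
  fix \<sigma>
  show "L.rho iota v0 \<sigma> = v0 \<sigma>"
  proof (cases "\<sigma> permutes {1..n}")
    case True
    have "L.rho (prod_list (map (\<lambda>k. lagrange r u (c k) (XX k)) ks)) v0 \<sigma> =
        (if \<forall>k\<in>set ks. c (\<sigma> k) = c k then v0 \<sigma> else 0)" if "set ks \<subseteq> {1..n}" for ks
      using that
    proof (induction ks)
      case (Cons k ks)
      then show ?case
        using rho_lagrange[OF True, of k "c k"] c_range[of k] by (simp add: L.rho_mult)
    qed (simp add: L.rho_one)
    from this[of "[1..<Suc n]"]
    have "L.rho iota v0 \<sigma> = (if \<forall>k\<in>{1..n}. c (\<sigma> k) = c k then v0 \<sigma> else 0)"
      by (simp add: iota_def subset_iff atLeastLessThanSuc_atLeastAtMost del: upt_Suc)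
    then show ?thesis by (auto simp: v0_def delta_def)
  next
    case False
    then show ?thesis using V_D[OF L.rho_V[OF FA_iota v0_V]] V_D[OF v0_V] by simp
  qed
qed

definition dmatch :: "(nat \<Rightarrow> nat) \<Rightarrow> bool" where
  "dmatch d \<longleftrightarrow> (\<forall>j\<in>{1..n}. d j = c j)"

lemma eval_iota:
  assumes "\<And>j. j \<in> {1..n} \<Longrightarrow> d j \<in> {1..r}"
  shows "eval_character (gchar u d E) iota = (if dmatch d then 1 else 0)"
proof -
  have "prod_list (map (\<lambda>k. eval_character (gchar u d E) (lagrange r u (c k) (XX k))) ks) =
      (if \<forall>j\<in>set ks. d j = c j then 1 else 0)" if "set ks \<subseteq> {1..n}" for ks
    using that
  proof (induction ks)
    case (Cons k ks)
    then show ?case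
      using eval_character_lagrange[OF u_inj assms[of k] c_range[of k], of "gchar u d E" "XX k"] by auto
  qed simp
  from this[of "[1..<Suc n]"] show ?thesis
    unfolding iota_def eval_character_prod_list map_map comp_def dmatch_def
    by (simp add: subset_iff atLeastLessThanSuc_atLeastAtMost del: upt_Suc)
qed

definition rchar :: "nat set \<Rightarrow> nat \<Rightarrow> complex" where
  "rchar E i = (if i \<in> E then - 1 else 0)"

text \<open>At the identity, exchanging values and exchanging places coincide. This is the bridge
  from the right action to the left one.\<close>

lemma Rgop_v0:
  assumes "x \<in> Req"
  shows "R.gop x v0 = L.gop (GenT x) v0"
proof
  fix \<sigma>
  have x: "1 \<le> x" "x < n" "c x = c (Suc x)" using assms by (auto simp: Req_def)
  have 1: "ts x \<circ> \<sigma> = id \<longleftrightarrow> \<sigma> = ts x" "\<sigma> \<circ> ts x = id \<longleftrightarrow> \<sigma> = ts x"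
    by (metis comp_id id_comp transpose_comp_involutory comp_assoc)+
  have 2: "pinv id (Suc x) = Suc x" "pinv id x = x" by (simp_all add: inv_id)
  have 3: "pinv (ts x) (Suc x) = x" "pinv (ts x) x = Suc x" by simp_all
  show "R.gop x v0 \<sigma> = L.gop (GenT x) v0 \<sigma>"
  proof (cases "\<sigma> = id \<or> \<sigma> = ts x")
    case True
    then show ?thesis
    proof
      assume "\<sigma> = id"
      then show ?thesis using x 2 by (simp add: Rgop Lgop_T v0_def delta_def)
    next
      assume "\<sigma> = ts x"
      moreover have "ts x \<noteq> id" by (metis id_apply n_not_Suc_n transpose_apply_first)
      ultimately show ?thesis using x 3 1 by (simp add: Rgop Lgop_T v0_def delta_def)
    qed
  next
    case False
    then show ?thesis using 1 by (auto simp: Rgop Lgop_T v0_def delta_def)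
  qed
qed

text \<open>Right operators commute with left ones, so a right word acts on \<open>v0\<close> like
  the reversed left word: a new letter is multiplied to \<open>f\<close> from the right. Starting
  from \<open>iota\<close> instead of 1 makes the polynomial vanish under all characters with
  another color word.\<close>

lemma left_of_right:
  assumes "h \<in> FA Req"
  shows "\<exists>f\<in>AF n. R.rho h v0 = L.rho f v0 \<and> (\<forall>d E. (\<forall>j\<in>{1..n}. d j \<in> {1..r}) \<longrightarrow>
    eval_character (gchar u d E) f = (if dmatch d then eval_character (rchar E) h else 0))"
  using assms
proof (induction h rule: FA_induct)
  case one
  show ?case
    using FA_iota rho_iota eval_iota by (intro bexI[of _ iota]) (auto simp: R.rho_one')
next
  case (add h h')
  then obtain f f' where *: "f \<in> AF n" "R.rho h v0 = L.rho f v0" "f' \<in> AF n" "R.rho h' v0 = L.rho f' v0"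
    "\<And>d E. (\<forall>j\<in>{1..n}. d j \<in> {1..r}) \<Longrightarrow>
      eval_character (gchar u d E) f = (if dmatch d then eval_character (rchar E) h else 0)"
    "\<And>d E. (\<forall>j\<in>{1..n}. d j \<in> {1..r}) \<Longrightarrow>
      eval_character (gchar u d E) f' = (if dmatch d then eval_character (rchar E) h' else 0)"
    by blast
  show ?case
    by (rule bexI[of _ "f + f'"]) (use * in \<open>auto simp: R.rho_add[abs_def] L.rho_add[abs_def] FA_add\<close>)
next
  case (scal a h)
  then obtain f where *: "f \<in> AF n" "R.rho h v0 = L.rho f v0"
    "\<And>d E. (\<forall>j\<in>{1..n}. d j \<in> {1..r}) \<Longrightarrow>
      eval_character (gchar u d E) f = (if dmatch d then eval_character (rchar E) h else 0)"
    by blast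
  show ?case
    by (rule bexI[of _ "scal a * f"])
       (use * in \<open>auto simp: R.rho_mult L.rho_mult R.rho_scal[abs_def] L.rho_scal[abs_def] intro!: FA_intros\<close>)
next
  case (gen x h)
  then obtain f where *: "f \<in> AF n" "R.rho h v0 = L.rho f v0"
    "\<And>d E. (\<forall>j\<in>{1..n}. d j \<in> {1..r}) \<Longrightarrow>
      eval_character (gchar u d E) f = (if dmatch d then eval_character (rchar E) h else 0)"
    by blast
  have x: "GenT x \<in> ak_gens n" "gen x \<in> FA Req" "x \<in> {1..n}" "Suc x \<in> {1..n}" "c x = c (Suc x)"
    using gen.hyps(1) by (auto simp: Req_def intro: FA_gen)
  have "R.rho (gen x * h) v0 = L.rho f (R.rho (gen x) v0)"
    using rho_commute[OF *(1) x(2) v0_V] by (simp add: R.rho_mult *)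
  also have "\<dots> = L.rho (f * TT x) v0"
    using Rgop_v0[OF gen.hyps(1)] by (simp add: L.rho_mult L.rho_gen[abs_def] R.rho_gen[abs_def])
  finally show ?case
    using * x by (intro bexI[of _ "f * TT x"]) (auto simp: dmatch_def rchar_def intro!: FA_intros)
qed

text \<open>The character values single out the set \<open>E\<close> among the positions of equal
  colors. The factors need not commute, so the product need not be idempotent; \<open>eR\<close>
  repairs this without changing the values.\<close>

definition aR :: "nat set \<Rightarrow> nat ncpoly" where
  "aR E = prod_list (map (\<lambda>i. if i \<in> E then - gen i else 1 + gen i) (filter (\<lambda>i. c i = c (Suc i)) [1..<n]))"

definition eR :: "nat set \<Rightarrow> nat ncpoly" where
  "eR E = idem_poly height (aR E)"

lemma FA_aR: "aR E \<in> FA Req"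
  unfolding aR_def by (intro FA_prod_list) (auto simp: Req_def intro!: FA_intros)

lemma FA_eR: "eR E \<in> FA Req"
  unfolding eR_def by (intro FA_idem_poly FA_aR)

lemma eval_aR:
  assumes "\<And>i. i \<in> Req \<Longrightarrow> \<chi> i = (if Q i then - 1 else 0)"
  shows "eval_character \<chi> (aR E) = (if \<forall>i\<in>Req. Q i \<longleftrightarrow> i \<in> E then 1 else 0)"
proof -
  have p: "prod_list (map (\<lambda>i. eval_character \<chi> (if i \<in> E then - gen i else 1 + gen i)) is) =
      (if \<forall>i\<in>set is. Q i \<longleftrightarrow> i \<in> E then 1 else 0)" if "set is \<subseteq> Req" for "is"
    using that assms by (induction "is") auto
  have s: "set (filter (\<lambda>i. c i = c (Suc i)) [1..<n]) = Req"
    by (auto simp: Req_def)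
  show ?thesis
    unfolding aR_def eval_character_prod_list map_map comp_def
    using p[of "filter (\<lambda>i. c i = c (Suc i)) [1..<n]"] unfolding s by simp
qed

lemma eval_eR:
  assumes "\<And>i. i \<in> Req \<Longrightarrow> \<chi> i = (if Q i then - 1 else 0)"
  shows "eval_character \<chi> (eR E) = (if \<forall>i\<in>Req. Q i \<longleftrightarrow> i \<in> E then 1 else 0)"
  unfolding eR_def
  using eval_character_idem_poly[OF _ L.height_pos, of \<chi> "aR E"] eval_aR[OF assms, where E = E] by auto

lemma eval_eR_rdg:
  "eval_character (\<lambda>g. rdg g \<sigma>) (eR E) = (if \<forall>i\<in>Req. pinv \<sigma> (Suc i) < pinv \<sigma> i \<longleftrightarrow> i \<in> E then 1 else 0)"
  by (rule eval_eR) (simp add: rdg_def)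

lemma eR_idem: "v \<in> V \<Longrightarrow> R.rho (eR E) (R.rho (eR E) v) = R.rho (eR E) v"
  unfolding eR_def
proof (rule R.rho_idem_poly[OF FA_aR])
  fix \<sigma>
  show "eval_character (\<lambda>g. rdg g \<sigma>) (aR E) \<in> {0, 1}"
    by (subst eval_aR[where Q = "\<lambda>i. pinv \<sigma> (Suc i) < pinv \<sigma> i"]) (auto simp: rdg_def)
qed

text \<open>Used twice: for the word \<open>c\<close> it describes the generator of the summand from
  the left, and for the word of the other ribbon it supplies the polynomial that detects a
  composition factor.\<close>

lemma ex_character_idempotent:
  "\<exists>f\<in>AF n. R.rho (eR E) v0 = L.rho f v0 \<and> (\<forall>d E'. (\<forall>j\<in>{1..n}. d j \<in> {1..r}) \<longrightarrow>
    eval_character (gchar u d E') f = (if dmatch d \<and> (\<forall>i\<in>Req. i \<in> E' \<longleftrightarrow> i \<in> E) then 1 else 0))"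
proof -
  have "eval_character (rchar E') (eR E) = (if \<forall>i\<in>Req. i \<in> E' \<longleftrightarrow> i \<in> E then 1 else 0)" for E'
    by (rule eval_eR) (simp add: rchar_def)
  then show ?thesis using left_of_right[OF FA_eR[of E]]
    by (elim bexE, intro bexI) (auto split: if_splits)
qed

text \<open>The diagonal entries of the weight module are character values, so an element in the
  kernel of all characters acts strictly triangularly.\<close>

lemma rho_nilpotent_characters:
  assumes "z \<in> AF n" "\<And>d E. (\<And>j. j \<in> {1..n} \<Longrightarrow> d j \<in> {1..r}) \<Longrightarrow> eval_character (gchar u d E) z = 0" "v \<in> V"
  shows "L.rho (z ^ height) v = (\<lambda>_. 0)"
proof (rule L.rho_nilpotent[OF assms(1) _ assms(3)])
  fix \<sigma> assume "\<sigma> \<in> BB"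
  then show "eval_character (\<lambda>g. ldg g \<sigma>) z = 0"
    unfolding ldg_def using color_range by (intro assms(2)) auto
qed

end

subsection \<open>Indecomposable projective modules\<close>

lemma free_module_simps [simp]:
  "\<zero>\<^bsub>free_module R X\<^esub> = (\<lambda>x. \<zero>\<^bsub>R\<^esub>)"
  "f \<oplus>\<^bsub>free_module R X\<^esub> g = (\<lambda>x. f x \<oplus>\<^bsub>R\<^esub> g x)"
  "a \<odot>\<^bsub>free_module R X\<^esub> f = (\<lambda>x. a \<otimes>\<^bsub>R\<^esub> f x)"
  by (simp_all add: free_module_def)

lemma free_module_carrier:
  "f \<in> carrier (free_module R X) \<longleftrightarrow> (\<forall>x\<in>X. f x \<in> carrier R) \<and> (\<forall>x. x \<notin> X \<longrightarrow> f x = \<zero>\<^bsub>R\<^esub>) \<and>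
     finite {x. f x \<noteq> \<zero>\<^bsub>R\<^esub>}"
  by (simp add: free_module_def)

lemma (in ring) free_module_closed:
  assumes "f \<in> carrier (free_module R X)" shows "f x \<in> carrier R"
  using assms by (cases "x \<in> X") (auto simp: free_module_carrier)

lemma (in ring) free_module_left_module: "left_module R (free_module R X)"
proof (intro left_module.intro left_module_axioms.intro)
  show "ring R" by (rule ring_axioms)
  have fin: "finite {x. F x \<noteq> \<zero>}" if "\<And>x. f x = \<zero> \<Longrightarrow> g x = \<zero> \<Longrightarrow> F x = \<zero>"
    "f \<in> carrier (free_module R X)" "g \<in> carrier (free_module R X)" for f g F
    by (rule finite_subset[of _ "{x. f x \<noteq> \<zero>} \<union> {x. g x \<noteq> \<zero>}"])
       (use that in \<open>auto simp: free_module_carrier\<close>)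
  show "abelian_group (free_module R X)"
  proof (rule abelian_groupI)
    fix f g assume *: "f \<in> carrier (free_module R X)" "g \<in> carrier (free_module R X)"
    have "finite {x. f x \<oplus> g x \<noteq> \<zero>}" by (rule fin[OF _ *]) auto
    then show "f \<oplus>\<^bsub>free_module R X\<^esub> g \<in> carrier (free_module R X)"
      using * by (auto simp: free_module_carrier)
  next
    fix f assume *: "f \<in> carrier (free_module R X)"
    have "finite {x. \<ominus> f x \<noteq> \<zero>}" by (rule fin[OF _ * *]) auto
    then have "(\<lambda>x. \<ominus> f x) \<in> carrier (free_module R X)"
      using * by (auto simp: free_module_carrier)
    then show "\<exists>g\<in>carrier (free_module R X). g \<oplus>\<^bsub>free_module R X\<^esub> f = \<zero>\<^bsub>free_module R X\<^esub>"
      using free_module_closed[OF *] by (intro bexI[of _ "\<lambda>x. \<ominus> f x"]) (auto simp: l_neg)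
  qed (auto simp: free_module_closed a_ac free_module_carrier[of "\<lambda>_. \<zero>"])
  fix a f assume *: "a \<in> carrier R" "f \<in> carrier (free_module R X)"
  have "finite {x. a \<otimes> f x \<noteq> \<zero>}" by (rule fin[OF _ *(2) *(2)]) (use * in auto)
  then show "a \<odot>\<^bsub>free_module R X\<^esub> f \<in> carrier (free_module R X)"
    using * by (auto simp: free_module_carrier)
qed (auto simp: free_module_closed l_distr r_distr m_assoc)

text \<open>The simple top enters through \<chi>, in the application the projection of
  \<open>P\<close> to its simple quotient followed by an identification of that quotient with the
  complex numbers.\<close>

locale ak_proj = ak_word n r u c + ak_mod n r u P
  for n r u c and P :: "(ak_gen ncpoly set, 'p) module" +
  fixes E :: "nat set" and \<chi> :: "'p \<Rightarrow> complex"
  assumes proj: "projective (ak_algebra n r u) P" and indec: "indecomposable (ak_algebra n r u) P"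
    and chi_add: "x \<in> carrier P \<Longrightarrow> y \<in> carrier P \<Longrightarrow> \<chi> (x \<oplus>\<^bsub>P\<^esub> y) = \<chi> x + \<chi> y"
    and chi_act: "f \<in> AF n \<Longrightarrow> x \<in> carrier P \<Longrightarrow> \<chi> (act f x) = eval_character (gchar u c E) f * \<chi> x"
    and chi_nz: "\<exists>x\<in>carrier P. \<chi> x \<noteq> 0"
begin

abbreviation XK :: "ak_gen ncpoly \<Rightarrow> complex" where
  "XK \<equiv> eval_character (gchar u c E)"

text \<open>The character (c, E) as a functional on \<open>V\<close>. Its kernel satisfies
  \<open>lid\<close>, so it factors through f \<mapsto> \<open>L.rho f v0\<close>, and
  \<open>Th\<close> supplies a preimage.\<close>

definition zeta :: "((nat \<Rightarrow> nat) \<Rightarrow> complex) \<Rightarrow> complex" where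
  "zeta v = XK (Th v)"

definition q :: "(nat \<Rightarrow> nat) \<Rightarrow> complex" where
  "q = R.rho (eR E) v0"

text \<open>The model of the projective cover, a left module because the right action commutes with
  the left one.\<close>

definition Q :: "((nat \<Rightarrow> nat) \<Rightarrow> complex) set" where
  "Q = R.rho (eR E) ` V"

lemma zeta_rho: "f \<in> AF n \<Longrightarrow> zeta (L.rho f v0) = XK f"
proof -
  assume f: "f \<in> AF n"
  have "lid {f \<in> AF n. XK f = 0}"
    unfolding lid_def using gchar_kills_ideal[OF u_inj c_range, where E = E] ak_ideal_FA
    by (auto intro!: FA_intros)
  then interpret ak_word_lid n r u c "{f \<in> AF n. XK f = 0}"
    by unfold_locales
  show ?thesis using cg_Th[OF f] by (simp add: cg_def zeta_def)
qed

lemma zeta_mult: "f \<in> AF n \<Longrightarrow> v \<in> V \<Longrightarrow> zeta (L.rho f v) = XK f * zeta v"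
  using zeta_rho[of "f * Th v"] zeta_rho[OF FA_Th, of v] rho_Th[of v]
  by (simp add: FA_mult FA_Th L.rho_mult)

lemma q_V: "q \<in> V"
  unfolding q_def by (intro R.rho_V FA_eR v0_V)

lemma Q_V: "v \<in> Q \<Longrightarrow> v \<in> V"
  unfolding Q_def using R.rho_V[OF FA_eR] by auto

lemma Q_rho: "f \<in> AF n \<Longrightarrow> v \<in> Q \<Longrightarrow> L.rho f v \<in> Q"
  unfolding Q_def using rho_commute[OF _ FA_eR] L.rho_V by blast

lemma q_Q: "q \<in> Q"
  unfolding Q_def q_def using v0_V by auto

lemma Q_iff: "v \<in> Q \<longleftrightarrow> (\<exists>h\<in>AF n. v = L.rho h q)"
proof
  assume "v \<in> Q"
  then obtain w where w: "w \<in> V" "v = R.rho (eR E) w" by (auto simp: Q_def)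
  then have "v = R.rho (eR E) (L.rho (Th w) v0)" by (simp add: rho_Th)
  also have "\<dots> = L.rho (Th w) q"
    unfolding q_def by (rule rho_commute[OF FA_Th FA_eR v0_V, symmetric])
  finally show "\<exists>h\<in>AF n. v = L.rho h q" using FA_Th by blast
qed (use Q_rho q_Q in blast)

lemma Q_add: "v \<in> Q \<Longrightarrow> w \<in> Q \<Longrightarrow> (\<lambda>\<sigma>. v \<sigma> + w \<sigma>) \<in> Q"
proof -
  assume "v \<in> Q" "w \<in> Q"
  then obtain h k where "h \<in> AF n" "k \<in> AF n" "v = L.rho h q" "w = L.rho k q" by (auto simp: Q_iff)
  then show ?thesis unfolding Q_iff
    by (intro bexI[of _ "h + k"]) (auto simp: L.rho_add FA_add)
qed

lemma ex_fL: "\<exists>f\<in>AF n. q = L.rho f v0 \<and> (\<forall>d E'. (\<forall>j\<in>{1..n}. d j \<in> {1..r}) \<longrightarrow>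
    eval_character (gchar u d E') f = (if dmatch d \<and> (\<forall>i\<in>Req. i \<in> E' \<longleftrightarrow> i \<in> E) then 1 else 0))"
  unfolding q_def by (rule ex_character_idempotent)

lemma gchar_match:
  assumes "dmatch d" "\<forall>i\<in>Req. i \<in> E' \<longleftrightarrow> i \<in> E" "h \<in> AF n"
  shows "eval_character (gchar u d E') h = XK h"
  using assms(3)
proof (rule eval_character_cong)
  fix x assume "x \<in> ak_gens n"
  then show "gchar u d E' x = gchar u c E x"
    using assms(1,2) by (cases x) (auto simp: dmatch_def Req_def)
qed

text \<open>Locality of the endomorphism ring of \<open>Q\<close>, made explicit. Up to elements
  killed by all characters, \<open>fL * h * fL\<close> is \<open>lam\<close> times
  \<open>fL\<close>; so \<psi> is \<open>lam\<close> times one minus something nilpotent and can be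
  inverted.\<close>

lemma endomorphism_bijective:
  assumes psi: "\<And>v. v \<in> Q \<Longrightarrow> \<psi> v \<in> Q" "\<And>h v. h \<in> AF n \<Longrightarrow> v \<in> Q \<Longrightarrow> \<psi> (L.rho h v) = L.rho h (\<psi> v)"
    and nz: "zeta (\<psi> q) \<noteq> 0"
  shows "\<And>v. v \<in> Q \<Longrightarrow> \<psi> v = (\<lambda>_. 0) \<Longrightarrow> v = (\<lambda>_. 0)" and "Q \<subseteq> \<psi> ` Q"
proof -
  obtain fL where fL: "fL \<in> AF n" "q = L.rho fL v0" "\<And>d E'. (\<forall>j\<in>{1..n}. d j \<in> {1..r}) \<Longrightarrow>
    eval_character (gchar u d E') fL = (if dmatch d \<and> (\<forall>i\<in>Req. i \<in> E' \<longleftrightarrow> i \<in> E) then 1 else 0)"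
    using ex_fL by blast
  have XfL: "XK fL = 1"
    using fL(3)[of c E] c_range by (auto simp: dmatch_def)
  have zq: "zeta q = 1" using zeta_rho[OF fL(1)] fL(2) XfL by simp
  have fLq: "L.rho fL q = q"
  proof -
    have "L.rho fL q = R.rho (eR E) (L.rho fL v0)"
      unfolding q_def by (rule rho_commute[OF fL(1) FA_eR v0_V])
    also have "\<dots> = R.rho (eR E) q" by (simp only: fL(2))
    also have "\<dots> = q" unfolding q_def by (rule eR_idem[OF v0_V])
    finally show ?thesis .
  qed
  define z where "z = \<psi> q"
  have zQ: "z \<in> Q" unfolding z_def by (rule psi(1)[OF q_Q])
  have fLz: "L.rho fL z = z"
    unfolding z_def psi(2)[OF fL(1) q_Q, symmetric] fLq ..
  obtain h where h: "h \<in> AF n" "z = L.rho h q" using zQ Q_iff by auto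
  define lam where "lam = zeta z"
  have lam: "lam = XK h" "lam \<noteq> 0"
    using nz zeta_mult[OF h(1) q_V] zq h by (auto simp: lam_def z_def)
  \<comment> \<open>Every character vanishes on \<open>j\<close>: where \<open>fL\<close> has value
    1, \<open>h\<close> has value \<open>lam\<close>, and elsewhere \<open>fL\<close> has value 0.
    As \<open>fL\<close> fixes both \<open>q\<close> and \<open>z\<close>, \<open>j\<close> carries
    \<open>q\<close> to \<open>q - z / lam\<close>.\<close>
  define j where "j = fL - scal (1 / lam) * (fL * h * fL)"
  have j: "j \<in> AF n" unfolding j_def using fL(1) h(1) by (intro FA_intros)
  have jchar: "eval_character (gchar u d E') j = 0" if "\<And>j. j \<in> {1..n} \<Longrightarrow> d j \<in> {1..r}" for d E'
    using fL(3)[of d E'] that gchar_match[OF _ _ h(1), of d E'] lam by (auto simp: j_def)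
  have jq: "L.rho j q = (\<lambda>\<sigma>. q \<sigma> - 1 / lam * z \<sigma>)"
    by (simp add: j_def L.rho_diff[abs_def] L.rho_mult L.rho_scal fLq fLz flip: h(2))
  have jN: "L.rho (j ^ height) v = (\<lambda>_. 0)" if "v \<in> V" for v
    using j jchar that by (intro rho_nilpotent_characters) auto
  have step: "L.rho f z = (\<lambda>\<sigma>. lam * (L.rho f q \<sigma> - L.rho (f * j) q \<sigma>))" if "f \<in> AF n" for f
    using lam(2) L.rho_vscale[of f "1 / lam" z] by (simp add: L.rho_mult jq L.rho_vdiff)
  show "v = (\<lambda>_. 0)" if v: "v \<in> Q" and v0: "\<psi> v = (\<lambda>_. 0)" for v
  proof -
    obtain g where g: "g \<in> AF n" "v = L.rho g q" using v Q_iff by auto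
    \<comment> \<open>Because \<psi> kills \<open>v\<close>, one more factor \<open>j\<close> may be
      inserted without changing the vector; after \<open>height\<close> factors it is zero.\<close>
    have "v = L.rho (g * j ^ t) q" for t
    proof (induction t)
      case (Suc t)
      have F: "g * j ^ t \<in> AF n" using g(1) j by (intro FA_intros)
      have "\<psi> v = L.rho (g * j ^ t) z"
        using psi(2)[OF F q_Q] Suc by (simp add: z_def)
      then have "L.rho (g * j ^ t) z = (\<lambda>_. 0)" using v0 by simp
      then have "L.rho (g * j ^ t) q = L.rho (g * j ^ t * j) q"
        unfolding step[OF F] using lam(2) by (simp add: fun_eq_iff)
      then show ?case using Suc by (simp add: mult.assoc power_commutes)
    qed (use g in simp)
    from this[of height] show ?thesis by (simp add: L.rho_mult jN q_V L.rho_vzero)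
  qed
  \<comment> \<open>The geometric series that inverts \<open>1 - j\<close>.\<close>
  define S where "S = (\<Sum>t<height. j ^ t)"
  have S: "S \<in> AF n" unfolding S_def using j by (intro FA_intros)
  have "S * (1 - j) = (1 - j) * S"
    unfolding S_def using commutes_sum_power[of j j height] by (simp add: algebra_simps)
  then have S1: "S * (1 - j) = 1 - j ^ height"
    using one_minus_power_ring[of j height] by (simp add: S_def)
  have "L.rho S (\<lambda>\<sigma>. 1 / lam * z \<sigma>) = L.rho (S * (1 - j)) q"
    by (simp add: L.rho_mult L.rho_diff[abs_def] L.rho_one jq)
  also have "\<dots> = q"
    unfolding S1 by (simp add: L.rho_diff[abs_def] L.rho_one jN q_V)
  finally have Sz: "L.rho (S * scal (1 / lam)) z = q"
    by (simp add: L.rho_mult L.rho_scal[abs_def])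
  show "Q \<subseteq> \<psi> ` Q"
  proof
    fix v assume "v \<in> Q"
    then obtain g where g: "g \<in> AF n" "v = L.rho g q" using Q_iff by auto
    let ?f = "g * (S * scal (1 / lam))"
    have F: "?f \<in> AF n" using g(1) S by (intro FA_intros)
    have "\<psi> (L.rho ?f q) = L.rho ?f z"
      using psi(2)[OF F q_Q] by (simp add: z_def)
    also have "\<dots> = v" unfolding L.rho_mult[of g] Sz g(2) ..
    finally show "v \<in> \<psi> ` Q" using Q_rho[OF F q_Q] by (intro image_eqI) auto
  qed
qed

text \<open>\<open>iota\<close> turns a vector on which \<chi> is nonzero into one of weight
  \<open>c\<close>, and its character value 1 keeps \<chi> nonzero. The annihilator of the new
  vector satisfies \<open>lid\<close>, and the universal property yields \<theta>.\<close>

lemma ex_theta: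
  "\<exists>\<theta> x. x \<in> carrier P \<and> \<chi> x \<noteq> 0 \<and> (\<forall>v\<in>V. \<theta> v \<in> carrier P) \<and> (\<forall>f\<in>AF n. \<theta> (L.rho f v0) = act f x) \<and>
    (\<forall>f\<in>AF n. \<forall>v\<in>V. \<theta> (L.rho f v) = act f (\<theta> v))"
proof -
  obtain p where p: "p \<in> carrier P" "\<chi> p \<noteq> 0" using chi_nz by blast
  define x where "x = act iota p"
  have x: "x \<in> carrier P" unfolding x_def by (rule act_closed[OF FA_iota p(1)])
  have chix: "\<chi> x \<noteq> 0"
    unfolding x_def chi_act[OF FA_iota p(1)] using eval_iota[where d = c and E = E, OF c_range] p(2) by (simp add: dmatch_def)
  let ?L = "{f \<in> AF n. act f x = \<zero>\<^bsub>P\<^esub>}"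
  have "XX j - scal (u (c j)) \<in> ?L" if "j \<in> {1..n}" for j
  proof -
    have F: "XX j - scal (u (c j)) \<in> AF n" using that by (auto intro!: FA_intros)
    then have "act (XX j - scal (u (c j))) x = act ((XX j - scal (u (c j))) * iota) p"
      unfolding x_def by (rule act_mult[OF _ FA_iota p(1), symmetric])
    also have "\<dots> = \<zero>\<^bsub>P\<^esub>" by (rule act_ideal[OF xi_iota[OF that] p(1)])
    finally show ?thesis using F by simp
  qed
  then have "lid ?L"
    unfolding lid_def using ak_ideal_FA act_ideal x
    by (auto simp: act_add act_mult act_rzero intro!: FA_add FA_mult)
  then interpret ak_word_lid n r u c ?L
    by unfold_locales
  define \<theta> where "\<theta> v = act (Th v) x" for v
  have 1: "\<theta> (L.rho f v0) = act f x" if "f \<in> AF n" for f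
  proof -
    have "act f x \<ominus>\<^bsub>P\<^esub> act (Th (L.rho f v0)) x = \<zero>\<^bsub>P\<^esub>"
      using cg_Th[OF that] that x by (simp add: cg_def act_diff FA_Th)
    then show ?thesis
      unfolding \<theta>_def using eq_of_diff act_closed that x FA_Th by metis
  qed
  have 2: "\<theta> (L.rho f v) = act f (\<theta> v)" if "f \<in> AF n" "v \<in> V" for f v
    using 1[of "f * Th v"] that x by (simp add: FA_mult FA_Th L.rho_mult rho_Th \<theta>_def act_mult)
  show ?thesis
    using x chix 1 2 by (intro exI[of _ \<theta>] exI[of _ x]) (auto simp: \<theta>_def act_closed FA_Th)
qed

text \<open>Along the projection from a free module to \<open>P\<close>, \<chi> becomes a
  combination of the characters of the coordinates. As \<chi> does not vanish at \<open>x\<close>,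
  some coordinate \<open>y\<close> of \<open>x\<close> has nonzero character; reading off this
  coordinate and applying it to \<open>v0\<close> is the map to \<open>V\<close>.\<close>

lemma ex_pi:
  assumes x: "x \<in> carrier P" "\<chi> x \<noteq> 0"
  shows "\<exists>\<pi>. (\<forall>p\<in>carrier P. \<pi> p \<in> V) \<and> (\<forall>p\<in>carrier P. \<forall>p'\<in>carrier P. \<pi> (p \<oplus>\<^bsub>P\<^esub> p') = (\<lambda>\<sigma>. \<pi> p \<sigma> + \<pi> p' \<sigma>)) \<and>
    (\<forall>f\<in>AF n. \<forall>p\<in>carrier P. \<pi> (act f p) = L.rho f (\<pi> p)) \<and> zeta (\<pi> x) \<noteq> 0"
proof -
  obtain X :: "'p set" and N N' where ds: "internal_direct_sum A (free_module A X) N N'"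
    and "module_iso A P (free_module A X \<lparr>carrier := N\<rparr>)"
    using proj by (auto simp: projective_def)
  then obtain h where h: "bij_betw h (carrier P) N"
    "\<And>p p'. p \<in> carrier P \<Longrightarrow> p' \<in> carrier P \<Longrightarrow> h (p \<oplus>\<^bsub>P\<^esub> p') = (\<lambda>y. h p y \<oplus>\<^bsub>A\<^esub> h p' y)"
    "\<And>a p. a \<in> carrier A \<Longrightarrow> p \<in> carrier P \<Longrightarrow> h (a \<odot>\<^bsub>P\<^esub> p) = (\<lambda>y. a \<otimes>\<^bsub>A\<^esub> h p y)"
    by (auto simp: module_iso_def)
  interpret FM: left_module A "free_module A X" by (rule P.R.free_module_left_module)
  let ?F = "free_module A X"
  have N: "submodule N A ?F" "submodule N' A ?F" "N \<inter> N' = {\<lambda>x. \<zero>\<^bsub>A\<^esub>}" and sum': "N <+>\<^bsub>?F\<^esub> N' = carrier ?F"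
    using ds by (simp_all add: internal_direct_sum_def)
  have sum: "\<exists>m\<in>N. \<exists>m'\<in>N'. t = m \<oplus>\<^bsub>?F\<^esub> m'" if "t \<in> carrier ?F" for t
    using that unfolding sum'[symmetric] set_add_def' by blast
  note Nf = FM.submodule_facts[OF N(1)] and Nf' = FM.submodule_facts[OF N(2)]
  have hN: "h p \<in> N" if "p \<in> carrier P" for p using h(1) that by (auto simp: bij_betw_def)
  have hF: "h p \<in> carrier ?F" if "p \<in> carrier P" for p using hN[OF that] Nf(1) by auto
  \<comment> \<open>The projection from the free module to \<open>P\<close> as a relation:
    \<open>p\<close> corresponds to the component of \<open>t\<close> in \<open>N\<close>.\<close>
  define Rel where "Rel t p \<longleftrightarrow> p \<in> carrier P \<and> (\<exists>m'\<in>N'. t = h p \<oplus>\<^bsub>?F\<^esub> m')" for t p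
  have Rel_ex: "\<exists>p. Rel t p" if t: "t \<in> carrier ?F" for t
  proof -
    obtain m m' where m: "m \<in> N" "m' \<in> N'" "t = m \<oplus>\<^bsub>?F\<^esub> m'" using sum[OF t] by blast
    then obtain p where "p \<in> carrier P" "h p = m" using h(1) by (auto simp: bij_betw_def)
    then show ?thesis using m by (auto simp: Rel_def)
  qed
  have Rel_add: "Rel (t \<oplus>\<^bsub>?F\<^esub> t') (p \<oplus>\<^bsub>P\<^esub> p')" if rel: "Rel t p" "Rel t' p'" for t t' p p'
  proof -
    obtain m m' where m: "m \<in> N'" "m' \<in> N'" "t = h p \<oplus>\<^bsub>?F\<^esub> m" "t' = h p' \<oplus>\<^bsub>?F\<^esub> m'" "p \<in> carrier P" "p' \<in> carrier P"
      using rel unfolding Rel_def by blast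
    have F: "h p \<in> carrier ?F" "h p' \<in> carrier ?F" "m \<in> carrier ?F" "m' \<in> carrier ?F"
      using m hF Nf'(1) by auto
    have "t \<oplus>\<^bsub>?F\<^esub> t' = h (p \<oplus>\<^bsub>P\<^esub> p') \<oplus>\<^bsub>?F\<^esub> (m \<oplus>\<^bsub>?F\<^esub> m')"
      using F[THEN P.R.free_module_closed] by (simp add: m h P.R.a_ac)
    then show ?thesis using m Nf'(3)[OF m(1,2)] unfolding Rel_def by (intro conjI bexI[of _ "m \<oplus>\<^bsub>?F\<^esub> m'"]) auto
  qed
  have Rel_smult: "Rel (a \<odot>\<^bsub>?F\<^esub> t) (a \<odot>\<^bsub>P\<^esub> p)" if rel: "a \<in> carrier A" "Rel t p" for a t p
  proof -
    obtain m where m: "m \<in> N'" "t = h p \<oplus>\<^bsub>?F\<^esub> m" "p \<in> carrier P"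
      using rel unfolding Rel_def by blast
    have F: "h p \<in> carrier ?F" "m \<in> carrier ?F" using m hF Nf'(1) by auto
    have "a \<odot>\<^bsub>?F\<^esub> t = h (a \<odot>\<^bsub>P\<^esub> p) \<oplus>\<^bsub>?F\<^esub> (a \<odot>\<^bsub>?F\<^esub> m)"
      using F[THEN P.R.free_module_closed] rel(1) by (simp add: m h P.R.r_distr)
    then show ?thesis
      using m Nf'(5)[OF rel(1) m(1)] P.smult_closed[OF rel(1) m(3)] unfolding Rel_def
      by (intro conjI bexI[of _ "a \<odot>\<^bsub>?F\<^esub> m"]) auto
  qed
  have h0: "h \<zero>\<^bsub>P\<^esub> = (\<lambda>_. \<zero>\<^bsub>A\<^esub>)"
  proof -
    have "h \<zero>\<^bsub>P\<^esub> \<oplus>\<^bsub>?F\<^esub> h \<zero>\<^bsub>P\<^esub> = h \<zero>\<^bsub>P\<^esub>"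
      using h(2)[of "\<zero>\<^bsub>P\<^esub>" "\<zero>\<^bsub>P\<^esub>"] by simp
    moreover have "h \<zero>\<^bsub>P\<^esub> \<in> carrier ?F" by (rule hF) simp
    ultimately have "h \<zero>\<^bsub>P\<^esub> = \<zero>\<^bsub>?F\<^esub>"
      using FM.M.add.r_cancel_one' by metis
    then show ?thesis by simp
  qed
  have Rel_zero: "p = \<zero>\<^bsub>P\<^esub>" if rel: "Rel (\<lambda>_. \<zero>\<^bsub>A\<^esub>) p" for p
  proof -
    obtain m where m: "m \<in> N'" "\<zero>\<^bsub>?F\<^esub> = h p \<oplus>\<^bsub>?F\<^esub> m" "p \<in> carrier P" using rel unfolding Rel_def free_module_simps by blast
    have F: "h p \<in> carrier ?F" "m \<in> carrier ?F" using m hF Nf'(1) by auto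
    then have "\<ominus>\<^bsub>?F\<^esub> m = h p" using m(2) by (intro FM.M.minus_equality) auto
    then have "h p \<in> N'" using Nf'(4)[OF m(1)] by metis
    then have "h p \<in> N \<inter> N'" using hN[OF m(3)] by simp
    then have "h p = h \<zero>\<^bsub>P\<^esub>" unfolding N(3) h0 by simp
    then show ?thesis using h(1) m(3) by (auto simp: bij_betw_def dest: inj_onD)
  qed
  have chi0: "\<chi> \<zero>\<^bsub>P\<^esub> = 0"
    using chi_add[of "\<zero>\<^bsub>P\<^esub>" "\<zero>\<^bsub>P\<^esub>"] by simp
  have Rel_fun: "\<chi> p = \<chi> p'" if "Rel t p" "Rel t p'" "t \<in> carrier ?F" for t p p'
  proof -
    have m1: "\<ominus>\<^bsub>A\<^esub> \<one>\<^bsub>A\<^esub> \<in> carrier A" by simp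
    have pp: "p \<in> carrier P" "p' \<in> carrier P" using that by (auto simp: Rel_def)
    have "Rel (t \<oplus>\<^bsub>?F\<^esub> (\<ominus>\<^bsub>A\<^esub> \<one>\<^bsub>A\<^esub>) \<odot>\<^bsub>?F\<^esub> t) (p \<oplus>\<^bsub>P\<^esub> (\<ominus>\<^bsub>A\<^esub> \<one>\<^bsub>A\<^esub>) \<odot>\<^bsub>P\<^esub> p')"
      by (intro Rel_add Rel_smult that m1)
    moreover have "t \<oplus>\<^bsub>?F\<^esub> (\<ominus>\<^bsub>A\<^esub> \<one>\<^bsub>A\<^esub>) \<odot>\<^bsub>?F\<^esub> t = (\<lambda>_. \<zero>\<^bsub>A\<^esub>)"
      using P.R.free_module_closed[OF that(3)] by (auto simp: P.R.l_minus P.R.r_neg)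
    ultimately have e: "p \<oplus>\<^bsub>P\<^esub> (\<ominus>\<^bsub>A\<^esub> \<one>\<^bsub>A\<^esub>) \<odot>\<^bsub>P\<^esub> p' = \<zero>\<^bsub>P\<^esub>" using Rel_zero by simp
    have "\<ominus>\<^bsub>A\<^esub> \<one>\<^bsub>A\<^esub> = ak_class n r u (- 1)"
      using ak_add[of "- 1" n 1 r u] by (intro P.R.minus_equality)
        (auto simp: ak_one ak_zero ak_carrier FA_uminus FA_one)
    then have "(\<ominus>\<^bsub>A\<^esub> \<one>\<^bsub>A\<^esub>) \<odot>\<^bsub>P\<^esub> p' = act (- 1) p'" by (simp add: act_def)
    with e have "\<chi> (p \<oplus>\<^bsub>P\<^esub> act (- 1) p') = 0" using chi0 by simp
    then show ?thesis
      using pp chi_add[OF pp(1) act_closed[of "- 1" p']] chi_act[of "- 1" p'] by (simp add: FA_uminus FA_one)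
  qed
  \<comment> \<open>Induction on a finite set containing the support. Splitting off the coordinate
    \<open>y\<close> writes \<open>t\<close> as \<open>t(y := 0)\<close> plus \<open>t y\<close>
    times a basis vector, and \<chi> of the second part has the character value of
    \<open>t y\<close> as a factor.\<close>
  have vanish: "\<chi> p = 0" if "finite S" "t \<in> carrier ?F" "{y. t y \<noteq> \<zero>\<^bsub>A\<^esub>} \<subseteq> S" "Rel t p"
    "\<And>y f. y \<in> X \<Longrightarrow> f \<in> AF n \<Longrightarrow> t y = ak_class n r u f \<Longrightarrow> XK f = 0" for S t p
    using that
  proof (induction S arbitrary: t p)
    case empty
    then have "t = (\<lambda>_. \<zero>\<^bsub>A\<^esub>)" by auto
    then show ?case using empty Rel_zero chi0 by auto
  next
    case (insert y S)
    show ?case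
    proof (cases "y \<in> X")
      case False
      then have "t y = \<zero>\<^bsub>A\<^esub>" using insert.prems(1) by (simp add: free_module_carrier)
      then show ?thesis using insert.prems by (intro insert.IH[of t p]) auto
    next
      case True
      have cl: "\<And>z. t z \<in> carrier A" using P.R.free_module_closed[OF insert.prems(1)] .
      let ?b = "\<lambda>z. if z = y then \<one>\<^bsub>A\<^esub> else \<zero>\<^bsub>A\<^esub>"
      let ?t = "t(y := \<zero>\<^bsub>A\<^esub>)"
      have b: "?b \<in> carrier ?F"
        using True finite_subset[of "{z. ?b z \<noteq> \<zero>\<^bsub>A\<^esub>}" "{y}"] by (auto simp: free_module_carrier)
      have "finite {z. ?t z \<noteq> \<zero>\<^bsub>A\<^esub>}"
        by (rule finite_subset[of _ "{z. t z \<noteq> \<zero>\<^bsub>A\<^esub>}"]) (use insert.prems(1) in \<open>auto simp: free_module_carrier\<close>)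
      then have t': "?t \<in> carrier ?F"
        using insert.prems(1) unfolding free_module_carrier by (intro conjI) simp_all
      obtain p' where p': "Rel ?t p'" using Rel_ex[OF t'] by blast
      obtain w where w: "Rel ?b w" using Rel_ex[OF b] by blast
      obtain f where f: "f \<in> AF n" "t y = ak_class n r u f" using cl[of y] by (auto simp: ak_carrier)
      have "Rel (?t \<oplus>\<^bsub>?F\<^esub> t y \<odot>\<^bsub>?F\<^esub> ?b) (p' \<oplus>\<^bsub>P\<^esub> t y \<odot>\<^bsub>P\<^esub> w)"
        by (intro Rel_add Rel_smult p' w cl)
      moreover have "?t \<oplus>\<^bsub>?F\<^esub> t y \<odot>\<^bsub>?F\<^esub> ?b = t"
        using cl by (auto simp: fun_eq_iff)
      ultimately have "Rel t (p' \<oplus>\<^bsub>P\<^esub> act f w)" using f(2) by (simp add: act_def)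
      then have "\<chi> p = \<chi> (p' \<oplus>\<^bsub>P\<^esub> act f w)"
        using Rel_fun insert.prems by blast
      also have "\<dots> = \<chi> p' + XK f * \<chi> w"
        using p' w f chi_add[of p' "act f w"] chi_act[OF f(1)] act_closed by (auto simp: Rel_def)
      also have "XK f = 0" using insert.prems(4)[OF True f] .
      also have "\<chi> p' = 0"
      proof (rule insert.IH[OF t' _ p'])
        show "{z. ?t z \<noteq> \<zero>\<^bsub>A\<^esub>} \<subseteq> S" using insert.prems(2) by auto
        fix z f assume z: "z \<in> X" "f \<in> AF n" "?t z = ak_class n r u f"
        show "XK f = 0"
        proof (cases "z = y")
          case True
          then have "f \<in> ak_ideal n r u"
            using z(3) ak_class_eq_iff[of n r u f 0] by (simp add: ak_zero)
          from gchar_kills_ideal[where d = c and E = E, OF u_inj c_range this] show ?thesis .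
        next
          case False
          then show ?thesis using z insert.prems(4)[of z f] by simp
        qed
      qed
      finally show ?thesis by simp
    qed
  qed
  have Rx: "Rel (h x) x"
    using x Nf'(2) hF[OF x(1)] FM.M.r_zero[of "h x"] unfolding Rel_def
    by (intro conjI bexI[of _ "\<zero>\<^bsub>?F\<^esub>"]) auto
  have "\<exists>y\<in>X. \<exists>f\<in>AF n. h x y = ak_class n r u f \<and> XK f \<noteq> 0"
  proof (rule ccontr)
    assume "\<not> ?thesis"
    then have "\<chi> x = 0"
      using hF[OF x(1)] by (intro vanish[OF _ hF[OF x(1)] subset_refl Rx]) (auto simp: free_module_carrier)
    with x(2) show False by simp
  qed
  then obtain y f0 where y: "y \<in> X" "f0 \<in> AF n" "h x y = ak_class n r u f0" "XK f0 \<noteq> 0" by blast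
  define rp where "rp p = (SOME f. f \<in> AF n \<and> h p y = ak_class n r u f)" for p
  have rp: "rp p \<in> AF n" "h p y = ak_class n r u (rp p)" if "p \<in> carrier P" for p
  proof -
    have "\<exists>f. f \<in> AF n \<and> h p y = ak_class n r u f"
      using P.R.free_module_closed[OF hF[OF that], of y] by (auto simp: ak_carrier)
    from someI_ex[OF this] show "rp p \<in> AF n" "h p y = ak_class n r u (rp p)" by (auto simp: rp_def)
  qed
  define \<pi> where "\<pi> p = L.rho (rp p) v0" for p
  have pi_eq: "\<pi> p = L.rho f v0" if "p \<in> carrier P" "h p y = ak_class n r u f" for p f
  proof -
    have "rp p - f \<in> ak_ideal n r u" using rp[OF that(1)] that(2) ak_class_eq_iff by metis
    from rho_kills_ideal[OF this v0_V] show ?thesis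
      by (simp add: \<pi>_def L.rho_diff[abs_def] fun_eq_iff)
  qed
  show ?thesis
  proof (intro exI[of _ \<pi>] conjI ballI)
    fix p assume p: "p \<in> carrier P"
    show "\<pi> p \<in> V" unfolding \<pi>_def by (rule L.rho_V[OF rp(1)[OF p] v0_V])
    fix p' assume p': "p' \<in> carrier P"
    have "h (p \<oplus>\<^bsub>P\<^esub> p') y = ak_class n r u (rp p + rp p')"
      using p p' by (simp add: h rp ak_add)
    then show "\<pi> (p \<oplus>\<^bsub>P\<^esub> p') = (\<lambda>\<sigma>. \<pi> p \<sigma> + \<pi> p' \<sigma>)"
      using p p' pi_eq[of "p \<oplus>\<^bsub>P\<^esub> p'" "rp p + rp p'"] by (simp add: L.rho_add[abs_def] \<pi>_def)
  next
    fix f p assume f: "f \<in> AF n" and p: "p \<in> carrier P"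
    have "h (act f p) y = ak_class n r u (f * rp p)"
      using f p by (simp add: act_def h ak_carrier rp ak_mult)
    then show "\<pi> (act f p) = L.rho f (\<pi> p)"
      using f p pi_eq[of "act f p" "f * rp p"] by (simp add: act_closed L.rho_mult \<pi>_def)
  next
    show "zeta (\<pi> x) \<noteq> 0"
      using pi_eq[OF x(1) y(3)] zeta_rho[OF y(2)] y(4) by simp
  qed
qed

text \<open>\<open>\<beta> \<circ> \<theta>\<close> is an endomorphism of \<open>Q\<close> that does
  not vanish on the top, hence bijective. So \<open>P\<close> splits into the image of
  \<open>Q\<close> and the kernel of \<beta>; indecomposability forces the kernel to be
  zero.\<close>

theorem ex_iso:
  "\<exists>g. (\<forall>p\<in>carrier P. \<forall>p'\<in>carrier P. g (p \<oplus>\<^bsub>P\<^esub> p') = (\<lambda>\<sigma>. g p \<sigma> + g p' \<sigma>)) \<and>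
    (\<forall>f\<in>AF n. \<forall>p\<in>carrier P. g (act f p) = L.rho f (g p)) \<and> inj_on g (carrier P) \<and> g ` carrier P = Q"
proof -
  obtain \<theta> x where x: "x \<in> carrier P" "\<chi> x \<noteq> 0" and th: "\<And>v. v \<in> V \<Longrightarrow> \<theta> v \<in> carrier P"
    "\<And>f. f \<in> AF n \<Longrightarrow> \<theta> (L.rho f v0) = act f x" "\<And>f v. f \<in> AF n \<Longrightarrow> v \<in> V \<Longrightarrow> \<theta> (L.rho f v) = act f (\<theta> v)"
    using ex_theta by blast
  obtain \<pi> where pi: "\<And>p. p \<in> carrier P \<Longrightarrow> \<pi> p \<in> V"
    "\<And>p p'. p \<in> carrier P \<Longrightarrow> p' \<in> carrier P \<Longrightarrow> \<pi> (p \<oplus>\<^bsub>P\<^esub> p') = (\<lambda>\<sigma>. \<pi> p \<sigma> + \<pi> p' \<sigma>)"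
    "\<And>f p. f \<in> AF n \<Longrightarrow> p \<in> carrier P \<Longrightarrow> \<pi> (act f p) = L.rho f (\<pi> p)" "zeta (\<pi> x) \<noteq> 0"
    using ex_pi[OF x] by blast
  define \<beta> where "\<beta> p = R.rho (eR E) (\<pi> p)" for p
  have b_Q: "\<beta> p \<in> Q" if "p \<in> carrier P" for p
    unfolding \<beta>_def Q_def using pi(1)[OF that] by (rule imageI)
  have b_add: "\<beta> (p \<oplus>\<^bsub>P\<^esub> p') = (\<lambda>\<sigma>. \<beta> p \<sigma> + \<beta> p' \<sigma>)" if "p \<in> carrier P" "p' \<in> carrier P" for p p'
    using that by (simp add: \<beta>_def pi(2) R.rho_vadd)
  have b_act: "\<beta> (act f p) = L.rho f (\<beta> p)" if "f \<in> AF n" "p \<in> carrier P" for f p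
    using that rho_commute[OF that(1) FA_eR pi(1)[OF that(2)]] by (simp add: \<beta>_def pi(3))
  have b0: "\<beta> \<zero>\<^bsub>P\<^esub> = (\<lambda>_. 0)"
    using b_add[of "\<zero>\<^bsub>P\<^esub>" "\<zero>\<^bsub>P\<^esub>"] by (simp add: fun_eq_iff)
  have th_add: "\<theta> (\<lambda>\<sigma>. v \<sigma> + w \<sigma>) = \<theta> v \<oplus>\<^bsub>P\<^esub> \<theta> w" if "v \<in> V" "w \<in> V" for v w
  proof -
    have "\<theta> (L.rho (Th v + Th w) v0) = act (Th v) x \<oplus>\<^bsub>P\<^esub> act (Th w) x"
      using x by (simp add: th(2) FA_add FA_Th act_add)
    moreover have "act (Th v) x = \<theta> v" "act (Th w) x = \<theta> w"
      using th(2)[OF FA_Th, of v] th(2)[OF FA_Th, of w] that by (simp_all add: rho_Th)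
    ultimately show ?thesis using that by (simp add: L.rho_add[abs_def] rho_Th)
  qed
  have th0: "\<theta> (\<lambda>_. 0) = \<zero>\<^bsub>P\<^esub>"
    using th(2)[OF FA_zero] x by (simp add: L.rho_zero[abs_def] act_zero)
  have thq: "\<theta> v0 = x"
    using th(2)[OF FA_one] x by (simp add: L.rho_one' act_one)
  define \<psi> where "\<psi> v = \<beta> (\<theta> v)" for v
  have psi: "\<psi> v \<in> Q" "\<And>h. h \<in> AF n \<Longrightarrow> \<psi> (L.rho h v) = L.rho h (\<psi> v)" if "v \<in> Q" for v
    using Q_V[OF that] th b_Q b_act by (auto simp: \<psi>_def)
  \<comment> \<open>The right idempotent replaces \<open>Th v\<close> by \<open>Th v * fL\<close>,
    and the character has value 1 on \<open>fL\<close>.\<close>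
  have zeta_R: "zeta (R.rho (eR E) v) = zeta v" if v: "v \<in> V" for v
  proof -
    obtain fL where fL: "fL \<in> AF n" "q = L.rho fL v0" "\<And>d E'. (\<forall>j\<in>{1..n}. d j \<in> {1..r}) \<Longrightarrow>
      eval_character (gchar u d E') fL = (if dmatch d \<and> (\<forall>i\<in>Req. i \<in> E' \<longleftrightarrow> i \<in> E) then 1 else 0)"
      using ex_fL by blast
    have "XK fL = 1" using fL(3)[of c E] c_range by (auto simp: dmatch_def)
    then have zq: "zeta q = 1" using zeta_rho[OF fL(1)] fL(2) by simp
    have "R.rho (eR E) v = R.rho (eR E) (L.rho (Th v) v0)" using v by (simp add: rho_Th)
    also have "\<dots> = L.rho (Th v) q"
      unfolding q_def by (rule rho_commute[OF FA_Th FA_eR v0_V, symmetric])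
    finally have "zeta (R.rho (eR E) v) = XK (Th v) * zeta q"
      using zeta_mult[OF FA_Th q_V] by simp
    then show ?thesis by (simp only: zq mult_1_right zeta_def[of v])
  qed
  have nz: "zeta (\<psi> q) \<noteq> 0"
  proof -
    obtain fL where fL: "fL \<in> AF n" "q = L.rho fL v0" using ex_fL by blast
    have qf: "zeta q = XK fL" using zeta_rho[OF fL(1)] fL(2) by simp
    have "zeta q = zeta v0" unfolding q_def by (rule zeta_R[OF v0_V])
    also have "\<dots> = 1" using zeta_rho[OF FA_one] by (simp add: L.rho_one')
    finally have "XK fL = 1" using qf by simp
    have "zeta (\<psi> q) = zeta (\<pi> (\<theta> q))"
      unfolding \<psi>_def \<beta>_def by (rule zeta_R[OF pi(1)[OF th(1)[OF q_V]]])
    also have "\<pi> (\<theta> q) = L.rho fL (\<pi> x)"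
      using fL th(2)[OF fL(1)] pi(3)[OF fL(1) x(1)] by simp
    also have "zeta \<dots> = XK fL * zeta (\<pi> x)"
      by (rule zeta_mult[OF fL(1) pi(1)[OF x(1)]])
    finally show ?thesis using \<open>XK fL = 1\<close> pi(4) by simp
  qed
  note bij = endomorphism_bijective[of \<psi>, OF psi(1) psi(2) nz]
  let ?N = "\<theta> ` Q" and ?N' = "{p \<in> carrier P. \<beta> p = (\<lambda>_. 0)}"
  have zQ: "(\<lambda>_. 0) \<in> Q"
    using Q_iff FA_zero by (force simp: L.rho_zero[abs_def])
  have "internal_direct_sum A P ?N ?N'"
    unfolding internal_direct_sum_def
  proof (intro conjI)
    show "submodule ?N A P"
      unfolding submodule_act_iff
    proof (intro conjI ballI)
      show "\<zero>\<^bsub>P\<^esub> \<in> ?N" using th0 zQ by (metis image_eqI)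
      fix a b assume "a \<in> ?N" "b \<in> ?N"
      then obtain v w where "v \<in> Q" "w \<in> Q" "a = \<theta> v" "b = \<theta> w" by blast
      then show "a \<oplus>\<^bsub>P\<^esub> b \<in> ?N"
        using th_add[OF Q_V Q_V, symmetric] Q_add[of v w] by simp
    next
      fix f a assume "f \<in> AF n" "a \<in> ?N"
      then obtain v where "f \<in> AF n" "v \<in> Q" "a = \<theta> v" by blast
      then show "act f a \<in> ?N"
        using th(3)[OF _ Q_V, symmetric] Q_rho[of f v] by simp
    qed (use th Q_V in auto)
    show N': "submodule ?N' A P"
      unfolding submodule_act_iff by (auto simp: b_add b_act b0 act_closed L.rho_vzero)
    show "?N \<inter> ?N' = {\<zero>\<^bsub>P\<^esub>}"
    proof
      show "?N \<inter> ?N' \<subseteq> {\<zero>\<^bsub>P\<^esub>}"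
        using bij(1) th0 by (auto simp: \<psi>_def)
      show "{\<zero>\<^bsub>P\<^esub>} \<subseteq> ?N \<inter> ?N'"
        using th0 zQ b0 by (auto intro!: image_eqI[of _ \<theta> "\<lambda>_. 0"])
    qed
    show "?N <+>\<^bsub>P\<^esub> ?N' = carrier P"
    proof
      show "?N <+>\<^bsub>P\<^esub> ?N' \<subseteq> carrier P"
      proof
        fix p assume "p \<in> ?N <+>\<^bsub>P\<^esub> ?N'"
        then obtain v p' where "v \<in> Q" "p' \<in> carrier P" "p = \<theta> v \<oplus>\<^bsub>P\<^esub> p'"
          unfolding set_add_def' by blast
        then show "p \<in> carrier P" using th(1)[OF Q_V] by simp
      qed
      show "carrier P \<subseteq> ?N <+>\<^bsub>P\<^esub> ?N'"
      proof
        fix p assume p: "p \<in> carrier P"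
        have "\<beta> p \<in> \<psi> ` Q" using bij(2) b_Q[OF p] by (rule subsetD)
        then obtain v where v: "v \<in> Q" "\<psi> v = \<beta> p" by (elim imageE) simp
        have tv: "\<theta> v \<in> carrier P" by (rule th(1)[OF Q_V[OF v(1)]])
        let ?p' = "act (- 1) (\<theta> v) \<oplus>\<^bsub>P\<^esub> p"
        have F1: "- 1 \<in> AF n" by (intro FA_intros)
        have "\<beta> ?p' = (\<lambda>_. 0)"
          using p tv v F1 act_closed[OF F1 tv]
          by (simp add: b_add b_act L.rho_uminus[abs_def] L.rho_one) (simp add: \<psi>_def fun_eq_iff)
        moreover have "p = \<theta> v \<oplus>\<^bsub>P\<^esub> ?p'"
          using p tv act_closed[OF FA_one tv]
          by (simp add: act_uminus FA_one act_one P.M.a_assoc[symmetric] P.M.r_neg)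
        ultimately show "p \<in> ?N <+>\<^bsub>P\<^esub> ?N'"
          using p tv v act_closed[OF F1 tv] unfolding set_add_def' by blast
      qed
    qed
  qed
  then have "?N = {\<zero>\<^bsub>P\<^esub>} \<or> ?N' = {\<zero>\<^bsub>P\<^esub>}"
    using indec by (simp add: indecomposable_def)
  moreover have "?N \<noteq> {\<zero>\<^bsub>P\<^esub>}"
  proof
    assume "?N = {\<zero>\<^bsub>P\<^esub>}"
    then have "\<theta> q = \<zero>\<^bsub>P\<^esub>" using q_Q by blast
    then have "\<psi> q = (\<lambda>_. 0)" using b0 by (simp add: \<psi>_def)
    then show False using nz by (simp add: zeta_def Th_def)
  qed
  ultimately have N': "?N' = {\<zero>\<^bsub>P\<^esub>}" by blast
  have "inj_on \<beta> (carrier P)"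
  proof (rule inj_onI)
    fix p p' assume *: "p \<in> carrier P" "p' \<in> carrier P" "\<beta> p = \<beta> p'"
    have F1: "- 1 \<in> AF n" by (intro FA_intros)
    have "\<beta> (p \<oplus>\<^bsub>P\<^esub> act (- 1) p') = (\<lambda>_. 0)"
      using * F1 act_closed[OF F1] by (simp add: b_add b_act L.rho_uminus[abs_def] L.rho_one)
    then have "p \<oplus>\<^bsub>P\<^esub> act (- 1) p' \<in> ?N'" using * act_closed[OF F1] by simp
    then have "p \<oplus>\<^bsub>P\<^esub> act (- 1) p' = \<zero>\<^bsub>P\<^esub>" unfolding N' by simp
    then show "p = p'"
      using * eq_of_diff[of p p'] by (simp add: act_uminus FA_one act_one P.M.minus_eq)
  qed
  moreover have "\<beta> ` carrier P = Q"
  proof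
    show "\<beta> ` carrier P \<subseteq> Q" using b_Q by auto
    show "Q \<subseteq> \<beta> ` carrier P"
    proof
      fix v assume "v \<in> Q"
      then have "v \<in> \<psi> ` Q" using bij(2) by (rule subsetD[rotated])
      then obtain w where "w \<in> Q" "v = \<beta> (\<theta> w)" by (elim imageE) (simp add: \<psi>_def)
      then show "v \<in> \<beta> ` carrier P" using th(1)[OF Q_V] by (intro image_eqI)
    qed
  qed
  ultimately show ?thesis using b_add b_act by (intro exI[of _ \<beta>]) auto
qed

end

subsection \<open>Composition multiplicities\<close>

text \<open>The common index set of both counts. Inverting \<sigma> exchanges the roles of (c, E)
  and (d, E').\<close>

definition cartan_perms :: "nat \<Rightarrow> (nat \<Rightarrow> nat) \<Rightarrow> nat set \<Rightarrow> (nat \<Rightarrow> nat) \<Rightarrow> nat set \<Rightarrow> (nat \<Rightarrow> nat) set" where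
  "cartan_perms n c E d E' = {\<sigma>. \<sigma> permutes {1..n} \<and> (\<forall>j\<in>{1..n}. c (\<sigma> j) = d j) \<and>
     (\<forall>i\<in>{1..<n}. d i = d (Suc i) \<longrightarrow> (\<sigma> (Suc i) < \<sigma> i \<longleftrightarrow> i \<in> E')) \<and>
     (\<forall>i\<in>{1..<n}. c i = c (Suc i) \<longrightarrow> (pinv \<sigma> (Suc i) < pinv \<sigma> i \<longleftrightarrow> i \<in> E))}"

text \<open>\<open>eJ\<close> stands for the idempotent of the character (d, EJ): it separates this
  character from all others and is a genuine idempotent on \<open>V\<close>. The map
  \<open>g\<close> is the isomorphism of \<open>P\<close> with \<open>Q\<close>.\<close>

locale ak_mult = ak_proj n r u c P E \<chi>
  for n r u c and P :: "(ak_gen ncpoly set, 'p) module" and E \<chi> +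
  fixes d :: "nat \<Rightarrow> nat" and EJ :: "nat set" and eJ :: "ak_gen ncpoly" and g :: "'p \<Rightarrow> (nat \<Rightarrow> nat) \<Rightarrow> complex"
  assumes d_range: "\<And>j. j \<in> {1..n} \<Longrightarrow> d j \<in> {1..r}"
    and eJ_FA: "eJ \<in> AF n"
    and eJ_char: "\<And>d' E'. (\<And>j. j \<in> {1..n} \<Longrightarrow> d' j \<in> {1..r}) \<Longrightarrow> eval_character (gchar u d' E') eJ =
      (if (\<forall>j\<in>{1..n}. d' j = d j) \<and> (\<forall>i\<in>{1..<n}. d i = d (Suc i) \<longrightarrow> (i \<in> E' \<longleftrightarrow> i \<in> EJ)) then 1 else 0)"
    and eJ_idem: "\<And>v. v \<in> V \<Longrightarrow> L.rho eJ (L.rho eJ v) = L.rho eJ v"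
    and g_add: "\<And>p p'. p \<in> carrier P \<Longrightarrow> p' \<in> carrier P \<Longrightarrow> g (p \<oplus>\<^bsub>P\<^esub> p') = (\<lambda>\<sigma>. g p \<sigma> + g p' \<sigma>)"
    and g_act: "\<And>f p. f \<in> AF n \<Longrightarrow> p \<in> carrier P \<Longrightarrow> g (act f p) = L.rho f (g p)"
    and g_inj: "inj_on g (carrier P)" and g_Q: "g ` carrier P = Q"
begin

abbreviation XJ :: "ak_gen ncpoly \<Rightarrow> complex" where
  "XJ \<equiv> eval_character (gchar u d EJ)"

definition W :: "'p set \<Rightarrow> ((nat \<Rightarrow> nat) \<Rightarrow> complex) set" where
  "W N = (\<lambda>p. L.rho eJ (g p)) ` N"

text \<open>It plays the role of the Jacobson radical, lifted to polynomials.\<close>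

definition JJ :: "ak_gen ncpoly set" where
  "JJ = {k \<in> AF n. \<forall>d' E'. (\<forall>j\<in>{1..n}. d' j \<in> {1..r}) \<longrightarrow> eval_character (gchar u d' E') k = 0}"

lemma g_V: "p \<in> carrier P \<Longrightarrow> g p \<in> V"
  using g_Q Q_V by blast

lemma g_zero: "g \<zero>\<^bsub>P\<^esub> = (\<lambda>_. 0)"
  using g_add[of "\<zero>\<^bsub>P\<^esub>" "\<zero>\<^bsub>P\<^esub>"] by (simp add: fun_eq_iff)

lemma g_scal: "p \<in> carrier P \<Longrightarrow> g (act (scal a) p) = (\<lambda>\<sigma>. a * g p \<sigma>)"
  using g_act[OF FA_scal] by (simp add: L.rho_scal[abs_def])

lemma g_eq_zero: "p \<in> carrier P \<Longrightarrow> g p = (\<lambda>_. 0) \<Longrightarrow> p = \<zero>\<^bsub>P\<^esub>"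
  using inj_onD[OF g_inj, of p "\<zero>\<^bsub>P\<^esub>"] g_zero by simp

lemma g_lincomb: "p \<in> carrier P \<Longrightarrow> p' \<in> carrier P \<Longrightarrow>
    g (act (scal a) p \<oplus>\<^bsub>P\<^esub> act (scal b) p') = (\<lambda>\<sigma>. a * g p \<sigma> + b * g p' \<sigma>)"
  by (simp add: g_add g_scal act_closed FA_scal)

lemma sm_carrier: "submodule N A P \<Longrightarrow> p \<in> N \<Longrightarrow> p \<in> carrier P"
  using P.sm_subset by blast

lemma sm_act: "submodule N A P \<Longrightarrow> f \<in> AF n \<Longrightarrow> p \<in> N \<Longrightarrow> act f p \<in> N"
  by (simp add: submodule_act_iff)

lemma subsp_g: "submodule N A P \<Longrightarrow> subsp (g ` N)"
  unfolding subsp_def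
proof (intro conjI ballI allI)
  assume N: "submodule N A P"
  show "g ` N \<subseteq> V" using g_V sm_carrier[OF N] by blast
  show "(\<lambda>_. 0) \<in> g ` N" using g_zero P.sm_zero[OF N] by (metis image_eqI)
  fix v w a b assume "v \<in> g ` N" "w \<in> g ` N"
  then obtain p p' where p: "p \<in> N" "v = g p" "p' \<in> N" "w = g p'" by blast
  have "act (scal a) p \<oplus>\<^bsub>P\<^esub> act (scal b) p' \<in> N"
    using p by (intro P.sm_add[OF N] sm_act[OF N] FA_scal)
  then show "(\<lambda>\<sigma>. a * v \<sigma> + b * w \<sigma>) \<in> g ` N"
    using g_lincomb[of p p' a b] p sm_carrier[OF N] by (intro image_eqI) auto
qed

lemma subsp_W: "submodule N A P \<Longrightarrow> subsp (W N)"
  unfolding subsp_def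
proof (intro conjI ballI allI)
  assume N: "submodule N A P"
  show "W N \<subseteq> V" unfolding W_def using g_V sm_carrier[OF N] L.rho_V[OF eJ_FA] by blast
  show "(\<lambda>_. 0) \<in> W N" unfolding W_def using P.sm_zero[OF N]
    by (intro image_eqI[of _ _ "\<zero>\<^bsub>P\<^esub>"]) (simp_all add: g_zero L.rho_vzero)
  fix v w a b assume "v \<in> W N" "w \<in> W N"
  then obtain p p' where p: "p \<in> N" "v = L.rho eJ (g p)" "p' \<in> N" "w = L.rho eJ (g p')"
    unfolding W_def by blast
  have "act (scal a) p \<oplus>\<^bsub>P\<^esub> act (scal b) p' \<in> N"
    using p by (intro P.sm_add[OF N] sm_act[OF N] FA_scal)
  then show "(\<lambda>\<sigma>. a * v \<sigma> + b * w \<sigma>) \<in> W N"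
    unfolding W_def using g_lincomb[of p p' a b] p sm_carrier[OF N]
    by (intro image_eqI) (auto simp: L.rho_lincomb)
qed

lemma act_eJ_idem: "p \<in> carrier P \<Longrightarrow> act eJ (act eJ p) = act eJ p"
  using inj_onD[OF g_inj, of "act eJ (act eJ p)" "act eJ p"] g_act[OF eJ_FA] eJ_idem g_V act_closed[OF eJ_FA]
  by simp

lemma gchar_eq_XJ:
  assumes "\<forall>j\<in>{1..n}. d' j = d j" "\<forall>i\<in>{1..<n}. d i = d (Suc i) \<longrightarrow> (i \<in> E' \<longleftrightarrow> i \<in> EJ)" "h \<in> AF n"
  shows "eval_character (gchar u d' E') h = XJ h"
  using assms(3)
proof (rule eval_character_cong)
  fix x assume "x \<in> ak_gens n"
  then show "gchar u d' E' x = gchar u d EJ x"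
    using assms(1,2) by (cases x) auto
qed

text \<open>\<open>eJ\<close> vanishes under every character that differs from \<open>XJ\<close>,
  and under \<open>XJ\<close> the first factor vanishes.\<close>

lemma JJ_eJ: "f \<in> AF n \<Longrightarrow> (f - scal (XJ f)) * eJ \<in> JJ"
  unfolding JJ_def
proof (intro CollectI conjI allI impI)
  assume f: "f \<in> AF n"
  then show "(f - scal (XJ f)) * eJ \<in> AF n" using eJ_FA by (intro FA_mult FA_diff FA_scal)
  fix d' E' assume d': "\<forall>j\<in>{1..n}. d' j \<in> {1..r}"
  let ?m = "(\<forall>j\<in>{1..n}. d' j = d j) \<and> (\<forall>i\<in>{1..<n}. d i = d (Suc i) \<longrightarrow> (i \<in> E' \<longleftrightarrow> i \<in> EJ))"
  show "eval_character (gchar u d' E') ((f - scal (XJ f)) * eJ) = 0"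
  proof (cases ?m)
    case True
    then have "eval_character (gchar u d' E') f = XJ f" using gchar_eq_XJ f by blast
    then show ?thesis by simp
  next
    case False
    have "eval_character (gchar u d' E') eJ = (if ?m then 1 else 0)"
      using d' by (intro eJ_char) blast
    with False have "eval_character (gchar u d' E') eJ = 0" by argo
    then show ?thesis by simp
  qed
qed

lemma JJ_ideal: "k \<in> JJ \<Longrightarrow> f \<in> AF n \<Longrightarrow> f * k \<in> JJ"
  and JJ_add: "k \<in> JJ \<Longrightarrow> k' \<in> JJ \<Longrightarrow> k + k' \<in> JJ"
  and JJ_FA: "k \<in> JJ \<Longrightarrow> k \<in> AF n"
  by (auto simp: JJ_def intro: FA_intros)

lemma JJ_zero: "0 \<in> JJ"
  by (simp add: JJ_def FA_zero)

lemma JJ_nilpotent: "k \<in> JJ \<Longrightarrow> p \<in> carrier P \<Longrightarrow> act (k ^ height) p = \<zero>\<^bsub>P\<^esub>"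
  using rho_nilpotent_characters[of k "g p"] g_V g_act[of "k ^ height" p] act_closed[of "k ^ height" p]
  by (intro g_eq_zero) (auto simp: JJ_def FA_power)

text \<open>Nakayama's argument: \<open>k\<close> is nilpotent on \<open>P\<close>, so
  \<open>1 - k\<close> can be inverted by a geometric series, and \<open>p\<close> is recovered from
  its image in \<open>N\<close>.\<close>

lemma not_JJ_fixed:
  assumes N: "submodule N A P" and k: "k \<in> JJ" and p: "p \<in> carrier P" and e: "p \<ominus>\<^bsub>P\<^esub> act k p \<in> N"
  shows "p \<in> N"
proof -
  have kF: "\<And>t. k ^ t \<in> AF n" using k JJ_FA FA_power by blast
  have "act (1 - k ^ t) p \<in> N" for t
  proof (induction t)
    case 0
    then show ?case using P.sm_zero[OF N] p by (simp add: act_zero)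
  next
    case (Suc t)
    have 1: "act (1 - k) p \<in> N" using e p k JJ_FA by (simp add: act_diff FA_one act_one)
    have "act (k * (1 - k ^ t)) p = act k (act (1 - k ^ t) p)"
      using k JJ_FA kF p by (intro act_mult) (auto intro: FA_intros)
    then have "act (k * (1 - k ^ t)) p \<in> N" using Suc k JJ_FA sm_act[OF N] by simp
    with 1 have "act (1 - k) p \<oplus>\<^bsub>P\<^esub> act (k * (1 - k ^ t)) p \<in> N" by (rule P.sm_add[OF N])
    also have "act (1 - k) p \<oplus>\<^bsub>P\<^esub> act (k * (1 - k ^ t)) p = act ((1 - k) + k * (1 - k ^ t)) p"
      using k JJ_FA kF p by (intro act_add[symmetric]) (auto intro!: FA_intros)
    also have "(1 - k) + k * (1 - k ^ t) = 1 - k ^ Suc t" by (simp add: algebra_simps)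
    finally show ?case .
  qed
  from this[of height] have "p \<ominus>\<^bsub>P\<^esub> \<zero>\<^bsub>P\<^esub> \<in> N"
    using p kF JJ_nilpotent[OF k p] by (simp add: act_diff FA_one act_one)
  moreover have "p \<ominus>\<^bsub>P\<^esub> \<zero>\<^bsub>P\<^esub> = p"
    using p P.M.minus_equality[of "\<zero>\<^bsub>P\<^esub>" "\<zero>\<^bsub>P\<^esub>"] by (simp add: P.M.minus_eq)
  ultimately show ?thesis by simp
qed

definition quotient_character :: "'p set \<Rightarrow> 'p set \<Rightarrow> ('p \<Rightarrow> complex) \<Rightarrow> bool" where
  "quotient_character N1 N2 \<kappa> \<longleftrightarrow> (\<forall>x\<in>N2. \<forall>y\<in>N2. \<kappa> (x \<oplus>\<^bsub>P\<^esub> y) = \<kappa> x + \<kappa> y) \<and> (\<forall>f\<in>AF n. \<forall>x\<in>N2. \<kappa> (act f x) = XJ f * \<kappa> x) \<and>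
      (\<forall>x\<in>N2. \<kappa> x = 0 \<longleftrightarrow> x \<in> N1) \<and> \<kappa> ` N2 = UNIV"

text \<open>The number \<open>card (lead (W N))\<close>, the dimension of the image of \<open>eJ\<close> on \<open>N\<close>, counts the
  composition factors of \<open>N\<close> with character \<open>XJ\<close>.\<close>

lemma composition_step:
  assumes N: "submodule N1 A P" "submodule N2 A P" "N1 \<subseteq> N2"
    and simple: "simple_module A (quot_module (P\<lparr>carrier := N2\<rparr>) N1)"
  defines "isoJ \<equiv> \<exists>\<chi>. quotient_character N1 N2 \<chi>"
  shows "card (lead (W N2)) = card (lead (W N1)) + (if isoJ then 1 else 0)"
proof (cases "\<forall>p\<in>N2. act eJ p \<in> N1")
  case True
  \<comment> \<open>Idempotence of \<open>eJ\<close> allows \<open>p\<close> to be replaced by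
    \<open>act eJ p\<close>, which already lies in \<open>N1\<close>.\<close>
  have "W N2 \<subseteq> W N1"
  proof
    fix v assume "v \<in> W N2"
    then obtain p where p: "p \<in> N2" "v = L.rho eJ (g p)" by (auto simp: W_def)
    then have "v = L.rho eJ (g (act eJ p))"
      using eJ_idem[OF g_V] sm_carrier[OF N(2)] g_act[OF eJ_FA] by simp
    then show "v \<in> W N1" using True p by (auto simp: W_def)
  qed
  then have "W N2 = W N1" using N(3) by (auto simp: W_def)
  moreover have "\<not> isoJ"
  proof
    assume isoJ
    then obtain \<chi> where "quotient_character N1 N2 \<chi>" unfolding isoJ_def by blast
    then have chi: "\<And>f x. f \<in> AF n \<Longrightarrow> x \<in> N2 \<Longrightarrow> \<chi> (act f x) = XJ f * \<chi> x"
      "\<And>x. x \<in> N2 \<Longrightarrow> \<chi> x = 0 \<longleftrightarrow> x \<in> N1" "\<chi> ` N2 = (UNIV :: complex set)"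
      unfolding quotient_character_def by simp_all
    have "(1 :: complex) \<in> \<chi> ` N2" using chi(3) by simp
    then obtain p where p: "p \<in> N2" "\<chi> p = 1" by (elim imageE) simp
    have "XJ eJ = 1" using eJ_char[where d' = d and E' = EJ, OF d_range] by simp
    then have "\<chi> (act eJ p) = 1" using chi(1)[OF eJ_FA p(1)] p(2) by simp
    moreover have "\<chi> (act eJ p) = 0"
      using chi(2)[OF sm_act[OF N(2) eJ_FA p(1)]] True p(1) by blast
    ultimately show False by simp
  qed
  ultimately show ?thesis by simp
next
  case False
  then obtain p0 where p0: "p0 \<in> N2" "act eJ p0 \<notin> N1" by blast
  define p where "p = act eJ p0"
  have p: "p \<in> N2" "p \<notin> N1" "p \<in> carrier P" "act eJ p = p"
    using p0 sm_act[OF N(2) eJ_FA] sm_carrier[OF N(2)] act_eJ_idem by (auto simp: p_def)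
  note c1 = sm_carrier[OF N(1)] and c2 = sm_carrier[OF N(2)]
  \<comment> \<open>\<open>N1\<close> together with the \<open>JJ\<close>-multiples of
    \<open>p\<close> is a submodule between \<open>N1\<close> and \<open>N2\<close>. It is not
    \<open>N2\<close>, since \<open>not_JJ_fixed\<close> would put \<open>p\<close> into
    \<open>N1\<close>; so it is \<open>N1\<close>.\<close>
  have Jp: "act k p \<in> N1" if k: "k \<in> JJ" for k
  proof -
    let ?M = "{m \<oplus>\<^bsub>P\<^esub> act k p | m k. m \<in> N1 \<and> k \<in> JJ}"
    have "submodule ?M A P"
      unfolding submodule_act_iff
    proof (intro conjI ballI)
      show "?M \<subseteq> carrier P" using c1 p act_closed JJ_FA by auto
      show "\<zero>\<^bsub>P\<^esub> \<in> ?M"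
        using P.sm_zero[OF N(1)] JJ_zero p(3)
        by (intro CollectI exI[of _ "\<zero>\<^bsub>P\<^esub>"] exI[of _ 0]) (simp add: act_zero)
      fix x assume "x \<in> ?M"
      then obtain m k where x: "x = m \<oplus>\<^bsub>P\<^esub> act k p" "m \<in> N1" "k \<in> JJ" by blast
      note xc = c1[OF x(2)] act_closed[OF JJ_FA[OF x(3)] p(3)]
      {
        fix y assume "y \<in> ?M"
        then obtain m' k' where y: "y = m' \<oplus>\<^bsub>P\<^esub> act k' p" "m' \<in> N1" "k' \<in> JJ" by blast
        note yc = c1[OF y(2)] act_closed[OF JJ_FA[OF y(3)] p(3)]
        have "x \<oplus>\<^bsub>P\<^esub> y = (m \<oplus>\<^bsub>P\<^esub> m') \<oplus>\<^bsub>P\<^esub> act (k + k') p"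
          using x y xc yc p(3) JJ_FA by (simp add: act_add P.M.a_ac)
        then show "x \<oplus>\<^bsub>P\<^esub> y \<in> ?M"
          using JJ_add[OF x(3) y(3)] P.sm_add[OF N(1) x(2) y(2)] by blast
      }
      fix f assume f: "f \<in> AF n"
      have "act f x = act f m \<oplus>\<^bsub>P\<^esub> act (f * k) p"
        using x xc f p(3) JJ_FA by (simp add: act_radd act_mult)
      then show "act f x \<in> ?M"
        using JJ_ideal[OF x(3) f] sm_act[OF N(1) f x(2)] by blast
    qed
    moreover have "N1 \<subseteq> ?M"
    proof
      fix m assume "m \<in> N1"
      then show "m \<in> ?M" using JJ_zero p(3) c1
        by (intro CollectI exI[of _ m] exI[of _ 0]) (simp add: act_zero)
    qed
    moreover have "?M \<subseteq> N2"
    proof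
      fix x assume "x \<in> ?M"
      then obtain m k where x: "x = m \<oplus>\<^bsub>P\<^esub> act k p" "m \<in> N1" "k \<in> JJ" by blast
      then show "x \<in> N2"
        using P.sm_add[OF N(2)] sm_act[OF N(2) JJ_FA[OF x(3)] p(1)] N(3) by blast
    qed
    ultimately have "?M = N1 \<or> ?M = N2"
      by (rule P.simple_subq_no_intermediate(2)[OF N simple])
    moreover have "?M \<noteq> N2"
    proof
      assume "?M = N2"
      then obtain m k where m: "p = m \<oplus>\<^bsub>P\<^esub> act k p" "m \<in> N1" "k \<in> JJ" using p(1) by blast
      have cc: "m \<in> carrier P" "act k p \<in> carrier P" using m c1 act_closed JJ_FA p(3) by auto
      have "p \<ominus>\<^bsub>P\<^esub> act k p = (m \<oplus>\<^bsub>P\<^esub> act k p) \<ominus>\<^bsub>P\<^esub> act k p" by (subst m(1)) (rule refl)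
      also have "\<dots> = m" using cc by (simp add: P.M.minus_eq P.M.a_assoc P.M.r_neg)
      finally show False using not_JJ_fixed[OF N(1) m(3) p(3)] m(2) p(2) by simp
    qed
    moreover have "act k p \<in> ?M"
      using k p(3) P.sm_zero[OF N(1)] act_closed[OF JJ_FA[OF k] p(3)]
      by (intro CollectI exI[of _ "\<zero>\<^bsub>P\<^esub>"] exI[of _ k]) simp
    ultimately show ?thesis by auto
  qed
  \<comment> \<open>As \<open>eJ\<close> fixes \<open>p\<close>, the difference between
    \<open>f\<close> and its character value acts on \<open>p\<close> like an element of
    \<open>JJ\<close>. Modulo \<open>N1\<close> the vector \<open>p\<close> therefore spans a
    submodule of dimension one, which by simplicity is all of \<open>N2 / N1\<close>.\<close>
  have fp: "act f p \<ominus>\<^bsub>P\<^esub> act (scal (XJ f)) p \<in> N1" if f: "f \<in> AF n" for f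
  proof -
    have "act ((f - scal (XJ f)) * eJ) p = act f p \<ominus>\<^bsub>P\<^esub> act (scal (XJ f)) p"
      using f p by (simp add: act_mult act_diff FA_diff FA_scal eJ_FA)
    then show ?thesis using Jp[OF JJ_eJ[OF f]] by simp
  qed
  let ?M = "{m \<oplus>\<^bsub>P\<^esub> act (scal a) p | m a. m \<in> N1}"
  have sc: "act (scal a) p \<in> carrier P" for a using act_closed[OF FA_scal p(3)] .
  have fmap: "act f (m \<oplus>\<^bsub>P\<^esub> act (scal a) p) =
      (act f m \<oplus>\<^bsub>P\<^esub> act (scal a) (act f p \<ominus>\<^bsub>P\<^esub> act (scal (XJ f)) p)) \<oplus>\<^bsub>P\<^esub> act (scal (XJ f * a)) p"
    if f: "f \<in> AF n" and m: "m \<in> N1" for f m a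
  proof -
    have "act f (act (scal a) p) = act (scal a * f) p"
      using f p(3) by (simp add: act_mult[symmetric] FA_scal scal_comm)
    also have "scal a * f = scal a * (f - scal (XJ f)) + scal (XJ f * a)"
      by (simp add: algebra_simps scal_mult scal_comm[of "scal a"])
    also have "act \<dots> p = act (scal a) (act f p \<ominus>\<^bsub>P\<^esub> act (scal (XJ f)) p) \<oplus>\<^bsub>P\<^esub> act (scal (XJ f * a)) p"
      using f p(3) by (simp add: act_add act_mult act_diff FA_intros)
    finally have e: "act f (act (scal a) p) =
      act (scal a) (act f p \<ominus>\<^bsub>P\<^esub> act (scal (XJ f)) p) \<oplus>\<^bsub>P\<^esub> act (scal (XJ f * a)) p" .
    have "act (scal a) (act f p \<ominus>\<^bsub>P\<^esub> act (scal (XJ f)) p) \<in> carrier P"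
      using f p(3) by (intro act_closed FA_scal P.M.minus_closed)
    then show ?thesis
      using f c1[OF m] sc[of a] sc[of "XJ f * a"] act_closed[OF f c1[OF m]]
      by (simp add: act_radd e P.M.a_assoc)
  qed
  have nadd: "act f m \<oplus>\<^bsub>P\<^esub> act (scal a) (act f p \<ominus>\<^bsub>P\<^esub> act (scal (XJ f)) p) \<in> N1" if "f \<in> AF n" "m \<in> N1" for f m a
    using that fp by (intro P.sm_add[OF N(1)] sm_act[OF N(1)] FA_scal)
  have madd: "(m \<oplus>\<^bsub>P\<^esub> act (scal a) p) \<oplus>\<^bsub>P\<^esub> (m' \<oplus>\<^bsub>P\<^esub> act (scal a') p) =
      (m \<oplus>\<^bsub>P\<^esub> m') \<oplus>\<^bsub>P\<^esub> act (scal (a + a')) p" if "m \<in> N1" "m' \<in> N1" for m m' a a'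
    using that c1 sc by (simp add: scal_add act_add FA_scal p(3) P.M.a_ac)
  have "submodule ?M A P"
    unfolding submodule_act_iff
  proof (intro conjI ballI)
    show "?M \<subseteq> carrier P" using c1 sc by auto
    show "\<zero>\<^bsub>P\<^esub> \<in> ?M"
      using P.sm_zero[OF N(1)] p(3)
      by (intro CollectI exI[of _ "\<zero>\<^bsub>P\<^esub>"] exI[of _ 0]) (simp add: act_zero)
    fix x assume "x \<in> ?M"
    then obtain m a where x: "x = m \<oplus>\<^bsub>P\<^esub> act (scal a) p" "m \<in> N1" by blast
    {
      fix y assume "y \<in> ?M"
      then obtain m' a' where y: "y = m' \<oplus>\<^bsub>P\<^esub> act (scal a') p" "m' \<in> N1" by blast
      then show "x \<oplus>\<^bsub>P\<^esub> y \<in> ?M"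
        using madd[OF x(2) y(2)] P.sm_add[OF N(1) x(2) y(2)] unfolding x y by blast
    }
    fix f assume "f \<in> AF n"
    then show "act f x \<in> ?M"
      using fmap nadd x(2) unfolding x(1) by blast
  qed
  moreover have "N1 \<subseteq> ?M"
  proof
    fix m assume "m \<in> N1"
    then show "m \<in> ?M" using p(3) c1
      by (intro CollectI exI[of _ m] exI[of _ 0]) (simp add: act_zero)
  qed
  moreover have "?M \<subseteq> N2"
    using P.sm_add[OF N(2)] sm_act[OF N(2) FA_scal p(1)] N(3) by blast
  ultimately have "?M = N1 \<or> ?M = N2"
    by (rule P.simple_subq_no_intermediate(2)[OF N simple])
  moreover have "p \<in> ?M"
    using P.sm_zero[OF N(1)] p(3)
    by (intro CollectI exI[of _ "\<zero>\<^bsub>P\<^esub>"] exI[of _ 1]) (simp add: act_one)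
  ultimately have M: "?M = N2" using p(2) by blast
  have scN1: "a = 0" if "act (scal a) p \<in> N1" for a
  proof (rule ccontr)
    assume a: "a \<noteq> 0"
    have "act (scal (1 / a)) (act (scal a) p) \<in> N1" using that sm_act[OF N(1) FA_scal] by blast
    moreover have "act (scal (1 / a)) (act (scal a) p) = p"
      using a p(3) by (simp add: act_mult[symmetric] FA_scal scal_mult[symmetric] act_one)
    ultimately show False using p(2) by simp
  qed
  have uniq: "a = a'" if m: "m \<in> N1" "m' \<in> N1" and e: "m \<oplus>\<^bsub>P\<^esub> act (scal a) p = m' \<oplus>\<^bsub>P\<^esub> act (scal a') p" for m m' a a'
  proof -
    have "act (scal a) p = (\<ominus>\<^bsub>P\<^esub> m) \<oplus>\<^bsub>P\<^esub> (m \<oplus>\<^bsub>P\<^esub> act (scal a) p)"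
      using m c1 sc by (simp add: P.M.a_assoc[symmetric] P.M.l_neg)
    also have "\<dots> = (\<ominus>\<^bsub>P\<^esub> m \<oplus>\<^bsub>P\<^esub> m') \<oplus>\<^bsub>P\<^esub> act (scal a') p"
      unfolding e using m c1 sc by (simp add: P.M.a_assoc)
    finally have "act (scal a) p \<ominus>\<^bsub>P\<^esub> act (scal a') p = \<ominus>\<^bsub>P\<^esub> m \<oplus>\<^bsub>P\<^esub> m'"
      using m c1 sc by (simp add: P.M.minus_eq P.M.a_assoc P.M.r_neg)
    moreover have "\<ominus>\<^bsub>P\<^esub> m \<oplus>\<^bsub>P\<^esub> m' \<in> N1"
      using m P.sm_add[OF N(1)] P.sm_minus[OF N(1)] by blast
    ultimately have "act (scal (a - a')) p \<in> N1"
      using p(3) by (simp add: scal_diff act_diff FA_scal)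
    then show ?thesis using scN1 by fastforce
  qed
  \<comment> \<open>The coordinate along \<open>p\<close>; it is well defined by
    \<open>uniq\<close>.\<close>
  define \<chi> where "\<chi> x = (THE a. \<exists>m\<in>N1. x = m \<oplus>\<^bsub>P\<^esub> act (scal a) p)" for x
  have chi: "\<chi> (m \<oplus>\<^bsub>P\<^esub> act (scal a) p) = a" if "m \<in> N1" for m a
    unfolding \<chi>_def using that uniq by (intro the_equality) blast+
  have rep: "\<exists>m a. m \<in> N1 \<and> x = m \<oplus>\<^bsub>P\<^esub> act (scal a) p" if "x \<in> N2" for x
    using that unfolding M[symmetric] by blast
  have isoJ
    unfolding isoJ_def quotient_character_def
  proof (intro exI[of _ \<chi>] conjI ballI)
    fix x assume x: "x \<in> N2"
    obtain m a where xm: "m \<in> N1" "x = m \<oplus>\<^bsub>P\<^esub> act (scal a) p" using rep[OF x] by blast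
    {
      fix y assume y: "y \<in> N2"
      obtain m' a' where ym: "m' \<in> N1" "y = m' \<oplus>\<^bsub>P\<^esub> act (scal a') p" using rep[OF y] by blast
      show "\<chi> (x \<oplus>\<^bsub>P\<^esub> y) = \<chi> x + \<chi> y"
        unfolding xm ym madd[OF xm(1) ym(1)] using xm ym P.sm_add[OF N(1)] by (simp add: chi)
    }
    {
      fix f assume f: "f \<in> AF n"
      show "\<chi> (act f x) = XJ f * \<chi> x"
        unfolding xm fmap[OF f xm(1)] chi[OF nadd[OF f xm(1)]] chi[OF xm(1)] ..
    }
    show "\<chi> x = 0 \<longleftrightarrow> x \<in> N1"
    proof
      assume "\<chi> x = 0"
      then have "a = 0" using chi xm by simp
      then show "x \<in> N1" using xm p(3) c1 by (simp add: act_zero)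
    next
      assume "x \<in> N1"
      moreover have "x = x \<oplus>\<^bsub>P\<^esub> act (scal 0) p" using c1[OF \<open>x \<in> N1\<close>] p(3) by (simp add: act_zero)
      ultimately show "\<chi> x = 0" using chi by metis
    qed
  next
    have "a \<in> \<chi> ` N2" for a
    proof (rule image_eqI)
      show "a = \<chi> (\<zero>\<^bsub>P\<^esub> \<oplus>\<^bsub>P\<^esub> act (scal a) p)" using chi[OF P.sm_zero[OF N(1)]] by simp
      show "\<zero>\<^bsub>P\<^esub> \<oplus>\<^bsub>P\<^esub> act (scal a) p \<in> N2" unfolding M[symmetric] using P.sm_zero[OF N(1)] by blast
    qed
    then show "\<chi> ` N2 = UNIV" by auto
  qed
  moreover have "card (lead (W N2)) = Suc (card (lead (W N1)))"
  proof (rule card_lead_extend[OF subsp_W[OF N(1)], where p = "g p"])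
    show "g p \<in> V" using g_V p(3) .
    have gp: "L.rho eJ (g p) = g p" using g_act[OF eJ_FA p(3)] p(4) by simp
    show "g p \<notin> W N1"
    proof
      assume "g p \<in> W N1"
      then obtain m where m: "m \<in> N1" "g p = L.rho eJ (g m)" by (auto simp: W_def)
      then have "g p = g (act eJ m)" using g_act[OF eJ_FA] c1 by simp
      then have "p = act eJ m" using g_inj p(3) act_closed[OF eJ_FA] c1 m by (auto dest: inj_onD)
      then show False using p(2) sm_act[OF N(1) eJ_FA m(1)] by simp
    qed
    have key: "L.rho eJ (g (m \<oplus>\<^bsub>P\<^esub> act (scal a) p)) = (\<lambda>\<sigma>. L.rho eJ (g m) \<sigma> + a * g p \<sigma>)" if "m \<in> N1" for m a
      using that c1 p(3) sc by (simp add: g_add g_scal L.rho_vadd L.rho_vscale gp)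
    show "W N2 = {(\<lambda>\<sigma>. w \<sigma> + a * g p \<sigma>) | w a. w \<in> W N1}"
    proof
      show "W N2 \<subseteq> {(\<lambda>\<sigma>. w \<sigma> + a * g p \<sigma>) | w a. w \<in> W N1}"
      proof
        fix v assume "v \<in> W N2"
        then obtain x where "x \<in> N2" "v = L.rho eJ (g x)" by (auto simp: W_def)
        moreover from this rep obtain m a where "m \<in> N1" "x = m \<oplus>\<^bsub>P\<^esub> act (scal a) p" by blast
        ultimately show "v \<in> {(\<lambda>\<sigma>. w \<sigma> + a * g p \<sigma>) | w a. w \<in> W N1}"
          by (intro CollectI exI[of _ "L.rho eJ (g m)"] exI[of _ a]) (auto simp: key W_def)
      qed
      show "{(\<lambda>\<sigma>. w \<sigma> + a * g p \<sigma>) | w a. w \<in> W N1} \<subseteq> W N2"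
      proof
        fix v assume "v \<in> {(\<lambda>\<sigma>. w \<sigma> + a * g p \<sigma>) | w a. w \<in> W N1}"
        then obtain m a where m: "m \<in> N1" "v = (\<lambda>\<sigma>. L.rho eJ (g m) \<sigma> + a * g p \<sigma>)" by (auto simp: W_def)
        have "m \<oplus>\<^bsub>P\<^esub> act (scal a) p \<in> N2" unfolding M[symmetric] using m(1) by blast
        then show "v \<in> W N2" unfolding W_def by (rule image_eqI[rotated]) (simp only: key[OF m(1)] m(2))
      qed
    qed
    show "subsp (W N2)" by (rule subsp_W[OF N(2)])
  qed
  ultimately show ?thesis by simp
qed

text \<open>\<open>eJ\<close> and \<open>eR E\<close> commute, are triangular and are idempotent on
  \<open>V\<close>, so \<open>lead_idempotent_image\<close> applies to their product. Its diagonal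
  at \<sigma> is a product of two indicators, one for the colors and descents of \<sigma>, one for
  the descents of its inverse.\<close>

lemma lead_W_carrier: "lead (W (carrier P)) = cartan_perms n c E d EJ"
proof -
  let ?T = "\<lambda>v. L.rho eJ (R.rho (eR E) v)"
  let ?l = "\<lambda>\<sigma>. eval_character (\<lambda>g. ldg g \<sigma>) eJ" and ?r = "\<lambda>\<sigma>. eval_character (\<lambda>g. rdg g \<sigma>) (eR E)"
  have "W (carrier P) = (\<lambda>v. L.rho eJ v) ` Q"
    unfolding W_def g_Q[symmetric] image_image ..
  also have "\<dots> = ?T ` V" unfolding Q_def image_image ..
  finally have "lead (W (carrier P)) = lead (?T ` V)" by simp
  also have "\<dots> = {\<sigma>\<in>BB. ?l \<sigma> * ?r \<sigma> \<noteq> 0}"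
  proof (rule lead_idempotent_image)
    fix v assume v: "v \<in> V"
    have R: "R.rho (eR E) v \<in> V" by (rule R.rho_V[OF FA_eR v])
    show "?T v \<in> V" by (rule L.rho_V[OF eJ_FA R])
    have "?T (?T v) = L.rho eJ (L.rho eJ (R.rho (eR E) (R.rho (eR E) v)))"
      by (simp only: rho_commute[OF eJ_FA FA_eR R])
    then show "?T (?T v) = ?T v" using eR_idem[OF v] eJ_idem[OF R] by simp
    fix \<sigma> assume \<sigma>: "\<sigma> \<in> BB" "top_at \<sigma> v"
    have "top_at \<sigma> (R.rho (eR E) v)"
      unfolding top_at_def
    proof (intro ballI impI)
      fix \<tau> assume \<tau>: "\<tau> \<in> BB" "srank n \<sigma> < srank n \<tau>"
      then have "top_at \<tau> v" "v \<tau> = 0" using \<sigma>(2) by (auto simp: top_at_def)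
      then show "R.rho (eR E) v \<tau> = 0" using R.rho_diag[OF FA_eR v \<tau>(1)] by simp
    qed
    then show "?T v \<sigma> = ?l \<sigma> * ?r \<sigma> * v \<sigma>"
      using L.rho_diag[OF eJ_FA R \<sigma>(1)] R.rho_diag[OF FA_eR v \<sigma>] by simp
  qed
  also have "\<dots> = cartan_perms n c E d EJ"
  proof -
    have "?l \<sigma> * ?r \<sigma> \<noteq> 0 \<longleftrightarrow> (\<forall>j\<in>{1..n}. c (\<sigma> j) = d j) \<and>
       (\<forall>i\<in>{1..<n}. d i = d (Suc i) \<longrightarrow> (\<sigma> (Suc i) < \<sigma> i \<longleftrightarrow> i \<in> EJ)) \<and>
       (\<forall>i\<in>{1..<n}. c i = c (Suc i) \<longrightarrow> (pinv \<sigma> (Suc i) < pinv \<sigma> i \<longleftrightarrow> i \<in> E))" if "\<sigma> \<in> BB" for \<sigma>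
    proof -
      have "(c \<circ> \<sigma>) j \<in> {1..r}" if "j \<in> {1..n}" for j
        using color_range \<open>\<sigma> \<in> BB\<close> that by simp
      then show ?thesis
        unfolding ldg_def eval_eR_rdg using eJ_char[of "c \<circ> \<sigma>" "{i. \<sigma> (Suc i) < \<sigma> i}"]
        by (auto simp: Req_def)
    qed
    then show ?thesis by (auto simp: cartan_perms_def)
  qed
  finally show ?thesis .
qed

text \<open>The number of leading positions drops strictly from a submodule to a smaller one. A
  proper submodule for which it is greatest is therefore maximal, and the induction continues below
  it.\<close>

lemma composition_series_exists:
  assumes "submodule N A P"
  shows "\<exists>Ms. Ms \<noteq> [] \<and> hd Ms = {\<zero>\<^bsub>P\<^esub>} \<and> last Ms = N \<and> (\<forall>N\<in>set Ms. submodule N A P) \<and>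
     (\<forall>i. Suc i < length Ms \<longrightarrow> Ms ! i \<subseteq> Ms ! Suc i \<and> simple_module A (composition_factor P Ms i))"
  using assms
proof (induction "card (lead (g ` N))" arbitrary: N rule: less_induct)
  case less
  have strict: "card (lead (g ` N1)) < card (lead (g ` N2))"
    if s: "submodule N1 A P" "submodule N2 A P" "N1 \<subset> N2" for N1 N2
  proof -
    have "g ` N1 \<subseteq> g ` N2" using s by auto
    moreover have "g ` N1 \<noteq> g ` N2"
      using s sm_carrier inj_on_image_eq_iff[OF g_inj, of N1 N2] P.sm_subset by blast
    ultimately have "lead (g ` N1) \<noteq> lead (g ` N2)"
      using lead_eq_imp_eq[OF subsp_g[OF s(1)] subsp_g[OF s(2)]] by blast
    moreover have "lead (g ` N1) \<subseteq> lead (g ` N2)" using \<open>g ` N1 \<subseteq> g ` N2\<close> by (rule lead_mono)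
    ultimately show ?thesis using finite_lead by (intro psubset_card_mono) auto
  qed
  show ?case
  proof (cases "N = {\<zero>\<^bsub>P\<^esub>}")
    case True
    then show ?thesis by (intro exI[of _ "[N]"]) (auto simp: zero_submodule)
  next
    case False
    let ?S = "{N'. submodule N' A P \<and> N' \<subset> N}"
    let ?m = "\<lambda>N'. card (lead (g ` N'))"
    have z: "{\<zero>\<^bsub>P\<^esub>} \<in> ?S" using zero_submodule False P.sm_zero[OF less.prems] by auto
    have "\<exists>N'. N' \<in> ?S \<and> (\<forall>M. M \<in> ?S \<longrightarrow> ?m M \<le> ?m N')"
      by (rule ex_has_greatest_nat[where P = "\<lambda>N'. N' \<in> ?S" and f = ?m, OF z, where b = "Suc (?m N)"])
         (use strict[OF _ less.prems] in \<open>auto intro: less_SucI\<close>)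
    then obtain N' where N': "submodule N' A P" "N' \<subset> N" "\<And>M. M \<in> ?S \<Longrightarrow> ?m M \<le> ?m N'" by blast
    obtain Ms where Ms: "Ms \<noteq> []" "hd Ms = {\<zero>\<^bsub>P\<^esub>}" "last Ms = N'" "\<forall>N\<in>set Ms. submodule N A P"
      "\<forall>i. Suc i < length Ms \<longrightarrow> Ms ! i \<subseteq> Ms ! Suc i \<and> simple_module A (composition_factor P Ms i)"
      using less.hyps[OF strict[OF N'(1) less.prems N'(2)] N'(1)] by blast
    have "simple_module A (quot_module (P\<lparr>carrier := N\<rparr>) N')"
    proof (rule P.simple_subqI[OF N'(1) less.prems])
      fix M assume M: "submodule M A P" "N' \<subseteq> M" "M \<subseteq> N"
      show "M = N' \<or> M = N"
      proof (rule ccontr)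
        assume "\<not> ?thesis"
        then have "M \<in> ?S" "N' \<subset> M" using M by auto
        then show False using strict[OF N'(1) M(1)] N'(3)[of M] by auto
      qed
    qed (use N' in auto)
    moreover have "Ms ! (length Ms - 1) = N'" using Ms by (simp add: last_conv_nth)
    ultimately have last: "Ms ! (length Ms - 1) \<subseteq> N \<and> simple_module A (quot_module (P\<lparr>carrier := N\<rparr>) (Ms ! (length Ms - 1)))"
      using N'(2) by auto
    have "(Ms @ [N]) ! i \<subseteq> (Ms @ [N]) ! Suc i \<and> simple_module A (composition_factor P (Ms @ [N]) i)"
      if i: "Suc i < length (Ms @ [N])" for i
    proof (cases "Suc i < length Ms")
      case True
      then show ?thesis using Ms(5) by (simp add: composition_factor_def nth_append)
    next
      case False
      then have "i = length Ms - 1" "Suc i = length Ms" using i Ms(1) by auto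
      then show ?thesis using last by (simp add: composition_factor_def nth_append)
    qed
    with Ms(1,2,4) less.prems show ?thesis
      by (intro exI[of _ "Ms @ [N]"]) simp
  qed
qed

text \<open>Adding up \<open>composition_step\<close> along a series from zero to \<open>P\<close>
  gives the leading positions of \<open>W (carrier P)\<close>. The series is arbitrary, which also
  settles uniqueness in the definite description.\<close>

theorem multiplicity_eq_card:
  assumes ev: "\<And>f. f \<in> AF n \<Longrightarrow> the_elem (eval_character (simple_character u C) ` ak_class n r u f) = XJ f"
  shows "composition_multiplicity A P (simple_ak_module u C) = card (cartan_perms n c E d EJ)"
  unfolding composition_multiplicity_def
proof (rule the_equality)
  let ?iso = "\<lambda>Ms i. module_iso A (composition_factor P Ms i) (simple_ak_module u C)"
  have count: "card {i. Suc i < length Ms \<and> ?iso Ms i} = card (cartan_perms n c E d EJ)"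
    if cs: "composition_series A P Ms" for Ms
  proof -
    have Ms: "Ms \<noteq> []" "hd Ms = {\<zero>\<^bsub>P\<^esub>}" "last Ms = carrier P" "\<And>N. N \<in> set Ms \<Longrightarrow> submodule N A P"
      "\<And>i. Suc i < length Ms \<Longrightarrow> Ms ! i \<subseteq> Ms ! Suc i \<and> simple_module A (composition_factor P Ms i)"
      using cs by (auto simp: composition_series_def)
    have "k < length Ms \<Longrightarrow> card (lead (W (Ms ! k))) = card {i. i < k \<and> ?iso Ms i}" for k
    proof (induction k)
      case 0
      have "W (Ms ! 0) = {\<lambda>_. 0}"
        using Ms(1,2) by (simp add: hd_conv_nth[symmetric] W_def g_zero L.rho_vzero)
      then show ?case by (simp add: lead_zero)
    next
      case (Suc k)
      have N: "submodule (Ms ! k) A P" "submodule (Ms ! Suc k) A P" "Ms ! k \<subseteq> Ms ! Suc k"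
        using Ms(4) Ms(5)[OF Suc.prems] Suc.prems by auto
      have s: "simple_module A (quot_module (P\<lparr>carrier := Ms ! Suc k\<rparr>) (Ms ! k))"
        using Ms(5)[OF Suc.prems] by (simp add: composition_factor_def)
      have "card (lead (W (Ms ! Suc k))) = card (lead (W (Ms ! k))) + (if ?iso Ms k then 1 else 0)"
        using composition_step[OF N s] subq_iso_simple_iff[OF N, of C XJ, OF ev]
        by (simp add: composition_factor_def quotient_character_def)
      also have "card (lead (W (Ms ! k))) = card {i. i < k \<and> ?iso Ms i}"
        using Suc by simp
      also have "\<dots> + (if ?iso Ms k then 1 else 0) = card {i. i < Suc k \<and> ?iso Ms i}"
      proof -
        have "{i. i < Suc k \<and> ?iso Ms i} = (if ?iso Ms k then insert k {i. i < k \<and> ?iso Ms i} else {i. i < k \<and> ?iso Ms i})"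
          by (auto simp: less_Suc_eq)
        then show ?thesis by auto
      qed
      finally show ?case .
    qed
    from this[of "length Ms - 1"] Ms(1,3)
    have "card (lead (W (carrier P))) = card {i. i < length Ms - 1 \<and> ?iso Ms i}"
      by (simp add: last_conv_nth)
    moreover have "{i. i < length Ms - 1 \<and> ?iso Ms i} = {i. Suc i < length Ms \<and> ?iso Ms i}"
      by auto
    ultimately show ?thesis by (simp add: lead_W_carrier)
  qed
  obtain Ms where "composition_series A P Ms"
    using composition_series_exists[OF carrier_submodule] unfolding composition_series_def by blast
  then show "\<exists>Ms. composition_series A P Ms \<and> card (cartan_perms n c E d EJ) =
      card {i. Suc i < length Ms \<and> ?iso Ms i}"
    using count by auto
  show "m = card (cartan_perms n c E d EJ)"
    if "\<exists>Ms. composition_series A P Ms \<and> m = card {i. Suc i < length Ms \<and> ?iso Ms i}" for m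
    using that count by auto
qed

end

theorem (in ak_proj) multiplicity:
  assumes d: "\<And>j. j \<in> {1..n} \<Longrightarrow> d j \<in> {1..r}"
    and ev: "\<And>f. f \<in> AF n \<Longrightarrow>
      the_elem (eval_character (simple_character u C) ` ak_class n r u f) = eval_character (gchar u d EJ) f"
  shows "composition_multiplicity (ak_algebra n r u) P (simple_ak_module u C) = card (cartan_perms n c E d EJ)"
proof -
  \<comment> \<open>The construction of idempotents is repeated for the word \<open>d\<close>, but
    the resulting polynomial is made to act on the weight module of \<open>c\<close>.\<close>
  interpret D: ak_word n r u d by unfold_locales (use u_inj d in auto)
  obtain f where f: "f \<in> AF n" "\<And>d' E'. (\<forall>j\<in>{1..n}. d' j \<in> {1..r}) \<Longrightarrow>
    eval_character (gchar u d' E') f = (if D.dmatch d' \<and> (\<forall>i\<in>D.Req. i \<in> E' \<longleftrightarrow> i \<in> EJ) then 1 else 0)"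
    using D.ex_character_idempotent[of EJ] by blast
  define eJ where "eJ = idem_poly height f"
  have f01: "eval_character (\<lambda>g. ldg g \<sigma>) f \<in> {0, 1}" if "\<sigma> \<in> BB" for \<sigma>
    unfolding ldg_def using f(2)[of "c \<circ> \<sigma>" "{i. \<sigma> (Suc i) < \<sigma> i}"] color_range that by auto
  obtain g where g: "\<And>p p'. p \<in> carrier P \<Longrightarrow> p' \<in> carrier P \<Longrightarrow> g (p \<oplus>\<^bsub>P\<^esub> p') = (\<lambda>\<sigma>. g p \<sigma> + g p' \<sigma>)"
    "\<And>f p. f \<in> AF n \<Longrightarrow> p \<in> carrier P \<Longrightarrow> g (act f p) = L.rho f (g p)" "inj_on g (carrier P)" "g ` carrier P = Q"
    using ex_iso by blast
  interpret M: ak_mult n r u c P E \<chi> d EJ eJ g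
  proof unfold_locales
    show "eJ \<in> AF n" unfolding eJ_def by (rule FA_idem_poly[OF f(1)])
    show "L.rho eJ (L.rho eJ v) = L.rho eJ v" if "v \<in> V" for v
      unfolding eJ_def by (rule L.rho_idem_poly[OF f(1) f01 that])
    show "eval_character (gchar u d' E') eJ =
      (if (\<forall>j\<in>{1..n}. d' j = d j) \<and> (\<forall>i\<in>{1..<n}. d i = d (Suc i) \<longrightarrow> (i \<in> E' \<longleftrightarrow> i \<in> EJ)) then 1 else 0)"
      if "\<And>j. j \<in> {1..n} \<Longrightarrow> d' j \<in> {1..r}" for d' E'
      unfolding eJ_def using f(2)[of d' E'] that
      by (subst eval_character_idem_poly[OF _ L.height_pos]) (auto simp: D.dmatch_def D.Req_def)
  qed ((rule d g(1) g(2); assumption) | rule g(3) | rule g(4))+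
  show ?thesis by (rule M.multiplicity_eq_card[OF ev])
qed

subsection \<open>Compositions and descent sets\<close>

lemma Des_Nil [simp]: "Des [] = {}"
  by (auto simp: Des_def)

lemma Des_Cons: "Des (i # I) = (if I = [] then {} else insert i ((+) i ` Des I))"
proof (cases "I = []")
  case False
  have "x \<in> Des (i # I) \<longleftrightarrow> (\<exists>k<length I. x = i + sum_list (take k I))" for x
  proof
    assume "x \<in> Des (i # I)"
    then obtain k where k: "1 \<le> k" "k < Suc (length I)" "x = sum_list (take k (i # I))" by (auto simp: Des_def)
    then obtain k' where "k = Suc k'" by (cases k) auto
    with k show "\<exists>k<length I. x = i + sum_list (take k I)" by auto
  next
    assume "\<exists>k<length I. x = i + sum_list (take k I)"
    then obtain k where "k < length I" "x = i + sum_list (take k I)" by blast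
    then show "x \<in> Des (i # I)" unfolding Des_def by (intro CollectI exI[of _ "Suc k"]) auto
  qed
  then have "Des (i # I) = {i + sum_list (take k I) | k. k < length I}"
    by blast
  also have "\<dots> = insert i ((+) i ` Des I)"
  proof
    show "{i + sum_list (take k I) | k. k < length I} \<subseteq> insert i ((+) i ` Des I)"
    proof
      fix x assume "x \<in> {i + sum_list (take k I) | k. k < length I}"
      then obtain k where "k < length I" "x = i + sum_list (take k I)" by blast
      moreover have "sum_list (take k I) \<in> Des I" if "k \<noteq> 0"
        using that \<open>k < length I\<close> unfolding Des_def by (intro CollectI exI[of _ k]) auto
      ultimately show "x \<in> insert i ((+) i ` Des I)"
        by (cases "k = 0") auto
    qed
    show "insert i ((+) i ` Des I) \<subseteq> {i + sum_list (take k I) | k. k < length I}"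
    proof
      fix x assume "x \<in> insert i ((+) i ` Des I)"
      then consider "x = i" | k where "k < length I" "x = i + sum_list (take k I)"
        by (auto simp: Des_def)
      then show "x \<in> {i + sum_list (take k I) | k. k < length I}"
      proof cases
        case 1
        then show ?thesis using False by (intro CollectI exI[of _ 0]) simp
      qed blast
    qed
  qed
  finally show ?thesis using False by simp
qed (auto simp: Des_def)

lemma Des_bounds: "\<forall>i\<in>set I. 1 \<le> i \<Longrightarrow> x \<in> Des I \<Longrightarrow> 1 \<le> x \<and> x < sum_list I"
proof (induction I arbitrary: x)
  case (Cons i I)
  have "1 \<le> sum_list I" if "I \<noteq> []"
    using that Cons.prems(1) by (cases I) auto
  moreover have "I \<noteq> []" "x = i \<or> (\<exists>y\<in>Des I. x = i + y)"
    using Cons.prems(2) by (auto simp: Des_Cons split: if_splits)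
  ultimately show ?case
    using Cons.IH Cons.prems(1) by force
qed simp

lemma Des_inj:
  "\<forall>i\<in>set I. 1 \<le> i \<Longrightarrow> \<forall>i\<in>set J. 1 \<le> i \<Longrightarrow> sum_list I = sum_list J \<Longrightarrow> Des I = Des J \<Longrightarrow> I = J"
proof (induction I arbitrary: J)
  case Nil
  then show ?case by (cases J) auto
next
  case (Cons i I)
  then obtain j J' where J: "J = j # J'" by (cases J) auto
  have pos: "\<forall>i\<in>set I. 1 \<le> i" "\<forall>i\<in>set J'. 1 \<le> i" using Cons.prems J by auto
  show ?case
  proof (cases "I = [] \<or> J' = []")
    case True
    then have "I = [] \<and> J' = []" using Cons.prems(4) J by (auto simp: Des_Cons split: if_splits)
    then show ?thesis using Cons.prems(3) J by simp
  next
    case False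
    then have eq: "insert i ((+) i ` Des I) = insert j ((+) j ` Des J')"
      using Cons.prems(4) J by (simp add: Des_Cons)
    have "i \<in> insert j ((+) j ` Des J')" "j \<in> insert i ((+) i ` Des I)"
      using eq by blast+
    then have ij: "i = j" by auto
    have "0 \<notin> Des I" "0 \<notin> Des J'" using Des_bounds[OF pos(1), of 0] Des_bounds[OF pos(2), of 0] by auto
    then have "i \<notin> (+) i ` Des I" "i \<notin> (+) i ` Des J'"
      by auto
    then have "(+) i ` Des I = (+) i ` Des J'"
      using eq insert_ident[of i "(+) i ` Des I" "(+) i ` Des J'"] ij by simp
    then have "Des I = Des J'" by (simp add: inj_image_eq_iff)
    then show ?thesis using Cons.IH[OF pos] Cons.prems(3) J ij by simp
  qed
qed

lemma composition_eqI: "is_composition n I \<Longrightarrow> is_composition n J \<Longrightarrow> Des I = Des J \<Longrightarrow> I = J"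
  using Des_inj[of I J] by (simp add: is_composition_def)

text \<open>The first part is the least element of \<open>D\<close>; the remaining parts come from
  the elements above it, shifted down.\<close>

lemma ex_composition_of_Des: "D \<subseteq> {1..<n} \<Longrightarrow> \<exists>I. is_composition n I \<and> Des I = D"
proof (induction n arbitrary: D rule: less_induct)
  case (less n)
  have fin: "finite D" using less.prems finite_subset by blast
  show ?case
  proof (cases "D = {}")
    case True
    show ?thesis
      by (rule exI[of _ "if n = 0 then [] else [n]"]) (simp add: True is_composition_def Des_Cons)
  next
    case False
    define m where "m = Min D"
    have m: "m \<in> D" "\<And>x. x \<in> D \<Longrightarrow> m \<le> x" using False fin by (auto simp: m_def)
    have mn: "1 \<le> m" "m < n" using m(1) less.prems by auto
    let ?D = "{x. m + x \<in> D \<and> 1 \<le> x}"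
    have "?D \<subseteq> {1..<n - m}" using less.prems by auto
    then obtain I where I: "is_composition (n - m) I" "Des I = ?D"
      using less.IH[of "n - m" ?D] mn by auto
    have "I \<noteq> []" using I(1) mn by (auto simp: is_composition_def)
    then have "Des (m # I) = insert m ((+) m ` ?D)" using I(2) by (simp add: Des_Cons)
    also have "\<dots> = D"
    proof
      show "D \<subseteq> insert m ((+) m ` ?D)"
      proof
        fix x assume x: "x \<in> D"
        then have "x = m + (x - m)" using m(2) by simp
        then show "x \<in> insert m ((+) m ` ?D)"
          using x by (cases "x = m") (auto intro!: image_eqI[of _ _ "x - m"])
      qed
    qed (use m(1) in auto)
    finally have "Des (m # I) = D" .
    then show ?thesis
      using I(1) mn by (intro exI[of _ "m # I"]) (auto simp: is_composition_def)
  qed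
qed

lemma composition_of_Des:
  assumes "D \<subseteq> {1..<n}"
  shows "is_composition n (composition_of_Des n D)" "Des (composition_of_Des n D) = D"
proof -
  have "\<exists>!I. is_composition n I \<and> Des I = D"
    using ex_composition_of_Des[OF assms] composition_eqI by blast
  from theI'[OF this] show "is_composition n (composition_of_Des n D)" "Des (composition_of_Des n D) = D"
    unfolding composition_of_Des_def by auto
qed

lemma Des_subset: "is_composition n I \<Longrightarrow> Des I \<subseteq> {1..<n}"
  using Des_bounds[of I] by (auto simp: is_composition_def)

subsection \<open>The cycloribbon series\<close>

lemma col_Suc [simp]: "col c (Suc j) = c ! j"
  by (simp add: col_def)

text \<open>Where the indices do not rise, there is no descent and the colors of a cycloribbon do
  not fall. So an admissible index word zipped with \<open>c\<close> is sorted lexicographically and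
  must be \<open>xs\<close> itself; this leaves at most one index word.\<close>

lemma F_series_value:
  assumes cyc: "cycloribbon r k (I, c)" and xs: "sorted (xs :: (nat \<times> nat) list)"
  shows "F_series (I, c) (mset xs) =
    (if c = map snd xs \<and> set (map fst xs) \<subseteq> {1..} \<and> (\<forall>j\<in>Des I. fst (xs ! (j - 1)) < fst (xs ! j)) then 1 else 0)"
proof -
  have c: "length c = k" "is_composition k I" and
    asc: "\<And>j. j \<in> {1..<k} \<Longrightarrow> j \<notin> Des I \<Longrightarrow> c ! (j - 1) \<le> c ! j"
    using cyc by (auto simp: cycloribbon_def is_colored_ribbon_def col_def)
  have D: "Des I \<subseteq> {1..<k}" using Des_subset[OF c(2)] .
  let ?S = "{is. length is = length c \<and> set is \<subseteq> {1..} \<and> sorted is \<and>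
          (\<forall>j\<in>Des I. col is j < col is (j+1)) \<and> mset (zip is c) = mset xs}"
  let ?P = "c = map snd xs \<and> set (map fst xs) \<subseteq> {1..} \<and> (\<forall>j\<in>Des I. fst (xs ! (j - 1)) < fst (xs ! j))"
  have 1: "is = map fst xs \<and> ?P" if iS: "is \<in> ?S" for "is"
  proof -
    have "zip is c ! i \<le> zip is c ! Suc i" if i: "Suc i < length (zip is c)" for i
    proof -
      have "is ! i \<le> is ! Suc i" using iS i by (auto simp: sorted_iff_nth_Suc)
      moreover have "c ! i \<le> c ! Suc i" if "is ! i = is ! Suc i"
      proof -
        have "Suc i \<notin> Des I" using iS that by (auto simp: col_def)
        then show ?thesis using asc[of "Suc i"] i c by auto
      qed
      ultimately show ?thesis using i by (cases "is ! i = is ! Suc i") (auto simp: le_neq_implies_less)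
    qed
    then have "sorted (zip is c)" by (simp add: sorted_iff_nth_Suc)
    then have z: "zip is c = xs"
    proof -
      have "mset (zip is c) = mset xs" using iS by simp
      from properties_for_sort[OF this \<open>sorted (zip is c)\<close>] show ?thesis using sorted_sort_id[OF xs] by simp
    qed
    have l: "length is = length c" using iS by auto
    have "is = map fst xs" "c = map snd xs" using l by (auto simp: z[symmetric])
    moreover from this have "fst (xs ! (j - 1)) < fst (xs ! j)" if "j \<in> Des I" for j
    proof -
      have "j \<in> {1..<k}" using that D by blast
      then have "j - 1 < length xs" "j < length xs" using c l by (auto simp: z[symmetric])
      then show ?thesis using iS that \<open>is = map fst xs\<close> by (auto simp: col_def)
    qed
    ultimately show ?thesis using iS by auto
  qed
  have 2: "map fst xs \<in> ?S" if P: ?P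
  proof -
    have "sorted (map fst xs)"
      using xs by (auto simp: sorted_iff_nth_Suc less_eq_prod_def intro: less_imp_le)
    moreover have "col (map fst xs) j < col (map fst xs) (j + 1)" if "j \<in> Des I" for j
    proof -
      have "j \<in> {1..<k}" "length c = length xs" using that D P by auto
      then have "j - 1 < length xs" "j < length xs" using c by auto
      then show ?thesis using P that by (auto simp: col_def)
    qed
    moreover have "mset (zip (map fst xs) c) = mset xs" using P by (simp add: zip_map_fst_snd)
    ultimately show ?thesis using P by auto
  qed
  have "?S = (if ?P then {map fst xs} else {})"
  proof (cases ?P)
    case True
    then have "?S = {map fst xs}" using 1 2 by blast
    then show ?thesis unfolding if_P[OF True] .
  next
    case False
    then have "?S = {}" using 1 by blast
    then show ?thesis unfolding if_not_P[OF False] .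
  qed
  then have "card ?S = (if ?P then 1 else 0)" by simp
  then show ?thesis by (simp add: F_series_def)
qed

text \<open>The monomial of the series with the smallest possible indices: the index rises by one
  exactly at the descents. Since \<open>i\<close> counts from 0, a descent \<open>e\<close> has been
  passed when \<open>e \<le> i\<close>.\<close>

definition test_monomial :: "nat list \<Rightarrow> nat list \<Rightarrow> (nat \<times> nat) list" where
  "test_monomial I c = map (\<lambda>i. (Suc (card {e \<in> Des I. e \<le> i}), c ! i)) [0..<length c]"

lemma test_monomial:
  assumes cyc: "cycloribbon r k (I, c)"
  shows "sorted (test_monomial I c)" "map snd (test_monomial I c) = c" "set (map fst (test_monomial I c)) \<subseteq> {1..}"
    "j \<in> {1..<k} \<Longrightarrow> fst (test_monomial I c ! (j - 1)) < fst (test_monomial I c ! j) \<longleftrightarrow> j \<in> Des I"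
proof -
  have c: "length c = k" "is_composition k I" and
    asc: "\<And>j. j \<in> {1..<k} \<Longrightarrow> j \<notin> Des I \<Longrightarrow> c ! (j - 1) \<le> c ! j"
    using cyc by (auto simp: cycloribbon_def is_colored_ribbon_def col_def)
  have fin: "finite (Des I)" using Des_subset[OF c(2)] finite_subset by blast
  have step: "card {e \<in> Des I. e \<le> Suc i} = card {e \<in> Des I. e \<le> i} + (if Suc i \<in> Des I then 1 else 0)" for i
  proof -
    have "{e \<in> Des I. e \<le> Suc i} = (if Suc i \<in> Des I then insert (Suc i) {e \<in> Des I. e \<le> i} else {e \<in> Des I. e \<le> i})"
      by (auto simp: le_Suc_eq)
    then show ?thesis using fin by auto
  qed
  show "sorted (test_monomial I c)"
    unfolding sorted_iff_nth_Suc
  proof (intro allI impI)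
    fix i assume "Suc i < length (test_monomial I c)"
    then show "test_monomial I c ! i \<le> test_monomial I c ! Suc i"
      using asc[of "Suc i"] step[of i] c by (auto simp: test_monomial_def)
  qed
  show "map snd (test_monomial I c) = c"
    by (simp add: test_monomial_def comp_def map_nth)
  show "set (map fst (test_monomial I c)) \<subseteq> {1..}"
    by (auto simp: test_monomial_def)
  show "fst (test_monomial I c ! (j - 1)) < fst (test_monomial I c ! j) \<longleftrightarrow> j \<in> Des I" if "j \<in> {1..<k}"
    using that step[of "j - 1"] c by (auto simp: test_monomial_def)
qed

text \<open>Unitriangularity of the F series with respect to inclusion of descent sets, separately
  for each color word.\<close>

lemma F_series_test_monomial:
  assumes "cycloribbon r k (I, c)" "cycloribbon r k0 (I0, c0)"
  shows "F_series (I, c) (mset (test_monomial I0 c0)) = (if c = c0 \<and> Des I \<subseteq> Des I0 then 1 else 0)"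
proof -
  note t = test_monomial[OF assms(2)]
  have "k = k0" "Des I \<subseteq> {1..<k}" if "c = c0"
    using that assms Des_subset by (auto simp: cycloribbon_def is_colored_ribbon_def)
  then have "(\<forall>j\<in>Des I. fst (test_monomial I0 c0 ! (j - 1)) < fst (test_monomial I0 c0 ! j)) \<longleftrightarrow> Des I \<subseteq> Des I0" if "c = c0"
    using that t(4) by (auto simp: subset_iff)
  then show ?thesis
    unfolding F_series_value[OF assms(1) t(1)] using t(2,3) by auto
qed

lemma finite_cycloribbons_color: "finite {C. (\<exists>k. cycloribbon r k C) \<and> snd C = c}"
proof (rule inj_on_finite)
  show "inj_on (\<lambda>C. Des (fst C)) {C. (\<exists>k. cycloribbon r k C) \<and> snd C = c}"
    by (rule inj_onI) (auto simp: cycloribbon_def is_colored_ribbon_def intro: composition_eqI)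
  show "(\<lambda>C. Des (fst C)) ` {C. (\<exists>k. cycloribbon r k C) \<and> snd C = c} \<subseteq> Pow {1..<length c}"
    using Des_subset by (fastforce simp: cycloribbon_def is_colored_ribbon_def)
qed simp

text \<open>Test monomials yield, for each color word, the sums of the coefficients over the descent
  sets contained in a given one. These sums determine the coefficients by induction on the size of
  that set.\<close>

lemma F_expansion_unique:
  assumes a: "F_expansion r a f" and b: "F_expansion r b f"
  shows "a = b"
proof
  have val: "f (mset (test_monomial I0 c0)) =
      (\<Sum>C\<in>{C. (\<exists>k. cycloribbon r k C) \<and> snd C = c0 \<and> Des (fst C) \<subseteq> Des I0}. a C)"
    if a: "F_expansion r a f" and C0: "cycloribbon r k0 (I0, c0)" for a I0 c0 k0
  proof -
    let ?T = "{C. (\<exists>k. cycloribbon r k C) \<and> snd C = c0 \<and> Des (fst C) \<subseteq> Des I0}"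
    have finT: "finite ?T" by (rule finite_subset[OF _ finite_cycloribbons_color[of r c0]]) auto
    have fin: "finite {C. a C \<noteq> 0}" and cyc: "\<And>C. a C \<noteq> 0 \<Longrightarrow> \<exists>k. cycloribbon r k C"
      and f: "f = (\<lambda>m. \<Sum>C\<in>{C. a C \<noteq> 0}. a C * F_series C m)"
      using a by (auto simp: F_expansion_def)
    have "f (mset (test_monomial I0 c0)) = (\<Sum>C\<in>{C. a C \<noteq> 0}. if C \<in> ?T then a C else 0)"
      unfolding f
    proof (rule sum.cong[OF refl])
      fix C assume "C \<in> {C. a C \<noteq> 0}"
      then obtain k where k: "cycloribbon r k C" using cyc[of C] by blast
      obtain I c where C: "C = (I, c)" by (cases C)
      show "a C * F_series C (mset (test_monomial I0 c0)) = (if C \<in> ?T then a C else 0)"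
        using F_series_test_monomial[OF k[unfolded C] C0] k by (auto simp: C)
    qed
    also have "\<dots> = (\<Sum>C\<in>{C. a C \<noteq> 0} \<inter> ?T. a C)"
      using fin by (simp add: sum.inter_restrict)
    also have "\<dots> = (\<Sum>C\<in>?T. a C)"
      by (rule sum.mono_neutral_left) (use finT in auto)
    finally show ?thesis .
  qed
  have eq: "a (I0, c0) = b (I0, c0)" if "cycloribbon r k0 (I0, c0)" for I0 c0 k0
    using that
  proof (induction "card (Des I0)" arbitrary: I0 k0 rule: less_induct)
    case less
    let ?T = "{C. (\<exists>k. cycloribbon r k C) \<and> snd C = c0 \<and> Des (fst C) \<subseteq> Des I0}"
    let ?T' = "?T - {(I0, c0)}"
    have finT: "finite ?T" by (rule finite_subset[OF _ finite_cycloribbons_color[of r c0]]) auto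
    have in_T: "(I0, c0) \<in> ?T" using less.prems by auto
    have "a C = b C" if C: "C \<in> ?T'" for C
    proof -
      obtain I k where I: "C = (I, c0)" "cycloribbon r k (I, c0)" "Des I \<subseteq> Des I0" "I \<noteq> I0"
        using C by (cases C) auto
      have "is_composition (length c0) I" "is_composition (length c0) I0"
        using I(2) less.prems by (auto simp: cycloribbon_def is_colored_ribbon_def)
      then have "Des I \<noteq> Des I0" using I(4) composition_eqI by blast
      moreover have "finite (Des I0)"
        using less.prems Des_subset finite_subset by (fastforce simp: cycloribbon_def is_colored_ribbon_def)
      ultimately have "card (Des I) < card (Des I0)" using I(3) by (intro psubset_card_mono) auto
      then show ?thesis using less.hyps I by blast
    qed
    then have "sum a ?T' = sum b ?T'" by (rule sum.cong[OF refl])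
    moreover have "sum a ?T = sum b ?T" using val[OF a less.prems] val[OF b less.prems] by simp
    ultimately show ?case
      unfolding sum.remove[OF finT in_T] by simp
  qed
  fix C :: colored_ribbon
  obtain I c where C: "C = (I, c)" by (cases C)
  show "a C = b C"
  proof (cases "\<exists>k. cycloribbon r k C")
    case True
    then show ?thesis using eq C by auto
  next
    case False
    then have "a C = 0" "b C = 0" using a b unfolding F_expansion_def by blast+
    then show ?thesis by simp
  qed
qed

lemma F_coeff_eqI: "F_expansion r a f \<Longrightarrow> F_coeff r f = a"
  unfolding F_coeff_def by (rule the_equality) (auto intro: F_expansion_unique)

subsection \<open>Colored compositions\<close>

definition color_word :: "colored_composition \<Rightarrow> nat list" where
  "color_word I = concat (map (\<lambda>(k, a). replicate k a) I)"

definition positive_parts :: "colored_composition \<Rightarrow> bool" where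
  "positive_parts I \<longleftrightarrow> (\<forall>p\<in>set I. 1 \<le> fst p)"

abbreviation cDes :: "colored_composition \<Rightarrow> nat set" where
  "cDes I \<equiv> Des (map fst I)"

lemma color_word_simps [simp]:
  "color_word [] = []" "color_word ((k, a) # I) = replicate k a @ color_word I"
  "color_word (I @ J) = color_word I @ color_word J"
  by (simp_all add: color_word_def)

lemma positive_parts_simps [simp]:
  "positive_parts []" "positive_parts (p # I) \<longleftrightarrow> 1 \<le> fst p \<and> positive_parts I"
  "positive_parts (I @ J) \<longleftrightarrow> positive_parts I \<and> positive_parts J"
  by (auto simp: positive_parts_def)

lemma length_color_word: "length (color_word I) = sum_list (map fst I)"
  by (induction I) auto

lemma color_word_eq_imp_eq:
  "map fst I = map fst J \<Longrightarrow> color_word I = color_word J \<Longrightarrow> positive_parts I \<Longrightarrow> I = J"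
proof (induction I arbitrary: J)
  case (Cons p I)
  then obtain q J' where J: "J = q # J'" by (cases J) auto
  obtain k a b where pq: "p = (k, a)" "q = (k, b)" using Cons.prems(1) J by (cases p; cases q) auto
  have "replicate k a = replicate k b \<and> color_word I = color_word J'"
    using Cons.prems(2) J pq by (simp add: append_eq_append_conv)
  then show ?case using Cons J pq by (auto simp: replicate_eq_replicate)
qed auto

text \<open>The encoding by color word and descent set is faithful. Under it coarsening becomes
  inclusion of descent sets with the color word unchanged, by \<open>coarser_eq_imp\<close> and
  \<open>coarser_eqI\<close>.\<close>

lemma cDes_inj:
  assumes "positive_parts I" "positive_parts J" "color_word I = color_word J" "cDes I = cDes J"
  shows "I = J"
proof (rule color_word_eq_imp_eq[OF _ assms(3,1)])
  show "map fst I = map fst J"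
  proof (rule Des_inj)
    show "sum_list (map fst I) = sum_list (map fst J)"
      unfolding length_color_word[symmetric] assms(3) ..
  qed (use assms in \<open>auto simp: positive_parts_def\<close>)
qed

lemma color_word_monochrome: "\<forall>p\<in>set g. snd p = a \<Longrightarrow> color_word g = replicate (sum_list (map fst g)) a"
  by (induction g) (simp_all add: replicate_add split_beta color_word_def)

lemma monochrome_color_word: "positive_parts g \<Longrightarrow> color_word g = replicate k a \<Longrightarrow> p \<in> set g \<Longrightarrow> snd p = a"
proof (induction g arbitrary: k)
  case (Cons q g)
  obtain l b where q: "q = (l, b)" "1 \<le> l" using Cons.prems(1) by (cases q) auto
  have k: "k = l + length (color_word g)"
    using arg_cong[OF Cons.prems(2), of length] q by simp
  then have "replicate l b @ color_word g = replicate l a @ replicate (length (color_word g)) a"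
    using Cons.prems(2) q by (simp add: replicate_add)
  then have "replicate l b = replicate l a" "color_word g = replicate (length (color_word g)) a"
    by (simp_all add: append_eq_append_conv)
  then show ?case using Cons q by auto
qed simp

lemma sum_list_ge_1: "positive_parts g \<Longrightarrow> g \<noteq> [] \<Longrightarrow> 1 \<le> sum_list (map fst g)"
  by (cases g) auto

lemma coarser_eq_imp:
  assumes "coarser_eq J I" "positive_parts I"
  shows "positive_parts J" "color_word J = color_word I" "cDes J \<subseteq> cDes I"
proof -
  obtain gs where gs: "concat gs = I" "\<forall>g\<in>set gs. g \<noteq> [] \<and> (\<forall>p\<in>set g. snd p = snd (hd g))"
    "J = map (\<lambda>g. (sum_list (map fst g), snd (hd g))) gs"
    using assms(1) unfolding coarser_eq_def by blast
  have pos: "positive_parts g" if "g \<in> set gs" for g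
    using assms(2) gs(1) that by (auto simp: positive_parts_def)
  show "positive_parts J"
    unfolding gs(3) positive_parts_def[of "map _ _"] set_map ball_simps fst_conv
    using pos gs(2) sum_list_ge_1 by blast
  have "color_word (map (\<lambda>g. (sum_list (map fst g), snd (hd g))) hs) = color_word (concat hs)"
    if "set hs \<subseteq> set gs" for hs
    using that
  proof (induction hs)
    case (Cons h hs)
    then have "\<forall>p\<in>set h. snd p = snd (hd h)" using gs(2) by auto
    with Cons color_word_monochrome[of h "snd (hd h)"] show ?case by simp
  qed simp
  from this[of gs] show "color_word J = color_word I" using gs by simp
  have "Des (map fst (map (\<lambda>g. (sum_list (map fst g), snd (hd g))) hs)) \<subseteq> cDes (concat hs)"
    if "set hs \<subseteq> set gs" for hs
    using that
  proof (induction hs)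
    case (Cons h hs)
    have h: "h \<noteq> []" "positive_parts h" using Cons.prems gs(2) pos by auto
    have app: "Des (A @ B) = (if B = [] then Des A else Des A \<union> (if A = [] then {} else {sum_list A}) \<union> (+) (sum_list A) ` Des B)"
      for A B :: "nat list"
      by (induction A) (auto simp: Des_Cons image_image add.assoc)
    have ne: "concat hs \<noteq> []" if "hs \<noteq> []"
      using that Cons.prems gs(2) by (cases hs) auto
    have IH: "Des (map (\<lambda>g. sum_list (map fst g)) hs) \<subseteq> Des (map fst (concat hs))"
      using Cons by (simp add: comp_def)
    show ?case
      using IH h ne by (auto simp: app Des_Cons comp_def)
  qed simp
  from this[of gs] show "cDes J \<subseteq> cDes I" using gs by simp
qed

text \<open>Unless \<open>J\<close> has a single part, its first part is a descent of
  \<open>J\<close>, hence of \<open>I\<close>, and so the sum of a prefix of \<open>I\<close>. The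
  common color word makes this prefix monochrome, so it can serve as the first group.\<close>

lemma coarser_eqI:
  assumes "positive_parts J" "positive_parts I" "color_word J = color_word I" "cDes J \<subseteq> cDes I"
  shows "coarser_eq J I"
  using assms
proof (induction J arbitrary: I)
  case Nil
  then have "I = []" by (cases I) (auto simp: Suc_le_eq)
  then show ?case by (simp add: coarser_eq_refl)
next
  case (Cons p J)
  obtain k a where p: "p = (k, a)" by (cases p)
  have k: "1 \<le> k" using Cons.prems(1) p by simp
  show ?case
  proof (cases "J = []")
    case True
    have I: "color_word I = replicate k a" using Cons.prems(3) p True by simp
    then have "I \<noteq> []" using k by auto
    moreover have snd: "\<forall>q\<in>set I. snd q = a"
      using monochrome_color_word[OF Cons.prems(2) I] by blast
    moreover have "sum_list (map fst I) = k"
      using I length_color_word[of I] by simp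
    ultimately show ?thesis
      unfolding coarser_eq_def using True p by (intro exI[of _ "[I]"]) auto
  next
    case False
    have "k \<in> cDes (p # J)" using False p by (simp add: Des_Cons)
    then have "k \<in> cDes I" using Cons.prems(4) by blast
    then obtain l where l: "1 \<le> l" "l < length I" "k = sum_list (map fst (take l I))"
      by (auto simp: Des_def take_map)
    let ?g = "take l I" and ?I = "drop l I"
    have pos: "positive_parts ?g" "positive_parts ?I"
      using Cons.prems(2) by (auto simp: positive_parts_def dest: in_set_takeD in_set_dropD)
    have "replicate k a @ color_word J = color_word ?g @ color_word ?I"
      using Cons.prems(3) p color_word_simps(3)[of ?g ?I] by simp
    moreover have "length (color_word ?g) = k" by (simp add: length_color_word l)
    ultimately have g: "color_word ?g = replicate k a" "color_word J = color_word ?I"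
      by (simp_all add: append_eq_append_conv)
    have "cDes J \<subseteq> cDes ?I"
    proof
      fix x assume x: "x \<in> cDes J"
      then have "1 \<le> x" using Des_bounds[of "map fst J" x] Cons.prems(1) by (auto simp: positive_parts_def)
      have "k + x \<in> cDes (p # J)" using x False p by (simp add: Des_Cons)
      then have "k + x \<in> cDes I" using Cons.prems(4) by blast
      then obtain m where m: "m < length I" "k + x = sum_list (map fst (take m I))"
        by (auto simp: Des_def take_map)
      have ml: "l < m"
      proof (rule ccontr)
        assume "\<not> l < m"
        then have "take l I = take m I @ take (l - m) (drop m I)"
          by (metis le_add_diff_inverse not_less take_add)
        then have "sum_list (map fst (take m I)) \<le> sum_list (map fst (take l I))" by simp
        then show False using l m \<open>1 \<le> x\<close> by simp
      qed
      then have "take m I = take l I @ take (m - l) (drop l I)"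
        by (metis le_add_diff_inverse less_imp_le take_add)
      then have "x = sum_list (map fst (take (m - l) ?I))" using m l by simp
      then show "x \<in> cDes ?I"
        unfolding Des_def using ml m by (intro CollectI exI[of _ "m - l"]) (auto simp: take_map)
    qed
    then have "coarser_eq J ?I"
      using Cons.IH[of ?I] Cons.prems(1) pos g by simp
    then obtain gs where gs: "concat gs = ?I" "\<forall>g\<in>set gs. g \<noteq> [] \<and> (\<forall>p\<in>set g. snd p = snd (hd g))"
      "J = map (\<lambda>g. (sum_list (map fst g), snd (hd g))) gs"
      unfolding coarser_eq_def by blast
    have sndg: "\<forall>q\<in>set ?g. snd q = a" using monochrome_color_word[OF pos(1) g(1)] by blast
    have gne: "?g \<noteq> []" using l by auto
    then have "snd (hd ?g) = a" using sndg hd_in_set by blast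
    note hd_a = this
    show ?thesis
      unfolding coarser_eq_def
    proof (intro exI conjI)
      show "concat (?g # gs) = I" using gs(1) by simp
      show "\<forall>h\<in>set (?g # gs). h \<noteq> [] \<and> (\<forall>p\<in>set h. snd p = snd (hd h))"
      proof
        fix h assume "h \<in> set (?g # gs)"
        then consider "h = ?g" | "h \<in> set gs" by auto
        then show "h \<noteq> [] \<and> (\<forall>p\<in>set h. snd p = snd (hd h))"
        proof cases
          case 1
          then show ?thesis using gne sndg hd_a by (simp only: not_False_eq_True simp_thms)
        next
          case 2
          then show ?thesis using gs(2) by blast
        qed
      qed
      show "p # J = map (\<lambda>g. (sum_list (map fst g), snd (hd g))) (?g # gs)"
        unfolding list.map gs(3)[symmetric] hd_a l(3)[symmetric] p ..
    qed
  qed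
qed

text \<open>The construction inside \<open>corresponding_colored_composition\<close>, freed from the
  particular composition used there.\<close>

definition colorize :: "nat list \<Rightarrow> nat list \<Rightarrow> colored_composition" where
  "colorize I c = map (\<lambda>k. (I ! k, col c (sum_list (take k I) + 1))) [0..<length I]"

lemma colorize_Cons: "i + sum_list I \<le> length c \<Longrightarrow> colorize (i # I) c = (i, col c 1) # colorize I (drop i c)"
proof -
  assume le: "i + sum_list I \<le> length c"
  have "map (\<lambda>k. ((i # I) ! k, col c (sum_list (take k (i # I)) + 1))) [0..<length (i # I)] =
     (i, col c 1) # map (\<lambda>k. (I ! k, col c (i + sum_list (take k I) + 1))) [0..<length I]"
    by (simp add: map_upt_Suc del: upt_Suc)
  also have "map (\<lambda>k. (I ! k, col c (i + sum_list (take k I) + 1))) [0..<length I] = colorize I (drop i c)"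
    unfolding colorize_def
  proof (rule map_cong[OF refl])
    fix k assume "k \<in> set [0..<length I]"
    have "sum_list (take k I) \<le> sum_list I"
      by (metis append_take_drop_id le_add1 sum_list_append)
    then show "(I ! k, col c (i + sum_list (take k I) + 1)) = (I ! k, col (drop i c) (sum_list (take k I) + 1))"
      using le by (simp add: col_def)
  qed
  finally show ?thesis by (simp add: colorize_def)
qed

lemma map_fst_colorize: "map fst (colorize I c) = I"
  by (simp add: colorize_def comp_def map_nth)

lemma color_word_colorize:
  assumes "is_composition n I" "length c = n" "\<And>j. j \<in> {1..<n} \<Longrightarrow> c ! (j - 1) \<noteq> c ! j \<Longrightarrow> j \<in> Des I"
  shows "color_word (colorize I c) = c"
  using assms
proof (induction I arbitrary: n c)
  case Nil
  then show ?case by (simp add: is_composition_def colorize_def)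
next
  case (Cons i I)
  have i: "1 \<le> i" "n = i + sum_list I" and I: "is_composition (n - i) I"
    using Cons.prems(1) by (auto simp: is_composition_def)
  have const: "j < i \<Longrightarrow> c ! j = c ! 0" for j
  proof (induction j)
    case (Suc j)
    have "Suc j \<notin> Des (i # I)"
      using Suc.prems by (auto simp: Des_Cons)
    then have "c ! j = c ! Suc j" using Cons.prems(3)[of "Suc j"] Suc.prems i by auto
    then show ?case using Suc by simp
  qed simp
  have take: "take i c = replicate i (c ! 0)"
  proof (rule nth_equalityI)
    fix j assume "j < length (take i c)"
    then show "take i c ! j = replicate i (c ! 0) ! j" using const[of j] by simp
  qed (use Cons.prems(2) i in simp)
  have "color_word (colorize I (drop i c)) = drop i c"
  proof (rule Cons.IH[OF I])
    fix j assume j: "j \<in> {1..<n - i}" "drop i c ! (j - 1) \<noteq> drop i c ! j"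
    then have "c ! (i + j - 1) \<noteq> c ! (i + j)" using Cons.prems(2) i by auto
    then have "i + j \<in> Des (i # I)" using j by (intro Cons.prems(3)) auto
    then show "j \<in> Des I" using j by (auto simp: Des_Cons split: if_splits)
  qed (use Cons.prems in auto)
  then have "color_word (colorize (i # I) c) = replicate i (c ! 0) @ drop i c"
    using i Cons.prems(2) by (simp add: colorize_Cons col_def)
  then show ?case using take by (metis append_take_drop_id)
qed

lemma color_changes_subset_cDes:
  assumes "j \<in> {1..<length (color_word I)}" "color_word I ! (j - 1) \<noteq> color_word I ! j" "positive_parts I"
  shows "j \<in> cDes I"
  using assms
proof (induction I arbitrary: j)
  case (Cons p I)
  obtain k a where p: "p = (k, a)" by (cases p)
  consider "j < k" | "j = k" | "k < j" by linarith
  then show ?case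
  proof cases
    case 1
    then show ?thesis using Cons.prems p by (auto simp: nth_append less_imp_diff_less)
  next
    case 2
    then show ?thesis using Cons.prems p by (auto simp: Des_Cons)
  next
    case 3
    then have e: "\<not> j - 1 < k" "\<not> j < k" "j - 1 - k = j - k - 1" by auto
    have "color_word I ! (j - k - 1) \<noteq> color_word I ! (j - k)"
      using Cons.prems(2) e by (simp add: p nth_append)
    then have "j - k \<in> cDes I"
      using Cons.prems(1,3) p 3 by (intro Cons.IH) auto
    then show ?thesis using 3 Cons.prems p by (cases "I = []") (auto simp: Des_Cons image_iff intro!: bexI[of _ "j - k"])
  qed
qed simp

text \<open>Descents at color changes have to stay, and any set of the other descents can be
  removed.\<close>

lemma bij_betw_coarser:
  assumes I: "positive_parts I"
  shows "bij_betw cDes {J. coarser_eq J I}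
    {Z. {j \<in> {1..<length (color_word I)}. color_word I ! (j - 1) \<noteq> color_word I ! j} \<subseteq> Z \<and> Z \<subseteq> cDes I}"
    (is "bij_betw _ ?A ?B")
  unfolding bij_betw_def
proof
  show "inj_on cDes ?A"
    by (rule inj_onI) (auto intro: cDes_inj simp: coarser_eq_imp[OF _ I])
  show "cDes ` ?A = ?B"
  proof
    show "cDes ` ?A \<subseteq> ?B"
      using coarser_eq_imp[OF _ I] color_changes_subset_cDes by (auto simp: subset_iff)
    show "?B \<subseteq> cDes ` ?A"
    proof
      fix Z assume Z: "Z \<in> ?B"
      let ?n = "length (color_word I)"
      have comp: "is_composition ?n (map fst I)"
        using I by (auto simp: is_composition_def positive_parts_def length_color_word)
      have "Z \<subseteq> {1..<?n}" using Z Des_subset[OF comp] by auto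
      then obtain K where K: "is_composition ?n K" "Des K = Z" using ex_composition_of_Des by blast
      let ?J = "colorize K (color_word I)"
      have J: "map fst ?J = K" "color_word ?J = color_word I"
        using color_word_colorize[OF K(1) refl] Z K(2) by (auto simp: map_fst_colorize)
      have "positive_parts ?J"
      proof -
        have "\<forall>p\<in>set (map fst ?J). 1 \<le> p" using K(1) unfolding J by (simp add: is_composition_def)
        then show ?thesis by (simp add: positive_parts_def)
      qed
      then have "coarser_eq ?J I" using I J K Z by (intro coarser_eqI) auto
      then show "Z \<in> cDes ` ?A" using J K by (intro image_eqI[of _ _ ?J]) auto
    qed
  qed
qed

subsection \<open>Products of complete homogeneous series\<close>

definition series_mult :: "series \<Rightarrow> series \<Rightarrow> series" where
  "series_mult f g = (\<lambda>m. \<Sum>a\<in>{a. a \<subseteq># m}. f a * g (m - a))"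

definition prodser :: "colored_composition \<Rightarrow> series" where
  "prodser I = foldr (\<lambda>p g. series_mult (complete_homogeneous (fst p) (snd p)) g) I (\<lambda>m. if m = {#} then 1 else 0)"

text \<open>A monomial of a complete homogeneous series is represented by its sorted word; a product
  of such series is a concatenation of sorted blocks of the prescribed lengths and colors.\<close>

fun blocky :: "colored_composition \<Rightarrow> (nat \<times> nat) list \<Rightarrow> bool" where
  "blocky [] ys \<longleftrightarrow> ys = []"
| "blocky (p # I) ys \<longleftrightarrow> fst p \<le> length ys \<and> sorted (take (fst p) ys) \<and>
     set (take (fst p) ys) \<subseteq> {1..} \<times> {snd p} \<and> blocky I (drop (fst p) ys)"

lemma finite_submultisets: "finite {a. a \<subseteq># (m :: 'a multiset)}"
proof (rule finite_subset)
  show "{a. a \<subseteq># m} \<subseteq> mset ` {xs. set xs \<subseteq> set_mset m \<and> length xs \<le> size m}"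
  proof
    fix a assume a: "a \<in> {a. a \<subseteq># m}"
    obtain xs where "a = mset xs" using ex_mset by metis
    then show "a \<in> mset ` {xs. set xs \<subseteq> set_mset m \<and> length xs \<le> size m}"
      using a set_mset_mono[of a m] size_mset_mono[of a m] by (intro image_eqI) auto
  qed
qed (simp add: finite_lists_length_le)

lemma finite_mset_eq: "finite {ys. mset ys = m \<and> Q ys}"
  by (rule finite_subset[OF _ finite_lists_length_eq[of "set_mset m" "size m"]]) auto

text \<open>Choosing a submultiset for the first factor is choosing the first block, because a block
  is the sorted list of its multiset.\<close>

lemma prodser_card: "prodser I m = of_nat (card {ys. mset ys = m \<and> blocky I ys})"
proof (induction I arbitrary: m)
  case Nil
  have "{ys. mset ys = m \<and> blocky [] ys} = (if m = {#} then {[]} else {})" by auto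
  then show ?case by (simp add: prodser_def)
next
  case (Cons p I)
  let ?H = "{A. A \<subseteq># m \<and> size A = fst p \<and> set_mset A \<subseteq> {1..} \<times> {snd p}}"
  let ?Y = "\<lambda>A. (\<lambda>ys. sorted_list_of_multiset A @ ys) ` {ys. mset ys = m - A \<and> blocky I ys}"
  have finH: "finite ?H" by (rule finite_subset[OF _ finite_submultisets[of m]]) auto
  have len: "length (sorted_list_of_multiset A) = size A" for A :: "(nat \<times> nat) multiset"
    by (metis mset_sorted_list_of_multiset size_mset)
  have "{ys. mset ys = m \<and> blocky (p # I) ys} = (\<Union>A\<in>?H. ?Y A)"
  proof
    show "{ys. mset ys = m \<and> blocky (p # I) ys} \<subseteq> (\<Union>A\<in>?H. ?Y A)"
    proof
      fix ys assume "ys \<in> {ys. mset ys = m \<and> blocky (p # I) ys}"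
      then have ys: "mset ys = m" "fst p \<le> length ys" "sorted (take (fst p) ys)"
        "set (take (fst p) ys) \<subseteq> {1..} \<times> {snd p}" "blocky I (drop (fst p) ys)" by auto
      let ?A = "mset (take (fst p) ys)"
      have m: "m = ?A + mset (drop (fst p) ys)"
        unfolding ys(1)[symmetric] mset_append[symmetric] append_take_drop_id ..
      then have "?A \<subseteq># m" "mset (drop (fst p) ys) = m - ?A" by simp_all
      then have A: "?A \<in> ?H" using ys by (simp add: min_def)
      have "ys = sorted_list_of_multiset ?A @ drop (fst p) ys"
        using ys(3) by (simp add: sorted_sort_id)
      then have "ys \<in> ?Y ?A"
        using \<open>mset (drop (fst p) ys) = m - ?A\<close> ys(5) by (intro image_eqI[of _ _ "drop (fst p) ys"]) simp_all
      with A show "ys \<in> (\<Union>A\<in>?H. ?Y A)" by blast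
    qed
    show "(\<Union>A\<in>?H. ?Y A) \<subseteq> {ys. mset ys = m \<and> blocky (p # I) ys}"
      by (auto simp: len subset_mset.add_diff_inverse)
  qed
  moreover have "card (\<Union>A\<in>?H. ?Y A) = (\<Sum>A\<in>?H. card (?Y A))"
  proof (rule card_UN_disjoint[OF finH])
    show "\<forall>A\<in>?H. finite (?Y A)" using finite_mset_eq by blast
    show "\<forall>A\<in>?H. \<forall>B\<in>?H. A \<noteq> B \<longrightarrow> ?Y A \<inter> ?Y B = {}"
    proof (intro ballI impI)
      fix A B assume AB: "A \<in> ?H" "B \<in> ?H" "A \<noteq> B"
      show "?Y A \<inter> ?Y B = {}"
      proof (rule ccontr)
        assume "?Y A \<inter> ?Y B \<noteq> {}"
        then obtain x y where "sorted_list_of_multiset A @ x = sorted_list_of_multiset B @ y" by blast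
        then have "sorted_list_of_multiset A = sorted_list_of_multiset B"
          using AB len by (simp add: append_eq_append_conv)
        then have "A = B" by (metis mset_sorted_list_of_multiset)
        with AB show False by simp
      qed
    qed
  qed
  moreover have "card (?Y A) = card {ys. mset ys = m - A \<and> blocky I ys}" for A
    by (rule card_image) (simp add: inj_on_def)
  ultimately have c: "card {ys. mset ys = m \<and> blocky (p # I) ys} =
      (\<Sum>A\<in>?H. card {ys. mset ys = m - A \<and> blocky I ys})" by simp
  have "prodser (p # I) m = (\<Sum>A\<in>{A. A \<subseteq># m}. complete_homogeneous (fst p) (snd p) A * prodser I (m - A))"
    by (simp add: prodser_def series_mult_def)
  also have "\<dots> = (\<Sum>A\<in>{A. A \<subseteq># m}. if A \<in> ?H then prodser I (m - A) else 0)"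
    by (rule sum.cong) (auto simp: complete_homogeneous_def)
  also have "\<dots> = (\<Sum>A\<in>?H. prodser I (m - A))"
    by (rule sum.mono_neutral_cong_right[OF finite_submultisets]) auto
  finally show ?case unfolding c by (simp only: Cons of_nat_sum)
qed

text \<open>Neighbouring letters lie in the same block exactly when the position between them is not
  a descent of the composition, so sortedness of the blocks becomes a local condition.\<close>

lemma blocky_iff:
  assumes "positive_parts I"
  shows "blocky I ys \<longleftrightarrow> map snd ys = color_word I \<and> (\<forall>p\<in>set ys. 1 \<le> fst p) \<and>
    (\<forall>j\<in>{1..<length ys}. j \<notin> cDes I \<longrightarrow> ys ! (j - 1) \<le> ys ! j)"
  using assms
proof (induction I arbitrary: ys)
  case (Cons p I)
  obtain k a where p: "p = (k, a)" by (cases p)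
  have k: "1 \<le> k" using Cons.prems p by simp
  have snd_iff: "map snd ys = replicate k a @ color_word I \<longleftrightarrow>
      k \<le> length ys \<and> map snd (take k ys) = replicate k a \<and> map snd (drop k ys) = color_word I"
  proof
    assume e: "map snd ys = replicate k a @ color_word I"
    have "length ys = k + length (color_word I)" using arg_cong[OF e, of length] by simp
    then show "k \<le> length ys \<and> map snd (take k ys) = replicate k a \<and> map snd (drop k ys) = color_word I"
      using arg_cong[OF e, of "take k"] arg_cong[OF e, of "drop k"] by (simp add: take_map drop_map)
  next
    assume "k \<le> length ys \<and> map snd (take k ys) = replicate k a \<and> map snd (drop k ys) = color_word I"
    then show "map snd ys = replicate k a @ color_word I"
      by (metis append_take_drop_id map_append)
  qed
  show ?case
  proof (cases "map snd ys = replicate k a @ color_word I")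
    case False
    have "\<not> blocky (p # I) ys"
    proof
      assume b: "blocky (p # I) ys"
      then have kl: "k \<le> length ys" and t: "set (take k ys) \<subseteq> {1..} \<times> {a}" using p by simp_all
      have "map snd (drop k ys) = color_word I"
        using b Cons p by simp
      moreover have "map snd (take k ys) = replicate k a"
        using t kl by (intro replicate_eqI) auto
      ultimately show False using False snd_iff kl by simp
    qed
    with False show ?thesis using p by simp
  next
    case True
    then have kl: "k \<le> length ys" and t: "map snd (take k ys) = replicate k a"
      and dr: "map snd (drop k ys) = color_word I" using snd_iff by auto
    have tk: "set (take k ys) \<subseteq> {1..} \<times> {a} \<longleftrightarrow> (\<forall>p\<in>set (take k ys). 1 \<le> fst p)"
    proof -
      have "snd p = a" if "p \<in> set (take k ys)" for p
      proof -
        have "snd p \<in> set (map snd (take k ys))" using that by simp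
        then show ?thesis unfolding t by auto
      qed
      then show ?thesis by (auto simp: subset_iff)
    qed
    have all: "(\<forall>p\<in>set ys. 1 \<le> fst p) \<longleftrightarrow> (\<forall>p\<in>set (take k ys). 1 \<le> fst p) \<and> (\<forall>p\<in>set (drop k ys). 1 \<le> fst p)"
      by (subst (1) append_take_drop_id[of k ys, symmetric]) (simp only: set_append ball_Un)
    have st: "sorted (take k ys) \<longleftrightarrow> (\<forall>j\<in>{1..<k}. ys ! (j - 1) \<le> ys ! j)"
    proof
      assume "sorted (take k ys)"
      then show "\<forall>j\<in>{1..<k}. ys ! (j - 1) \<le> ys ! j"
        using kl by (auto simp: sorted_iff_nth_mono)
    next
      assume *: "\<forall>j\<in>{1..<k}. ys ! (j - 1) \<le> ys ! j"
      show "sorted (take k ys)"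
        unfolding sorted_iff_nth_Suc
      proof (intro allI impI)
        fix i assume "Suc i < length (take k ys)"
        then show "take k ys ! i \<le> take k ys ! Suc i" using bspec[OF *, of "Suc i"] by simp
      qed
    qed
    have bI: "blocky I (drop k ys) \<longleftrightarrow> (\<forall>p\<in>set (drop k ys). 1 \<le> fst p) \<and>
        (\<forall>j\<in>{1..<length ys - k}. j \<notin> cDes I \<longrightarrow> ys ! (k + j - 1) \<le> ys ! (k + j))"
    proof -
      have "drop k ys ! (j - 1) = ys ! (k + j - 1)" "drop k ys ! j = ys ! (k + j)" if "j \<in> {1..<length ys - k}" for j
        using that kl by (simp_all add: nth_drop)
      then show ?thesis
        using Cons.IH[of "drop k ys"] Cons.prems p dr by simp
    qed
    have big: "(\<forall>j\<in>{1..<length ys}. j \<notin> cDes (p # I) \<longrightarrow> ys ! (j - 1) \<le> ys ! j) \<longleftrightarrow>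
        (\<forall>j\<in>{1..<k}. ys ! (j - 1) \<le> ys ! j) \<and>
        (\<forall>j\<in>{1..<length ys - k}. j \<notin> cDes I \<longrightarrow> ys ! (k + j - 1) \<le> ys ! (k + j))"
    proof (intro iffI conjI ballI impI)
      fix j assume "\<forall>j\<in>{1..<length ys}. j \<notin> cDes (p # I) \<longrightarrow> ys ! (j - 1) \<le> ys ! j" "j \<in> {1..<k}"
      note * = this
      have "j \<notin> cDes (p # I)" using *(2) p by (auto simp: Des_Cons)
      then show "ys ! (j - 1) \<le> ys ! j" using *(2) kl bspec[OF *(1), of j] by simp
    next
      fix j assume *: "\<forall>j\<in>{1..<length ys}. j \<notin> cDes (p # I) \<longrightarrow> ys ! (j - 1) \<le> ys ! j"
        "j \<in> {1..<length ys - k}" "j \<notin> cDes I"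
      then have "k + j \<notin> cDes (p # I)" using p by (auto simp: Des_Cons)
      then show "ys ! (k + j - 1) \<le> ys ! (k + j)" using * bspec[OF *(1), of "k + j"] by auto
    next
      fix j assume *: "(\<forall>j\<in>{1..<k}. ys ! (j - 1) \<le> ys ! j) \<and>
        (\<forall>j\<in>{1..<length ys - k}. j \<notin> cDes I \<longrightarrow> ys ! (k + j - 1) \<le> ys ! (k + j))"
        and j: "j \<in> {1..<length ys}" "j \<notin> cDes (p # I)"
      have "length ys = k" if "I = []" using arg_cong[OF True, of length] that by simp
      then have I: "I \<noteq> []" if "k \<le> j" using that j by auto
      have jk: "j \<noteq> k" using I j(2) p by (auto simp: Des_Cons)
      show "ys ! (j - 1) \<le> ys ! j"
      proof (cases "j < k")
        case True
        then show ?thesis using * j by auto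
      next
        case False
        then have "j - k \<notin> cDes I" "j - k \<in> {1..<length ys - k}"
          using jk j p I by (auto simp: Des_Cons image_iff)
        then have "ys ! (k + (j - k) - 1) \<le> ys ! (k + (j - k))" using * by blast
        then show ?thesis using False by simp
      qed
    qed
    show ?thesis
      unfolding blocky.simps p fst_conv snd_conv tk st bI big[unfolded p] all color_word_simps using True kl by blast
  qed
qed auto

subsection \<open>Stable sorting\<close>

text \<open>\<sigma> sends each letter of the sorted list \<open>xs\<close> to its place in a
  rearranged word with colors \<open>c\<close>. The third condition is stability: equal letters keep
  their order.\<close>

definition Pset :: "nat list \<Rightarrow> nat set \<Rightarrow> (nat \<times> nat) list \<Rightarrow> (nat \<Rightarrow> nat) set" where
  "Pset c Z xs = {\<sigma>. \<sigma> permutes {1..length xs} \<and> (\<forall>j\<in>{1..length xs}. col c (\<sigma> j) = snd (xs ! (j - 1))) \<and>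
     (\<forall>j\<in>{1..<length xs}. xs ! (j - 1) = xs ! j \<longrightarrow> \<sigma> j < \<sigma> (Suc j)) \<and>
     (\<forall>i\<in>{1..<length xs}. i \<notin> Z \<longrightarrow> pinv \<sigma> i < pinv \<sigma> (Suc i))}"

text \<open>As \<open>Pset\<close>, except that the descents of the inverse at equal colors are
  prescribed exactly instead of being bounded by \<open>Z\<close>.\<close>

definition Rset :: "nat list \<Rightarrow> nat set \<Rightarrow> (nat \<times> nat) list \<Rightarrow> (nat \<Rightarrow> nat) set" where
  "Rset c Z xs = {\<sigma>. \<sigma> permutes {1..length xs} \<and> (\<forall>j\<in>{1..length xs}. col c (\<sigma> j) = snd (xs ! (j - 1))) \<and>
     (\<forall>j\<in>{1..<length xs}. xs ! (j - 1) = xs ! j \<longrightarrow> \<sigma> j < \<sigma> (Suc j)) \<and>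
     (\<forall>i\<in>{1..<length xs}. col c i = col c (Suc i) \<longrightarrow> (pinv \<sigma> (Suc i) < pinv \<sigma> i \<longleftrightarrow> i \<in> Z))}"

text \<open>In a sorted list everything between two equal letters is equal to them, so stability
  propagates from neighbours to the whole run.\<close>

lemma stable_run:
  assumes "sorted (xs :: (nat \<times> nat) list)" "\<forall>j\<in>{1..<length xs}. xs ! (j - 1) = xs ! j \<longrightarrow> \<sigma> j < (\<sigma> (Suc j) :: nat)"
    and "1 \<le> a" "a < b" "b \<le> length xs" "xs ! (a - 1) = xs ! (b - 1)"
  shows "\<sigma> a < \<sigma> b"
  using assms(4-6)
proof (induction b)
  case (Suc b)
  have b: "a \<le> b" using Suc.prems by simp
  have le: "xs ! (a - 1) \<le> xs ! (b - 1)" "xs ! (b - 1) \<le> xs ! b"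
    using Suc.prems(2) b by (simp_all add: sorted_nth_mono[OF assms(1)])
  have ab: "xs ! (a - 1) = xs ! b" using Suc.prems(3) by simp
  have e: "xs ! (b - 1) = xs ! b" "xs ! (a - 1) = xs ! (b - 1)"
    using le unfolding ab by (auto intro: antisym)
  have "b \<in> {1..<length xs}" using assms(3) b Suc.prems by simp
  then have lt: "\<sigma> b < \<sigma> (Suc b)" using assms(2) e(1) by blast
  show ?case
  proof (cases "a = b")
    case False
    then have "\<sigma> a < \<sigma> b" using Suc.prems b e(2) by (intro Suc.IH) auto
    with lt show ?thesis by simp
  qed (use lt in simp)
qed simp

text \<open>A word and its stable sorting permutation determine each other. Both injectivity and
  surjectivity come from sorting the letters together with their places.\<close>

lemma card_Pset:
  assumes xs: "sorted xs" and c: "length c = length xs"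
  shows "card {ys. mset ys = mset xs \<and> map snd ys = c \<and> (\<forall>j\<in>{1..<length ys}. j \<notin> Z \<longrightarrow> ys ! (j - 1) \<le> ys ! j)} =
    card (Pset c Z xs)"
proof -
  let ?n = "length xs"
  let ?\<Phi> = "\<lambda>\<sigma>. map (\<lambda>i. xs ! (pinv \<sigma> (Suc i) - 1)) [0..<?n]"
  let ?Y = "{ys. mset ys = mset xs \<and> map snd ys = c \<and> (\<forall>j\<in>{1..<length ys}. j \<notin> Z \<longrightarrow> ys ! (j - 1) \<le> ys ! j)}"
  have nthPhi: "?\<Phi> \<sigma> ! (i - 1) = xs ! (pinv \<sigma> i - 1)" if "i \<in> {1..?n}" for \<sigma> i
    using that by auto
  have inv_in: "pinv \<sigma> i \<in> {1..?n}" if "\<sigma> permutes {1..?n}" "i \<in> {1..?n}" for \<sigma> i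
    using permutes_in_image[OF permutes_inv[OF that(1)], of i] that(2) by blast
  have pin: "\<sigma> i \<in> {1..?n}" if "\<sigma> permutes {1..?n}" "i \<in> {1..?n}" for \<sigma> i
    using permutes_in_image[OF that(1), of i] that(2) by blast
  \<comment> \<open>Equal letters stand in the word in the order of their indices in
    \<open>xs\<close>. Hence weak ascents of the word, ties included, are exactly ascents of the
    inverse.\<close>
  have le_iff: "?\<Phi> \<sigma> ! (j - 1) \<le> ?\<Phi> \<sigma> ! j \<longleftrightarrow> pinv \<sigma> j < pinv \<sigma> (Suc j)"
    if s: "\<sigma> permutes {1..?n}" "\<forall>j\<in>{1..<?n}. xs ! (j - 1) = xs ! j \<longrightarrow> \<sigma> j < \<sigma> (Suc j)" and j: "j \<in> {1..<?n}" for \<sigma> j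
  proof -
    have n1: "?\<Phi> \<sigma> ! (j - 1) = xs ! (pinv \<sigma> j - 1)" "?\<Phi> \<sigma> ! j = xs ! (pinv \<sigma> (Suc j) - 1)"
      using nthPhi[of j \<sigma>] nthPhi[of "Suc j" \<sigma>] j by auto
    have r: "pinv \<sigma> j \<in> {1..?n}" "pinv \<sigma> (Suc j) \<in> {1..?n}" using inv_in[OF s(1)] j by auto
    have ne: "pinv \<sigma> j \<noteq> pinv \<sigma> (Suc j)"
      using permutes_inj[OF permutes_inv[OF s(1)]] by (simp add: inj_eq)
    show ?thesis
    proof
      assume "pinv \<sigma> j < pinv \<sigma> (Suc j)"
      then show "?\<Phi> \<sigma> ! (j - 1) \<le> ?\<Phi> \<sigma> ! j"
        unfolding n1 using r xs by (auto simp: sorted_iff_nth_mono)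
    next
      assume le: "?\<Phi> \<sigma> ! (j - 1) \<le> ?\<Phi> \<sigma> ! j"
      show "pinv \<sigma> j < pinv \<sigma> (Suc j)"
      proof (rule ccontr)
        assume "\<not> ?thesis"
        then have lt: "pinv \<sigma> (Suc j) < pinv \<sigma> j" using ne by simp
        then have "xs ! (pinv \<sigma> (Suc j) - 1) \<le> xs ! (pinv \<sigma> j - 1)"
          using r xs by (auto simp: sorted_iff_nth_mono)
        then have "xs ! (pinv \<sigma> (Suc j) - 1) = xs ! (pinv \<sigma> j - 1)" using le unfolding n1 by simp
        then have "\<sigma> (pinv \<sigma> (Suc j)) < \<sigma> (pinv \<sigma> j)"
          using r lt by (intro stable_run[OF xs s(2)]) auto
        then show False using permutes_inverses(1)[OF s(1)] by simp
      qed
    qed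
  qed
  have snd_iff: "map snd (?\<Phi> \<sigma>) = c \<longleftrightarrow> (\<forall>j\<in>{1..?n}. col c (\<sigma> j) = snd (xs ! (j - 1)))"
    if s: "\<sigma> permutes {1..?n}" for \<sigma>
  proof
    assume e: "map snd (?\<Phi> \<sigma>) = c"
    show "\<forall>j\<in>{1..?n}. col c (\<sigma> j) = snd (xs ! (j - 1))"
    proof
      fix j assume j: "j \<in> {1..?n}"
      have sj: "\<sigma> j \<in> {1..?n}" by (rule pin[OF s j])
      then have "col c (\<sigma> j) = snd (?\<Phi> \<sigma> ! (\<sigma> j - 1))"
        unfolding e[symmetric] col_def by (subst nth_map) auto
      also have "\<dots> = snd (xs ! (j - 1))"
        unfolding nthPhi[OF sj] permutes_inverses(2)[OF s] ..
      finally show "col c (\<sigma> j) = snd (xs ! (j - 1))" .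
    qed
  next
    assume *: "\<forall>j\<in>{1..?n}. col c (\<sigma> j) = snd (xs ! (j - 1))"
    show "map snd (?\<Phi> \<sigma>) = c"
    proof (rule nth_equalityI)
      show "length (map snd (?\<Phi> \<sigma>)) = length c" using c by simp
      fix i assume "i < length (map snd (?\<Phi> \<sigma>))"
      then have i: "i < ?n" by simp
      then have "pinv \<sigma> (Suc i) \<in> {1..?n}" by (intro inv_in[OF s]) auto
      from bspec[OF * this] have "c ! i = snd (xs ! (pinv \<sigma> (Suc i) - 1))"
        using permutes_inverses(1)[OF s] by simp
      then show "map snd (?\<Phi> \<sigma>) ! i = c ! i" using i by simp
    qed
  qed
  have mset_Phi: "mset (?\<Phi> \<sigma>) = mset xs" if s: "\<sigma> permutes {1..?n}" for \<sigma>
  proof -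
    have list: "map (\<lambda>i. h (Suc i)) [0..<?n] = map h [1..<Suc ?n]" for h :: "nat \<Rightarrow> nat \<times> nat"
      by (rule nth_equalityI) (auto simp: One_nat_def simp del: upt_Suc)
    have "mset (?\<Phi> \<sigma>) = image_mset (\<lambda>i. xs ! (pinv \<sigma> i - 1)) (mset_set {1..?n})"
      unfolding list[of "\<lambda>i. xs ! (pinv \<sigma> i - 1)"] mset_map mset_upt by (simp add: atLeastLessThanSuc_atLeastAtMost)
    also have "\<dots> = image_mset (\<lambda>i. xs ! (i - 1)) (image_mset (pinv \<sigma>) (mset_set {1..?n}))"
      by (simp add: multiset.map_comp comp_def)
    also have "image_mset (pinv \<sigma>) (mset_set {1..?n}) = mset_set (pinv \<sigma> ` {1..?n})"
      using permutes_inj_on[OF permutes_inv[OF s]] by (intro image_mset_mset_set)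
    also have "pinv \<sigma> ` {1..?n} = {1..?n}" by (rule permutes_image[OF permutes_inv[OF s]])
    also have "image_mset (\<lambda>i. xs ! (i - 1)) (mset_set {1..?n}) = mset (map (\<lambda>i. xs ! (i - 1)) [1..<Suc ?n])"
      unfolding mset_map mset_upt by (simp add: atLeastLessThanSuc_atLeastAtMost)
    also have "map (\<lambda>i. xs ! (i - 1)) [1..<Suc ?n] = xs"
      unfolding list[of "\<lambda>i. xs ! (i - 1)", symmetric] by (simp add: map_nth)
    finally show ?thesis .
  qed
  have "bij_betw ?\<Phi> (Pset c Z xs) ?Y"
    unfolding bij_betw_def
  proof
    show "inj_on ?\<Phi> (Pset c Z xs)"
    proof (rule inj_onI)
      fix \<sigma> \<sigma>' assume s: "\<sigma> \<in> Pset c Z xs" "\<sigma>' \<in> Pset c Z xs" and eq: "?\<Phi> \<sigma> = ?\<Phi> \<sigma>'"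
      \<comment> \<open>The list of pairs of a letter and its place, sorted by stability. Its
        underlying set depends on the word alone, so equal words give equal lists.\<close>
      let ?z = "\<lambda>\<sigma>. map (\<lambda>j. (xs ! j, \<sigma> (Suc j))) [0..<?n]"
      have sd: "sorted (?z \<sigma>) \<and> distinct (?z \<sigma>)" and st: "set (?z \<sigma>) = {(?\<Phi> \<sigma> ! (i - 1), i) | i. i \<in> {1..?n}}"
        if "\<sigma> \<in> Pset c Z xs" for \<sigma>
      proof -
        have p: "\<sigma> permutes {1..?n}" "\<forall>j\<in>{1..<?n}. xs ! (j - 1) = xs ! j \<longrightarrow> \<sigma> j < \<sigma> (Suc j)"
          using that by (auto simp: Pset_def)
        have "?z \<sigma> ! i \<le> ?z \<sigma> ! Suc i" if "Suc i < length (?z \<sigma>)" for i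
        proof -
          have i: "Suc i < ?n" using that by simp
          have "xs ! i \<le> xs ! Suc i" using xs i by (auto simp: sorted_iff_nth_Suc)
          moreover have "\<sigma> (Suc i) < \<sigma> (Suc (Suc i))" if "xs ! i = xs ! Suc i"
            using bspec[OF p(2), of "Suc i"] i that by simp
          ultimately show ?thesis using i by (cases "xs ! i = xs ! Suc i") (auto simp: less_eq_prod_def[of "(_, _ :: nat)"])
        qed
        moreover have "distinct (?z \<sigma>)"
          unfolding distinct_map by (auto intro!: inj_onI dest: injD[OF permutes_inj[OF p(1)]])
        ultimately show "sorted (?z \<sigma>) \<and> distinct (?z \<sigma>)" by (simp only: sorted_iff_nth_Suc) simp
        show "set (?z \<sigma>) = {(?\<Phi> \<sigma> ! (i - 1), i) | i. i \<in> {1..?n}}"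
        proof
          show "set (?z \<sigma>) \<subseteq> {(?\<Phi> \<sigma> ! (i - 1), i) | i. i \<in> {1..?n}}"
          proof
            fix x assume "x \<in> set (?z \<sigma>)"
            then obtain j where j: "j < ?n" "x = (xs ! j, \<sigma> (Suc j))" by auto
            have "\<sigma> (Suc j) \<in> {1..?n}" using j by (intro pin[OF p(1)]) auto
            then show "x \<in> {(?\<Phi> \<sigma> ! (i - 1), i) | i. i \<in> {1..?n}}"
              using nthPhi[of "\<sigma> (Suc j)" \<sigma>] permutes_inverses(2)[OF p(1), of "Suc j"] j
              by (intro CollectI exI[of _ "\<sigma> (Suc j)"]) simp
          qed
          show "{(?\<Phi> \<sigma> ! (i - 1), i) | i. i \<in> {1..?n}} \<subseteq> set (?z \<sigma>)"
          proof
            fix x assume "x \<in> {(?\<Phi> \<sigma> ! (i - 1), i) | i. i \<in> {1..?n}}"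
            then obtain i where i: "i \<in> {1..?n}" "x = (xs ! (pinv \<sigma> i - 1), i)" using nthPhi by auto
            have "pinv \<sigma> i \<in> {1..?n}" by (rule inv_in[OF p(1) i(1)])
            moreover from this have "Suc (pinv \<sigma> i - 1) = pinv \<sigma> i" by auto
            moreover have "\<sigma> (pinv \<sigma> i) = i" by (rule permutes_inverses(1)[OF p(1)])
            ultimately show "x \<in> set (?z \<sigma>)"
              unfolding i(2) set_map by (intro image_eqI[of _ _ "pinv \<sigma> i - 1"]) (simp, auto)
          qed
        qed
      qed
      have "?z \<sigma> = ?z \<sigma>'"
      proof (rule sorted_distinct_set_unique)
        show "set (?z \<sigma>) = set (?z \<sigma>')" unfolding st[OF s(1)] st[OF s(2)] eq ..
      qed (rule sd[OF s(1), THEN conjunct1] sd[OF s(1), THEN conjunct2]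
        sd[OF s(2), THEN conjunct1] sd[OF s(2), THEN conjunct2])+
      then have e: "\<sigma> (Suc j) = \<sigma>' (Suc j)" if "j < ?n" for j
        using that by (auto dest: map_eq_conv[THEN iffD1])
      show "\<sigma> = \<sigma>'"
      proof
        fix i
        show "\<sigma> i = \<sigma>' i"
        proof (cases "i \<in> {1..?n}")
          case True
          then have "i - 1 < ?n" "Suc (i - 1) = i" by auto
          with e[of "i - 1"] show ?thesis by simp
        next
          case False
          have "\<sigma> permutes {1..?n}" "\<sigma>' permutes {1..?n}" using s by (simp_all add: Pset_def)
          then show ?thesis using False by (simp only: permutes_not_in not_False_eq_True)
        qed
      qed
    qed
    show "?\<Phi> ` Pset c Z xs = ?Y"
    proof
      show "?\<Phi> ` Pset c Z xs \<subseteq> ?Y"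
      proof
        fix ys assume "ys \<in> ?\<Phi> ` Pset c Z xs"
        then obtain \<sigma> where s: "\<sigma> \<in> Pset c Z xs" "ys = ?\<Phi> \<sigma>" by blast
        then have p: "\<sigma> permutes {1..?n}" "\<forall>j\<in>{1..<?n}. xs ! (j - 1) = xs ! j \<longrightarrow> \<sigma> j < \<sigma> (Suc j)"
          "\<forall>j\<in>{1..?n}. col c (\<sigma> j) = snd (xs ! (j - 1))"
          "\<And>j. j \<in> {1..<?n} \<Longrightarrow> j \<notin> Z \<Longrightarrow> pinv \<sigma> j < pinv \<sigma> (Suc j)"
          by (auto simp: Pset_def)
        have "ys ! (j - 1) \<le> ys ! j" if "j \<in> {1..<length ys}" "j \<notin> Z" for j
        proof -
          have j: "j \<in> {1..<?n}" using that s(2) by simp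
          show ?thesis unfolding s(2) by (rule le_iff[OF p(1,2) j, THEN iffD2, OF p(4)[OF j that(2)]])
        qed
        moreover have "mset ys = mset xs" unfolding s(2) by (rule mset_Phi[OF p(1)])
        moreover have "map snd ys = c" unfolding s(2) by (rule snd_iff[OF p(1), THEN iffD2, OF p(3)])
        ultimately show "ys \<in> ?Y" by blast
      qed
      show "?Y \<subseteq> ?\<Phi> ` Pset c Z xs"
      proof
        fix ys assume "ys \<in> ?Y"
        then have ys: "mset ys = mset xs" "map snd ys = c"
          "\<And>j. j \<in> {1..<length ys} \<Longrightarrow> j \<notin> Z \<Longrightarrow> ys ! (j - 1) \<le> ys ! j" by auto
        have len: "length ys = ?n" using ys(1) by (metis size_mset)
        \<comment> \<open>Stable sorting: the place is adjoined to each letter to break ties, and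
          the second components read off \<sigma>.\<close>
        define z where "z = sort (zip ys [1..<Suc ?n])"
        have zl: "length z = ?n" using len by (simp add: z_def del: upt_Suc)
        have zm: "mset z = mset (zip ys [1..<Suc ?n])" by (simp add: z_def)
        have zs: "sorted z" by (simp add: z_def)
        have "sorted (map fst z)"
          using zs by (auto simp: sorted_iff_nth_Suc less_eq_prod_def[of "_ :: (nat \<times> nat) \<times> nat"] intro: less_imp_le)
        moreover have "mset (map fst z) = mset xs"
        proof -
          have "mset (map fst z) = mset (map fst (zip ys [1..<Suc ?n]))" by (simp only: mset_map zm)
          also have "map fst (zip ys [1..<Suc ?n]) = ys" using len by (simp del: upt_Suc)
          finally show ?thesis using ys(1) by simp
        qed
        ultimately have zf: "map fst z = xs"
          using properties_for_sort[of "map fst z" xs] sorted_sort_id[OF xs] by simp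
        have "mset (map snd z) = mset [1..<Suc ?n]"
        proof -
          have "mset (map snd z) = mset (map snd (zip ys [1..<Suc ?n]))" by (simp only: mset_map zm)
          also have "map snd (zip ys [1..<Suc ?n]) = [1..<Suc ?n]" using len by (simp del: upt_Suc)
          finally show ?thesis .
        qed
        then have zd: "distinct (map snd z)" "set (map snd z) = {1..?n}"
          using mset_eq_imp_distinct_iff[of "map snd z" "[1..<Suc ?n]"] mset_eq_setD[of "map snd z" "[1..<Suc ?n]"]
          by (auto simp: atLeastLessThanSuc_atLeastAtMost simp del: upt_Suc)
        define \<sigma> where "\<sigma> j = (if j \<in> {1..?n} then snd (z ! (j - 1)) else j)" for j
        have inj: "inj_on \<sigma> {1..?n}"
        proof (rule inj_onI)
          fix i j assume ij: "i \<in> {1..?n}" "j \<in> {1..?n}" "\<sigma> i = \<sigma> j"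
          then have "map snd z ! (i - 1) = map snd z ! (j - 1)" using zl by (auto simp: \<sigma>_def)
          then have "i - 1 = j - 1"
            using zd(1) ij zl by (subst (asm) nth_eq_iff_index_eq) auto
          then show "i = j" using ij by auto
        qed
        have img: "\<sigma> ` {1..?n} \<subseteq> {1..?n}"
        proof
          fix x assume "x \<in> \<sigma> ` {1..?n}"
          then obtain j where j: "j \<in> {1..?n}" "x = snd (z ! (j - 1))" by (auto simp: \<sigma>_def)
          then have "x \<in> set (map snd z)" using zl by (auto intro!: image_eqI[of _ snd "z ! (j - 1)"])
          then show "x \<in> {1..?n}" unfolding zd(2) .
        qed
        have perm: "\<sigma> permutes {1..?n}"
          by (rule bij_imp_permutes) (use inj img endo_inj_surj[of "{1..?n}" \<sigma>] in \<open>auto simp: bij_betw_def \<sigma>_def\<close>)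
        have zmem: "ys ! (snd p - 1) = fst p" if "p \<in> set z" for p
        proof -
          have "p \<in> set (zip ys [1..<Suc ?n])" using that mset_eq_setD[OF zm] by blast
          then obtain i where "i < ?n" "p = (ys ! i, [1..<Suc ?n] ! i)" using len by (auto simp: set_zip simp del: upt_Suc)
          then show ?thesis by (simp del: upt_Suc)
        qed
        have ysx: "ys ! (\<sigma> j - 1) = xs ! (j - 1)" if "j \<in> {1..?n}" for j
        proof -
          have "z ! (j - 1) \<in> set z" using that zl by (intro nth_mem) auto
          from zmem[OF this] have "ys ! (\<sigma> j - 1) = fst (z ! (j - 1))" using that by (simp add: \<sigma>_def)
          also have "\<dots> = xs ! (j - 1)" unfolding zf[symmetric] using that zl by (subst nth_map) auto
          finally show ?thesis .
        qed
        have stable: "\<forall>j\<in>{1..<?n}. xs ! (j - 1) = xs ! j \<longrightarrow> \<sigma> j < \<sigma> (Suc j)"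
        proof (intro ballI impI)
          fix j assume j: "j \<in> {1..<?n}" "xs ! (j - 1) = xs ! j"
          have "z ! (j - 1) \<le> z ! j" using zs j(1) zl by (auto simp: sorted_iff_nth_mono)
          moreover have "fst (z ! (j - 1)) = fst (z ! j)"
          proof -
            have "j - 1 < length z" "j < length z" using j(1) zl by auto
            then show ?thesis
              using j(2) by (metis nth_map zf)
          qed
          ultimately have "snd (z ! (j - 1)) \<le> snd (z ! j)"
            by (auto simp: less_eq_prod_def[of "_ :: (nat \<times> nat) \<times> nat"])
          then have "\<sigma> j \<le> \<sigma> (Suc j)" using j(1) by (simp add: \<sigma>_def)
          moreover have "\<sigma> j \<noteq> \<sigma> (Suc j)" using permutes_inj[OF perm] by (simp add: inj_eq)
          ultimately show "\<sigma> j < \<sigma> (Suc j)" by simp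
        qed
        have Phi: "?\<Phi> \<sigma> = ys"
        proof (rule nth_equalityI)
          show "length (?\<Phi> \<sigma>) = length ys" using len by simp
          fix i assume "i < length (?\<Phi> \<sigma>)"
          then have i: "i < ?n" by simp
          then have "pinv \<sigma> (Suc i) \<in> {1..?n}" by (intro inv_in[OF perm]) auto
          from ysx[OF this] show "?\<Phi> \<sigma> ! i = ys ! i"
            using i permutes_inverses(1)[OF perm, of "Suc i"] by simp
        qed
        have "\<sigma> \<in> Pset c Z xs"
          unfolding Pset_def
        proof (intro CollectI conjI)
          show "\<forall>j\<in>{1..?n}. col c (\<sigma> j) = snd (xs ! (j - 1))"
            by (rule snd_iff[OF perm, THEN iffD1]) (simp only: Phi ys(2))
          show "\<forall>i\<in>{1..<?n}. i \<notin> Z \<longrightarrow> pinv \<sigma> i < pinv \<sigma> (Suc i)"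
          proof (intro ballI impI)
            fix i assume i: "i \<in> {1..<?n}" "i \<notin> Z"
            have "?\<Phi> \<sigma> ! (i - 1) \<le> ?\<Phi> \<sigma> ! i" unfolding Phi using i len by (intro ys(3)) auto
            then show "pinv \<sigma> i < pinv \<sigma> (Suc i)" by (rule le_iff[OF perm stable i(1), THEN iffD1])
          qed
        qed (use perm stable in auto)
        then show "ys \<in> ?\<Phi> ` Pset c Z xs"
          by (rule rev_image_eqI[where f = ?\<Phi>]) (rule Phi[symmetric])
      qed
    qed
  qed
  from bij_betw_same_card[OF this] show ?thesis by simp
qed

lemma finite_Rset: "finite (Rset c W xs)"
  by (rule finite_subset[OF _ finite_permutations[of "{1..length xs}"]]) (auto simp: Rset_def)

lemma permutes_pinv_neq:
  assumes "\<sigma> permutes A"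
  shows "\<sigma> (Suc i) \<noteq> \<sigma> i" "pinv \<sigma> (Suc i) \<noteq> pinv \<sigma> i"
  using injD[OF permutes_inj[OF assms], of "Suc i" i] injD[OF permutes_inj[OF permutes_inv[OF assms]], of "Suc i" i]
  by auto

text \<open>The permutations are grouped by the exact set of descents of the inverse at equal
  colors. \<open>Rset\<close> leaves the color changes unconstrained; putting them into every
  \<open>W\<close> makes \<open>W\<close> unique.\<close>

lemma card_Pset_eq_sum_card_Rset:
  assumes len: "length c = length xs" and Z: "Z \<subseteq> {1..<length xs}"
    and N: "{j \<in> {1..<length c}. c ! (j - 1) \<noteq> c ! j} \<subseteq> Z"
  shows "card (Pset c Z xs) =
    (\<Sum>W\<in>{W. {j \<in> {1..<length c}. c ! (j - 1) \<noteq> c ! j} \<subseteq> W \<and> W \<subseteq> Z}. card (Rset c W xs))"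
proof -
  let ?n = "length xs"
  let ?N = "{j \<in> {1..<length c}. c ! (j - 1) \<noteq> c ! j}"
  let ?A = "{W. ?N \<subseteq> W \<and> W \<subseteq> Z}"
  have eqN: "i \<in> ?N \<longleftrightarrow> col c i \<noteq> col c (Suc i)" if "i \<in> {1..<?n}" for i
    using that by (simp add: len col_def)
  have "Pset c Z xs = (\<Union>W\<in>?A. Rset c W xs)"
  proof
    show "Pset c Z xs \<subseteq> (\<Union>W\<in>?A. Rset c W xs)"
    proof
      fix \<sigma> assume s: "\<sigma> \<in> Pset c Z xs"
      define W where "W = ?N \<union> {i \<in> {1..<?n}. col c i = col c (Suc i) \<and> pinv \<sigma> (Suc i) < pinv \<sigma> i}"
      have desZ: "i \<in> Z" if i: "i \<in> {1..<?n}" "pinv \<sigma> (Suc i) < pinv \<sigma> i" for i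
      proof (rule ccontr)
        assume "i \<notin> Z"
        then have "pinv \<sigma> i < pinv \<sigma> (Suc i)" using s i by (simp add: Pset_def)
        with i(2) show False by simp
      qed
      have "W \<subseteq> Z" unfolding W_def using N desZ by blast
      then have "W \<in> ?A" unfolding W_def by blast
      moreover have "pinv \<sigma> (Suc i) < pinv \<sigma> i \<longleftrightarrow> i \<in> W" if "i \<in> {1..<?n}" "col c i = col c (Suc i)" for i
        using that eqN[OF that(1)] by (simp add: W_def len)
      then have "\<sigma> \<in> Rset c W xs" using s by (simp add: Pset_def Rset_def)
      ultimately show "\<sigma> \<in> (\<Union>W\<in>?A. Rset c W xs)" by blast
    qed
    show "(\<Union>W\<in>?A. Rset c W xs) \<subseteq> Pset c Z xs"
    proof
      fix \<sigma> assume "\<sigma> \<in> (\<Union>W\<in>?A. Rset c W xs)"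
      then obtain W where W: "?N \<subseteq> W" "W \<subseteq> Z" and s: "\<sigma> \<in> Rset c W xs" by blast
      have "pinv \<sigma> i < pinv \<sigma> (Suc i)" if i: "i \<in> {1..<?n}" "i \<notin> Z" for i
      proof -
        have W': "i \<notin> W" "i \<notin> ?N" using i W by blast+
        then have "col c i = col c (Suc i)" using eqN[OF i(1)] by blast
        then have "\<not> pinv \<sigma> (Suc i) < pinv \<sigma> i" using s i(1) W'(1) by (simp add: Rset_def)
        moreover have "\<sigma> permutes {1..?n}" using s by (simp add: Rset_def)
        ultimately show ?thesis using permutes_pinv_neq(2)[of \<sigma> "{1..?n}" i] by simp
      qed
      then show "\<sigma> \<in> Pset c Z xs" using s by (simp add: Pset_def Rset_def)
    qed
  qed
  moreover have "card (\<Union>W\<in>?A. Rset c W xs) = (\<Sum>W\<in>?A. card (Rset c W xs))"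
  proof (rule card_UN_disjoint)
    show "finite ?A" by (rule finite_subset[of _ "Pow Z"]) (use Z finite_subset in auto)
    show "\<forall>W\<in>?A. finite (Rset c W xs)" by (simp add: finite_Rset)
    show "\<forall>W\<in>?A. \<forall>W'\<in>?A. W \<noteq> W' \<longrightarrow> Rset c W xs \<inter> Rset c W' xs = {}"
    proof (intro ballI impI)
      fix W W' assume W: "W \<in> ?A" "W' \<in> ?A" "W \<noteq> W'"
      show "Rset c W xs \<inter> Rset c W' xs = {}"
      proof (rule ccontr)
        assume "Rset c W xs \<inter> Rset c W' xs \<noteq> {}"
        then obtain \<sigma> where s: "\<sigma> \<in> Rset c W xs" "\<sigma> \<in> Rset c W' xs" by blast
        have "i \<in> W \<longleftrightarrow> i \<in> W'" if i: "i \<in> {1..<?n}" for i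
        proof (cases "i \<in> ?N")
          case True
          then show ?thesis using W by blast
        next
          case False
          then have "col c i = col c (Suc i)" using eqN[OF i] by blast
          then show ?thesis using s i by (simp add: Rset_def)
        qed
        moreover have "W \<subseteq> {1..<?n}" "W' \<subseteq> {1..<?n}" using W Z by blast+
        ultimately have "W = W'" by blast
        with W(3) show False ..
      qed
    qed
  qed
  ultimately show ?thesis by simp
qed

subsection \<open>Colored ribbon series\<close>

definition ribbon_coeff :: "nat list \<Rightarrow> nat set \<Rightarrow> (nat \<times> nat) list \<Rightarrow> complex" where
  "ribbon_coeff c W xs =
     (if length xs = length c \<and> (\<forall>p\<in>set xs. 1 \<le> fst p) then of_nat (card (Rset c W xs)) else 0)"

text \<open>The future image of a colored ribbon element, written down directly in terms of
  permutations; \<open>image_R_basis\<close> makes the identification.\<close>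

definition ribbon_series :: "nat list \<Rightarrow> nat set \<Rightarrow> series" where
  "ribbon_series c W m = ribbon_coeff c W (sorted_list_of_multiset m)"

text \<open>The counterpart for series of the relation between \<open>S_basis\<close> and
  \<open>R_basis\<close>: bounding the descents of the inverse is summing over their exact sets, and
  these sets are the coarsenings of \<open>I\<close>.\<close>

lemma prodser_eq_sum_ribbon_series:
  assumes I: "positive_parts I"
  shows "prodser I m = (\<Sum>J\<in>{J. coarser_eq J I}. ribbon_series (color_word J) (cDes J) m)"
proof -
  define xs where "xs = sorted_list_of_multiset m"
  have xs: "sorted xs" "mset xs = m" by (simp_all add: xs_def)
  let ?c = "color_word I"
  let ?N = "{j \<in> {1..<length ?c}. ?c ! (j - 1) \<noteq> ?c ! j}"
  have "is_composition (length ?c) (map fst I)"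
    using I by (auto simp: is_composition_def positive_parts_def length_color_word)
  then have D: "cDes I \<subseteq> {1..<length ?c}" by (rule Des_subset)
  have N: "?N \<subseteq> cDes I" using color_changes_subset_cDes[OF _ _ I] by blast
  have "(\<Sum>J\<in>{J. coarser_eq J I}. ribbon_series (color_word J) (cDes J) m) =
      (\<Sum>J\<in>{J. coarser_eq J I}. ribbon_coeff ?c (cDes J) xs)"
    using coarser_eq_imp(2)[OF _ I] by (intro sum.cong) (simp_all add: ribbon_series_def xs_def)
  then have R: "(\<Sum>J\<in>{J. coarser_eq J I}. ribbon_series (color_word J) (cDes J) m) =
      (\<Sum>W\<in>{W. ?N \<subseteq> W \<and> W \<subseteq> cDes I}. ribbon_coeff ?c W xs)"
    using sum.reindex_bij_betw[OF bij_betw_coarser[OF I], of "\<lambda>W. ribbon_coeff ?c W xs"] by simp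
  have P: "prodser I m = of_nat (card {ys. mset ys = mset xs \<and> map snd ys = ?c \<and> (\<forall>p\<in>set ys. 1 \<le> fst p) \<and>
      (\<forall>j\<in>{1..<length ys}. j \<notin> cDes I \<longrightarrow> ys ! (j - 1) \<le> ys ! j)})"
    unfolding prodser_card xs(2) blocky_iff[OF I] ..
  show ?thesis
  proof (cases "length xs = length ?c \<and> (\<forall>p\<in>set xs. 1 \<le> fst p)")
    case True
    have "{ys. mset ys = mset xs \<and> map snd ys = ?c \<and> (\<forall>p\<in>set ys. 1 \<le> fst p) \<and>
        (\<forall>j\<in>{1..<length ys}. j \<notin> cDes I \<longrightarrow> ys ! (j - 1) \<le> ys ! j)} =
      {ys. mset ys = mset xs \<and> map snd ys = ?c \<and>
        (\<forall>j\<in>{1..<length ys}. j \<notin> cDes I \<longrightarrow> ys ! (j - 1) \<le> ys ! j)}"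
    proof -
      have "\<forall>p\<in>set ys. 1 \<le> fst p" if "mset ys = mset xs" for ys
        using True mset_eq_setD[OF that] by simp
      then show ?thesis by blast
    qed
    then have "prodser I m = of_nat (card (Pset ?c (cDes I) xs))"
      unfolding P using card_Pset[OF xs(1), of ?c "cDes I"] True by simp
    then show ?thesis
      unfolding R using card_Pset_eq_sum_card_Rset[of ?c xs "cDes I", OF _ _ N] D True
      by (simp add: ribbon_coeff_def)
  next
    case False
    have "{ys. mset ys = mset xs \<and> map snd ys = ?c \<and> (\<forall>p\<in>set ys. 1 \<le> fst p) \<and>
        (\<forall>j\<in>{1..<length ys}. j \<notin> cDes I \<longrightarrow> ys ! (j - 1) \<le> ys ! j)} = {}"
    proof (rule ccontr)
      assume "\<not> ?thesis"
      then obtain ys where ys: "mset ys = mset xs" "map snd ys = ?c" "\<forall>p\<in>set ys. 1 \<le> fst p" by blast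
      have "length xs = length ys" using ys(1) by (metis size_mset)
      then have "length xs = length ?c" using arg_cong[OF ys(2), of length] by simp
      with ys(3) mset_eq_setD[OF ys(1)] False show False by simp
    qed
    then have "prodser I m = 0" unfolding P by (simp only: card.empty of_nat_0)
    then show ?thesis unfolding R ribbon_coeff_def if_not_P[OF False] by simp
  qed
qed

lemma finite_cycloribbons: "finite {C. cycloribbon r n C}"
proof (rule finite_subset)
  show "{C. cycloribbon r n C} \<subseteq>
      (\<Union>c\<in>{c. set c \<subseteq> {1..r} \<and> length c = n}. {C. (\<exists>k. cycloribbon r k C) \<and> snd C = c})"
    by (auto simp: cycloribbon_def is_colored_ribbon_def)
qed (use finite_lists_length_eq[of "{1..r}" n] finite_cycloribbons_color in auto)

lemma cycloribbon_iff:
  "cycloribbon r n (I, c) \<longleftrightarrow> is_composition n I \<and> length c = n \<and> set c \<subseteq> {1..r} \<and>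
    (\<forall>j\<in>{1..<n}. (j \<notin> Des I \<longrightarrow> col c j \<le> col c (Suc j)) \<and> (j \<in> Des I \<longrightarrow> col c (Suc j) \<le> col c j))"
  by (simp only: cycloribbon_def is_colored_ribbon_def Suc_eq_plus1 split_conv) blast

lemma finite_cartan_perms: "finite (cartan_perms n c E d E')"
  by (rule finite_subset[OF _ finite_permutations[of "{1..n}"]]) (auto simp: cartan_perms_def)

text \<open>The cycloribbon of \<sigma> is forced: its colors are those of \<open>xs\<close>, its
  descents are the drops of color and the descents of \<sigma> at equal colors. Stability says that
  the indices of \<open>xs\<close> rise strictly at the latter; at drops of color they do so because
  \<open>xs\<close> is sorted.\<close>

lemma card_Rset:
  fixes xs :: "(nat \<times> nat) list"
  assumes xs: "sorted xs" "length xs = n" and c: "length c = n" "set c \<subseteq> {1..r}"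
  shows "card (Rset c W xs) = (\<Sum>C\<in>{C. cycloribbon r n C \<and> snd C = map snd xs \<and>
      (\<forall>j\<in>Des (fst C). fst (xs ! (j - 1)) < fst (xs ! j))}.
    card (cartan_perms n (col c) W (col (snd C)) (Des (fst C))))"
proof -
  let ?T = "{C. cycloribbon r n C \<and> snd C = map snd xs \<and> (\<forall>j\<in>Des (fst C). fst (xs ! (j - 1)) < fst (xs ! j))}"
  let ?P = "\<lambda>C. cartan_perms n (col c) W (col (snd C)) (Des (fst C))"
  let ?d = "map snd xs"
  have cold: "col ?d j = snd (xs ! (j - 1))" if "j \<in> {1..n}" for j
    using that xs(2) by (auto simp: col_def)
  have "Rset c W xs = (\<Union>C\<in>?T. ?P C)"
  proof
    show "Rset c W xs \<subseteq> (\<Union>C\<in>?T. ?P C)"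
    proof
      fix \<sigma> assume "\<sigma> \<in> Rset c W xs"
      then have p: "\<sigma> permutes {1..n}" and cd: "\<And>j. j \<in> {1..n} \<Longrightarrow> col c (\<sigma> j) = col ?d j"
        and st: "\<And>j. j \<in> {1..<n} \<Longrightarrow> xs ! (j - 1) = xs ! j \<Longrightarrow> \<sigma> j < \<sigma> (Suc j)"
        and W: "\<forall>i\<in>{1..<n}. col c i = col c (Suc i) \<longrightarrow> (pinv \<sigma> (Suc i) < pinv \<sigma> i \<longleftrightarrow> i \<in> W)"
        by (simp_all add: Rset_def xs(2) cold)
      define D where "D = {j \<in> {1..<n}. col ?d j = col ?d (Suc j) \<and> \<sigma> (Suc j) < \<sigma> j \<or> col ?d (Suc j) < col ?d j}"
      have "D \<subseteq> {1..<n}" by (auto simp: D_def)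
      note D = composition_of_Des[OF this]
      let ?C = "(composition_of_Des n D, ?d)"
      have "set ?d \<subseteq> {1..r}"
      proof
        fix x assume "x \<in> set ?d"
        then obtain i where i: "i < n" "x = snd (xs ! i)" using xs(2) by (auto simp: in_set_conv_nth)
        then have "x = col c (\<sigma> (Suc i))" using cd[of "Suc i"] xs(2) by simp
        moreover have "\<sigma> (Suc i) \<in> {1..n}" using permutes_in_image[OF p, of "Suc i"] i by simp
        then have "c ! (\<sigma> (Suc i) - 1) \<in> set c" using c(1) by (intro nth_mem) auto
        ultimately show "x \<in> {1..r}" using c(2) by (auto simp: col_def)
      qed
      then have cyc: "cycloribbon r n ?C"
        unfolding cycloribbon_iff D(2) using D(1) xs(2) by (auto simp: D_def)
      have "fst (xs ! (j - 1)) < fst (xs ! j)" if j: "j \<in> D" for j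
      proof (rule ccontr)
        have jn: "j \<in> {1..<n}" using j by (simp add: D_def)
        have le: "xs ! (j - 1) \<le> xs ! j" using jn xs by (intro sorted_nth_mono) auto
        have sj: "col ?d j = snd (xs ! (j - 1))" "col ?d (Suc j) = snd (xs ! j)"
          using cold[of j] cold[of "Suc j"] jn by auto
        assume "\<not> fst (xs ! (j - 1)) < fst (xs ! j)"
        then have f: "fst (xs ! (j - 1)) = fst (xs ! j)" "snd (xs ! (j - 1)) \<le> snd (xs ! j)"
          using le by (auto simp: less_eq_prod_def)
        then have "snd (xs ! (j - 1)) = snd (xs ! j)" "\<sigma> (Suc j) < \<sigma> j"
          using j unfolding D_def mem_Collect_eq sj by auto
        moreover from this(1) f(1) have "xs ! (j - 1) = xs ! j" by (rule prod_eqI[rotated])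
        ultimately show False using st[OF jn] by simp
      qed
      then have "?C \<in> ?T" using cyc D(2) by simp
      moreover have "\<sigma> \<in> ?P ?C"
        using p cd W D(2) by (auto simp: cartan_perms_def D_def)
      ultimately show "\<sigma> \<in> (\<Union>C\<in>?T. ?P C)" by blast
    qed
    show "(\<Union>C\<in>?T. ?P C) \<subseteq> Rset c W xs"
    proof
      fix \<sigma> assume "\<sigma> \<in> (\<Union>C\<in>?T. ?P C)"
      then obtain C where C: "cycloribbon r n C" "snd C = ?d"
        "\<And>j. j \<in> Des (fst C) \<Longrightarrow> fst (xs ! (j - 1)) < fst (xs ! j)" and s: "\<sigma> \<in> ?P C" by blast
      have p: "\<sigma> permutes {1..n}" using s by (simp add: cartan_perms_def)
      have "\<sigma> j < \<sigma> (Suc j)" if j: "j \<in> {1..<n}" "xs ! (j - 1) = xs ! j" for j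
      proof -
        have "j \<notin> Des (fst C)" using C(3)[of j] j(2) by auto
        moreover have "col ?d j = col ?d (Suc j)" using cold[of j] cold[of "Suc j"] j by auto
        ultimately have "\<not> \<sigma> (Suc j) < \<sigma> j" using s j(1) C(2) by (simp add: cartan_perms_def)
        then show ?thesis using permutes_pinv_neq(1)[OF p, of j] by simp
      qed
      then show "\<sigma> \<in> Rset c W xs" using s C(2) by (simp add: Rset_def cartan_perms_def xs(2) cold)
    qed
  qed
  moreover have "card (\<Union>C\<in>?T. ?P C) = (\<Sum>C\<in>?T. card (?P C))"
  proof (rule card_UN_disjoint)
    show "finite ?T" by (rule finite_subset[OF _ finite_cycloribbons[of r n]]) auto
    show "\<forall>C\<in>?T. finite (?P C)" by (simp add: finite_cartan_perms)
    show "\<forall>C\<in>?T. \<forall>C'\<in>?T. C \<noteq> C' \<longrightarrow> ?P C \<inter> ?P C' = {}"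
    proof (intro ballI impI)
      fix C C' assume C: "C \<in> ?T" "C' \<in> ?T" "C \<noteq> C'"
      obtain I I' where I: "C = (I, ?d)" "C' = (I', ?d)" using C by (cases C; cases C') auto
      have cy: "cycloribbon r n (I, ?d)" "cycloribbon r n (I', ?d)" using C I by simp_all
      show "?P C \<inter> ?P C' = {}"
      proof (rule ccontr)
        assume "?P C \<inter> ?P C' \<noteq> {}"
        then obtain \<sigma> where s: "\<sigma> \<in> ?P (I, ?d)" "\<sigma> \<in> ?P (I', ?d)" using I by blast
        have "j \<in> Des I \<longleftrightarrow> j \<in> Des I'" if j: "j \<in> {1..<n}" for j
        proof (cases "col ?d j = col ?d (Suc j)")
          case True
          then show ?thesis using s j by (simp add: cartan_perms_def)
        next
          case False
          have "(j \<notin> Des I \<longrightarrow> col ?d j \<le> col ?d (Suc j)) \<and> (j \<in> Des I \<longrightarrow> col ?d (Suc j) \<le> col ?d j)"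
            "(j \<notin> Des I' \<longrightarrow> col ?d j \<le> col ?d (Suc j)) \<and> (j \<in> Des I' \<longrightarrow> col ?d (Suc j) \<le> col ?d j)"
            using cy j unfolding cycloribbon_iff by blast+
          then show ?thesis using False by linarith
        qed
        moreover have comp: "is_composition n I" "is_composition n I'" using cy unfolding cycloribbon_iff by blast+
        ultimately have "Des I = Des I'" using Des_subset[OF comp(1)] Des_subset[OF comp(2)] by blast
        then have "I = I'" by (rule composition_eqI[OF comp])
        with I C(3) show False by simp
      qed
    qed
  qed
  ultimately show ?thesis by simp
qed

text \<open>At each monomial the conditions on the cycloribbons in \<open>card_Rset\<close> are
  those under which \<open>F_series_value\<close> gives 1.\<close>

lemma F_expansion_ribbon_series:
  assumes c: "length c = n" "set c \<subseteq> {1..r}"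
  shows "F_expansion r (\<lambda>C. if cycloribbon r n C
      then of_nat (card (cartan_perms n (col c) W (col (snd C)) (Des (fst C)))) else 0) (ribbon_series c W)"
    (is "F_expansion r ?a _")
  unfolding F_expansion_def
proof (intro conjI allI impI ext)
  show fin: "finite {C. ?a C \<noteq> 0}"
    by (rule finite_subset[OF _ finite_cycloribbons[of r n]]) (auto split: if_splits)
  show "\<exists>n. cycloribbon r n C" if "?a C \<noteq> 0" for C
    using that by (auto split: if_splits)
  fix m :: "(nat \<times> nat) multiset"
  define xs where "xs = sorted_list_of_multiset m"
  have xs: "sorted xs" "mset xs = m" by (simp_all add: xs_def)
  let ?T = "{C. cycloribbon r n C \<and> snd C = map snd xs \<and> (\<forall>j\<in>Des (fst C). fst (xs ! (j - 1)) < fst (xs ! j))}"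
  let ?ok = "\<forall>p\<in>set xs. 1 \<le> fst p"
  let ?h = "\<lambda>C. of_nat (card (cartan_perms n (col c) W (col (snd C)) (Des (fst C)))) :: complex"
  have ok: "?ok \<longleftrightarrow> set (map fst xs) \<subseteq> {1..}" by auto
  have "(\<Sum>C\<in>{C. ?a C \<noteq> 0}. ?a C * F_series C m) = (\<Sum>C\<in>{C. cycloribbon r n C}. ?a C * F_series C m)"
    by (rule sum.mono_neutral_left[OF finite_cycloribbons]) (auto split: if_splits)
  also have "\<dots> = (\<Sum>C\<in>{C. cycloribbon r n C}. if C \<in> ?T \<and> ?ok then ?h C else 0)"
  proof (rule sum.cong)
    fix C assume C: "C \<in> {C. cycloribbon r n C}"
    then have "cycloribbon r n (fst C, snd C)" by simp
    from F_series_value[OF this xs(1)] C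
    show "?a C * F_series C m = (if C \<in> ?T \<and> ?ok then ?h C else 0)"
      unfolding xs(2) ok by simp
  qed simp
  also have "\<dots> = (\<Sum>C\<in>{C. C \<in> ?T \<and> ?ok}. ?h C)"
    by (rule sum.mono_neutral_cong_right[OF finite_cycloribbons]) auto
  also have "\<dots> = ribbon_series c W m"
  proof (cases "length xs = length c \<and> ?ok")
    case True
    then have "{C. C \<in> ?T \<and> ?ok} = ?T" by blast
    then show ?thesis
      unfolding ribbon_series_def ribbon_coeff_def xs_def[symmetric]
      using card_Rset[OF xs(1) _ c, of W] True c(1) by simp
  next
    case False
    have empty: "{C. C \<in> ?T \<and> ?ok} = {}"
    proof (rule ccontr)
      assume "\<not> ?thesis"
      then obtain C where C: "C \<in> ?T" "?ok" by blast
      then have "length (snd C) = n" "snd C = map snd xs" by (auto simp: cycloribbon_def is_colored_ribbon_def)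
      then show False using C(2) False c(1) by simp
    qed
    show ?thesis
      unfolding empty ribbon_series_def ribbon_coeff_def xs_def[symmetric] if_not_P[OF False] by simp
  qed
  finally show "ribbon_series c W m = (\<Sum>C\<in>{C. ?a C \<noteq> 0}. ?a C * F_series C m)" ..
qed

text \<open>As power series the two generators coincide, so the embedding \<open>d\<close> fixes
  them.\<close>

lemma F_series_row:
  assumes "1 \<le> j" "i \<in> {1..r}"
  shows "F_series ([j], replicate j i) = complete_homogeneous j i"
proof
  fix m :: "(nat \<times> nat) multiset"
  define xs where "xs = sorted_list_of_multiset m"
  have xs: "sorted xs" "mset xs = m" by (simp_all add: xs_def)
  have D: "Des [j] = {}" by (auto simp: Des_def)
  have cyc: "cycloribbon r j ([j], replicate j i)"
    using assms unfolding cycloribbon_iff D by (auto simp: is_composition_def col_def)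
  have a: "replicate j i = map snd xs \<longleftrightarrow> length xs = j \<and> (\<forall>p\<in>set xs. snd p = i)"
  proof
    assume e: "replicate j i = map snd xs"
    have "snd p = i" if "p \<in> set xs" for p
    proof -
      have "snd p \<in> set (map snd xs)" using that by simp
      then show ?thesis unfolding e[symmetric] by simp
    qed
    with arg_cong[OF e, of length] show "length xs = j \<and> (\<forall>p\<in>set xs. snd p = i)" by simp
  next
    assume "length xs = j \<and> (\<forall>p\<in>set xs. snd p = i)"
    then show "replicate j i = map snd xs" by (intro replicate_eqI[symmetric]) auto
  qed
  have b: "set (map fst xs) \<subseteq> {1..} \<and> (\<forall>p\<in>set xs. snd p = i) \<longleftrightarrow> set xs \<subseteq> {1..} \<times> {i}"
    by auto
  have c: "complete_homogeneous j i m =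
      (if length xs = j \<and> set (map fst xs) \<subseteq> {1..} \<and> (\<forall>p\<in>set xs. snd p = i) then 1 else 0)"
    unfolding complete_homogeneous_def b by (simp flip: xs(2))
  have f: "F_series ([j], replicate j i) m =
      (if (length xs = j \<and> (\<forall>p\<in>set xs. snd p = i)) \<and> set (map fst xs) \<subseteq> {1..} then 1 else 0)"
    using F_series_value[OF cyc xs(1)] unfolding D xs(2) a by (simp only: ball_empty simp_thms)
  show "F_series ([j], replicate j i) m = complete_homogeneous j i m"
    unfolding c f by (rule if_cong) blast+
qed

subsection \<open>The image of the colored ribbon basis\<close>

text \<open>The images of the ribbons and the ribbon series obey the same triangular recursion,
  whose left side is the product of complete homogeneous series; induction on the number of parts
  compares them.\<close>

lemma image_R_basis:
  fixes h :: "(nat \<times> nat) ncpoly \<Rightarrow> series" and r :: nat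
  defines "G \<equiv> {(j, i). 1 \<le> j \<and> i \<in> {1..r}}"
  assumes add: "\<And>x y. x \<in> FA G \<Longrightarrow> y \<in> FA G \<Longrightarrow> h (x + y) = (\<lambda>m. h x m + h y m)"
    and mult: "\<And>x y. x \<in> FA G \<Longrightarrow> y \<in> FA G \<Longrightarrow> h (x * y) = series_mult (h x) (h y)"
    and one: "h 1 = (\<lambda>m. if m = {#} then 1 else 0)"
    and gen: "\<And>j i. 1 \<le> j \<Longrightarrow> i \<in> {1..r} \<Longrightarrow> h (gen (j, i)) = complete_homogeneous j i"
    and I: "positive_parts I" "set (color_word I) \<subseteq> {1..r}"
  shows "h (R_basis I) = ribbon_series (color_word I) (cDes I)"
proof -
  have S: "S_basis I \<in> FA G \<and> h (S_basis I) = prodser I"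
    if "positive_parts I" "set (color_word I) \<subseteq> {1..r}" for I
    using that
  proof (induction I)
    case Nil
    then show ?case by (simp add: S_basis_def prodser_def one FA_one)
  next
    case (Cons p I)
    obtain j i where p: "p = (j, i)" by (cases p)
    have ji: "1 \<le> j" "i \<in> {1..r}" using Cons.prems p by auto
    then have g: "gen (j, i) \<in> FA G" by (intro FA_gen) (simp add: G_def)
    have S: "S_basis I \<in> FA G" "h (S_basis I) = prodser I" using Cons p by auto
    have "S_basis (p # I) = gen (j, i) * S_basis I" by (simp add: S_basis_def p)
    moreover have "prodser (p # I) = series_mult (complete_homogeneous j i) (prodser I)"
      by (simp add: prodser_def p)
    ultimately show ?case using FA_mult[OF g S(1)] mult[OF g S(1)] S(2) gen[OF ji] by simp
  qed
  have zero: "h 0 = (\<lambda>m. 0)"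
  proof
    fix m
    show "h 0 m = 0" using fun_cong[OF add[OF FA_zero FA_zero], of m] by simp
  qed
  have sum: "h (sum f A) m = (\<Sum>x\<in>A. h (f x) m)" if "\<And>x. x \<in> A \<Longrightarrow> f x \<in> FA G"
    for f :: "colored_composition \<Rightarrow> _" and A m
    using that by (induction A rule: infinite_finite_induct) (simp_all add: zero add FA_sum)
  have "R_basis I \<in> FA G \<and> h (R_basis I) = ribbon_series (color_word I) (cDes I)"
    using I
  proof (induction "length I" arbitrary: I rule: less_induct)
    case less
    let ?C = "{J. coarser_eq J I \<and> J \<noteq> I}"
    have IH: "R_basis J \<in> FA G \<and> h (R_basis J) = ribbon_series (color_word J) (cDes J)" if "J \<in> ?C" for J
      using that coarser_eq_imp(1,2)[of J I] less.prems coarser_neq_length by (intro less.hyps) auto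
    have fin: "finite ?C" by (rule finite_subset[OF _ finite_coarser_eq[of I]]) auto
    have split: "{J. coarser_eq J I} = insert I ?C" using coarser_eq_refl by auto
    have sC: "sum R_basis ?C \<in> FA G" using IH by (intro FA_sum) blast
    have SI: "S_basis I \<in> FA G" "h (S_basis I) = prodser I" using S[OF less.prems] by auto
    have RI: "R_basis I \<in> FA G"
      unfolding R_basis.simps[of I] by (rule FA_diff[OF SI(1) sC])
    have "S_basis I = R_basis I + sum R_basis ?C" by (simp add: R_basis.simps[of I])
    then have "prodser I = (\<lambda>m. h (R_basis I) m + h (sum R_basis ?C) m)"
      using add[OF RI sC] SI(2) by simp
    then have a: "prodser I m = h (R_basis I) m + (\<Sum>J\<in>?C. h (R_basis J) m)" for m
      using sum[of ?C R_basis m] IH by simp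
    have b: "(\<Sum>J\<in>?C. h (R_basis J) m) = (\<Sum>J\<in>?C. ribbon_series (color_word J) (cDes J) m)" for m
      using IH by (intro sum.cong) simp_all
    have c: "prodser I m = ribbon_series (color_word I) (cDes I) m +
        (\<Sum>J\<in>?C. ribbon_series (color_word J) (cDes J) m)" for m
      unfolding prodser_eq_sum_ribbon_series[OF less.prems(1)] split using fin by simp
    have "h (R_basis I) m = ribbon_series (color_word I) (cDes I) m" for m
      using a[of m] unfolding b c by (simp only: add_right_cancel)
    with RI show ?case by blast
  qed
  then show ?thesis ..
qed

subsection \<open>The Cartan map\<close>

lemma phi_properties:
  assumes "is_colored_ribbon r n C"
  shows "is_composition n (fst (phi C))" "snd (phi C) = snd C"
    "Des (fst (phi C)) = {j \<in> {1..<n}. j \<in> Des (fst C) \<longleftrightarrow> col (snd C) j = col (snd C) (Suc j)}"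
proof -
  obtain I c where C: "C = (I, c)" by (cases C)
  have n: "length c = n" using assms C by (simp add: is_colored_ribbon_def)
  let ?D = "{j \<in> {1..<n}. j \<in> Des I \<and> col c j = col c (j+1)} \<union> {j \<in> {1..<n}. j \<notin> Des I \<and> col c j \<noteq> col c (j+1)}"
  have "?D \<subseteq> {1..<n}" by auto
  note D = composition_of_Des[OF this]
  have f: "fst (phi C) = composition_of_Des n ?D" "snd (phi C) = c"
    by (simp_all only: phi_def C split_conv n fst_conv snd_conv)
  show "is_composition n (fst (phi C))" unfolding f by (rule D(1))
  show "snd (phi C) = snd C" unfolding f unfolding C by simp
  show "Des (fst (phi C)) = {j \<in> {1..<n}. j \<in> Des (fst C) \<longleftrightarrow> col (snd C) j = col (snd C) (Suc j)}"
    unfolding f D(2) unfolding C fst_conv snd_conv Suc_eq_plus1 by blast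
qed

lemma cycloribbon_phi:
  assumes "anticycloribbon r n K"
  shows "cycloribbon r n (phi K)"
proof -
  obtain I c where K: "K = (I, c)" by (cases K)
  have rib: "is_colored_ribbon r n K" using assms by (simp add: K anticycloribbon_def)
  have a: "\<forall>j\<in>{1..<n}. (j \<notin> Des I \<longrightarrow> col c (Suc j) \<le> col c j) \<and> (j \<in> Des I \<longrightarrow> col c j \<le> col c (Suc j))"
    using assms unfolding K anticycloribbon_def split_conv Suc_eq_plus1 by blast
  have D: "Des (fst (phi K)) = {j \<in> {1..<n}. j \<in> Des I \<longleftrightarrow> col c j = col c (Suc j)}"
    and s: "snd (phi K) = c"
    using phi_properties[OF rib] by (simp_all add: K)
  have "cycloribbon r n (fst (phi K), snd (phi K))"
    unfolding cycloribbon_iff D s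
  proof (intro conjI ballI)
    show "is_composition n (fst (phi K))" by (rule phi_properties(1)[OF rib])
    show "length c = n" "set c \<subseteq> {1..r}" using rib by (simp_all add: K is_colored_ribbon_def)
    fix j assume j: "j \<in> {1..<n}"
    note aj = bspec[OF a j]
    show "j \<notin> {j \<in> {1..<n}. j \<in> Des I \<longleftrightarrow> col c j = col c (Suc j)} \<longrightarrow> col c j \<le> col c (Suc j)"
      "j \<in> {j \<in> {1..<n}. j \<in> Des I \<longleftrightarrow> col c j = col c (Suc j)} \<longrightarrow> col c (Suc j) \<le> col c j"
      using aj j unfolding mem_Collect_eq by linarith+
  qed
  then show ?thesis by simp
qed

text \<open>\<open>phi\<close> keeps descents at equal colors and reverses them at different ones.
  In a cycloribbon different colors form a descent exactly when they fall, so \<open>phi\<close>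
  produces descents at the rising pairs, where \<open>gchar\<close> has value -1.\<close>

lemma simple_character_eq_gchar:
  assumes C: "cycloribbon r n C" and g: "g \<in> ak_gens n"
  shows "simple_character u C g = gchar u (col (snd C)) (Des (fst C)) g"
proof (cases g)
  case (GenT i)
  obtain I c where [simp]: "C = (I, c)" by (cases C)
  have i: "i \<in> {1..<n}" using g GenT by (auto simp: ak_gens_def)
  have "is_colored_ribbon r n C" using C by (simp add: cycloribbon_def)
  from phi_properties(3)[OF this] have "i \<in> Des (fst (phi C)) \<longleftrightarrow> (i \<in> Des I \<longleftrightarrow> col c i = col c (Suc i))"
    using i by simp
  moreover have "(i \<notin> Des I \<longrightarrow> col c i \<le> col c (Suc i)) \<and> (i \<in> Des I \<longrightarrow> col c (Suc i) \<le> col c i)"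
    using C i unfolding \<open>C = (I, c)\<close> cycloribbon_iff by blast
  ultimately have "i \<in> Des (fst (phi C)) \<longleftrightarrow> col c i < col c (Suc i) \<or> col c i = col c (Suc i) \<and> i \<in> Des I"
    by linarith
  then show ?thesis unfolding GenT simple_character_def gchar_simps by simp
qed (simp add: simple_character_def)

lemma col_cycloribbon:
  assumes "cycloribbon r n C" "j \<in> {1..n}"
  shows "col (snd C) j \<in> {1..r}"
proof -
  have "length (snd C) = n" "set (snd C) \<subseteq> {1..r}"
    using assms(1) by (auto simp: cycloribbon_def is_colored_ribbon_def)
  moreover from this have "snd C ! (j - 1) \<in> set (snd C)" using assms(2) by (intro nth_mem) auto
  ultimately show ?thesis unfolding col_def by blast
qed

lemma the_elem_simple_character:
  assumes u: "inj_on u {1..r}" and C: "cycloribbon r n C" and f: "f \<in> AF n"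
  shows "the_elem (eval_character (simple_character u C) ` ak_class n r u f) =
    eval_character (gchar u (col (snd C)) (Des (fst C))) f"
proof -
  have cong: "eval_character (simple_character u C) x = eval_character (gchar u (col (snd C)) (Des (fst C))) x"
    if "x \<in> AF n" for x
    by (rule eval_character_cong[OF that simple_character_eq_gchar[OF C]])
  have "eval_character (simple_character u C) x = 0" if "x \<in> ak_ideal n r u" for x
    unfolding cong[OF ak_ideal_FA[OF that]]
    by (rule gchar_kills_ideal[OF u col_cycloribbon[OF C] that])
  then show ?thesis unfolding the_elem_ak_class[of n r u] by (simp add: the_elem_ak_class cong f)
qed

lemma corresponding_colored_composition_properties:
  assumes "is_colored_ribbon r n K"
  shows "positive_parts (corresponding_colored_composition K)"
    "color_word (corresponding_colored_composition K) = snd K"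
    "j \<in> {1..<n} \<Longrightarrow> col (snd K) j = col (snd K) (Suc j) \<Longrightarrow>
      j \<in> cDes (corresponding_colored_composition K) \<longleftrightarrow> j \<in> Des (fst K)"
proof -
  obtain I c where K: "K = (I, c)" by (cases K)
  have n: "length c = n" using assms K by (simp add: is_colored_ribbon_def)
  let ?D = "(Des I \<inter> {j \<in> {1..<n}. col c j = col c (j+1)}) \<union> {j \<in> {1..<n}. col c j \<noteq> col c (j+1)}"
  have "?D \<subseteq> {1..<n}" by auto
  note D = composition_of_Des[OF this]
  have e: "corresponding_colored_composition K = colorize (composition_of_Des n ?D) c"
    by (simp add: corresponding_colored_composition_def colorize_def K n Let_def)
  have "fst p \<in> set (composition_of_Des n ?D)" if "p \<in> set (colorize (composition_of_Des n ?D) c)" for p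
    using imageI[OF that, of fst] unfolding set_map[symmetric] map_fst_colorize .
  then show "positive_parts (corresponding_colored_composition K)"
    using D(1) unfolding e positive_parts_def is_composition_def by blast
  have chg: "j \<in> Des (composition_of_Des n ?D)" if "j \<in> {1..<n}" "c ! (j - 1) \<noteq> c ! j" for j
    using that unfolding D(2) by (simp add: col_def)
  show "color_word (corresponding_colored_composition K) = snd K"
    unfolding e unfolding K snd_conv by (rule color_word_colorize[OF D(1) n]) (rule chg)
  show "j \<in> {1..<n} \<Longrightarrow> col (snd K) j = col (snd K) (Suc j) \<Longrightarrow>
      j \<in> cDes (corresponding_colored_composition K) \<longleftrightarrow> j \<in> Des (fst K)"
    unfolding e unfolding map_fst_colorize D(2) K fst_conv snd_conv Suc_eq_plus1 by blast
qed

lemma cartan_perms_cong: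
  assumes "\<And>i. i \<in> {1..<n} \<Longrightarrow> c i = c (Suc i) \<Longrightarrow> i \<in> E1 \<longleftrightarrow> i \<in> E2"
  shows "cartan_perms n c E1 d E' = cartan_perms n c E2 d E'"
proof -
  have "(\<forall>i\<in>{1..<n}. c i = c (Suc i) \<longrightarrow> (X i \<longleftrightarrow> i \<in> E1)) \<longleftrightarrow>
      (\<forall>i\<in>{1..<n}. c i = c (Suc i) \<longrightarrow> (X i \<longleftrightarrow> i \<in> E2))" for X
    using assms by blast
  then show ?thesis unfolding cartan_perms_def by simp
qed

lemma composition_multiplicity_eq:
  fixes P :: "(ak_gen ncpoly set, 'p) module"
  assumes u: "inj_on u {1..r}" and C: "cycloribbon r n C" and J: "cycloribbon r n J"
    and top: "indec_projective_with_top (ak_algebra n r u) P (simple_ak_module u C)"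
  shows "composition_multiplicity (ak_algebra n r u) P (simple_ak_module u J) =
    card (cartan_perms n (col (snd C)) (Des (fst C)) (col (snd J)) (Des (fst J)))"
proof -
  let ?A = "ak_algebra n r u"
  have proj: "projective ?A P" and indec: "indecomposable ?A P"
    using top by (simp_all add: indec_projective_with_top_def)
  have P: "left_module ?A P" using proj by (simp add: projective_def)
  interpret M: ak_mod n r u P by (rule ak_mod.intro[OF P])
  note top' = top[unfolded indec_projective_with_top_def, THEN conjunct2, THEN conjunct2]
  note ex = ex1_implies_ex[OF top'[THEN conjunct1]]
  obtain N where N': "submodule N ?A P \<and> simple_module ?A (quot_module P N)"
    using ex by (elim exE) (rule that)
  note N = N'[THEN conjunct1] top'[THEN conjunct2, rule_format, OF N']
  have NP: "N \<subseteq> carrier P" by (rule N(1)[unfolded M.submodule_act_iff, THEN conjunct1])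
  \<comment> \<open>The quotient of \<open>P\<close> by \<open>N\<close> is viewed as a subquotient,
    to which the criterion by functionals applies.\<close>
  have P': "P\<lparr>carrier := carrier P\<rparr> = P" by simp
  have "module_iso ?A (quot_module (P\<lparr>carrier := carrier P\<rparr>) N) (simple_ak_module u C)"
    unfolding P' by (rule N(2))
  then have "\<exists>\<chi>. (\<forall>x\<in>carrier P. \<forall>y\<in>carrier P. \<chi> (x \<oplus>\<^bsub>P\<^esub> y) = \<chi> x + \<chi> y) \<and>
      (\<forall>f\<in>AF n. \<forall>x\<in>carrier P. \<chi> (M.act f x) = eval_character (gchar u (col (snd C)) (Des (fst C))) f * \<chi> x) \<and>
      (\<forall>x\<in>carrier P. \<chi> x = 0 \<longleftrightarrow> x \<in> N) \<and> \<chi> ` carrier P = UNIV"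
    by (rule M.subq_iso_simple_iff[OF N(1) M.carrier_submodule NP the_elem_simple_character[OF u C], THEN iffD1, rotated])
  then obtain \<chi> where \<chi>: "\<forall>x\<in>carrier P. \<forall>y\<in>carrier P. \<chi> (x \<oplus>\<^bsub>P\<^esub> y) = \<chi> x + \<chi> y"
    "\<forall>f\<in>AF n. \<forall>x\<in>carrier P. \<chi> (M.act f x) = eval_character (gchar u (col (snd C)) (Des (fst C))) f * \<chi> x"
    "\<chi> ` carrier P = UNIV"
    by (elim exE conjE) (rule that)
  have "\<exists>x\<in>carrier P. \<chi> x \<noteq> 0"
  proof -
    have "1 \<in> \<chi> ` carrier P" unfolding \<chi>(3) by simp
    then obtain x where "x \<in> carrier P" "\<chi> x = 1" by (metis imageE)
    then show ?thesis by (intro bexI[of _ x]) simp_all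
  qed
  then interpret ak_proj n r u "col (snd C)" P "Des (fst C)" \<chi>
    by unfold_locales (use u col_cycloribbon[OF C] proj indec \<chi>(1,2) in auto)
  show ?thesis
    by (rule multiplicity[OF col_cycloribbon[OF J] the_elem_simple_character[OF u J]])
qed

lemma cartan_map_R_basis:
  assumes e: "e \<in> algebra_hom (MR r) (Sym r)"
    and e_gen: "\<And>i j. i \<in> {1..r} \<Longrightarrow> j \<ge> 1 \<Longrightarrow> e (gen (j, i)) = complete_homogeneous j i"
    and d: "d \<in> algebra_hom (Sym r) (QMR r)"
    and d_h: "\<And>i j. i \<in> {1..r} \<Longrightarrow> j \<ge> 1 \<Longrightarrow> d (complete_homogeneous j i) = F_series ([j], replicate j i)"
    and I: "positive_parts I" "set (color_word I) \<subseteq> {1..r}"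
  shows "(d \<circ> e) (R_basis I) = ribbon_series (color_word I) (cDes I)"
proof (rule image_R_basis[OF _ _ _ _ I])
  let ?G = "{(j, i). 1 \<le> j \<and> i \<in> {1..r}}"
  have eh: "e \<in> ring_hom (MR r) (Sym r)" and dh: "d \<in> ring_hom (Sym r) (QMR r)"
    using e d by (simp_all add: algebra_hom_def)
  have MR: "carrier (MR r) = FA ?G" "add (MR r) = (+)" "mult (MR r) = (*)" "one (MR r) = 1"
    by (simp_all add: MR_def)
  have Sq: "add (QMR r) = (\<lambda>f g m. f m + g m)" "mult (QMR r) = series_mult"
      "one (QMR r) = (\<lambda>m. if m = {#} then 1 else 0)"
    by (simp_all add: QMR_def series_algebra_def series_mult_def fun_eq_iff)
  show "(d \<circ> e) (x + y) = (\<lambda>m. (d \<circ> e) x m + (d \<circ> e) y m)" if "x \<in> FA ?G" "y \<in> FA ?G" for x y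
    using ring_hom_add[OF eh, of x y] ring_hom_add[OF dh, of "e x" "e y"] ring_hom_closed[OF eh] that
    by (simp add: MR Sq)
  show "(d \<circ> e) (x * y) = series_mult ((d \<circ> e) x) ((d \<circ> e) y)" if "x \<in> FA ?G" "y \<in> FA ?G" for x y
    using ring_hom_mult[OF eh, of x y] ring_hom_mult[OF dh, of "e x" "e y"] ring_hom_closed[OF eh] that
    by (simp add: MR Sq)
  show "(d \<circ> e) 1 = (\<lambda>m. if m = {#} then 1 else 0)"
    using ring_hom_one[OF eh] ring_hom_one[OF dh] by (simp add: MR Sq)
  show "(d \<circ> e) (gen (j, i)) = complete_homogeneous j i" if "1 \<le> j" "i \<in> {1..r}" for j i
    using e_gen[OF that(2,1)] d_h[OF that(2,1)] F_series_row[OF that] by simp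
qed

theorem mainTheorem6:
  fixes n r :: nat
    and u :: "nat \<Rightarrow> complex"
    and e :: "(nat \<times> nat) ncpoly \<Rightarrow> series"
    and d :: "series \<Rightarrow> series"
    and K J :: colored_ribbon
    and P :: "(ak_gen ncpoly set, 'p) module"
  assumes "n \<ge> 1" and "r \<ge> 1" and "inj_on u {1..r}"
    and "e \<in> algebra_hom (MR r) (Sym r)"
    and "\<And>i j. i \<in> {1..r} \<Longrightarrow> j \<ge> 1 \<Longrightarrow> e (gen (j, i)) = complete_homogeneous j i"
    and "d \<in> algebra_hom (Sym r) (QMR r)"
    and "\<And>i j. i \<in> {1..r} \<Longrightarrow> j \<ge> 1 \<Longrightarrow> d (complete_homogeneous j i) = F_series ([j], replicate j i)"
    and "anticycloribbon r n K"
    and "indec_projective_with_top (ak_algebra n r u) P (simple_ak_module u (phi K))"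
    and "cycloribbon r n J"
  shows "of_nat (composition_multiplicity (ak_algebra n r u) P (simple_ak_module u J))
       = F_coeff r ((d \<circ> e) (R_basis (corresponding_colored_composition K))) J"
proof -
  let ?I = "corresponding_colored_composition K"
  let ?c = "snd K"
  have rib: "is_colored_ribbon r n K" using assms(8) by (auto simp: anticycloribbon_def)
  then have c: "length ?c = n" "set ?c \<subseteq> {1..r}" by (auto simp: is_colored_ribbon_def)
  note I = corresponding_colored_composition_properties[OF rib]
  have "(d \<circ> e) (R_basis ?I) = ribbon_series ?c (cDes ?I)"
    using cartan_map_R_basis[OF assms(4-7) I(1)] c(2) unfolding I(2) by blast
  then have "F_coeff r ((d \<circ> e) (R_basis ?I)) J =
      of_nat (card (cartan_perms n (col ?c) (cDes ?I) (col (snd J)) (Des (fst J))))"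
    using F_coeff_eqI[OF F_expansion_ribbon_series[OF c]] assms(10) by simp
  \<comment> \<open>Only positions of equal colors enter, and there both descent sets agree with the
    descent set of \<open>K\<close>.\<close>
  also have "cartan_perms n (col ?c) (cDes ?I) (col (snd J)) (Des (fst J)) =
      cartan_perms n (col ?c) (Des (fst (phi K))) (col (snd J)) (Des (fst J))"
  proof (rule cartan_perms_cong)
    fix i assume i: "i \<in> {1..<n}" "col ?c i = col ?c (Suc i)"
    show "i \<in> cDes ?I \<longleftrightarrow> i \<in> Des (fst (phi K))"
      using I(3)[OF i] i unfolding phi_properties(3)[OF rib] by blast
  qed
  finally show ?thesis
    using composition_multiplicity_eq[OF assms(3) cycloribbon_phi[OF assms(8)] assms(10,9)]
    unfolding phi_properties(2)[OF rib] by simp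
qed

end
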